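(* Let $N\ge 2$ be an integer and let $X=(x_1,\dots,x_N)\in\mathbb{R}^N$ with $x_1<x_2<\dots<x_N$. For any $K\in\{1,\dots,N-1\}$, let $\nu_{X,K}$ be the radial part of the pushforward $p^N_K(\mu_X)$ of the orbital measure $\mu_X$ under the projection of $N\times N$ Hermitian matrices onto their upper left $K\times K$ corners; it is a probability measure on $\mathcal{X}(K)=\{(a_1,\dots,a_K)\in\mathbb{R}^K: a_1\le\dots\le a_K\}$. Then $\nu_{X,K}$ is absolutely continuous with respect to Lebesgue measure on $\mathcal{X}(K)\subset\mathbb{R}^K$, and its density at $A=(a_1,\dots,a_K)\in\mathcal{X}(K)$ is $$M(a_1,\dots,a_K;x_1,\dots,x_N):=c_{N,K}\,\frac{V(A)\,\det\left[M(a_j;x_i,x_{i+1},\dots,x_{N-K+i})\right]_{i,j=1}^K}{\prod\limits_{(j,i):\,j-i\ge N-K+1}(x_j-x_i)},$$ where the product in the denominator is over all pairs $(j,i)$ with $1\le i,j\le N$ and $j-i\ge N-K+1$, and $$c_{N,K}=\prod_{i=1}^{K-1}\binom{N-K+i}{i}.$$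
   Context: Hermitian matrices and corners: $\mathcal{H}(N)$ is the space of $N\times N$ complex Hermitian matrices. For $1\le K\le N-1$, $p^N_K:\mathcal{H}(N)\to\mathcal{H}(K)$ is the linear projection that deletes the last $N-K$ rows and columns. For a measure $\mu$ on $\mathcal{H}(N)$, $p^N_K(\mu)$ denotes its pushforward under $p^N_K$. Orbital measures: the unitary group $U(N)$ acts on $\mathcal{H}(N)$ by conjugation. Let $\mathcal{X}(N)=\{(x_1,\dots,x_N)\in\mathbb{R}^N: x_1\le\dots\le x_N\}$. For $X\in\mathcal{X}(N)$, $O_X\subset\mathcal{H}(N)$ is the $U(N)$-orbit of all Hermitian matrices with eigenvalues $x_1,\dots,x_N$ (with multiplicity), and $\mu_X$ is the unique $U(N)$-invariant probability measure on $\mathcal{H}(N)$ concentrated on $O_X$. The same notation is used for every size; in particular, for $Y\in\mathcal{X}(K)$, $\mu_Y$ is the orbital measure on $\mathcal{H}(K)$. Radial part: $p^N_K(\mu_X)$ is a $U(K)$-invariant probability measure on $\mathcal{H}(K)$, and $\nu_{X,K}$ is the unique probability measure on $\mathcal{X}(K)$ such that for every Borel set $S\subseteq\mathcal{H}(K)$, $$(p^N_K(\mu_X))(S)=\int_{Y\in\mathcal{X}(K)}\mu_Y(S)\,\nu_{X,K}(dY).$$ Equivalently, $\nu_{X,K}$ is the distribution of the weakly increasing tuple of eigenvalues of $p^N_K(H)$ when $H$ is distributed according to $\mu_X$. Vandermonde notation: for $A=(a_1,\dots,a_K)$, $V(A)=\prod_{1\le i<j\le K}(a_j-a_i)$. Empty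 products equal $1$. Fundamental spline (one real variable $a$ before the semicolon): for $n\ge2$ and real knots $y_1<\dots<y_n$, $$M(a;y_1,\dots,y_n):=(n-1)\sum_{i:\,y_i>a}\frac{(y_i-a)^{n-2}}{\prod_{r\ne i}(y_i-y_r)},\qquad a\in\mathbb{R},$$ where $i,r$ range over $\{1,\dots,n\}$. (For $n=2$ this is $\mathbf 1_{y_1\le a\le y_2}/(y_2-y_1)$, up to the value at the single point $a=y_2$, which is irrelevant for densities.) In the determinant, the $(i,j)$ entry is the fundamental spline with the $N-K+1$ knots $x_i,x_{i+1},\dots,x_{N-K+i}$, evaluated at $a_j$. *)

theory Defs
  imports
    "HOL-Probability.Probability"
    "Jordan_Normal_Form.Schur_Decomposition"
begin

text \<open>
  A real tuple \<open>(x\<^sub>1, \<dots>, x\<^sub>n)\<close> is a function on \<open>nat\<close> of which only the values on \<open>{1..n}\<close>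
  matter; rows and columns of matrices are numbered from 0.
\<close>

definition herm :: "nat \<Rightarrow> complex mat set" where
  "herm n = {H \<in> carrier_mat n n. mat_adjoint H = H}"

definition unitary_group :: "nat \<Rightarrow> complex mat set" where
  "unitary_group n =
    {U \<in> carrier_mat n n. U * mat_adjoint U = 1\<^sub>m n \<and> mat_adjoint U * U = 1\<^sub>m n}"

text \<open>
  The Borel sigma-algebra of the vector space of Hermitian matrices is the one generated by the
  matrix entries. As in \<open>borel\<close>, only the space and the sigma-algebra of \<open>herm_borel\<close> matter.
\<close>

definition herm_borel :: "nat \<Rightarrow> complex mat measure" where
  "herm_borel n =
    vimage_algebra (herm n) (\<lambda>H. \<lambda>ij\<in>{..<n} \<times> {..<n}. H $$ ij)
      (PiM ({..<n} \<times> {..<n}) (\<lambda>_. borel))"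

definition corner :: "nat \<Rightarrow> complex mat \<Rightarrow> complex mat" where
  "corner k H = mat k k (\<lambda>ij. H $$ ij)"

definition spectral_orbit :: "nat \<Rightarrow> (nat \<Rightarrow> real) \<Rightarrow> complex mat set" where
  "spectral_orbit n x =
    {H \<in> herm n. char_poly H = (\<Prod>i\<in>{1..n}. [:- complex_of_real (x i), 1:])}"

definition is_orbital_measure :: "nat \<Rightarrow> (nat \<Rightarrow> real) \<Rightarrow> complex mat measure \<Rightarrow> bool" where
  "is_orbital_measure n x \<mu> \<longleftrightarrow>
    sets \<mu> = sets (herm_borel n) \<and> prob_space \<mu> \<and>
    (\<forall>U\<in>unitary_group n. distr \<mu> (herm_borel n) (\<lambda>H. U * H * mat_adjoint U) = \<mu>) \<and>
    (AE H in \<mu>. H \<in> spectral_orbit n x)"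

definition orbital_measure :: "nat \<Rightarrow> (nat \<Rightarrow> real) \<Rightarrow> complex mat measure" where
  "orbital_measure n x = (THE \<mu>. is_orbital_measure n x \<mu>)"

definition corner_measure :: "nat \<Rightarrow> nat \<Rightarrow> (nat \<Rightarrow> real) \<Rightarrow> complex mat measure" where
  "corner_measure n k x = distr (orbital_measure n x) (herm_borel k) (corner k)"

definition weyl_chamber :: "nat \<Rightarrow> (nat \<Rightarrow> real) set" where
  "weyl_chamber k = {a \<in> extensional {1..k}. mono_on {1..k} a}"

definition chamber_lebesgue :: "nat \<Rightarrow> (nat \<Rightarrow> real) measure" where
  "chamber_lebesgue k = restrict_space (PiM {1..k} (\<lambda>_. lborel)) (weyl_chamber k)"

definition is_radial_part ::
    "nat \<Rightarrow> nat \<Rightarrow> (nat \<Rightarrow> real) \<Rightarrow> (nat \<Rightarrow> real) measure \<Rightarrow> bool" where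
  "is_radial_part n k x \<nu> \<longleftrightarrow>
    sets \<nu> = sets (chamber_lebesgue k) \<and> prob_space \<nu> \<and>
    (\<forall>S\<in>sets (herm_borel k).
      emeasure (corner_measure n k x) S = (\<integral>\<^sup>+ Y. emeasure (orbital_measure k Y) S \<partial>\<nu>))"

definition radial_part :: "nat \<Rightarrow> nat \<Rightarrow> (nat \<Rightarrow> real) \<Rightarrow> (nat \<Rightarrow> real) measure" where
  "radial_part n k x = (THE \<nu>. is_radial_part n k x \<nu>)"

definition vandermonde :: "nat \<Rightarrow> (nat \<Rightarrow> real) \<Rightarrow> real" where
  "vandermonde k a = (\<Prod>(i, j)\<in>{(i, j) \<in> {1..k} \<times> {1..k}. i < j}. a j - a i)"

text \<open>The fundamental spline with the \<open>n \<ge> 2\<close> knots \<open>y\<^sub>1 < \<dots> < y\<^sub>n\<close>.\<close>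

definition fundamental_spline :: "nat \<Rightarrow> (nat \<Rightarrow> real) \<Rightarrow> real \<Rightarrow> real" where
  "fundamental_spline n y a =
    real (n - 1) * (\<Sum>i\<in>{i \<in> {1..n}. y i > a}.
      (y i - a) ^ (n - 2) / (\<Prod>r\<in>{1..n} - {i}. y i - y r))"

text \<open>
  Entry \<open>(i, j)\<close> below, for \<open>i\<close> and \<open>j\<close> starting from 0, is the spline with the \<open>N - K + 1\<close> knots
  \<open>x\<^sub>i\<^sub>+\<^sub>1, \<dots>, x\<^sub>N\<^sub>-\<^sub>K\<^sub>+\<^sub>i\<^sub>+\<^sub>1\<close> at \<open>a\<^sub>j\<^sub>+\<^sub>1\<close>.
\<close>

definition spline_matrix :: "nat \<Rightarrow> nat \<Rightarrow> (nat \<Rightarrow> real) \<Rightarrow> (nat \<Rightarrow> real) \<Rightarrow> real mat" where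
  "spline_matrix N K x a =
    mat K K (\<lambda>(i, j). fundamental_spline (N - K + 1) (\<lambda>l. x (i + l)) (a (j + 1)))"

definition corner_density :: "nat \<Rightarrow> nat \<Rightarrow> (nat \<Rightarrow> real) \<Rightarrow> (nat \<Rightarrow> real) \<Rightarrow> real" where
  "corner_density N K x a =
    (\<Prod>i\<in>{1..<K}. real ((N - K + i) choose i)) *
    (vandermonde K a * Determinant.det (spline_matrix N K x a)) /
    (\<Prod>(j, i)\<in>{(j, i) \<in> {1..N} \<times> {1..N}. i + (N - K + 1) \<le> j}. x j - x i)"

end

theory Submission
  imports Defs
begin

text \<open>
  The eigenvalues of the \<open>K \<times> K\<close> corner are reached by deleting one row and one column at a time.

  Deleting the last row and column of the \<open>n \<times> n\<close> matrix \<open>H = Q diag(x) Q\<^sup>*\<close>, with \<open>Q\<close> Haar distributed. By Cramer's rule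
  for the resolvent, the characteristic polynomial of the corner is
  \<open>\<Sum>i. |q i|\<^sup>2 * (\<Prod>r \<noteq> i. z - x r)\<close>, where \<open>q\<close> is the last row of \<open>Q\<close>
  (\<open>char_poly_corner_conjugate\<close>). That row is a normalized complex Gaussian vector, so
  \<open>|q i|\<^sup>2 = s i / S\<close> with independent exponential variables \<open>s i\<close> and \<open>S = \<Sum>i. s i\<close>. The map from
  \<open>s\<close> to the pair of \<open>S\<close> and the roots \<open>a\<close> is a bijection from the positive orthant onto
  \<open>S > 0\<close> and \<open>a\<close> interlacing \<open>x\<close>, with Jacobian \<open>S ^ (n - 1) * V(a) / V(x)\<close>
  (\<open>nn_integral_positive_orthant\<close>). The density of \<open>s\<close> is \<open>exp (- S)\<close>; integrating out \<open>S\<close> leaves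
  the density \<open>(n - 1)! V(a) / V(x)\<close> on the tuples \<open>a\<close> that interlace \<open>x\<close>
  (\<open>nn_integral_sorted_eigenvalues_corner_codim1\<close>). This is the claim for \<open>K = N - 1\<close>, since a spline with
  two knots is a normalized indicator and the determinant of these indicators detects interlacing.

  Deleting one more row and column. The law of the corner of size \<open>K + 1\<close> is invariant under conjugation,
  so, given its eigenvalues \<open>Y\<close>, this corner is distributed according to the orbital measure of \<open>Y\<close>
  (\<open>conj_invariant_radial\<close>). Hence the density for \<open>K\<close> is the integral of the density for \<open>K + 1\<close>
  against \<open>K! V(a) / V(Y)\<close> over the tuples \<open>Y\<close> interlaced by \<open>a\<close>. The factor \<open>V(Y)\<close> cancels, and what
  remains is the integral of a determinant of splines with \<open>L = N - K\<close> knots over a product of intervals,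
  which is computed column by column. The integral of a spline from \<open>t\<close> to infinity is an
  explicit function \<open>spline_tail\<close>, and its values for two consecutive groups of knots differ by a
  multiple of the spline with \<open>L + 1\<close> knots (\<open>spline_tail_diff\<close>). Unimodular row and
  column operations therefore turn the integral into the determinant of size \<open>K\<close>, multiplied by
  \<open>\<Prod>i. (x (i + L) - x i) / L\<close> (\<open>integral_det_spline_interlaces\<close>). These factors cancel one diagonal of
  the denominator and turn the binomial constant for \<open>K + 1\<close> into the one for \<open>K\<close>
  (\<open>corner_density_recursion\<close>).

  The measures themselves come from Gaussian vectors. Gram-Schmidt orthogonalization of independent Gaussian
  rows is almost surely unitary and commutes with right multiplication by unitary matrices, which yields an
  invariant law \<open>haar\<close>. By the spectral theorem, and averaging over \<open>haar\<close>, the orbital measures exist, are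
  unique, and every conjugation-invariant law is the mixture of orbital measures over its own law of sorted
  eigenvalues. So the radial part is the law of the sorted eigenvalues of the corner
  (\<open>radial_part_eq\<close>).
\<close>

section \<open>Substitution and scaling of Lebesgue integrals\<close>

text \<open>
  The image of the open interval is unbounded, so the substitution is made on compact intervals that
  exhaust it, where the reflection \<open>a \<mapsto> - a\<close> turns \<open>g\<close> into an increasing function; monotone
  convergence gives the limit.
\<close>

lemma nn_integral_substitution_decreasing:
  fixes G :: "real \<Rightarrow> ennreal" and g g' :: "real \<Rightarrow> real" and l u :: real
  assumes [measurable]: "G \<in> borel_measurable borel"
    and lu: "l < u"
    and deriv: "\<And>a. a \<in> {l<..<u} \<Longrightarrow> (g has_real_derivative - g' a) (at a)"
    and cont: "continuous_on {l<..<u} g'"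
    and g'_nonneg: "\<And>a. a \<in> {l<..<u} \<Longrightarrow> 0 \<le> g' a"
    and g_pos: "\<And>a. a \<in> {l<..<u} \<Longrightarrow> 0 < g a"
    and lim_u: "(g \<longlongrightarrow> 0) (at_left u)"
    and lim_l: "filterlim g at_top (at_right l)"
  shows "(\<integral>\<^sup>+t. G t * indicator {0<..} t \<partial>lborel)
       = (\<integral>\<^sup>+a. G (g a) * ennreal (g' a) * indicator {l<..<u} a \<partial>lborel)"
proof -
  \<comment> \<open>The offset 3 keeps \<open>d k\<close> below half the length of the interval, already for \<open>k = 0\<close>.\<close>
  define d where "d k = (u - l) / (real k + 3)" for k :: nat
  have d_pos: "0 < d k" for k
    using lu by (simp add: d_def)
  have d_less: "d k < (u - l) / 2" for k
    unfolding d_def using lu by (intro divide_strict_left_mono) auto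
  have d_mono: "d k' \<le> d k" if "k \<le> k'" for k k'
    using lu that by (auto simp: d_def intro!: divide_left_mono)
  have d_lim: "d \<longlonglongrightarrow> 0"
    unfolding d_def by real_asymp
  define lo where "lo k = l + d k" for k
  define hi where "hi k = u - d k" for k
  have lohi: "l < lo k" "lo k < hi k" "hi k < u" for k
    using d_pos[of k] d_less[of k] by (auto simp: lo_def hi_def field_simps)
  have "lo \<longlonglongrightarrow> l"
    using tendsto_add[OF tendsto_const d_lim, of l] by (simp add: lo_def[abs_def])
  then have lo_lim: "filterlim lo (at_right l) sequentially"
    using lohi by (intro tendsto_imp_filterlim_at_right) auto
  have "hi \<longlonglongrightarrow> u"
    using tendsto_diff[OF tendsto_const d_lim, of u] by (simp add: hi_def[abs_def])
  then have hi_lim: "filterlim hi (at_left u) sequentially"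
    using lohi by (intro tendsto_imp_filterlim_at_left) auto
  have anti: "g b \<le> g a" if "l < a" "a \<le> b" "b < u" for a b
  proof (rule DERIV_nonpos_imp_nonincreasing[OF \<open>a \<le> b\<close>])
    fix t assume "a \<le> t" "t \<le> b"
    then have t: "t \<in> {l<..<u}" using that by auto
    show "\<exists>y. (g has_real_derivative y) (at t) \<and> y \<le> 0"
      using deriv[OF t] g'_nonneg[OF t] by (intro exI[of _ "- g' t"] conjI) simp_all
  qed
  have meas: "(\<lambda>a. G (g a) * ennreal (g' a) * indicator {lo k..hi k} a) \<in> borel_measurable borel" for k
  proof -
    have cg: "continuous_on {lo k..hi k} g"
      by (rule DERIV_continuous_on[of _ g "\<lambda>a. - g' a"], rule has_field_derivative_at_within, rule deriv)
         (use lohi[of k] in auto)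
    have cg': "continuous_on {lo k..hi k} g'"
      by (rule continuous_on_subset[OF cont]) (use lohi[of k] in auto)
    have m1: "(\<lambda>a. indicator {lo k..hi k} a *\<^sub>R g a) \<in> borel_measurable borel"
      and m2: "(\<lambda>a. indicator {lo k..hi k} a *\<^sub>R g' a) \<in> borel_measurable borel"
      by (rule borel_measurable_continuous_on_indicator[OF _ cg] borel_measurable_continuous_on_indicator[OF _ cg'], simp)+
    have "(\<lambda>a. G (indicator {lo k..hi k} a *\<^sub>R g a) * ennreal (indicator {lo k..hi k} a *\<^sub>R g' a) * indicator {lo k..hi k} a) \<in> borel_measurable borel"
      using m1 m2 by measurable
    also have "(\<lambda>a. G (indicator {lo k..hi k} a *\<^sub>R g a) * ennreal (indicator {lo k..hi k} a *\<^sub>R g' a) * indicator {lo k..hi k} a)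
        = (\<lambda>a. G (g a) * ennreal (g' a) * indicator {lo k..hi k} a)"
      by (auto split: split_indicator)
    finally show ?thesis by simp
  qed
  have fin: "(\<integral>\<^sup>+t. G t * indicator {g (hi k)..g (lo k)} t \<partial>lborel)
      = (\<integral>\<^sup>+a. G (g a) * ennreal (g' a) * indicator {lo k..hi k} a \<partial>lborel)" for k
  proof -
    define h where "h b = g (- b)" for b
    define h' where "h' b = g' (- b)" for b
    have "(\<integral>\<^sup>+t. G t * indicator {h (- hi k)..h (- lo k)} t \<partial>lborel)
        = (\<integral>\<^sup>+b. G (h b) * h' b * indicator {- hi k..- lo k} b \<partial>lborel)"
    proof (rule nn_integral_substitution_aux)
      show "(h has_real_derivative h' b) (at b)" if "b \<in> {- hi k..- lo k}" for b
      proof -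
        have "- b \<in> {l<..<u}" using that lohi[of k] by auto
        from deriv[OF this] show ?thesis
          unfolding DERIV_mirror by (simp add: h_def[abs_def] h'_def)
      qed
      have "continuous_on {- hi k..- lo k} (g' \<circ> uminus)"
        by (intro continuous_on_compose continuous_intros continuous_on_subset[OF cont])
           (use lohi[of k] in auto)
      then show "continuous_on {- hi k..- lo k} h'"
        by (simp add: h'_def[abs_def] o_def)
      show "0 \<le> h' b" if "b \<in> {- hi k..- lo k}" for b
        using that lohi[of k] g'_nonneg[of "- b"] by (auto simp: h'_def)
    qed (use lohi[of k] in auto)
    also have "\<dots> = (\<integral>\<^sup>+b. G (g (- b)) * g' (- b) * indicator {lo k..hi k} (- b) \<partial>lborel)"
      by (intro nn_integral_cong) (auto simp: h_def h'_def split: split_indicator)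
    also have "\<dots> = (\<integral>\<^sup>+a. G (g a) * ennreal (g' a) * indicator {lo k..hi k} a \<partial>distr lborel borel uminus)"
      using meas by (subst nn_integral_distr) auto
    also have "distr lborel borel uminus = (lborel :: real measure)"
      by (rule lborel_distr_uminus)
    finally show ?thesis by (simp add: h_def)
  qed
  have ind_mono: "indicator A t \<le> (indicator B t :: ennreal)" if "A \<subseteq> B" for A B :: "real set" and t
    using that by (auto simp: indicator_def)
  have inc: "{g (hi k)..g (lo k)} \<subseteq> {g (hi k')..g (lo k')}" "{lo k..hi k} \<subseteq> {lo k'..hi k'}" if "k \<le> k'" for k k'
    using d_mono[OF that] anti[of "lo k'" "lo k"] anti[of "hi k" "hi k'"] lohi[of k] lohi[of k']
    by (auto simp: lo_def hi_def)
  have "(\<lambda>k. \<integral>\<^sup>+t. G t * indicator {g (hi k)..g (lo k)} t \<partial>lborel)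
      \<longlonglongrightarrow> (\<integral>\<^sup>+t. G t * indicator {0<..} t \<partial>lborel)"
  proof (rule nn_integral_LIMSEQ)
    show "incseq (\<lambda>k t. G t * indicator {g (hi k)..g (lo k)} t)"
      unfolding incseq_def le_fun_def by (intro allI impI mult_left_mono ind_mono inc) auto
    show "(\<lambda>k. G t * indicator {g (hi k)..g (lo k)} t) \<longlonglongrightarrow> G t * indicator {0<..} t" for t
    proof (cases "0 < t")
      case True
      have "eventually (\<lambda>k. g (hi k) < t) sequentially"
        using filterlim_compose[OF lim_u hi_lim] True by (auto dest: order_tendstoD)
      moreover have "eventually (\<lambda>k. t \<le> g (lo k)) sequentially"
        using filterlim_compose[OF lim_l lo_lim] by (auto simp: filterlim_at_top)
      ultimately have "eventually (\<lambda>k. G t * indicator {g (hi k)..g (lo k)} t = G t) sequentially"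
        by eventually_elim auto
      then show ?thesis using True by (simp add: tendsto_eventually)
    next
      case False
      then have z: "G t * indicator {g (hi k)..g (lo k)} t = 0" for k
        using g_pos[of "hi k"] lohi[of k] by (auto split: split_indicator)
      show ?thesis unfolding z using False by simp
    qed
  qed auto
  moreover have "(\<lambda>k. \<integral>\<^sup>+a. G (g a) * ennreal (g' a) * indicator {lo k..hi k} a \<partial>lborel)
      \<longlonglongrightarrow> (\<integral>\<^sup>+a. G (g a) * ennreal (g' a) * indicator {l<..<u} a \<partial>lborel)"
  proof (rule nn_integral_LIMSEQ)
    show "incseq (\<lambda>k a. G (g a) * ennreal (g' a) * indicator {lo k..hi k} a)"
      unfolding incseq_def le_fun_def by (intro allI impI mult_left_mono ind_mono inc) auto
    show "(\<lambda>k. G (g a) * ennreal (g' a) * indicator {lo k..hi k} a)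
        \<longlonglongrightarrow> G (g a) * ennreal (g' a) * indicator {l<..<u} a" for a
    proof (cases "a \<in> {l<..<u}")
      case True
      have "eventually (\<lambda>k. lo k < a) sequentially"
        using tendsto_add[OF tendsto_const d_lim, of l] True by (auto simp: lo_def dest: order_tendstoD)
      moreover have "eventually (\<lambda>k. a < hi k) sequentially"
        using tendsto_diff[OF tendsto_const d_lim, of u] True by (auto simp: hi_def dest: order_tendstoD)
      ultimately have "eventually (\<lambda>k. G (g a) * ennreal (g' a) * indicator {lo k..hi k} a = G (g a) * ennreal (g' a)) sequentially"
        by eventually_elim auto
      then show ?thesis using True by (simp add: tendsto_eventually)
    next
      case False
      then have "indicator {lo k..hi k} a = (0::ennreal)" for k
        using lohi[of k] by (auto split: split_indicator)
      then show ?thesis using False by simp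
    qed
    show "(\<lambda>a. G (g a) * ennreal (g' a) * indicator {lo k..hi k} a) \<in> borel_measurable lborel" for k
      unfolding measurable_lborel2 by (rule meas)
  qed
  ultimately show ?thesis
    unfolding fin by (rule LIMSEQ_unique)
qed

lemma measurable_component_lborel [measurable (raw)]:
  "i \<in> I \<Longrightarrow> (\<lambda>s. s i) \<in> borel_measurable (PiM I (\<lambda>_. lborel))"
  using measurable_component_singleton[of i I "\<lambda>_. lborel"] by simp

lemma sigma_finite_PiM_lborel:
  "finite I \<Longrightarrow> sigma_finite_measure (PiM I (\<lambda>_. lborel :: 'a::euclidean_space measure))"
  by (intro product_sigma_finite.sigma_finite product_sigma_finite.intro lborel.sigma_finite_measure_axioms)

lemma product_sigma_finite_lborel: "product_sigma_finite (\<lambda>_. lborel :: 'a::euclidean_space measure)"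
  by (intro product_sigma_finite.intro lborel.sigma_finite_measure_axioms)

lemma nn_integral_PiM_lborel_scale:
  fixes c :: "'i \<Rightarrow> real"
  assumes "finite I" and "\<And>i. i \<in> I \<Longrightarrow> 0 < c i"
    and "F \<in> borel_measurable (PiM I (\<lambda>_. lborel))"
  shows "(\<integral>\<^sup>+s. F s \<partial>PiM I (\<lambda>_. lborel))
    = (\<integral>\<^sup>+s. F (\<lambda>i\<in>I. c i * s i) * ennreal (\<Prod>i\<in>I. c i) \<partial>PiM I (\<lambda>_. lborel))"
  using assms
proof (induction I arbitrary: F rule: finite_induct)
  case empty
  interpret product_sigma_finite "\<lambda>_. lborel :: real measure"
    by (rule product_sigma_finite_lborel)
  show ?case by (simp add: PiM_empty nn_integral_count_space_finite restrict_def max.absorb2)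
next
  case (insert i I)
  interpret product_sigma_finite "\<lambda>_. lborel :: real measure"
    by (rule product_sigma_finite_lborel)
  interpret I: sigma_finite_measure "PiM I (\<lambda>_. lborel :: real measure)"
    by (rule sigma_finite_PiM_lborel) (rule insert.hyps)
  note [measurable] = insert.prems(2)
  have c: "0 < c i" "\<And>j. j \<in> I \<Longrightarrow> 0 < c j" "0 \<le> (\<Prod>j\<in>I. c j)"
    using insert.prems(1) by (auto intro!: prod_nonneg intro: less_imp_le)
  have [measurable]: "(\<lambda>(y, s). (\<lambda>j\<in>I. c j * s j)(i := y)) \<in> borel \<Otimes>\<^sub>M PiM I (\<lambda>_. lborel) \<rightarrow>\<^sub>M PiM (insert i I) (\<lambda>_. lborel)"
  proof -
    have "(\<lambda>(y, s). (\<lambda>j\<in>I. c j * s j)(i := y)) = (\<lambda>p. \<lambda>j\<in>insert i I. if j = i then fst p else c j * snd p j)"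
      using insert.hyps by (auto simp: fun_eq_iff restrict_def split: prod.splits)
    also have "\<dots> \<in> borel \<Otimes>\<^sub>M PiM I (\<lambda>_. lborel) \<rightarrow>\<^sub>M PiM (insert i I) (\<lambda>_. lborel)"
    proof (rule measurable_restrict)
      fix j assume "j \<in> insert i I"
      then show "(\<lambda>p. if j = i then fst p else c j * snd p j) \<in> borel \<Otimes>\<^sub>M PiM I (\<lambda>_. lborel) \<rightarrow>\<^sub>M lborel"
        by (cases "j = i") auto
    qed
    finally show ?thesis .
  qed
  have [measurable]: "(\<lambda>p. F ((\<lambda>j\<in>I. c j * snd p j)(i := fst p))) \<in> borel_measurable (borel \<Otimes>\<^sub>M PiM I (\<lambda>_. lborel))"
  proof -
    have "(\<lambda>p. F ((\<lambda>(y, s). (\<lambda>j\<in>I. c j * s j)(i := y)) p)) \<in> borel_measurable (borel \<Otimes>\<^sub>M PiM I (\<lambda>_. lborel))"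
      by measurable
    then show ?thesis by (simp add: split_beta)
  qed
  have "(\<integral>\<^sup>+s. F s \<partial>PiM (insert i I) (\<lambda>_. lborel)) = (\<integral>\<^sup>+y. \<integral>\<^sup>+s. F (s(i := y)) \<partial>PiM I (\<lambda>_. lborel) \<partial>lborel)"
    by (rule product_nn_integral_insert_rev) (use insert.hyps insert.prems in auto)
  also have "\<dots> = (\<integral>\<^sup>+y. \<integral>\<^sup>+s. F ((\<lambda>j\<in>I. c j * s j)(i := y)) * ennreal (\<Prod>j\<in>I. c j) \<partial>PiM I (\<lambda>_. lborel) \<partial>lborel)"
  proof (rule nn_integral_cong)
    fix y :: real
    have "(\<lambda>s. F (s(i := y))) \<in> borel_measurable (PiM I (\<lambda>_. lborel))"
      by (rule measurable_compose[OF measurable_fun_upd[where J=I] insert.prems(2)]) auto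
    from insert.IH[OF c(2) this]
    show "(\<integral>\<^sup>+s. F (s(i := y)) \<partial>PiM I (\<lambda>_. lborel)) = (\<integral>\<^sup>+s. F ((\<lambda>j\<in>I. c j * s j)(i := y)) * ennreal (\<Prod>j\<in>I. c j) \<partial>PiM I (\<lambda>_. lborel))" .
  qed
  also have "\<dots> = \<bar>c i\<bar> * (\<integral>\<^sup>+y. \<integral>\<^sup>+s. F ((\<lambda>j\<in>I. c j * s j)(i := c i * y)) * ennreal (\<Prod>j\<in>I. c j) \<partial>PiM I (\<lambda>_. lborel) \<partial>lborel)"
    by (subst nn_integral_real_affine[where c="c i" and t=0]) (use c in \<open>auto\<close>)
  also have "\<dots> = (\<integral>\<^sup>+y. \<integral>\<^sup>+s. F ((\<lambda>j\<in>I. c j * s j)(i := c i * y)) * ennreal (\<Prod>j\<in>insert i I. c j) \<partial>PiM I (\<lambda>_. lborel) \<partial>lborel)"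
  proof -
    have m: "(\<lambda>s. F ((\<lambda>j\<in>I. c j * s j)(i := c i * y)) * ennreal (\<Prod>j\<in>I. c j)) \<in> borel_measurable (PiM I (\<lambda>_. lborel))" for y
    proof -
      have "(\<lambda>s. (\<lambda>p. F ((\<lambda>j\<in>I. c j * snd p j)(i := fst p))) (c i * y, s)) \<in> borel_measurable (PiM I (\<lambda>_. lborel))"
        by measurable
      then show ?thesis by simp
    qed
    have m2: "(\<lambda>y. \<integral>\<^sup>+s. F ((\<lambda>j\<in>I. c j * s j)(i := c i * y)) * ennreal (\<Prod>j\<in>I. c j) \<partial>PiM I (\<lambda>_. lborel)) \<in> borel_measurable borel"
    proof -
      have "(\<lambda>q. (\<lambda>p. F ((\<lambda>j\<in>I. c j * snd p j)(i := fst p)) * ennreal (\<Prod>j\<in>I. c j)) (c i * fst q, snd q)) \<in> borel_measurable (borel \<Otimes>\<^sub>M PiM I (\<lambda>_. lborel))"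
        by measurable
      from I.borel_measurable_nn_integral_fst[OF this] show ?thesis by simp
    qed
    show ?thesis
      using c insert.hyps m m2
      by (simp add: nn_integral_cmult[symmetric] ennreal_mult' prod_nonneg mult_ac less_imp_le)
  qed
  also have "\<dots> = (\<integral>\<^sup>+s. F (\<lambda>j\<in>insert i I. c j * s j) * ennreal (\<Prod>j\<in>insert i I. c j) \<partial>PiM (insert i I) (\<lambda>_. lborel))"
  proof (subst product_nn_integral_insert_rev)
    have eq: "(\<lambda>j\<in>I. c j * s j)(i := c i * y) = (\<lambda>j\<in>insert i I. c j * (s(i := y)) j)" for s y
      using insert.hyps by (auto simp: fun_eq_iff restrict_def)
    show "(\<integral>\<^sup>+y. \<integral>\<^sup>+s. F ((\<lambda>j\<in>I. c j * s j)(i := c i * y)) * ennreal (\<Prod>j\<in>insert i I. c j) \<partial>PiM I (\<lambda>_. lborel) \<partial>lborel)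
      = (\<integral>\<^sup>+y. \<integral>\<^sup>+s. F (\<lambda>j\<in>insert i I. c j * (s(i := y)) j) * ennreal (\<Prod>j\<in>insert i I. c j) \<partial>PiM I (\<lambda>_. lborel) \<partial>lborel)"
      by (simp only: eq)
  qed (use insert.hyps in auto)
  finally show ?case .
qed

section \<open>Interlacing tuples and their weights at the nodes\<close>

text \<open>
  The residue at \<open>z = x i\<close> of \<open>S * (\<Prod>j. z - a j) / (\<Prod>r. z - x r)\<close>. Read backwards, \<open>S\<close> is the sum of the
  weights and the \<open>a j\<close> are the zeros of \<open>\<Sum>i. s i / (z - x i)\<close>.
\<close>

definition node_weight :: "nat \<Rightarrow> (nat \<Rightarrow> real) \<Rightarrow> real \<Rightarrow> (nat \<Rightarrow> real) \<Rightarrow> nat \<Rightarrow> real" where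
  "node_weight n x S a i = S * (\<Prod>j\<in>{1..<n}. x i - a j) / (\<Prod>r\<in>{1..n} - {i}. x i - x r)"

definition strictly_interlaces :: "nat \<Rightarrow> (nat \<Rightarrow> real) \<Rightarrow> (nat \<Rightarrow> real) \<Rightarrow> bool" where
  "strictly_interlaces n x a \<longleftrightarrow> (\<forall>j\<in>{1..<n}. x j < a j \<and> a j < x (Suc j))"

text \<open>
  Lagrange interpolation: both sides have degree less than \<open>n\<close> and agree at the \<open>n\<close> nodes.
\<close>

lemma node_weight_interpolation:
  assumes inj: "inj_on x {1..n}" and n: "1 \<le> n"
  shows "(\<Sum>i\<in>{1..n}. Polynomial.smult (node_weight n x S a i) (\<Prod>r\<in>{1..n} - {i}. [:- x r, 1:]))
    = Polynomial.smult S (\<Prod>j\<in>{1..<n}. [:- a j, 1:])" (is "?L = ?R")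
proof (rule poly_eqI_degree)
  have card: "card (x ` {1..n}) = n"
    using card_image[OF inj] by simp
  have deg: "degree (\<Prod>r\<in>A. [:- f r, 1:]) \<le> card A" if "finite A" for A :: "nat set" and f :: "nat \<Rightarrow> real"
    using degree_prod_sum_le[OF that, of "\<lambda>r. [:- f r, 1:]"] by (simp add: o_def)
  have "degree ?L \<le> n - 1"
  proof (rule degree_sum_le)
    fix i assume "i \<in> {1..n}"
    then show "degree (Polynomial.smult (node_weight n x S a i) (\<Prod>r\<in>{1..n} - {i}. [:- x r, 1:])) \<le> n - 1"
      using deg[of "{1..n} - {i}" x] by (intro order_trans[OF degree_smult_le]) simp
  qed simp
  then show "degree ?L < card (x ` {1..n})" unfolding card using n by linarith
  have "degree ?R \<le> n - 1"
    using deg[of "{1..<n}" a] by (intro order_trans[OF degree_smult_le]) simp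
  then show "degree ?R < card (x ` {1..n})" unfolding card using n by linarith
  fix z assume "z \<in> x ` {1..n}"
  then obtain k where k: "k \<in> {1..n}" "z = x k" by auto
  have nz: "(\<Prod>r\<in>{1..n} - {k}. x k - x r) \<noteq> 0"
    using inj_on_eq_iff[OF inj k(1)] by auto
  have "poly ?L z = (\<Sum>i\<in>{1..n}. node_weight n x S a i * (\<Prod>r\<in>{1..n} - {i}. x k - x r))"
    by (simp add: k poly_sum poly_prod)
  also have "\<dots> = (\<Sum>i\<in>{1..n}. if i = k then S * (\<Prod>j\<in>{1..<n}. x k - a j) else 0)"
  proof (rule sum.cong[OF refl])
    fix i assume i: "i \<in> {1..n}"
    show "node_weight n x S a i * (\<Prod>r\<in>{1..n} - {i}. x k - x r) = (if i = k then S * (\<Prod>j\<in>{1..<n}. x k - a j) else 0)"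
    proof (cases "i = k")
      case True then show ?thesis using nz by (simp add: node_weight_def)
    next
      case False
      then have "(\<Prod>r\<in>{1..n} - {i}. x k - x r) = 0"
        using k by (intro prod_zero) auto
      then show ?thesis using False by simp
    qed
  qed
  also have "\<dots> = poly ?R z" using k by (simp add: poly_prod)
  finally show "poly ?L z = poly ?R z" .
qed

lemma node_weight_partial_fractions:
  assumes inj: "inj_on x {1..n}" and n: "1 \<le> n" and z: "\<And>i. i \<in> {1..n} \<Longrightarrow> z \<noteq> x i"
  shows "(\<Sum>i\<in>{1..n}. node_weight n x S a i / (z - x i))
    = S * (\<Prod>j\<in>{1..<n}. z - a j) / (\<Prod>i\<in>{1..n}. z - x i)"
proof -
  have nz: "(\<Prod>i\<in>{1..n}. z - x i) \<noteq> 0" using z by auto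
  have "S * (\<Prod>j\<in>{1..<n}. z - a j) = poly (Polynomial.smult S (\<Prod>j\<in>{1..<n}. [:- a j, 1:])) z"
    by (simp add: poly_prod)
  also have "\<dots> = (\<Sum>i\<in>{1..n}. node_weight n x S a i * (\<Prod>r\<in>{1..n} - {i}. z - x r))"
    unfolding node_weight_interpolation[OF inj n, symmetric] by (simp add: poly_sum poly_prod)
  also have "\<dots> = (\<Sum>i\<in>{1..n}. node_weight n x S a i / (z - x i)) * (\<Prod>i\<in>{1..n}. z - x i)"
    unfolding sum_distrib_right
  proof (rule sum.cong[OF refl])
    fix i assume i: "i \<in> {1..n}"
    have "(\<Prod>r\<in>{1..n}. z - x r) = (z - x i) * (\<Prod>r\<in>{1..n} - {i}. z - x r)"
      using i by (intro prod.remove) auto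
    then show "node_weight n x S a i * (\<Prod>r\<in>{1..n} - {i}. z - x r) = node_weight n x S a i / (z - x i) * (\<Prod>r\<in>{1..n}. z - x r)"
      using z[OF i] by simp
  qed
  finally show ?thesis using nz by (simp add: field_simps)
qed

text \<open>
  Comparison of the coefficients of degree \<open>n - 1\<close> in the interpolation formula.
\<close>

lemma sum_node_weight:
  assumes inj: "inj_on x {1..n}" and n: "1 \<le> n"
  shows "(\<Sum>i\<in>{1..n}. node_weight n x S a i) = S"
proof -
  have lead: "poly.coeff (\<Prod>r\<in>A. [:- f r, 1:]) (card A) = (1::real)" if "finite A" for A :: "nat set" and f
  proof -
    have "degree (\<Prod>r\<in>A. [:- f r, 1:]) = card A"
      by (subst degree_prod_eq_sum_degree) auto
    moreover have "lead_coeff (\<Prod>r\<in>A. [:- f r, 1:]) = 1" by (simp add: lead_coeff_prod)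
    ultimately show ?thesis by simp
  qed
  have "S = poly.coeff (Polynomial.smult S (\<Prod>j\<in>{1..<n}. [:- a j, 1:])) (n - 1)"
    using lead[of "{1..<n}" a] by simp
  also have "\<dots> = (\<Sum>i\<in>{1..n}. node_weight n x S a i * poly.coeff (\<Prod>r\<in>{1..n} - {i}. [:- x r, 1:]) (n - 1))"
    unfolding node_weight_interpolation[OF inj n, symmetric] by (simp add: coeff_sum)
  also have "\<dots> = (\<Sum>i\<in>{1..n}. node_weight n x S a i)"
  proof (intro sum.cong refl)
    fix i assume i: "i \<in> {1..n}"
    then have "card ({1..n} - {i}) = n - 1" by (simp add: card_Diff_singleton)
    with lead[of "{1..n} - {i}" x]
    show "node_weight n x S a i * poly.coeff (\<Prod>r\<in>{1..n} - {i}. [:- x r, 1:]) (n - 1) = node_weight n x S a i"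
      by (simp only: finite_Diff finite_atLeastAtMost mult_1_right)
  qed
  finally show ?thesis by simp
qed

lemma vandermonde_Suc:
  "vandermonde (Suc k) a = vandermonde k a * (\<Prod>i\<in>{1..k}. a (Suc k) - a i)"
proof -
  have "{(i, j) \<in> {1..Suc k} \<times> {1..Suc k}. i < j}
      = {(i, j) \<in> {1..k} \<times> {1..k}. i < j} \<union> (\<lambda>i. (i, Suc k)) ` {1..k}"
    by (auto simp: le_Suc_eq)
  moreover have "{(i, j) \<in> {1..k} \<times> {1..k}. i < j} \<inter> (\<lambda>i. (i, Suc k)) ` {1..k} = {}"
    by auto
  moreover have "finite {(i, j) \<in> {1..k} \<times> {1..k}. i < j}"
    by (rule finite_subset[of _ "{1..k} \<times> {1..k}"]) auto
  ultimately show ?thesis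
    unfolding vandermonde_def
    by (simp add: prod.union_disjoint prod.reindex inj_on_def)
qed

lemma vandermonde_pos:
  assumes "strict_mono_on {1..k} a" shows "0 < vandermonde k a"
  unfolding vandermonde_def
  using assms by (intro prod_pos) (auto simp: strict_mono_on_def)

lemma vandermonde_cong:
  "(\<And>i. i \<in> {1..k} \<Longrightarrow> a i = b i) \<Longrightarrow> vandermonde k a = vandermonde k b"
  unfolding vandermonde_def by (intro prod.cong) auto

lemma strictly_interlaces_Suc:
  "strictly_interlaces (Suc n) x a \<longleftrightarrow> 
    strictly_interlaces n x a \<and> (1 \<le> n \<longrightarrow> x n < a n \<and> a n < x (Suc n))"
  by (auto simp: strictly_interlaces_def less_Suc_eq)

lemma strictly_interlaces_cong:
  "(\<And>j. j \<in> {1..<n} \<Longrightarrow> a j = b j) \<Longrightarrow> strictly_interlaces n x a = strictly_interlaces n x b"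
  by (simp add: strictly_interlaces_def)

lemma strictly_interlaces_nodes:
  assumes x: "strict_mono_on {1..n} x" and a: "strictly_interlaces n x a"
  shows "i \<in> {1..n} \<Longrightarrow> j \<in> {1..<n} \<Longrightarrow> j < i \<Longrightarrow> a j < x i"
    and "i \<in> {1..n} \<Longrightarrow> j \<in> {1..<n} \<Longrightarrow> i \<le> j \<Longrightarrow> x i < a j"
proof -
  have m: "x k \<le> x l" if "k \<in> {1..n}" "l \<in> {1..n}" "k \<le> l" for k l
    using x that by (cases "k = l") (auto simp: strict_mono_on_def intro: less_imp_le)
  show "a j < x i" if "i \<in> {1..n}" "j \<in> {1..<n}" "j < i"
  proof -
    have "a j < x (Suc j)" using a that by (simp add: strictly_interlaces_def)
    also have "x (Suc j) \<le> x i" using that by (intro m) auto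
    finally show ?thesis .
  qed
  show "x i < a j" if "i \<in> {1..n}" "j \<in> {1..<n}" "i \<le> j"
  proof -
    have "x i \<le> x j" using that by (intro m) auto
    also have "x j < a j" using a that by (simp add: strictly_interlaces_def)
    finally show ?thesis .
  qed
qed

lemma strictly_interlaces_strict_mono:
  assumes x: "strict_mono_on {1..n} x" and a: "strictly_interlaces n x a"
  shows "strict_mono_on {1..<n} a"
proof (rule strict_mono_onI)
  fix i j assume ij: "i \<in> {1..<n}" "j \<in> {1..<n}" "i < j"
  then have "a i < x j" "x j < a j"
    using strictly_interlaces_nodes[OF x a, of j i] strictly_interlaces_nodes[OF x a, of j j] by auto
  then show "a i < a j" by simp
qed

text \<open>
  Passage from \<open>n\<close> to \<open>n + 1\<close> nodes, where the interlacing tuple \<open>a'\<close> is extended by a last entry \<open>a\<close>.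
  The first \<open>n\<close> weights are multiplied by factors that depend only on \<open>a\<close> and the nodes, and the last weight is then
  determined by \<open>a\<close> being a zero of \<open>\<Sum>i. s i / (z - x i)\<close>.
\<close>

context
  fixes n :: nat and x :: "nat \<Rightarrow> real" and a' :: "nat \<Rightarrow> real" and a S :: real
  assumes x: "strict_mono_on {1..Suc n} x" and n: "1 \<le> n"
    and a: "x n < a" "a < x (Suc n)"
begin

lemma adjoin_node_facts:
  shows "inj_on x {1..n}" and "strict_mono_on {1..n} x"
    and "\<And>i. i \<in> {1..n} \<Longrightarrow> x i < a" and "\<And>i. i \<in> {1..n} \<Longrightarrow> x i < x (Suc n)"
proof -
  show s: "strict_mono_on {1..n} x"
    using x by (auto simp: strict_mono_on_def)
  show "inj_on x {1..n}" by (rule strict_mono_on_imp_inj_on[OF s])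
  show u: "x i < x (Suc n)" if "i \<in> {1..n}" for i
    using x that by (auto simp: strict_mono_on_def)
  show "x i < a" if "i \<in> {1..n}" for i
  proof (cases "i = n")
    case False
    then have "x i < x n" using that n by (intro strict_mono_onD[OF s]) auto
    then show ?thesis using a by simp
  qed (use a in simp)
qed

lemma node_weight_adjoin_old:
  assumes i: "i \<in> {1..n}"
  shows "node_weight (Suc n) x S (a'(n := a)) i
    = (a - x i) / (x (Suc n) - x i) * node_weight n x S a' i"
proof -
  have "{1..<Suc n} = insert n {1..<n}" using n by auto
  then have p: "(\<Prod>j\<in>{1..<Suc n}. x i - (a'(n := a)) j) = (x i - a) * (\<Prod>j\<in>{1..<n}. x i - a' j)"
    by (simp add: prod.insert)
  have "{1..Suc n} - {i} = insert (Suc n) ({1..n} - {i})" using i by auto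
  then have q: "(\<Prod>r\<in>{1..Suc n} - {i}. x i - x r) = (x i - x (Suc n)) * (\<Prod>r\<in>{1..n} - {i}. x i - x r)"
    by (simp add: prod.insert)
  have r: "(x i - a) / (x i - x (Suc n)) = (a - x i) / (x (Suc n) - x i)"
    by (metis minus_diff_eq minus_divide_divide)
  show ?thesis
    unfolding node_weight_def p q r[symmetric] by (simp add: mult_ac)
qed

lemma node_weight_adjoin_new:
  "node_weight (Suc n) x S (a'(n := a)) (Suc n)
    = (x (Suc n) - a) * (\<Sum>i\<in>{1..n}. node_weight (Suc n) x S (a'(n := a)) i / (a - x i))"
proof -
  have "(\<Sum>i\<in>{1..n}. node_weight (Suc n) x S (a'(n := a)) i / (a - x i))
      = (\<Sum>i\<in>{1..n}. node_weight n x S a' i / (x (Suc n) - x i))"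
    using adjoin_node_facts(3) by (intro sum.cong refl) (simp add: node_weight_adjoin_old del: fun_upd_apply, force)
  also have "\<dots> = S * (\<Prod>j\<in>{1..<n}. x (Suc n) - a' j) / (\<Prod>i\<in>{1..n}. x (Suc n) - x i)"
    using adjoin_node_facts(4) by (intro node_weight_partial_fractions adjoin_node_facts n) force
  finally have e: "(\<Sum>i\<in>{1..n}. node_weight (Suc n) x S (a'(n := a)) i / (a - x i))
      = S * (\<Prod>j\<in>{1..<n}. x (Suc n) - a' j) / (\<Prod>i\<in>{1..n}. x (Suc n) - x i)" .
  have "{1..<Suc n} = insert n {1..<n}" using n by auto
  then have p: "(\<Prod>j\<in>{1..<Suc n}. x (Suc n) - (a'(n := a)) j) = (x (Suc n) - a) * (\<Prod>j\<in>{1..<n}. x (Suc n) - a' j)"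
    by (simp add: prod.insert)
  have q: "{1..Suc n} - {Suc n} = {1..n}" by auto
  show ?thesis unfolding e unfolding node_weight_def p q by simp
qed

text \<open>
  On the left are the derivative in \<open>a\<close>, with the sign reversed, of the last weight for fixed first
  \<open>n\<close> weights, the Jacobian of the rescaling of the first \<open>n\<close> weights, and the density for \<open>n\<close> nodes.
  Expressed by the weights before the rescaling, the sum is the partial fraction expansion at \<open>a\<close>.
\<close>

lemma adjoin_jacobian:
  "(\<Sum>i\<in>{1..n}. node_weight (Suc n) x S (a'(n := a)) i * (x (Suc n) - x i) / (a - x i)\<^sup>2)
    * (\<Prod>i\<in>{1..n}. (a - x i) / (x (Suc n) - x i)) * (S ^ (n - 1) * vandermonde (n - 1) a' / vandermonde n x)
    = S ^ n * vandermonde n (a'(n := a)) / vandermonde (Suc n) x"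
proof -
  have "(\<Sum>i\<in>{1..n}. node_weight (Suc n) x S (a'(n := a)) i * (x (Suc n) - x i) / (a - x i)\<^sup>2)
      = (\<Sum>i\<in>{1..n}. node_weight n x S a' i / (a - x i))"
  proof (intro sum.cong refl)
    fix i assume i: "i \<in> {1..n}"
    have "a - x i \<noteq> 0" "x (Suc n) - x i \<noteq> 0"
      using adjoin_node_facts(3)[OF i] adjoin_node_facts(4)[OF i] by auto
    then show "node_weight (Suc n) x S (a'(n := a)) i * (x (Suc n) - x i) / (a - x i)\<^sup>2 = node_weight n x S a' i / (a - x i)"
      unfolding node_weight_adjoin_old[OF i] by (simp add: power2_eq_square)
  qed
  also have "\<dots> = S * (\<Prod>j\<in>{1..<n}. a - a' j) / (\<Prod>i\<in>{1..n}. a - x i)"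
    using adjoin_node_facts(3) by (intro node_weight_partial_fractions adjoin_node_facts n) force
  finally have e: "(\<Sum>i\<in>{1..n}. node_weight (Suc n) x S (a'(n := a)) i * (x (Suc n) - x i) / (a - x i)\<^sup>2)
      = S * (\<Prod>j\<in>{1..<n}. a - a' j) / (\<Prod>i\<in>{1..n}. a - x i)" .
  have nz: "(\<Prod>i\<in>{1..n}. a - x i) \<noteq> 0"
    using adjoin_node_facts(3) by force
  obtain m where m: "n = Suc m" using n by (cases n) auto
  have va: "vandermonde n (a'(n := a)) = vandermonde (n - 1) a' * (\<Prod>j\<in>{1..<n}. a - a' j)"
  proof -
    have "vandermonde m (a'(n := a)) = vandermonde m a'"
      by (rule vandermonde_cong) (auto simp: m)
    moreover have "(\<Prod>j\<in>{1..m}. (a'(n := a)) n - (a'(n := a)) j) = (\<Prod>j\<in>{1..<n}. a - a' j)"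
      by (rule prod.cong) (auto simp: m)
    ultimately show ?thesis
      using vandermonde_Suc[of m "a'(n := a)"] m by simp
  qed
  show ?thesis
  proof -
    have "S * p / q * (q / r) * (t * v / w) = S * t * (v * p) / (w * r)" if "q \<noteq> 0" for p q r t v w :: real
      using that by (simp add: mult_ac)
    note claim = this
    have Sn: "S ^ n = S * S ^ (n - 1)" by (simp add: m)
    show ?thesis
      unfolding e va vandermonde_Suc[of n x] prod_dividef Sn by (rule claim[OF nz])
  qed
qed

end

text \<open>
  For fixed first \<open>n\<close> weights, the last weight as a function of the largest zero \<open>a\<close> decreases from
  infinity at \<open>x n\<close> to 0 at \<open>x (Suc n)\<close>.
\<close>

lemma nn_integral_lborel_secular:
  fixes s :: "nat \<Rightarrow> real" and G :: "real \<Rightarrow> ennreal"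
  assumes x: "strict_mono_on {1..Suc n} x" and n: "1 \<le> n" and s: "\<And>i. i \<in> {1..n} \<Longrightarrow> 0 < s i"
    and G: "G \<in> borel_measurable borel"
  shows "(\<integral>\<^sup>+t. G t * indicator {0<..} t \<partial>lborel)
    = (\<integral>\<^sup>+a. G ((x (Suc n) - a) * (\<Sum>i\<in>{1..n}. s i / (a - x i)))
        * ennreal (\<Sum>i\<in>{1..n}. s i * (x (Suc n) - x i) / (a - x i)\<^sup>2) * indicator {x n<..<x (Suc n)} a \<partial>lborel)"
proof (rule nn_integral_substitution_decreasing[OF G])
  have xn: "x i < x (Suc n)" if "i \<in> {1..n}" for i
    using that by (intro strict_mono_onD[OF x]) auto
  then have xn_ne: "x (Suc n) - x i \<noteq> 0" if "i \<in> {1..n}" for i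
    using that by force
  have xn': "x i \<le> x n" if "i \<in> {1..n}" for i
  proof (cases "i = n")
    case False
    then have "x i < x n" using that n by (intro strict_mono_onD[OF x]) auto
    then show ?thesis by simp
  qed simp
  then have pos: "0 < a - x i" if "i \<in> {1..n}" "a \<in> {x n<..<x (Suc n)}" for i a
    using xn'[OF that(1)] that(2) by simp
  show "x n < x (Suc n)" using n xn by auto
  show "((\<lambda>a. (x (Suc n) - a) * (\<Sum>i\<in>{1..n}. s i / (a - x i))) has_real_derivative
      - (\<Sum>i\<in>{1..n}. s i * (x (Suc n) - x i) / (a - x i)\<^sup>2)) (at a)" if a: "a \<in> {x n<..<x (Suc n)}" for a
  proof -
    have d: "((\<lambda>a. (x (Suc n) - a) * (s i / (a - x i))) has_real_derivative - (s i * (x (Suc n) - x i) / (a - x i)\<^sup>2)) (at a)"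
      if "i \<in> {1..n}" for i
      using pos[OF that a] by (auto intro!: derivative_eq_intros simp: field_simps power2_eq_square)
        (simp add: diff_divide_distrib)
    show ?thesis
      unfolding sum_distrib_left sum_negf[symmetric] by (rule DERIV_sum) (rule d)
  qed
  show "continuous_on {x n<..<x (Suc n)} (\<lambda>a. \<Sum>i\<in>{1..n}. s i * (x (Suc n) - x i) / (a - x i)\<^sup>2)"
    using pos by (intro continuous_intros) force
  show "0 \<le> (\<Sum>i\<in>{1..n}. s i * (x (Suc n) - x i) / (a - x i)\<^sup>2)" if "a \<in> {x n<..<x (Suc n)}" for a
    using s xn by (intro sum_nonneg divide_nonneg_nonneg mult_nonneg_nonneg) (auto intro: less_imp_le)
  show "0 < (x (Suc n) - a) * (\<Sum>i\<in>{1..n}. s i / (a - x i))" if a: "a \<in> {x n<..<x (Suc n)}" for a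
    using a n s pos[OF _ a] by (intro mult_pos_pos sum_pos divide_pos_pos) auto
  have "((\<lambda>a. (x (Suc n) - a) * (\<Sum>i\<in>{1..n}. s i / (a - x i))) \<longlongrightarrow> (x (Suc n) - x (Suc n)) * (\<Sum>i\<in>{1..n}. s i / (x (Suc n) - x i))) (at_left (x (Suc n)))"
    by (intro tendsto_intros xn_ne)
  then show "((\<lambda>a. (x (Suc n) - a) * (\<Sum>i\<in>{1..n}. s i / (a - x i))) \<longlongrightarrow> 0) (at_left (x (Suc n)))"
    by simp
  have sn: "0 < s n" using s n by auto
  have pole: "filterlim (\<lambda>a. s n / (a - x n)) at_top (at_right (x n))"
    unfolding divide_inverse
  proof (rule filterlim_tendsto_pos_mult_at_top[OF tendsto_const sn])
    have "((\<lambda>a. a - x n) \<longlongrightarrow> x n - x n) (at_right (x n))" by (intro tendsto_intros)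
    then show "filterlim (\<lambda>a. inverse (a - x n)) at_top (at_right (x n))"
      by (intro filterlim_inverse_at_top) (auto simp: eventually_at_right_less eventually_at_filter)
  qed
  have dom: "filterlim (\<lambda>a. (x (Suc n) - a) * (s n / (a - x n))) at_top (at_right (x n))"
  proof (rule filterlim_tendsto_pos_mult_at_top[OF _ _ pole])
    show "((\<lambda>a. x (Suc n) - a) \<longlongrightarrow> x (Suc n) - x n) (at_right (x n))" by (intro tendsto_intros)
    show "0 < x (Suc n) - x n" using n xn[of n] by auto
  qed
  show "filterlim (\<lambda>a. (x (Suc n) - a) * (\<Sum>i\<in>{1..n}. s i / (a - x i))) at_top (at_right (x n))"
  proof (rule filterlim_at_top_mono[OF dom])
    have "eventually (\<lambda>a. a \<in> {x n<..<x (Suc n)}) (at_right (x n))"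
      using n xn[of n] by (intro eventually_at_right_real) auto
    then show "eventually (\<lambda>a. (x (Suc n) - a) * (s n / (a - x n)) \<le> (x (Suc n) - a) * (\<Sum>i\<in>{1..n}. s i / (a - x i))) (at_right (x n))"
    proof eventually_elim
      case (elim a)
      have "s n / (a - x n) \<le> (\<Sum>i\<in>{1..n}. s i / (a - x i))"
        using n s pos[OF _ elim] by (intro member_le_sum) (auto intro!: divide_nonneg_pos less_imp_le)
      then show ?case using elim by (intro mult_left_mono) auto
    qed
  qed
qed

section \<open>Interlacing coordinates on the positive orthant\<close>

lemma pair_sigma_finite_lborel:
  "finite I \<Longrightarrow> pair_sigma_finite (PiM I (\<lambda>_. lborel :: real measure)) (lborel :: real measure)"
  by (simp_all add: pair_sigma_finite.intro sigma_finite_PiM_lborel lborel.sigma_finite_measure_axioms)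

lemma borel_measurable_vandermonde [measurable]:
  "(\<lambda>a. vandermonde k a) \<in> borel_measurable (PiM {1..k} (\<lambda>_. lborel))"
  unfolding vandermonde_def by (rule borel_measurable_prod) (auto simp: split_beta)

lemma pred_strictly_interlaces [measurable]:
  "Measurable.pred (PiM {1..m} (\<lambda>_. lborel)) (strictly_interlaces (Suc m) x)"
  unfolding strictly_interlaces_def[abs_def] by measurable

lemma measurable_node_weights:
  "(\<lambda>p. \<lambda>i\<in>{1..Suc m}. node_weight (Suc m) x (fst p) (snd p) i)
    \<in> borel \<Otimes>\<^sub>M PiM {1..m} (\<lambda>_. lborel) \<rightarrow>\<^sub>M PiM {1..Suc m} (\<lambda>_. lborel)"
  unfolding node_weight_def measurable_lborel1
proof (rule measurable_restrict)
  fix i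
  have "(\<lambda>p. fst p * (\<Prod>j\<in>{1..<Suc m}. x i - snd p j) / (\<Prod>r\<in>{1..Suc m} - {i}. x i - x r))
      \<in> borel_measurable (borel \<Otimes>\<^sub>M PiM {1..m} (\<lambda>_. lborel))"
    by measurable
  then show "(\<lambda>p. fst p * (\<Prod>j\<in>{1..<Suc m}. x i - snd p j) / (\<Prod>r\<in>{1..Suc m} - {i}. x i - x r))
      \<in> borel \<Otimes>\<^sub>M PiM {1..m} (\<lambda>_. lborel) \<rightarrow>\<^sub>M lborel"
    unfolding measurable_lborel1 .
qed

text \<open>
  The change of variables of Dixon and Anderson. By induction on the number of nodes: the last weight is
  replaced by the largest zero \<open>a\<close>; for fixed \<open>a\<close>, the other weights are rescaled so that the induction
  hypothesis, for the remaining zeros, applies to them.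
\<close>

theorem nn_integral_positive_orthant:
  fixes F :: "(nat \<Rightarrow> real) \<Rightarrow> ennreal"
  assumes "strict_mono_on {1..Suc m} x"
    and "F \<in> borel_measurable (PiM {1..Suc m} (\<lambda>_. lborel))"
  shows "(\<integral>\<^sup>+s. F s * indicator {s. \<forall>i\<in>{1..Suc m}. 0 < s i} s \<partial>PiM {1..Suc m} (\<lambda>_. lborel))
    = (\<integral>\<^sup>+S. (\<integral>\<^sup>+a. F (\<lambda>i\<in>{1..Suc m}. node_weight (Suc m) x S a i)
          * ennreal (S ^ m * vandermonde m a / vandermonde (Suc m) x)
          * indicator {a. strictly_interlaces (Suc m) x a} a \<partial>PiM {1..m} (\<lambda>_. lborel))
        * indicator {0<..} S \<partial>lborel)"
  using assms
proof (induction m arbitrary: F)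
  case 0
  interpret product_sigma_finite "\<lambda>_::nat. lborel :: real measure"
    by (rule product_sigma_finite_lborel)
  have I: "{1..Suc 0} = insert (Suc 0) {}" by auto
  have v: "vandermonde (Suc 0) x = 1" "vandermonde 0 a = 1" for a
    by (simp_all add: vandermonde_Suc) (simp_all add: vandermonde_def)
  have F: "(\<lambda>s. F s * indicator {s. \<forall>i\<in>{1..Suc 0}. 0 < s i} s) \<in> borel_measurable (PiM (insert (Suc 0) {}) (\<lambda>_. lborel))"
    using 0(2) unfolding I by measurable
  have w: "(\<lambda>i\<in>{1..Suc 0}. node_weight (Suc 0) x S a i) = (\<lambda>_. undefined)(Suc 0 := S)" for S a
    by (auto simp: fun_eq_iff node_weight_def restrict_def)
  have "(\<integral>\<^sup>+s. F s * indicator {s. \<forall>i\<in>{1..Suc 0}. 0 < s i} s \<partial>PiM (insert (Suc 0) {}) (\<lambda>_. lborel))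
    = (\<integral>\<^sup>+u. \<integral>\<^sup>+y. F (u(Suc 0 := y)) * indicator {s. \<forall>i\<in>{1..Suc 0}. 0 < s i} (u(Suc 0 := y)) \<partial>lborel \<partial>PiM {} (\<lambda>_. lborel))"
    by (rule product_nn_integral_insert[OF finite.emptyI _ F]) simp
  also have "\<dots> = (\<integral>\<^sup>+y. F ((\<lambda>_. undefined)(Suc 0 := y)) * indicator {0<..} y \<partial>lborel)"
    by (simp add: PiM_empty nn_integral_count_space_finite indicator_def fun_upd_def)
  finally have L: "(\<integral>\<^sup>+s. F s * indicator {s. \<forall>i\<in>{1..Suc 0}. 0 < s i} s \<partial>PiM {1..Suc 0} (\<lambda>_. lborel))
    = (\<integral>\<^sup>+y. F ((\<lambda>_. undefined)(Suc 0 := y)) * indicator {0<..} y \<partial>lborel)"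
    by (simp only: I)
  have "{1..0::nat} = {}" by simp
  then show ?case
    unfolding L w v strictly_interlaces_def
    by (simp add: PiM_empty nn_integral_count_space_finite del: fun_upd_apply)
next
  case (Suc m)
  define n where "n = Suc m"
  define N where "N = Suc n"
  define I where "I = {1..n}"
  note x = Suc.prems(1)[folded n_def, folded N_def]
  note F [measurable] = Suc.prems(2)[folded n_def, folded N_def]
  have n: "1 \<le> n" by (simp add: n_def)
  have I: "{1..N} = insert N I" "finite I" "N \<notin> I" by (auto simp: I_def N_def)
  have Im: "I = insert n {1..m}" "n \<notin> {1..m}" by (auto simp: I_def n_def)
  have xI: "strict_mono_on {1..n} x" using x by (auto simp: strict_mono_on_def N_def)
  interpret product_sigma_finite "\<lambda>_::nat. lborel :: real measure"
    by (rule product_sigma_finite_lborel)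
  interpret PI: sigma_finite_measure "PiM I (\<lambda>_. lborel :: real measure)"
    by (rule sigma_finite_PiM_lborel) (rule I)
  interpret Pm: sigma_finite_measure "PiM {1..m} (\<lambda>_. lborel :: real measure)"
    by (rule sigma_finite_PiM_lborel) simp
  interpret PL: pair_sigma_finite "PiM I (\<lambda>_. lborel :: real measure)" "lborel :: real measure"
    by (rule pair_sigma_finite_lborel) (rule I)
  define upd where "upd s a = s(N := (x N - a) * (\<Sum>i\<in>I. s i / (a - x i)))" for s :: "nat \<Rightarrow> real" and a
  define D where "D s a = (\<Sum>i\<in>I. s i * (x N - x i) / (a - x i)\<^sup>2)" for s :: "nat \<Rightarrow> real" and a
  define pos where "pos s \<longleftrightarrow> (\<forall>i\<in>I. 0 < s i)" for s :: "nat \<Rightarrow> real"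
  define J where "J = {x n<..<x N}"
  define c where "c a i = (a - x i) / (x N - x i)" for a i
  define w where "w S a = (\<lambda>i\<in>I. node_weight n x S a i)" for S a
  define W where "W S a = (\<lambda>i\<in>{1..N}. node_weight N x S a i)" for S a
  define R where "R S A = F (W S A) * ennreal (S ^ n * vandermonde n A / vandermonde N x)
      * indicator {A. strictly_interlaces N x A} A" for S A
  have [measurable]: "(\<lambda>p. upd (fst p) (snd p)) \<in> PiM I (\<lambda>_. lborel) \<Otimes>\<^sub>M borel \<rightarrow>\<^sub>M PiM {1..N} (\<lambda>_. lborel)"
    unfolding upd_def by (rule measurable_fun_upd[where J=I]) (use I in auto)
  have [measurable]: "(\<lambda>p. D (fst p) (snd p)) \<in> borel_measurable (PiM I (\<lambda>_. lborel) \<Otimes>\<^sub>M borel)"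
    unfolding D_def by measurable
  have [measurable]: "Measurable.pred (PiM I (\<lambda>_. lborel)) pos"
    unfolding pos_def[abs_def] by measurable (use I in auto)
  have [measurable]: "J \<in> sets borel" by (simp add: J_def)
  have T_meas: "(\<lambda>p. F (upd (fst p) (snd p)) * ennreal (D (fst p) (snd p)) * indicator J (snd p) * indicator {s. pos s} (fst p))
      \<in> borel_measurable (PiM I (\<lambda>_. lborel) \<Otimes>\<^sub>M lborel)"
    unfolding measurable_cong_sets[OF sets_pair_measure_cong[OF refl sets_lborel] refl] by measurable
  have R: "(\<lambda>p. R (fst p) (snd p)) \<in> borel_measurable (borel \<Otimes>\<^sub>M PiM I (\<lambda>_. lborel))"
  proof -
    have [measurable]: "(\<lambda>p. W (fst p) (snd p)) \<in> borel \<Otimes>\<^sub>M PiM I (\<lambda>_. lborel) \<rightarrow>\<^sub>M PiM {1..N} (\<lambda>_. lborel)"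
      unfolding W_def N_def I_def by (rule measurable_node_weights)
    have [measurable]: "(\<lambda>A. vandermonde n A) \<in> borel_measurable (PiM I (\<lambda>_. lborel))"
      unfolding I_def by measurable
    have [measurable]: "Measurable.pred (PiM I (\<lambda>_. lborel)) (strictly_interlaces N x)"
      unfolding I_def N_def by measurable
    show ?thesis unfolding R_def by measurable
  qed
  have inner: "(\<lambda>p. \<integral>\<^sup>+a'. R (snd p) (a'(n := fst p)) \<partial>PiM {1..m} (\<lambda>_. lborel)) \<in> borel_measurable (borel \<Otimes>\<^sub>M borel)"
  proof -
    have "(\<lambda>q. (snd q)(n := fst (fst q))) \<in> (borel \<Otimes>\<^sub>M borel) \<Otimes>\<^sub>M PiM {1..m} (\<lambda>_. lborel) \<rightarrow>\<^sub>M PiM I (\<lambda>_. lborel)"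
      by (rule measurable_fun_upd[where J="{1..m}"]) (use Im in auto)
    then have "(\<lambda>q. (snd (fst q), (snd q)(n := fst (fst q)))) \<in> (borel \<Otimes>\<^sub>M borel) \<Otimes>\<^sub>M PiM {1..m} (\<lambda>_. lborel) \<rightarrow>\<^sub>M borel \<Otimes>\<^sub>M PiM I (\<lambda>_. lborel)"
      by measurable
    from measurable_compose[OF this R]
    have "(\<lambda>q. R (snd (fst q)) ((snd q)(n := fst (fst q)))) \<in> borel_measurable ((borel \<Otimes>\<^sub>M borel) \<Otimes>\<^sub>M PiM {1..m} (\<lambda>_. lborel))"
      by (simp del: fun_upd_apply)
    from Pm.borel_measurable_nn_integral_fst[OF this] show ?thesis by (simp del: fun_upd_apply)
  qed
  have "(\<integral>\<^sup>+s. F s * indicator {s. \<forall>i\<in>{1..N}. 0 < s i} s \<partial>PiM {1..N} (\<lambda>_. lborel))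
      = (\<integral>\<^sup>+s. \<integral>\<^sup>+t. F (s(N := t)) * indicator {s. \<forall>i\<in>{1..N}. 0 < s i} (s(N := t)) \<partial>lborel \<partial>PiM I (\<lambda>_. lborel))"
    unfolding I(1)
  proof (rule product_nn_integral_insert[OF I(2,3)])
    show "(\<lambda>s. F s * indicator {s. \<forall>i\<in>insert N I. 0 < s i} s) \<in> borel_measurable (PiM (insert N I) (\<lambda>_. lborel))"
      using F unfolding I(1) by measurable (use I in auto)
  qed
  \<comment> \<open>The last weight is replaced by the largest zero.\<close>
  also have "\<dots> = (\<integral>\<^sup>+s. \<integral>\<^sup>+a. F (upd s a) * ennreal (D s a) * indicator J a * indicator {s. pos s} s \<partial>lborel \<partial>PiM I (\<lambda>_. lborel))"
  proof (rule nn_integral_cong)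
    fix s :: "nat \<Rightarrow> real" assume s: "s \<in> space (PiM I (\<lambda>_. lborel))"
    have e: "F (s(N := t)) * indicator {s. \<forall>i\<in>{1..N}. 0 < s i} (s(N := t))
        = (F (s(N := t)) * indicator {0<..} t) * indicator {s. pos s} s" for t
      using I by (auto simp: pos_def indicator_def)
    show "(\<integral>\<^sup>+t. F (s(N := t)) * indicator {s. \<forall>i\<in>{1..N}. 0 < s i} (s(N := t)) \<partial>lborel)
        = (\<integral>\<^sup>+a. F (upd s a) * ennreal (D s a) * indicator J a * indicator {s. pos s} s \<partial>lborel)"
    proof (cases "pos s")
      case True
      have m: "(\<lambda>t. F (s(N := t))) \<in> borel_measurable borel"
      proof (rule measurable_compose[OF _ F])
        show "(\<lambda>t. s(N := t)) \<in> borel \<rightarrow>\<^sub>M PiM {1..N} (\<lambda>_. lborel)"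
          by (rule measurable_fun_upd[where J=I]) (use I s in auto)
      qed
      have "(\<integral>\<^sup>+t. F (s(N := t)) * indicator {0<..} t \<partial>lborel)
          = (\<integral>\<^sup>+a. F (upd s a) * ennreal (D s a) * indicator J a \<partial>lborel)"
        unfolding upd_def D_def J_def I_def N_def
        by (rule nn_integral_lborel_secular[OF x[unfolded N_def] n _ m[unfolded N_def]])
           (use True in \<open>auto simp: pos_def I_def\<close>)
      then show ?thesis unfolding e using True by simp
    next
      case False
      then show ?thesis unfolding e by simp
    qed
  qed
  also have "\<dots> = (\<integral>\<^sup>+a. \<integral>\<^sup>+s. F (upd s a) * ennreal (D s a) * indicator J a * indicator {s. pos s} s \<partial>PiM I (\<lambda>_. lborel) \<partial>lborel)"
    using PL.Fubini'[of "\<lambda>s a. F (upd s a) * ennreal (D s a) * indicator J a * indicator {s. pos s} s"] T_meas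
    by (simp add: split_beta')
  also have "\<dots> = (\<integral>\<^sup>+a. \<integral>\<^sup>+S. (\<integral>\<^sup>+a'. R S (a'(n := a)) \<partial>PiM {1..m} (\<lambda>_. lborel)) * indicator {0<..} S \<partial>lborel \<partial>lborel)"
  proof (rule nn_integral_cong)
    fix a :: real
    show "(\<integral>\<^sup>+s. F (upd s a) * ennreal (D s a) * indicator J a * indicator {s. pos s} s \<partial>PiM I (\<lambda>_. lborel))
        = (\<integral>\<^sup>+S. (\<integral>\<^sup>+a'. R S (a'(n := a)) \<partial>PiM {1..m} (\<lambda>_. lborel)) * indicator {0<..} S \<partial>lborel)"
    proof (cases "a \<in> J")
      case False
      have "R S (a'(n := a)) = 0" for S a'
        using False n by (auto simp: R_def N_def strictly_interlaces_Suc[of n] J_def)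
      then show ?thesis using False by simp
    next
      case True
      then have a: "x n < a" "a < x (Suc n)" by (auto simp: J_def N_def)
      note af = adjoin_node_facts[OF x[unfolded N_def] n a, folded N_def I_def]
      have c: "0 < c a i" if "i \<in> I" for i
        using af(3,4)[OF that] by (auto simp: c_def)
      have cm: "(\<lambda>s. \<lambda>i\<in>I. c a i * s i) \<in> PiM I (\<lambda>_. lborel) \<rightarrow>\<^sub>M PiM I (\<lambda>_. lborel)"
        by (rule measurable_restrict) auto
      have um: "(\<lambda>s. F (upd s a) * ennreal (D s a)) \<in> borel_measurable (PiM I (\<lambda>_. lborel))"
      proof -
        have "(\<lambda>s. (\<lambda>p. F (upd (fst p) (snd p)) * ennreal (D (fst p) (snd p))) (s, a)) \<in> borel_measurable (PiM I (\<lambda>_. lborel))"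
          by measurable
        then show ?thesis by simp
      qed
      \<comment> \<open>\<open>F\<close> in the rescaled first weights, for fixed \<open>a\<close>, with all the factors that do not come from the induction hypothesis.\<close>
      define F' where "F' s = F (upd (\<lambda>i\<in>I. c a i * s i) a) * ennreal (D (\<lambda>i\<in>I. c a i * s i) a) * ennreal (\<Prod>i\<in>I. c a i)" for s
      have F': "F' \<in> borel_measurable (PiM {1..Suc m} (\<lambda>_. lborel))"
        using measurable_compose[OF cm um] unfolding F'_def[abs_def] n_def[symmetric] I_def[symmetric] by measurable
      have "(\<integral>\<^sup>+s. F (upd s a) * ennreal (D s a) * indicator {s. pos s} s \<partial>PiM I (\<lambda>_. lborel))
        = (\<integral>\<^sup>+s. F' s * indicator {s. pos s} s \<partial>PiM I (\<lambda>_. lborel))"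
      proof (subst nn_integral_PiM_lborel_scale[OF I(2) c])
        have "pos (\<lambda>i\<in>I. c a i * s i) \<longleftrightarrow> pos s" for s
          using c by (simp add: pos_def zero_less_mult_iff) (meson not_less_iff_gr_or_eq)
        then show "(\<integral>\<^sup>+s. F (upd (\<lambda>i\<in>I. c a i * s i) a) * ennreal (D (\<lambda>i\<in>I. c a i * s i) a) * indicator {s. pos s} (\<lambda>i\<in>I. c a i * s i) * ennreal (\<Prod>i\<in>I. c a i) \<partial>PiM I (\<lambda>_. lborel))
          = (\<integral>\<^sup>+s. F' s * indicator {s. pos s} s \<partial>PiM I (\<lambda>_. lborel))"
          by (intro nn_integral_cong) (simp add: F'_def indicator_def)
        show "(\<lambda>s. F (upd s a) * ennreal (D s a) * indicator {s. pos s} s) \<in> borel_measurable (PiM I (\<lambda>_. lborel))"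
          using um by measurable
      qed
      also have "\<dots> = (\<integral>\<^sup>+S. (\<integral>\<^sup>+a'. F' (w S a') * ennreal (S ^ m * vandermonde m a' / vandermonde n x)
          * indicator {a'. strictly_interlaces n x a'} a' \<partial>PiM {1..m} (\<lambda>_. lborel)) * indicator {0<..} S \<partial>lborel)"
        unfolding pos_def w_def I_def n_def by (rule Suc.IH[OF xI[unfolded n_def] F'])
      also have "\<dots> = (\<integral>\<^sup>+S. (\<integral>\<^sup>+a'. R S (a'(n := a)) \<partial>PiM {1..m} (\<lambda>_. lborel)) * indicator {0<..} S \<partial>lborel)"
      proof (rule nn_integral_cong)
        fix S :: real
        have "F' (w S a') * ennreal (S ^ m * vandermonde m a' / vandermonde n x) * indicator {a'. strictly_interlaces n x a'} a'
            = R S (a'(n := a))" if S: "0 < S" for a'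
        proof (cases "strictly_interlaces n x a'")
          case False
          then have "\<not> strictly_interlaces N x (a'(n := a))"
            unfolding N_def strictly_interlaces_Suc[of n]
            using strictly_interlaces_cong[of n "a'(n := a)" a' x] by auto
          then show ?thesis using False by (simp add: R_def)
        next
          case il: True
          then have il': "strictly_interlaces N x (a'(n := a))"
            unfolding N_def strictly_interlaces_Suc[of n] using a
            using strictly_interlaces_cong[of n "a'(n := a)" a' x] by auto
          have old: "(\<lambda>i\<in>I. c a i * w S a' i) = (\<lambda>i\<in>I. node_weight N x S (a'(n := a)) i)"
            using node_weight_adjoin_old[OF x[unfolded N_def] n a, of _ S a']
            by (intro restrict_ext) (simp add: c_def w_def N_def I_def)
          have new: "upd (\<lambda>i\<in>I. node_weight N x S (a'(n := a)) i) a = W S (a'(n := a))"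
            using node_weight_adjoin_new[OF x[unfolded N_def] n a, of S a']
            by (auto simp: fun_eq_iff upd_def W_def N_def I_def simp del: fun_upd_apply split: if_splits)
               (simp_all add: restrict_def)
          have D: "D (\<lambda>i\<in>I. node_weight N x S (a'(n := a)) i) a
              = (\<Sum>i\<in>I. node_weight N x S (a'(n := a)) i * (x N - x i) / (a - x i)\<^sup>2)"
            by (simp add: D_def)
          note jac = adjoin_jacobian[OF x[unfolded N_def] n a, of S a', folded N_def I_def, folded D c_def]
          have v: "0 \<le> S ^ m * vandermonde m a' / vandermonde n x"
          proof -
            have "strict_mono_on {1..m} a'"
              using strictly_interlaces_strict_mono[OF xI il] by (simp add: n_def atLeastLessThanSuc_atLeastAtMost)
            then show ?thesis
              using vandermonde_pos[of m a'] vandermonde_pos[OF xI] S by simp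
          qed
          have p: "0 \<le> (\<Prod>i\<in>I. c a i)" using c by (intro prod_nonneg) (auto intro: less_imp_le)
          have "ennreal (D (\<lambda>i\<in>I. node_weight N x S (a'(n := a)) i) a) * ennreal (\<Prod>i\<in>I. c a i) * ennreal (S ^ m * vandermonde m a' / vandermonde n x)
              = ennreal (S ^ n * vandermonde n (a'(n := a)) / vandermonde N x)"
            unfolding ennreal_mult''[OF p, symmetric] ennreal_mult''[OF v, symmetric]
            unfolding jac[symmetric] by (simp add: n_def)
          then show ?thesis
            using il il' by (simp add: F'_def R_def old new mult.assoc)
        qed
        then show "(\<integral>\<^sup>+a'. F' (w S a') * ennreal (S ^ m * vandermonde m a' / vandermonde n x)
          * indicator {a'. strictly_interlaces n x a'} a' \<partial>PiM {1..m} (\<lambda>_. lborel)) * indicator {0<..} S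
          = (\<integral>\<^sup>+a'. R S (a'(n := a)) \<partial>PiM {1..m} (\<lambda>_. lborel)) * indicator {0<..} S"
          by (cases "0 < S") simp_all
      qed
      finally show ?thesis using True by simp
    qed
  qed
  also have "\<dots> = (\<integral>\<^sup>+S. \<integral>\<^sup>+a. (\<integral>\<^sup>+a'. R S (a'(n := a)) \<partial>PiM {1..m} (\<lambda>_. lborel)) * indicator {0<..} S \<partial>lborel \<partial>lborel)"
  proof (rule lborel_pair.Fubini')
    have "(\<lambda>p. (\<lambda>p. \<integral>\<^sup>+a'. R (snd p) (a'(n := fst p)) \<partial>PiM {1..m} (\<lambda>_. lborel)) (snd p, fst p) * indicator {0<..} (fst p)) \<in> borel_measurable (borel \<Otimes>\<^sub>M borel)"
      using inner by measurable
    then show "(\<lambda>(S, a). (\<integral>\<^sup>+a'. R S (a'(n := a)) \<partial>PiM {1..m} (\<lambda>_. lborel)) * indicator {0<..} S) \<in> borel_measurable (lborel \<Otimes>\<^sub>M lborel)"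
      unfolding measurable_cong_sets[OF sets_pair_measure_cong[OF sets_lborel sets_lborel] refl] by (simp add: split_beta' del: fun_upd_apply)
  qed
  also have "\<dots> = (\<integral>\<^sup>+S. (\<integral>\<^sup>+A. R S A \<partial>PiM I (\<lambda>_. lborel)) * indicator {0<..} S \<partial>lborel)"
  proof (rule nn_integral_cong)
    fix S :: real
    have RS: "R S \<in> borel_measurable (PiM I (\<lambda>_. lborel))"
    proof -
      have "(\<lambda>A. (\<lambda>p. R (fst p) (snd p)) (S, A)) \<in> borel_measurable (PiM I (\<lambda>_. lborel))"
        using R by measurable
      then show ?thesis by simp
    qed
    have m: "(\<lambda>a. \<integral>\<^sup>+a'. R S (a'(n := a)) \<partial>PiM {1..m} (\<lambda>_. lborel)) \<in> borel_measurable lborel"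
    proof -
      have "(\<lambda>a. (\<lambda>p. \<integral>\<^sup>+a'. R (snd p) (a'(n := fst p)) \<partial>PiM {1..m} (\<lambda>_. lborel)) (a, S)) \<in> borel_measurable borel"
        using inner by measurable
      then show ?thesis by simp
    qed
    have "(\<integral>\<^sup>+a. (\<integral>\<^sup>+a'. R S (a'(n := a)) \<partial>PiM {1..m} (\<lambda>_. lborel)) * indicator {0<..} S \<partial>lborel)
      = (\<integral>\<^sup>+a. \<integral>\<^sup>+a'. R S (a'(n := a)) \<partial>PiM {1..m} (\<lambda>_. lborel) \<partial>lborel) * indicator {0<..} S"
      by (rule nn_integral_multc[OF m])
    also have "(\<integral>\<^sup>+a. \<integral>\<^sup>+a'. R S (a'(n := a)) \<partial>PiM {1..m} (\<lambda>_. lborel) \<partial>lborel) = (\<integral>\<^sup>+A. R S A \<partial>PiM I (\<lambda>_. lborel))"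
      unfolding Im(1) by (rule product_nn_integral_insert_rev[symmetric]) (use RS Im in auto)
    finally show "(\<integral>\<^sup>+a. (\<integral>\<^sup>+a'. R S (a'(n := a)) \<partial>PiM {1..m} (\<lambda>_. lborel)) * indicator {0<..} S \<partial>lborel)
      = (\<integral>\<^sup>+A. R S A \<partial>PiM I (\<lambda>_. lborel)) * indicator {0<..} S" .
  qed
  finally show ?case unfolding R_def W_def I_def N_def n_def .
qed

section \<open>Fundamental splines\<close>

text \<open>
  For \<open>n \<ge> 2\<close> distinct knots, the integral of the fundamental spline from \<open>a\<close> to infinity.
\<close>

definition spline_tail :: "nat \<Rightarrow> (nat \<Rightarrow> real) \<Rightarrow> real \<Rightarrow> real" where
  "spline_tail n y a = (\<Sum>i\<in>{i \<in> {1..n}. y i > a}. (y i - a) ^ (n - 1) / (\<Prod>r\<in>{1..n} - {i}. y i - y r))"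

lemma spline_tail_alt:
  "spline_tail n y a = (\<Sum>i\<in>{1..n}. (if y i > a then (y i - a) ^ (n - 1) else 0) / (\<Prod>r\<in>{1..n} - {i}. y i - y r))"
  unfolding spline_tail_def by (subst sum.inter_filter) (auto intro!: sum.cong)

lemma fundamental_spline_alt:
  "fundamental_spline n y a = real (n - 1) *
    (\<Sum>i\<in>{1..n}. (if y i > a then (y i - a) ^ (n - 2) else 0) / (\<Prod>r\<in>{1..n} - {i}. y i - y r))"
  unfolding fundamental_spline_def by (subst sum.inter_filter) (auto intro!: sum.cong)

lemma spline_tail_right: "(\<And>i. i \<in> {1..n} \<Longrightarrow> y i \<le> a) \<Longrightarrow> spline_tail n y a = 0"
  unfolding spline_tail_alt by (intro sum.neutral) force

text \<open>
  To the left of all knots the truncation is void, and the summands are the node weights of the tuple whose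
  entries all equal \<open>a\<close>, with total mass 1.
\<close>

lemma spline_tail_left:
  assumes inj: "inj_on y {1..n}" and n: "1 \<le> n" and a: "\<And>i. i \<in> {1..n} \<Longrightarrow> a < y i"
  shows "spline_tail n y a = 1"
proof -
  have "spline_tail n y a = (\<Sum>i\<in>{1..n}. node_weight n y 1 (\<lambda>_. a) i)"
    unfolding spline_tail_alt node_weight_def using a by (intro sum.cong refl) simp
  then show ?thesis using sum_node_weight[OF inj n] by simp
qed

text \<open>
  Over the common denominator of all \<open>n + 1\<close> knots, dropping the first knot contributes a factor \<open>y i - y 1\<close>
  to the numerator and dropping the last one a factor \<open>y i - y (Suc n)\<close>; their difference does not depend
  on \<open>i\<close>.
\<close>

lemma spline_tail_diff:
  assumes y: "inj_on y {1..Suc n}" and n: "1 \<le> n"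
  shows "spline_tail n (\<lambda>l. y (Suc l)) a - spline_tail n y a
    = (y (Suc n) - y 1) / real n * fundamental_spline (Suc n) y a"
proof -
  define e where "e i = (if y i > a then (y i - a) ^ (n - 1) else 0)" for i
  define P where "P i = (\<Prod>r\<in>{1..Suc n} - {i}. y i - y r)" for i
  have ne: "y i - y r \<noteq> 0" if "i \<in> {1..Suc n}" "r \<in> {1..Suc n}" "r \<noteq> i" for i r
    using inj_on_eq_iff[OF y that(1,2)] that(3) by auto
  have P0: "P i \<noteq> 0" if "i \<in> {1..Suc n}" for i
    unfolding P_def using ne[OF that] by auto
  have 1: "spline_tail n (\<lambda>l. y (Suc l)) a = (\<Sum>i\<in>{1..Suc n}. e i * (y i - y 1) / P i)"
  proof -
    have "spline_tail n (\<lambda>l. y (Suc l)) a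
        = (\<Sum>i\<in>{1..n}. e (Suc i) / (\<Prod>r\<in>{1..n} - {i}. y (Suc i) - y (Suc r)))"
      unfolding spline_tail_alt e_def ..
    also have "\<dots> = (\<Sum>i\<in>{Suc 1..Suc n}. e i / (\<Prod>r\<in>{Suc 1..Suc n} - {i}. y i - y r))"
    proof (rule sum.reindex_bij_witness[of _ "\<lambda>i. i - 1" Suc]; (simp; fail)?)
      fix i assume i: "i \<in> {1..n}"
      have "(\<Prod>r\<in>{Suc 1..Suc n} - {Suc i}. y (Suc i) - y r) = (\<Prod>r\<in>{1..n} - {i}. y (Suc i) - y (Suc r))"
        by (rule prod.reindex_bij_witness[of _ Suc "\<lambda>i. i - 1"]) auto
      then show "e (Suc i) / (\<Prod>r\<in>{Suc 1..Suc n} - {Suc i}. y (Suc i) - y r) = e (Suc i) / (\<Prod>r\<in>{1..n} - {i}. y (Suc i) - y (Suc r))"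
        by simp
    qed auto
    also have "\<dots> = (\<Sum>i\<in>{Suc 1..Suc n}. e i * (y i - y 1) / P i)"
    proof (rule sum.cong[OF refl])
      fix i assume i: "i \<in> {Suc 1..Suc n}"
      then have "{1..Suc n} - {i} = insert 1 ({Suc 1..Suc n} - {i})" by auto
      then have "P i = (y i - y 1) * (\<Prod>r\<in>{Suc 1..Suc n} - {i}. y i - y r)"
        by (simp add: P_def)
      then show "e i / (\<Prod>r\<in>{Suc 1..Suc n} - {i}. y i - y r) = e i * (y i - y 1) / P i"
        using ne[of i 1] i by simp
    qed
    also have "\<dots> = (\<Sum>i\<in>insert 1 {Suc 1..Suc n}. e i * (y i - y 1) / P i)"
      by simp
    also have "insert 1 {Suc 1..Suc n} = {1..Suc n}" by auto
    finally show ?thesis .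
  qed
  have 2: "spline_tail n y a = (\<Sum>i\<in>{1..Suc n}. e i * (y i - y (Suc n)) / P i)"
  proof -
    have "spline_tail n y a = (\<Sum>i\<in>{1..n}. e i * (y i - y (Suc n)) / P i)"
      unfolding spline_tail_alt e_def[symmetric]
    proof (rule sum.cong[OF refl])
      fix i assume i: "i \<in> {1..n}"
      then have "{1..Suc n} - {i} = insert (Suc n) ({1..n} - {i})" by auto
      then have "P i = (y i - y (Suc n)) * (\<Prod>r\<in>{1..n} - {i}. y i - y r)"
        by (simp add: P_def)
      then show "e i / (\<Prod>r\<in>{1..n} - {i}. y i - y r) = e i * (y i - y (Suc n)) / P i"
        using ne[of i "Suc n"] i by simp
    qed
    then show ?thesis by simp
  qed
  have 3: "fundamental_spline (Suc n) y a = real n * (\<Sum>i\<in>{1..Suc n}. e i / P i)"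
  proof -
    have "Suc n - 2 = n - 1" "Suc n - 1 = n" by simp_all
    then show ?thesis unfolding fundamental_spline_alt e_def P_def by (simp only:)
  qed
  have "spline_tail n (\<lambda>l. y (Suc l)) a - spline_tail n y a
      = (\<Sum>i\<in>{1..Suc n}. (y (Suc n) - y 1) * (e i / P i))"
    unfolding 1 2 sum_subtractf[symmetric]
    by (intro sum.cong refl) (simp add: diff_divide_distrib[symmetric] algebra_simps)
  then have "spline_tail n (\<lambda>l. y (Suc l)) a - spline_tail n y a
      = (y (Suc n) - y 1) * (\<Sum>i\<in>{1..Suc n}. e i / P i)"
    by (simp only: sum_distrib_left)
  then show ?thesis unfolding 3 using n by simp
qed

text \<open>
  Both tails whose difference is a multiple of the spline are equal to 1 here.
\<close>

lemma fundamental_spline_left: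
  assumes y: "inj_on y {1..n}" and n: "2 \<le> n" and a: "\<And>i. i \<in> {1..n} \<Longrightarrow> a < y i"
  shows "fundamental_spline n y a = 0"
proof -
  obtain m where m: "n = Suc m" "1 \<le> m" using n by (cases n) auto
  have i1: "inj_on (\<lambda>l. y (Suc l)) {1..m}"
    using inj_onD[OF y[unfolded m(1)], of "Suc i" "Suc j" for i j] by (intro inj_onI) simp
  have i2: "inj_on y {1..m}"
    by (rule inj_on_subset[OF y]) (use m in auto)
  have "spline_tail m (\<lambda>l. y (Suc l)) a = 1" "spline_tail m y a = 1"
    by (rule spline_tail_left[OF i1 m(2)] spline_tail_left[OF i2 m(2)]; rule a; use m in simp)+
  then have "spline_tail m (\<lambda>l. y (Suc l)) a - spline_tail m y a = 0" by simp
  then have "(y (Suc m) - y 1) / real m * fundamental_spline (Suc m) y a = 0"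
    using spline_tail_diff[OF y[unfolded m] m(2)] by simp
  moreover have "y (Suc m) - y 1 \<noteq> 0"
    using inj_on_eq_iff[OF y, of "Suc m" 1] m by auto
  ultimately show ?thesis using m by simp
qed

lemma fundamental_spline_right:
  "(\<And>i. i \<in> {1..n} \<Longrightarrow> y i \<le> a) \<Longrightarrow> fundamental_spline n y a = 0"
  unfolding fundamental_spline_alt by (intro mult_eq_0_iff[THEN iffD2] disjI2 sum.neutral) force

lemma borel_measurable_fundamental_spline [measurable]:
  "fundamental_spline n y \<in> borel_measurable borel"
  unfolding fundamental_spline_alt[abs_def] by measurable

lemma continuous_spline_tail:
  assumes "2 \<le> n" shows "continuous_on A (spline_tail n y)"
proof -
  have e: "(if y i > a then (y i - a) ^ (n - 1) else 0) = (max 0 (y i - a)) ^ (n - 1)" for i a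
    using assms by (auto simp: max_def)
  show ?thesis
    unfolding spline_tail_alt[abs_def] e divide_inverse by (intro continuous_intros)
qed

lemma spline_tail_deriv:
  assumes n: "2 \<le> n" and a: "a \<notin> y ` {1..n}"
  shows "(spline_tail n y has_real_derivative - fundamental_spline n y a) (at a)"
proof -
  have d: "((\<lambda>a. (if y i > a then (y i - a) ^ (n - 1) else 0) / c) has_real_derivative
      - (real (n - 1) * ((if y i > a then (y i - a) ^ (n - 2) else 0) / c))) (at a)" if i: "i \<in> {1..n}" for i c
  proof (cases "a < y i")
    case True
    have der: "((\<lambda>a. (y i - a) ^ (n - 1) / c) has_real_derivative - (real (n - 1) * ((y i - a) ^ (n - 2) / c))) (at a)"
    proof -
      have e: "n - 1 - Suc 0 = n - 2" by simp
      have "((\<lambda>a. (y i - a) ^ (n - 1)) has_real_derivative - (real (n - 1) * (y i - a) ^ (n - 2))) (at a)"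
        using e by (auto intro!: derivative_eq_intros)
      from DERIV_cdivide[OF this, of c] show ?thesis by simp
    qed
    have "eventually (\<lambda>a. a < y i) (nhds a)"
      using True by (rule eventually_nhds_in_open[of "{..<y i}", simplified])
    then have ev: "eventually (\<lambda>a. (if y i > a then (y i - a) ^ (n - 1) else 0) / c = (y i - a) ^ (n - 1) / c) (nhds a)"
      by eventually_elim simp
    show ?thesis unfolding DERIV_cong_ev[OF refl ev refl] using True der by simp
  next
    case False
    then have "y i < a" using a i by force
    then have "eventually (\<lambda>a. y i < a) (nhds a)"
      by (rule eventually_nhds_in_open[of "{y i<..}", simplified])
    then have ev: "eventually (\<lambda>a. (if y i > a then (y i - a) ^ (n - 1) else 0) / c = 0) (nhds a)"
      by eventually_elim simp
    show ?thesis unfolding DERIV_cong_ev[OF refl ev refl] using False by simp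
  qed
  show ?thesis
    unfolding spline_tail_alt[abs_def] fundamental_spline_alt sum_distrib_left sum_negf[symmetric]
    by (intro DERIV_sum d)
qed

lemma fundamental_spline_bounded:
  assumes y: "inj_on y {1..n}" and n: "2 \<le> n"
  shows "\<exists>B l u. \<forall>a. \<bar>fundamental_spline n y a\<bar> \<le> B * indicator {l..u} a \<and> (\<forall>i\<in>{1..n}. l < y i \<and> y i < u)"
proof -
  define l where "l = Min (y ` {1..n}) - 1"
  define u where "u = Max (y ` {1..n}) + 1"
  have lu: "l < y i" "y i < u" if "i \<in> {1..n}" for i
  proof -
    have "Min (y ` {1..n}) \<le> y i" "y i \<le> Max (y ` {1..n})" using that by (auto intro!: Min_le Max_ge)
    then show "l < y i" "y i < u" by (auto simp: l_def u_def)
  qed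
  define B where "B = real (n - 1) * (\<Sum>i\<in>{1..n}. (u - l) ^ (n - 2) / \<bar>\<Prod>r\<in>{1..n} - {i}. y i - y r\<bar>)"
  have "\<bar>fundamental_spline n y a\<bar> \<le> B * indicator {l..u} a" for a
  proof (cases "a \<in> {l..u}")
    case True
    have "\<bar>\<Sum>i\<in>{1..n}. (if y i > a then (y i - a) ^ (n - 2) else 0) / (\<Prod>r\<in>{1..n} - {i}. y i - y r)\<bar>
        \<le> (\<Sum>i\<in>{1..n}. (u - l) ^ (n - 2) / \<bar>\<Prod>r\<in>{1..n} - {i}. y i - y r\<bar>)"
    proof (rule order_trans[OF sum_abs], rule sum_mono)
      fix i assume i: "i \<in> {1..n}"
      have "\<bar>if y i > a then (y i - a) ^ (n - 2) else 0\<bar> \<le> (u - l) ^ (n - 2)"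
        using lu[OF i] True by (auto intro!: power_mono)
      then show "\<bar>(if y i > a then (y i - a) ^ (n - 2) else 0) / (\<Prod>r\<in>{1..n} - {i}. y i - y r)\<bar>
          \<le> (u - l) ^ (n - 2) / \<bar>\<Prod>r\<in>{1..n} - {i}. y i - y r\<bar>"
        unfolding abs_divide by (intro divide_right_mono) auto
    qed
    then show ?thesis
      unfolding fundamental_spline_alt B_def abs_mult using True by (simp add: mult_left_mono)
  next
    case False
    have "fundamental_spline n y a = 0"
    proof (cases "a < l")
      case True then show ?thesis using lu by (intro fundamental_spline_left y n) force
    next
      case nl: False
      with False show ?thesis using lu by (intro fundamental_spline_right) force
    qed
    then show ?thesis using False by simp
  qed
  then show ?thesis using lu by blast
qed

lemma integrable_fundamental_spline:
  assumes "inj_on y {1..n}" and "2 \<le> n"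
  shows "integrable lborel (fundamental_spline n y)"
proof -
  obtain B l u where B: "\<And>a. \<bar>fundamental_spline n y a\<bar> \<le> B * indicator {l..u} a"
    using fundamental_spline_bounded[OF assms] by blast
  have "integrable lborel (\<lambda>a. B * indicator {l..u} a)"
    by (intro integrable_mult_right) (auto intro!: integrable_real_indicator emeasure_compact_finite)
  then show ?thesis
    by (rule Bochner_Integration.integrable_bound) (use B in \<open>auto intro: order_trans[OF B abs_ge_self]\<close>)
qed

text \<open>
  At a knot the tail is continuous but, when \<open>n = 2\<close>, not differentiable; the fundamental theorem of
  calculus admits the knots as exceptional points.
\<close>

lemma integral_fundamental_spline_Icc:
  assumes y: "inj_on y {1..n}" and n: "2 \<le> n" and ab: "a \<le> b"
  shows "(\<integral>t. fundamental_spline n y t * indicator {a..b} t \<partial>lborel) = spline_tail n y a - spline_tail n y b"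
proof -
  have "(fundamental_spline n y has_integral (- spline_tail n y b - (- spline_tail n y a))) {a..b}"
  proof (rule fundamental_theorem_of_calculus_interior_strong[of "y ` {1..n}"])
    show "continuous_on {a..b} (\<lambda>t. - spline_tail n y t)"
      by (intro continuous_intros continuous_spline_tail n)
    fix t assume t: "t \<in> {a<..<b} - y ` {1..n}"
    then have "((\<lambda>t. - spline_tail n y t) has_real_derivative - (- fundamental_spline n y t)) (at t)"
      by (intro DERIV_minus spline_tail_deriv n) auto
    then show "((\<lambda>t. - spline_tail n y t) has_vector_derivative fundamental_spline n y t) (at t)"
      by (simp add: has_real_derivative_iff_has_vector_derivative)
  qed (use ab in auto)
  then have "((\<lambda>t. if t \<in> {a..b} then fundamental_spline n y t else 0) has_integral (spline_tail n y a - spline_tail n y b)) UNIV"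
    unfolding has_integral_restrict_UNIV by simp
  also have "(\<lambda>t. if t \<in> {a..b} then fundamental_spline n y t else 0) = (\<lambda>t. fundamental_spline n y t * indicator {a..b} t)"
    by (auto simp: indicator_def)
  finally have h: "((\<lambda>t. fundamental_spline n y t * indicator {a..b} t) has_integral (spline_tail n y a - spline_tail n y b)) UNIV" .
  have "integrable lborel (\<lambda>t. fundamental_spline n y t * indicator {a..b} t)"
    by (intro integrable_real_mult_indicator integrable_fundamental_spline y n) auto
  from has_integral_unique[OF has_integral_integral_lborel[OF this] h] show ?thesis .
qed

section \<open>Integration of spline determinants over interlacing tuples\<close>

text \<open>
  The constraint on \<open>Y j\<close> when \<open>Y\<close> is interlaced by \<open>a\<close>: the tuple \<open>a\<close> cuts the line into \<open>K + 1\<close>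
  consecutive intervals, of which the first and the last are unbounded.
\<close>

definition slot :: "nat \<Rightarrow> (nat \<Rightarrow> real) \<Rightarrow> nat \<Rightarrow> real set" where
  "slot K a j = {t. (1 < j \<longrightarrow> a (j - 1) < t) \<and> (j \<le> K \<longrightarrow> t \<le> a j)}"

text \<open>
  The spline tail at the right end of the slot \<open>j\<close>, which is the left end of the next one; the index 0
  stands for minus infinity and \<open>K + 1\<close> for plus infinity.
\<close>

definition slot_tail :: "nat \<Rightarrow> (nat \<Rightarrow> real) \<Rightarrow> nat \<Rightarrow> (nat \<Rightarrow> real) \<Rightarrow> nat \<Rightarrow> real" where
  "slot_tail K a n y j = (if j = 0 then 1 else if j \<le> K then spline_tail n y (a j) else 0)"

lemma slot_borel [measurable]: "slot K a j \<in> sets borel"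
  unfolding slot_def by measurable

lemma integral_spline_slot:
  assumes y: "inj_on y {1..n}" and n: "2 \<le> n" and K: "1 \<le> K"
    and a: "mono_on {1..K} a" and j: "j \<in> {1..Suc K}"
  shows "(\<integral>t. fundamental_spline n y t * indicator (slot K a j) t \<partial>lborel)
    = slot_tail K a n y (j - 1) - slot_tail K a n y j"
proof -
  obtain B l u where B: "\<And>t. \<bar>fundamental_spline n y t\<bar> \<le> B * indicator {l..u} t"
    and lu: "\<And>i. i \<in> {1..n} \<Longrightarrow> l < y i \<and> y i < u"
    using fundamental_spline_bounded[OF y n] by blast
  have out: "fundamental_spline n y t = 0" if "t \<notin> {l..u}" for t
    using B[of t] that by simp
  \<comment> \<open>The unbounded slots are cut off outside the support of the spline.\<close>
  define b where "b = (if j = 1 then min l (a 1) else a (j - 1))"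
  define e where "e = (if j = Suc K then max u (a K) else a j)"
  have be: "b \<le> e"
  proof -
    have "a (j - 1) \<le> a j" if "j \<noteq> 1" "j \<noteq> Suc K"
      using j that by (intro mono_onD[OF a]) auto
    moreover have "a 1 \<le> a K" using K by (intro mono_onD[OF a]) auto
    ultimately show ?thesis by (auto simp: b_def e_def)
  qed
  have tb: "slot_tail K a n y (j - 1) = spline_tail n y b"
  proof (cases "j = 1")
    case True
    have "spline_tail n y b = 1"
      using lu n True by (intro spline_tail_left y) (force simp: b_def)+
    then show ?thesis using True by (simp add: slot_tail_def)
  next
    case False
    moreover have "j - 1 \<le> K" "j - 1 \<noteq> 0" using j False by auto
    ultimately show ?thesis by (simp add: slot_tail_def b_def)
  qed
  have te: "slot_tail K a n y j = spline_tail n y e"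
  proof (cases "j = Suc K")
    case True
    have "spline_tail n y e = 0"
      using lu True by (intro spline_tail_right) (force simp: e_def)
    then show ?thesis using True by (simp add: slot_tail_def)
  next
    case False
    then show ?thesis using j by (simp add: slot_tail_def e_def)
  qed
  have "AE t in lborel. t \<noteq> b" by (rule AE_lborel_singleton)
  moreover have "AE t in lborel. t \<noteq> l" by (rule AE_lborel_singleton)
  ultimately have "AE t in lborel. fundamental_spline n y t * indicator (slot K a j) t
      = fundamental_spline n y t * indicator {b..e} t"
  proof eventually_elim
    case (elim t)
    show ?case
    proof (cases "t \<in> {l..u}")
      case True
      then have "t \<in> slot K a j \<longleftrightarrow> t \<in> {b..e}"
        using elim j by (auto simp: slot_def b_def e_def)
      then show ?thesis by (simp add: indicator_def)
    qed (simp add: out)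
  qed
  then have "(\<integral>t. fundamental_spline n y t * indicator (slot K a j) t \<partial>lborel)
      = (\<integral>t. fundamental_spline n y t * indicator {b..e} t \<partial>lborel)"
    by (intro integral_cong_AE) auto
  then show ?thesis
    unfolding integral_fundamental_spline_Icc[OF y n be] tb te .
qed

lemma det_column_form:
  assumes A: "A \<in> carrier_mat n n"
  shows "Determinant.det A = (\<Sum>p\<in>{p. p permutes {0..<n}}. signof p * (\<Prod>j\<in>{0..<n}. A $$ (p j, j)))"
proof -
  have "Determinant.det A = Determinant.det (A\<^sup>T)"
    using det_transpose[OF A] by simp
  also have "\<dots> = (\<Sum>p\<in>{p. p permutes {0..<n}}. signof p * (\<Prod>j\<in>{0..<n}. A\<^sup>T $$ (j, p j)))"
    using A by (intro det_def') simp
  also have "\<dots> = (\<Sum>p\<in>{p. p permutes {0..<n}}. signof p * (\<Prod>j\<in>{0..<n}. A $$ (p j, j)))"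
    using A by (intro sum.cong arg_cong2[where f="(*)"] prod.cong refl) (auto dest: permutes_in_image)
  finally show ?thesis .
qed

text \<open>
  Each term of the Leibniz expansion is a product of functions of separate variables.
\<close>

lemma integral_det_columns:
  fixes f :: "nat \<Rightarrow> real \<Rightarrow> real" and S :: "nat \<Rightarrow> real set"
  assumes int: "\<And>i. i < n \<Longrightarrow> integrable lborel (f i)" and S: "\<And>j. S j \<in> sets borel"
  shows "integrable (PiM {1..n} (\<lambda>_. lborel))
      (\<lambda>Y. Determinant.det (mat n n (\<lambda>(i, j). f i (Y (Suc j)))) * (\<Prod>j\<in>{1..n}. indicator (S j) (Y j)))" (is ?int)
    and "(\<integral>Y. Determinant.det (mat n n (\<lambda>(i, j). f i (Y (Suc j)))) * (\<Prod>j\<in>{1..n}. indicator (S j) (Y j)) \<partial>PiM {1..n} (\<lambda>_. lborel))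
      = Determinant.det (mat n n (\<lambda>(i, j). \<integral>t. f i t * indicator (S (Suc j)) t \<partial>lborel))" (is ?eq)
proof -
  interpret product_sigma_finite "\<lambda>_::nat. lborel :: real measure"
    by (rule product_sigma_finite_lborel)
  let ?P = "{p. p permutes {0..<n}}"
  define g where "g p j t = f (p (j - 1)) t * indicator (S j) t" for p :: "nat \<Rightarrow> nat" and j :: nat and t :: real
  have gi: "integrable lborel (g p j)" if "p \<in> ?P" "j \<in> {1..n}" for p j
  proof -
    have "p (j - 1) < n" using that permutes_in_image[of p "{0..<n}" "j - 1"] by auto
    then show ?thesis unfolding g_def[abs_def]
      by (intro integrable_real_mult_indicator int) (simp_all add: S)
  qed
  have eq: "Determinant.det (mat n n (\<lambda>(i, j). f i (Y (Suc j)))) * (\<Prod>j\<in>{1..n}. indicator (S j) (Y j))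
      = (\<Sum>p\<in>?P. signof p * (\<Prod>j\<in>{1..n}. g p j (Y j)))" for Y
  proof -
    have "(\<Prod>j\<in>{0..<n}. mat n n (\<lambda>(i, j). f i (Y (Suc j))) $$ (p j, j)) * (\<Prod>j\<in>{1..n}. indicator (S j) (Y j))
        = (\<Prod>j\<in>{1..n}. g p j (Y j))" if p: "p \<in> ?P" for p
    proof -
      have "(\<Prod>j\<in>{0..<n}. mat n n (\<lambda>(i, j). f i (Y (Suc j))) $$ (p j, j)) = (\<Prod>j\<in>{0..<n}. f (p j) (Y (Suc j)))"
        using p by (intro prod.cong) (auto dest: permutes_in_image)
      also have "\<dots> = (\<Prod>j\<in>{1..n}. f (p (j - 1)) (Y j))"
        by (rule prod.reindex_bij_witness[of _ "\<lambda>j. j - 1" Suc]) auto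
      finally show ?thesis by (simp add: g_def prod.distrib)
    qed
    then show ?thesis
      by (subst det_column_form[of _ n]) (auto simp: sum_distrib_right mult.assoc intro!: sum.cong)
  qed
  have gp: "integrable (PiM {1..n} (\<lambda>_. lborel)) (\<lambda>Y. \<Prod>j\<in>{1..n}. g p j (Y j))" if "p \<in> ?P" for p
    by (rule product_integrable_prod) (use gi[OF that] in auto)
  show ?int unfolding eq by (intro Bochner_Integration.integrable_sum integrable_mult_right gp)
  have "(\<integral>Y. Determinant.det (mat n n (\<lambda>(i, j). f i (Y (Suc j)))) * (\<Prod>j\<in>{1..n}. indicator (S j) (Y j)) \<partial>PiM {1..n} (\<lambda>_. lborel))
      = (\<Sum>p\<in>?P. signof p * (\<integral>Y. (\<Prod>j\<in>{1..n}. g p j (Y j)) \<partial>PiM {1..n} (\<lambda>_. lborel)))"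
  proof -
    have "(\<integral>Y. (\<Sum>p\<in>?P. signof p * (\<Prod>j\<in>{1..n}. g p j (Y j))) \<partial>PiM {1..n} (\<lambda>_. lborel))
        = (\<Sum>p\<in>?P. (\<integral>Y. signof p * (\<Prod>j\<in>{1..n}. g p j (Y j)) \<partial>PiM {1..n} (\<lambda>_. lborel)))"
      by (intro Bochner_Integration.integral_sum integrable_mult_right gp)
    then show ?thesis unfolding eq by simp
  qed
  also have "\<dots> = (\<Sum>p\<in>?P. signof p * (\<Prod>j\<in>{1..n}. \<integral>t. g p j t \<partial>lborel))"
    by (intro sum.cong refl arg_cong2[where f="(*)"] product_integral_prod) (use gi in auto)
  also have "\<dots> = (\<Sum>p\<in>?P. signof p * (\<Prod>j\<in>{0..<n}. mat n n (\<lambda>(i, j). \<integral>t. f i t * indicator (S (Suc j)) t \<partial>lborel) $$ (p j, j)))"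
  proof (intro sum.cong refl arg_cong2[where f="(*)"])
    fix p assume p: "p \<in> ?P"
    have "(\<Prod>j\<in>{0..<n}. mat n n (\<lambda>(i, j). \<integral>t. f i t * indicator (S (Suc j)) t \<partial>lborel) $$ (p j, j))
        = (\<Prod>j\<in>{0..<n}. \<integral>t. f (p j) t * indicator (S (Suc j)) t \<partial>lborel)"
      using p by (intro prod.cong) (auto dest: permutes_in_image)
    also have "\<dots> = (\<Prod>j\<in>{1..n}. \<integral>t. g p j t \<partial>lborel)"
      unfolding g_def by (rule prod.reindex_bij_witness[of _ "\<lambda>j. j - 1" Suc]) auto
    finally show "(\<Prod>j\<in>{1..n}. \<integral>t. g p j t \<partial>lborel)
        = (\<Prod>j\<in>{0..<n}. mat n n (\<lambda>(i, j). \<integral>t. f i t * indicator (S (Suc j)) t \<partial>lborel) $$ (p j, j))" by simp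
  qed
  also have "\<dots> = Determinant.det (mat n n (\<lambda>(i, j). \<integral>t. f i t * indicator (S (Suc j)) t \<partial>lborel))"
    by (rule det_column_form[symmetric]) simp
  finally show ?eq .
qed

text \<open>
  Two unipotent factors. Summing columns from the left telescopes the entries to \<open>1 - E i (Suc j)\<close>, and
  subtracting from each row the next one leaves a last column that vanishes except for the entry 1 in the
  last row; the determinant is then expanded along that column.
\<close>

lemma det_consecutive_differences:
  fixes E :: "nat \<Rightarrow> nat \<Rightarrow> real"
  assumes first: "\<And>i. i \<le> K \<Longrightarrow> E i 0 = 1" and last: "\<And>i. i \<le> K \<Longrightarrow> E i (Suc K) = 0"
  shows "Determinant.det (mat (Suc K) (Suc K) (\<lambda>(i, j). E i j - E i (Suc j)))
    = Determinant.det (mat K K (\<lambda>(i, j). E (Suc i) (Suc j) - E i (Suc j)))"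
proof -
  let ?n = "Suc K"
  define B where "B = mat ?n ?n (\<lambda>(i, j). E i j - E i (Suc j))"
  define U where "U = mat ?n ?n (\<lambda>(i, j). if i \<le> j then 1 else 0 :: real)"
  define L where "L = mat ?n ?n (\<lambda>(i, j). if i = j then 1 else if j = Suc i then - 1 else 0 :: real)"
  define C where "C = mat ?n ?n (\<lambda>(i, j). if i = K then 1 - E i (Suc j) else E (Suc i) (Suc j) - E i (Suc j))"
  have carr: "B \<in> carrier_mat ?n ?n" "U \<in> carrier_mat ?n ?n" "L \<in> carrier_mat ?n ?n" "C \<in> carrier_mat ?n ?n"
    by (simp_all add: B_def U_def L_def C_def)
  have "Determinant.det U = prod_list (diag_mat U)"
    by (rule det_upper_triangular[OF _ carr(2)]) (auto simp: U_def)
  also have "\<dots> = 1" by (rule prod_list_neutral) (auto simp: diag_mat_def U_def)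
  finally have U: "Determinant.det U = 1" .
  have "Determinant.det L = prod_list (diag_mat L)"
    by (rule det_upper_triangular[OF _ carr(3)]) (auto simp: L_def)
  also have "\<dots> = 1" by (rule prod_list_neutral) (auto simp: diag_mat_def L_def)
  finally have L: "Determinant.det L = 1" .
  have BU: "B * U = mat ?n ?n (\<lambda>(i, j). 1 - E i (Suc j))"
  proof (rule eq_matI)
    fix i j assume "i < dim_row (mat ?n ?n (\<lambda>(i, j). 1 - E i (Suc j)))" "j < dim_col (mat ?n ?n (\<lambda>(i, j). 1 - E i (Suc j)))"
    then have ij: "i < ?n" "j < ?n" by auto
    have "(B * U) $$ (i, j) = (\<Sum>l\<in>{0..<?n}. (E i l - E i (Suc l)) * (if l \<le> j then 1 else 0))"
      using ij by (simp add: B_def U_def scalar_prod_def)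
    also have "\<dots> = (\<Sum>l\<in>{0..<?n}. if l \<le> j then E i l - E i (Suc l) else 0)"
      by (intro sum.cong) auto
    also have "\<dots> = (\<Sum>l\<in>{l\<in>{0..<?n}. l \<le> j}. E i l - E i (Suc l))"
      by (rule sum.inter_filter[symmetric]) simp
    also have "{l\<in>{0..<?n}. l \<le> j} = {..<Suc j}" using ij by auto
    also have "(\<Sum>l\<in>{..<Suc j}. E i l - E i (Suc l)) = E i 0 - E i (Suc j)"
      by (rule sum_lessThan_telescope')
    finally show "(B * U) $$ (i, j) = mat ?n ?n (\<lambda>(i, j). 1 - E i (Suc j)) $$ (i, j)"
      using ij first[of i] by simp
  qed (simp_all add: B_def U_def)
  have LBU: "L * (B * U) = C"
  proof (rule eq_matI)
    fix i j assume "i < dim_row C" "j < dim_col C"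
    then have ij: "i < ?n" "j < ?n" by (auto simp: C_def)
    have "(L * (B * U)) $$ (i, j)
        = (\<Sum>l\<in>{0..<?n}. (if i = l then 1 else if l = Suc i then - 1 else 0) * (1 - E l (Suc j)))"
      using ij unfolding BU by (simp add: L_def scalar_prod_def)
    also have "\<dots> = (\<Sum>l\<in>{0..<?n}. (if l = i then 1 - E l (Suc j) else 0) - (if l = Suc i then 1 - E l (Suc j) else 0))"
      by (intro sum.cong) auto
    also have "\<dots> = C $$ (i, j)"
      unfolding sum_subtractf using ij by (auto simp: C_def)
    finally show "(L * (B * U)) $$ (i, j) = C $$ (i, j)" .
  qed (simp_all add: B_def U_def L_def C_def)
  have "Determinant.det B = Determinant.det L * (Determinant.det B * Determinant.det U)"
    by (simp add: U L)
  also have "\<dots> = Determinant.det C"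
    unfolding LBU[symmetric] using carr by (simp add: det_mult[of _ ?n])
  also have "\<dots> = (\<Sum>i<?n. C $$ (i, K) * cofactor C i K)"
    by (rule laplace_expansion_column[OF carr(4)]) simp
  also have "\<dots> = (\<Sum>i<?n. if i = K then cofactor C i K else 0)"
    using last by (intro sum.cong) (auto simp: C_def)
  also have "\<dots> = Determinant.det (mat_delete C K K)"
    by (simp add: cofactor_def)
  also have "mat_delete C K K = mat K K (\<lambda>(i, j). E (Suc i) (Suc j) - E i (Suc j))"
    by (rule eq_matI) (auto simp: mat_delete_def C_def)
  finally show ?thesis by (simp add: B_def)
qed

lemma det_scale_rows:
  fixes c :: "nat \<Rightarrow> real"
  shows "Determinant.det (mat n n (\<lambda>(i, j). c i * f i j)) = (\<Prod>i\<in>{0..<n}. c i) * Determinant.det (mat n n (\<lambda>(i, j). f i j))"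
proof -
  have "(\<Prod>i\<in>{0..<n}. mat n n (\<lambda>(i, j). c i * f i j) $$ (i, p i))
      = (\<Prod>i\<in>{0..<n}. c i) * (\<Prod>i\<in>{0..<n}. mat n n (\<lambda>(i, j). f i j) $$ (i, p i))" if "p permutes {0..<n}" for p
    unfolding prod.distrib[symmetric]
    using that by (intro prod.cong) (auto dest: permutes_in_image)
  then show ?thesis
    by (subst (1 2) det_def'[of _ n]) (auto simp: sum_distrib_left mult_ac intro!: sum.cong)
qed

text \<open>
  The inequalities are half-open like those for the support of a fundamental spline with two knots. So, for
  \<open>K = N - 1\<close> and increasing \<open>a\<close>, the spline determinant vanishes exactly when they fail.
\<close>

definition interlaces :: "nat \<Rightarrow> (nat \<Rightarrow> real) \<Rightarrow> (nat \<Rightarrow> real) \<Rightarrow> bool" where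
  "interlaces n y a \<longleftrightarrow> (\<forall>j\<in>{1..<n}. y j \<le> a j \<and> a j < y (Suc j))"

lemma indicator_interlaces:
  assumes K: "1 \<le> K"
  shows "indicator {Y. interlaces (Suc K) Y a} Y = (\<Prod>j\<in>{1..Suc K}. indicator (slot K a j) (Y j) :: real)"
proof -
  have iff: "interlaces (Suc K) Y a \<longleftrightarrow> (\<forall>j\<in>{1..Suc K}. Y j \<in> slot K a j)"
  proof
    assume *: "interlaces (Suc K) Y a"
    show "\<forall>j\<in>{1..Suc K}. Y j \<in> slot K a j"
    proof
      fix j assume "j \<in> {1..Suc K}"
      then obtain i where "j = Suc i" "i \<le> K" by (cases j) auto
      then show "Y j \<in> slot K a j"
        using *[unfolded interlaces_def, rule_format, of "Suc i"] *[unfolded interlaces_def, rule_format, of i]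
        by (auto simp: slot_def)
    qed
  next
    assume *: "\<forall>j\<in>{1..Suc K}. Y j \<in> slot K a j"
    show "interlaces (Suc K) Y a"
      unfolding interlaces_def
    proof
      fix j assume "j \<in> {1..<Suc K}"
      then show "Y j \<le> a j \<and> a j < Y (Suc j)"
        using *[rule_format, of j] *[rule_format, of "Suc j"] by (auto simp: slot_def)
    qed
  qed
  show ?thesis
  proof (cases "interlaces (Suc K) Y a")
    case True
    then have "(\<Prod>j\<in>{1..Suc K}. indicator (slot K a j) (Y j) :: real) = 1"
      using iff by (intro prod.neutral) simp
    then show ?thesis using True by simp
  next
    case False
    then obtain j where "j \<in> {1..Suc K}" "Y j \<notin> slot K a j" using iff by blast
    then have "(\<Prod>j\<in>{1..Suc K}. indicator (slot K a j) (Y j) :: real) = 0"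
      by (intro prod_zero bexI[of _ j]) simp_all
    then show ?thesis using False by simp
  qed
qed

text \<open>
  Integrating out one level of the interlacing pattern adds a knot to every spline and removes a row and a
  column: the integrals over slots are consecutive differences of spline tails, and subtracting consecutive
  rows produces tails for knots shifted by one.
\<close>

theorem integral_det_spline_interlaces:
  assumes x: "strict_mono_on {1..N} x" and K: "1 \<le> K" "K + 2 \<le> N" and a: "mono_on {1..K} a"
  shows "integrable (PiM {1..Suc K} (\<lambda>_. lborel))
      (\<lambda>Y. Determinant.det (spline_matrix N (Suc K) x Y) * indicator {Y. interlaces (Suc K) Y a} Y)" (is ?int)
    and "(\<integral>Y. Determinant.det (spline_matrix N (Suc K) x Y) * indicator {Y. interlaces (Suc K) Y a} Y \<partial>PiM {1..Suc K} (\<lambda>_. lborel))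
      = (\<Prod>i\<in>{1..K}. (x (i + (N - K)) - x i) / real (N - K)) * Determinant.det (spline_matrix N K x a)" (is ?eq)
proof -
  define L where "L = N - K"
  have L: "2 \<le> L" "N - Suc K + 1 = L" "N - K + 1 = Suc L" using K by (auto simp: L_def)
  define f where "f i = fundamental_spline L (\<lambda>l. x (i + l))" for i
  have xinj: "inj_on x {1..N}" by (rule strict_mono_on_imp_inj_on[OF x])
  have inj: "inj_on (\<lambda>l. x (i + l)) {1..M}" if "i + M \<le> N" for i M
  proof (rule inj_onI)
    fix l l' assume "l \<in> {1..M}" "l' \<in> {1..M}" "x (i + l) = x (i + l')"
    then have "i + l = i + l'" using that by (intro inj_onD[OF xinj]) auto
    then show "l = l'" by simp
  qed
  have fi: "integrable lborel (f i)" if "i < Suc K" for i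
    unfolding f_def using that K by (intro integrable_fundamental_spline inj L) (auto simp: L_def)
  have sm: "spline_matrix N (Suc K) x Y = mat (Suc K) (Suc K) (\<lambda>(i, j). f i (Y (Suc j)))" for Y
    unfolding spline_matrix_def f_def L by simp
  show ?int
    unfolding sm indicator_interlaces[OF K(1)] by (rule integral_det_columns(1)) (auto intro: fi)
  define E where "E i = slot_tail K a L (\<lambda>l. x (i + l))" for i
  have "(\<integral>Y. Determinant.det (spline_matrix N (Suc K) x Y) * indicator {Y. interlaces (Suc K) Y a} Y \<partial>PiM {1..Suc K} (\<lambda>_. lborel))
      = Determinant.det (mat (Suc K) (Suc K) (\<lambda>(i, j). \<integral>t. f i t * indicator (slot K a (Suc j)) t \<partial>lborel))"
    unfolding sm indicator_interlaces[OF K(1)] by (rule integral_det_columns(2)) (auto intro: fi)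
  also have "mat (Suc K) (Suc K) (\<lambda>(i, j). \<integral>t. f i t * indicator (slot K a (Suc j)) t \<partial>lborel)
      = mat (Suc K) (Suc K) (\<lambda>(i, j). E i j - E i (Suc j))"
  proof (rule eq_matI; clarsimp)
    fix i j assume ij: "i < Suc K" "j < Suc K"
    have "inj_on (\<lambda>l. x (i + l)) {1..L}" using ij K by (intro inj) (simp add: L_def)
    from integral_spline_slot[OF this L(1) K(1) a, of "Suc j"]
    show "(\<integral>t. f i t * indicator (slot K a (Suc j)) t \<partial>lborel) = E i j - E i (Suc j)"
      using ij by (simp add: f_def E_def)
  qed
  also have "Determinant.det \<dots> = Determinant.det (mat K K (\<lambda>(i, j). E (Suc i) (Suc j) - E i (Suc j)))"
    by (rule det_consecutive_differences) (simp_all add: E_def slot_tail_def)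
  also have "mat K K (\<lambda>(i, j). E (Suc i) (Suc j) - E i (Suc j))
      = mat K K (\<lambda>(i, j). (x (Suc i + L) - x (Suc i)) / real L * fundamental_spline (Suc L) (\<lambda>l. x (i + l)) (a (Suc j)))"
  proof (rule eq_matI; clarsimp)
    fix i j assume ij: "i < K" "j < K"
    have "inj_on (\<lambda>l. x (i + l)) {1..Suc L}" using ij K by (intro inj) (simp add: L_def)
    from spline_tail_diff[OF this, of "a (Suc j)"] L ij
    show "E (Suc i) (Suc j) - E i (Suc j) = (x (Suc (i + L)) - x (Suc i)) * fundamental_spline (Suc L) (\<lambda>l. x (i + l)) (a (Suc j)) / real L"
      by (simp add: E_def slot_tail_def)
  qed
  also have "Determinant.det \<dots> = (\<Prod>i\<in>{0..<K}. (x (Suc i + L) - x (Suc i)) / real L) * Determinant.det (spline_matrix N K x a)"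
    unfolding det_scale_rows spline_matrix_def L by simp
  also have "(\<Prod>i\<in>{0..<K}. (x (Suc i + L) - x (Suc i)) / real L) = (\<Prod>i\<in>{1..K}. (x (i + L) - x i) / real L)"
    by (rule prod.reindex_bij_witness[of _ "\<lambda>i. i - 1" Suc]) auto
  finally show ?eq unfolding L_def .
qed

section \<open>Complex Gaussian vectors\<close>

lemma distr_PiM_sigma_finite:
  assumes fin: "finite I" and M: "product_sigma_finite M" and N: "product_sigma_finite N"
    and g: "\<And>i. i \<in> I \<Longrightarrow> g i \<in> M i \<rightarrow>\<^sub>M N i" and d: "\<And>i. i \<in> I \<Longrightarrow> distr (M i) (N i) (g i) = N i"
  shows "distr (PiM I M) (PiM I N) (\<lambda>v. \<lambda>i\<in>I. g i (v i)) = PiM I N"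
proof (rule product_sigma_finite.PiM_eqI[OF N fin])
  interpret M: product_sigma_finite M by (rule M)
  have m: "(\<lambda>v. \<lambda>i\<in>I. g i (v i)) \<in> PiM I M \<rightarrow>\<^sub>M PiM I N"
    by (intro measurable_restrict measurable_compose[OF measurable_component_singleton]) (auto intro: g)
  fix A assume A: "\<And>i. i \<in> I \<Longrightarrow> A i \<in> sets (N i)"
  have "emeasure (distr (PiM I M) (PiM I N) (\<lambda>v. \<lambda>i\<in>I. g i (v i))) (PiE I A)
      = emeasure (PiM I M) ((\<lambda>v. \<lambda>i\<in>I. g i (v i)) -` (PiE I A) \<inter> space (PiM I M))"
    by (rule emeasure_distr[OF m]) (use fin A in auto)
  also have "(\<lambda>v. \<lambda>i\<in>I. g i (v i)) -` (PiE I A) \<inter> space (PiM I M) = PiE I (\<lambda>i. g i -` A i \<inter> space (M i))"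
    by (auto simp: space_PiM PiE_iff)
  also have "emeasure (PiM I M) \<dots> = (\<Prod>i\<in>I. emeasure (M i) (g i -` A i \<inter> space (M i)))"
    by (rule M.emeasure_PiM[OF fin]) (use measurable_sets[OF g A] in auto)
  also have "\<dots> = (\<Prod>i\<in>I. emeasure (N i) (A i))"
  proof (rule prod.cong[OF refl])
    fix i assume i: "i \<in> I"
    show "emeasure (M i) (g i -` A i \<inter> space (M i)) = emeasure (N i) (A i)"
      using emeasure_distr[OF g[OF i] A[OF i]] d[OF i] by simp
  qed
  finally show "emeasure (distr (PiM I M) (PiM I N) (\<lambda>v. \<lambda>i\<in>I. g i (v i))) (PiE I A) = (\<Prod>i\<in>I. emeasure (N i) (A i))" .
qed simp

lemma density_PiM_sigma_finite:
  assumes fin: "finite I" and M: "product_sigma_finite M" and N: "product_sigma_finite (\<lambda>i. density (M i) (f i))"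
    and f: "\<And>i. i \<in> I \<Longrightarrow> f i \<in> borel_measurable (M i)"
  shows "PiM I (\<lambda>i. density (M i) (f i)) = density (PiM I M) (\<lambda>v. \<Prod>i\<in>I. f i (v i))"
proof (rule product_sigma_finite.PiM_eqI[OF N fin, symmetric])
  interpret M: product_sigma_finite M by (rule M)
  show "sets (density (PiM I M) (\<lambda>v. \<Prod>i\<in>I. f i (v i))) = sets (PiM I (\<lambda>i. density (M i) (f i)))"
    by (simp cong: sets_PiM_cong)
  have m: "(\<lambda>v. \<Prod>i\<in>I. f i (v i)) \<in> borel_measurable (PiM I M)"
    by (intro borel_measurable_prod_ennreal measurable_compose[OF measurable_component_singleton]) (auto intro: f)
  fix A assume A: "\<And>i. i \<in> I \<Longrightarrow> A i \<in> sets (density (M i) (f i))"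
  then have A': "\<And>i. i \<in> I \<Longrightarrow> A i \<in> sets (M i)" by simp
  then have E: "PiE I A \<in> sets (PiM I M)" using fin by auto
  have "emeasure (density (PiM I M) (\<lambda>v. \<Prod>i\<in>I. f i (v i))) (PiE I A)
      = (\<integral>\<^sup>+v. (\<Prod>i\<in>I. f i (v i)) * indicator (PiE I A) v \<partial>PiM I M)"
    by (rule emeasure_density[OF m E])
  also have "\<dots> = (\<integral>\<^sup>+v. (\<Prod>i\<in>I. f i (v i) * indicator (A i) (v i)) \<partial>PiM I M)"
  proof (rule nn_integral_cong)
    fix v assume v: "v \<in> space (PiM I M)"
    have "indicator (PiE I A) v = (\<Prod>i\<in>I. indicator (A i) (v i) :: ennreal)"
    proof (cases "v \<in> PiE I A")
      case True then show ?thesis by (simp add: PiE_iff)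
    next
      case False
      then obtain i where "i \<in> I" "v i \<notin> A i" using v by (auto simp: PiE_iff space_PiM)
      then have "(\<Prod>i\<in>I. indicator (A i) (v i) :: ennreal) = 0"
        using fin by (intro prod_zero bexI[of _ i]) auto
      then show ?thesis using False by simp
    qed
    then show "(\<Prod>i\<in>I. f i (v i)) * indicator (PiE I A) v = (\<Prod>i\<in>I. f i (v i) * indicator (A i) (v i))"
      by (simp add: prod.distrib)
  qed
  also have "\<dots> = (\<Prod>i\<in>I. \<integral>\<^sup>+z. f i z * indicator (A i) z \<partial>M i)"
    by (rule M.product_nn_integral_prod[OF fin]) (use f A' in auto)
  also have "\<dots> = (\<Prod>i\<in>I. emeasure (density (M i) (f i)) (A i))"
    using f A' by (intro prod.cong refl) (simp add: emeasure_density)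
  finally show "emeasure (density (PiM I M) (\<lambda>v. \<Prod>i\<in>I. f i (v i))) (PiE I A) = (\<Prod>i\<in>I. emeasure (density (M i) (f i)) (A i))" .
qed

text \<open>
  The disc of radius \<open>sqrt t\<close> has area \<open>pi * t\<close>.
\<close>

lemma distr_norm_squared_complex:
  "distr (lborel :: complex measure) borel (\<lambda>z. (cmod z)\<^sup>2) = density lborel (\<lambda>t. ennreal pi * indicator {0..} t)"
proof (rule measure_eqI_generator_eq[where E="range (\<lambda>a. {..a::real})" and \<Omega>=UNIV and A="\<lambda>i. {..real i}"])
  have area: "emeasure (distr (lborel :: complex measure) borel (\<lambda>z. (cmod z)\<^sup>2)) {..t} = (if 0 \<le> t then ennreal (pi * t) else 0)" for t
  proof -
    have "emeasure (distr (lborel :: complex measure) borel (\<lambda>z. (cmod z)\<^sup>2)) {..t} = emeasure lborel {z::complex. (cmod z)\<^sup>2 \<le> t}"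
      by (subst emeasure_distr) (auto simp: vimage_def)
    also have "\<dots> = (if 0 \<le> t then ennreal (pi * t) else 0)"
    proof (cases "0 \<le> t")
      case True
      have "{z::complex. (cmod z)\<^sup>2 \<le> t} = cball 0 (sqrt t)"
      proof (rule Set.set_eqI)
        fix z :: complex
        show "z \<in> {z. (cmod z)\<^sup>2 \<le> t} \<longleftrightarrow> z \<in> cball 0 (sqrt t)"
        proof -
        have "cmod z \<le> sqrt t \<longleftrightarrow> (cmod z)\<^sup>2 \<le> t"
          using True real_le_rsqrt[of "cmod z" t] power_mono[of "cmod z" "sqrt t" 2] by auto
        then show ?thesis by simp
        qed
      qed
      then show ?thesis using True by (simp add: emeasure_cball unit_ball_vol_2)
    next
      case False
      then have "{z::complex. (cmod z)\<^sup>2 \<le> t} = {}"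
        by (auto simp: not_le intro: less_le_trans)
      then show ?thesis using False by simp
    qed
    finally show ?thesis .
  qed
  have len: "emeasure (density lborel (\<lambda>t. ennreal pi * indicator {0..} t)) {..t} = (if 0 \<le> t then ennreal (pi * t) else 0)" for t
  proof -
    have "emeasure (density lborel (\<lambda>t. ennreal pi * indicator {0..} t)) {..t} = (\<integral>\<^sup>+s. ennreal pi * indicator {0..t} s \<partial>lborel)"
      by (subst emeasure_density) (auto intro!: nn_integral_cong simp: indicator_def)
    also have "\<dots> = (if 0 \<le> t then ennreal (pi * t) else 0)"
      by (simp add: nn_integral_cmult ennreal_mult)
    finally show ?thesis .
  qed
  show "emeasure (distr (lborel :: complex measure) borel (\<lambda>z. (cmod z)\<^sup>2)) X = emeasure (density lborel (\<lambda>t. ennreal pi * indicator {0..} t)) X"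
    if "X \<in> range (\<lambda>a. {..a::real})" for X
    using that area len by auto
  show "emeasure (distr (lborel :: complex measure) borel (\<lambda>z. (cmod z)\<^sup>2)) {..real i} \<noteq> \<infinity>" for i
    unfolding area by simp
  show "Int_stable (range (\<lambda>a. {..a::real}))"
    by (auto simp: Int_stable_def)
  show "(\<Union>i. {..real i}) = UNIV"
    by (auto intro: real_arch_simple)
  have b: "sets (borel :: real measure) = sigma_sets UNIV (range (\<lambda>a. {..a}))"
    by (subst borel_eq_atMost) (simp add: sets_measure_of)
  show "sets (distr (lborel :: complex measure) borel (\<lambda>z. (cmod z)\<^sup>2)) = sigma_sets UNIV (range (\<lambda>a. {..a}))"
    "sets (density lborel (\<lambda>t. ennreal pi * indicator {0..} t)) = sigma_sets UNIV (range (\<lambda>a. {..a::real}))"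
    by (simp_all add: b)
qed auto

text \<open>
  The complex Gaussian law for which the squared modulus is exponential with parameter 1.
\<close>

definition gauss :: "complex measure" where
  "gauss = density lborel (\<lambda>z. ennreal (exp (- (cmod z)\<^sup>2) / pi))"

lemma sets_gauss [measurable_cong, simp]: "sets gauss = sets borel"
  by (simp add: gauss_def)

lemma space_gauss [simp]: "space gauss = UNIV"
  by (simp add: gauss_def)

lemma distr_gauss_norm_squared:
  "distr gauss borel (\<lambda>z. (cmod z)\<^sup>2) = density lborel (exponential_density 1)"
proof (rule measure_eqI)
  fix A assume "A \<in> sets (distr gauss borel (\<lambda>z. (cmod z)\<^sup>2))"
  then have A [measurable]: "A \<in> sets borel" by simp
  have "emeasure (distr gauss borel (\<lambda>z. (cmod z)\<^sup>2)) A = (\<integral>\<^sup>+t. indicator A t \<partial>distr gauss borel (\<lambda>z. (cmod z)\<^sup>2))"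
    by simp
  also have "\<dots> = (\<integral>\<^sup>+z. indicator A ((cmod z)\<^sup>2) \<partial>gauss)"
    by (rule nn_integral_distr) measurable
  also have "\<dots> = (\<integral>\<^sup>+z. ennreal (exp (- (cmod z)\<^sup>2) / pi) * indicator A ((cmod z)\<^sup>2) \<partial>lborel)"
    unfolding gauss_def by (rule nn_integral_density) measurable
  also have "\<dots> = (\<integral>\<^sup>+t. ennreal (exp (- t) / pi) * indicator A t \<partial>distr (lborel :: complex measure) borel (\<lambda>z. (cmod z)\<^sup>2))"
    by (subst nn_integral_distr) auto
  also have "\<dots> = (\<integral>\<^sup>+t. ennreal pi * indicator {0..} t * (ennreal (exp (- t) / pi) * indicator A t) \<partial>lborel)"
    unfolding distr_norm_squared_complex by (rule nn_integral_density) measurable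
  also have "\<dots> = (\<integral>\<^sup>+t. ennreal (exponential_density 1 t) * indicator A t \<partial>lborel)"
    by (intro nn_integral_cong) (auto simp: exponential_density_def indicator_def ennreal_mult[symmetric])
  also have "\<dots> = emeasure (density lborel (exponential_density 1)) A"
    by (subst emeasure_density) auto
  finally show "emeasure (distr gauss borel (\<lambda>z. (cmod z)\<^sup>2)) A = emeasure (density lborel (exponential_density 1)) A" .
qed simp

lemma prob_space_gauss: "prob_space gauss"
proof (rule prob_spaceI)
  interpret E: prob_space "density lborel (exponential_density 1)"
    by (rule prob_space_exponential_density) simp
  have "emeasure gauss (space gauss) = emeasure (distr gauss borel (\<lambda>z. (cmod z)\<^sup>2)) UNIV"
    by (subst emeasure_distr) auto
  also have "\<dots> = 1" unfolding distr_gauss_norm_squared using E.emeasure_space_1 by simp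
  finally show "emeasure gauss (space gauss) = 1" .
qed

lemma product_sigma_finite_gauss: "product_sigma_finite (\<lambda>_. gauss)"
  using prob_space_gauss by (auto simp: product_sigma_finite_def prob_space_imp_sigma_finite)

definition gauss_vec_density :: "nat \<Rightarrow> (nat \<Rightarrow> complex) \<Rightarrow> ennreal" where
  "gauss_vec_density n v = (\<Prod>i\<in>{1..n}. ennreal (exp (- (cmod (v i))\<^sup>2) / pi))"

lemma gauss_vec_density_eq:
  "gauss_vec_density n v = ennreal (exp (- (\<Sum>i\<in>{1..n}. (cmod (v i))\<^sup>2)) / pi ^ n)"
  unfolding gauss_vec_density_def
  by (subst prod_ennreal) (auto simp: prod_dividef exp_sum[symmetric] sum_negf)

lemma PiM_gauss: "PiM {1..n} (\<lambda>_. gauss) = density (PiM {1..n} (\<lambda>_. lborel)) (gauss_vec_density n)"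
  unfolding gauss_vec_density_def[abs_def] gauss_def
  by (rule density_PiM_sigma_finite) 
     (use product_sigma_finite_gauss product_sigma_finite_lborel in \<open>auto simp: gauss_def\<close>)

lemma nn_integral_PiM_lborel_translate:
  fixes y :: "'i \<Rightarrow> 'a::euclidean_space"
  assumes fin: "finite I" and f: "f \<in> borel_measurable (PiM I (\<lambda>_. lborel))"
  shows "(\<integral>\<^sup>+v. f (\<lambda>i\<in>I. v i + y i) \<partial>PiM I (\<lambda>_. lborel)) = (\<integral>\<^sup>+v. f v \<partial>PiM I (\<lambda>_. lborel))"
proof -
  have g: "(\<lambda>z. z + y i) \<in> lborel \<rightarrow>\<^sub>M (lborel :: 'a measure)" for i by simp
  have d: "distr lborel lborel (\<lambda>z. z + y i) = (lborel :: 'a measure)" for i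
    using lborel_distr_plus[of "y i"] by (simp add: add.commute cong: distr_cong)
  have m: "(\<lambda>v. \<lambda>i\<in>I. v i + y i) \<in> PiM I (\<lambda>_. lborel) \<rightarrow>\<^sub>M PiM I (\<lambda>_. lborel)"
    by (rule measurable_restrict) simp
  have "(\<integral>\<^sup>+v. f v \<partial>PiM I (\<lambda>_. lborel))
      = (\<integral>\<^sup>+v. f v \<partial>distr (PiM I (\<lambda>_. lborel)) (PiM I (\<lambda>_. lborel)) (\<lambda>v. \<lambda>i\<in>I. v i + y i))"
    using distr_PiM_sigma_finite[OF fin product_sigma_finite_lborel product_sigma_finite_lborel g d] by simp
  also have "\<dots> = (\<integral>\<^sup>+v. f (\<lambda>i\<in>I. v i + y i) \<partial>PiM I (\<lambda>_. lborel))"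
    by (subst nn_integral_distr[OF m]) (use f in simp_all)
  finally show ?thesis by simp
qed

section \<open>Unitary matrices and Gram-Schmidt orthogonalization\<close>

definition hdot :: "nat \<Rightarrow> (nat \<Rightarrow> complex) \<Rightarrow> (nat \<Rightarrow> complex) \<Rightarrow> complex" where
  "hdot n u v = (\<Sum>i\<in>{1..n}. u i * cnj (v i))"

definition hnorm :: "nat \<Rightarrow> (nat \<Rightarrow> complex) \<Rightarrow> real" where
  "hnorm n u = sqrt (\<Sum>i\<in>{1..n}. (cmod (u i))\<^sup>2)"

text \<open>
  Entries of vectors are numbered from 1, rows and columns of matrices from 0.
\<close>

definition row_mult :: "nat \<Rightarrow> complex mat \<Rightarrow> (nat \<Rightarrow> complex) \<Rightarrow> nat \<Rightarrow> complex" where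
  "row_mult n U v = (\<lambda>j\<in>{1..n}. \<Sum>i\<in>{1..n}. v i * U $$ (i - 1, j - 1))"

lemma mat_adjoint_carrier [simp]: "A \<in> carrier_mat r c \<Longrightarrow> mat_adjoint A \<in> carrier_mat c r"
  by (auto simp: mat_adjoint_def)

lemma mat_adjoint_index:
  "A \<in> carrier_mat r c \<Longrightarrow> i < c \<Longrightarrow> j < r \<Longrightarrow> mat_adjoint A $$ (i, j) = cnj (A $$ (j, i))"
  for A :: "complex mat"
  by (auto simp: mat_adjoint_def mat_of_rows_def)

lemma mat_mult_index:
  assumes "A \<in> carrier_mat r m" "B \<in> carrier_mat m c" "i < r" "j < c"
  shows "(A * B) $$ (i, j) = (\<Sum>k\<in>{0..<m}. A $$ (i, k) * B $$ (k, j))"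
  using assms by (simp add: scalar_prod_def)

lemma mat_adjoint_mult:
  fixes A B :: "complex mat"
  assumes A: "A \<in> carrier_mat r m" and B: "B \<in> carrier_mat m c"
  shows "mat_adjoint (A * B) = mat_adjoint B * mat_adjoint A"
proof (rule eq_matI)
  have d: "mat_adjoint B * mat_adjoint A \<in> carrier_mat c r" using A B by (intro mult_carrier_mat[of _ _ m]) auto
  show "dim_row (mat_adjoint (A * B)) = dim_row (mat_adjoint B * mat_adjoint A)"
    "dim_col (mat_adjoint (A * B)) = dim_col (mat_adjoint B * mat_adjoint A)"
    using carrier_matD[OF d] carrier_matD[OF mat_adjoint_carrier[OF mult_carrier_mat[OF A B]]] by simp_all
  fix i j assume "i < dim_row (mat_adjoint B * mat_adjoint A)" "j < dim_col (mat_adjoint B * mat_adjoint A)"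
  then have ij: "i < c" "j < r" using d by auto
  have "mat_adjoint (A * B) $$ (i, j) = cnj (\<Sum>k\<in>{0..<m}. A $$ (j, k) * B $$ (k, i))"
    by (subst mat_adjoint_index[OF mult_carrier_mat[OF A B] ij]) (simp add: mat_mult_index[OF A B ij(2,1)] del: index_mult_mat)
  also have "\<dots> = (\<Sum>k\<in>{0..<m}. mat_adjoint B $$ (i, k) * mat_adjoint A $$ (k, j))"
    using ij by (simp add: mat_adjoint_index[OF A] mat_adjoint_index[OF B] mult.commute)
  also have "\<dots> = (mat_adjoint B * mat_adjoint A) $$ (i, j)"
    by (rule mat_mult_index[symmetric]) (use A B ij in auto)
  finally show "mat_adjoint (A * B) $$ (i, j) = (mat_adjoint B * mat_adjoint A) $$ (i, j)" .
qed

lemma mat_adjoint_adjoint: "A \<in> carrier_mat r c \<Longrightarrow> mat_adjoint (mat_adjoint A) = A" for A :: "complex mat"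
proof (rule eq_matI)
  assume A: "A \<in> carrier_mat r c"
  note A' = mat_adjoint_carrier[OF A] and A'' = mat_adjoint_carrier[OF mat_adjoint_carrier[OF A]]
  show "dim_row (mat_adjoint (mat_adjoint A)) = dim_row A" "dim_col (mat_adjoint (mat_adjoint A)) = dim_col A"
    using carrier_matD[OF A] carrier_matD[OF A''] by simp_all
  fix i j assume "i < dim_row A" "j < dim_col A"
  then have "i < r" "j < c" using A by auto
  then show "mat_adjoint (mat_adjoint A) $$ (i, j) = A $$ (i, j)"
    by (simp add: mat_adjoint_index[OF A'] mat_adjoint_index[OF A])
qed

lemma unitary_groupD:
  assumes "U \<in> unitary_group n"
  shows "U \<in> carrier_mat n n" "U * mat_adjoint U = 1\<^sub>m n" "mat_adjoint U * U = 1\<^sub>m n" "mat_adjoint U \<in> unitary_group n"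
  using assms mat_adjoint_carrier[of U n n] mat_adjoint_adjoint[of U n n]
  by (auto simp: unitary_group_def)

lemma conjugation_assoc:
  fixes V D W :: "complex mat"
  assumes "U \<in> carrier_mat n n" "V \<in> carrier_mat n n" "D \<in> carrier_mat n n" "V' \<in> carrier_mat n n" "U' \<in> carrier_mat n n"
  shows "U * (V * D * V') * U' = (U * V) * D * (V' * U')"
  using assms by (simp add: assoc_mult_mat[of _ n n _ n _ n])

lemma unitary_conjugation_cancel:
  assumes V: "V \<in> unitary_group n" and D: "D \<in> carrier_mat n n"
  shows "mat_adjoint V * (V * D * mat_adjoint V) * V = D"
  using conjugation_assoc[of "mat_adjoint V" n V D "mat_adjoint V" V] unitary_groupD[OF V] D by simp

lemma mat_adjoint_conjugation:
  fixes U H :: "complex mat"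
  assumes U: "U \<in> carrier_mat n n" and H: "H \<in> carrier_mat n n"
  shows "mat_adjoint (U * H * mat_adjoint U) = U * mat_adjoint H * mat_adjoint U"
  using U H mat_adjoint_mult[of "U * H" n n "mat_adjoint U" n] mat_adjoint_mult[of U n n H n]
  by (simp add: mat_adjoint_adjoint[of U n n] assoc_mult_mat[of _ n n _ n _ n])

lemma unitary_conjugation_comp:
  fixes U V D :: "complex mat"
  assumes U: "U \<in> carrier_mat n n" and V: "V \<in> carrier_mat n n" and D: "D \<in> carrier_mat n n"
  shows "U * (V * D * mat_adjoint V) * mat_adjoint U = (U * V) * D * mat_adjoint (U * V)"
  using conjugation_assoc[of U n V D "mat_adjoint V" "mat_adjoint U"] U V D by (simp add: mat_adjoint_mult[OF U V])

lemma sum_shift_index: "(\<Sum>i\<in>{1..n}. f (i - 1)) = (\<Sum>i\<in>{0..<n}. f i)" for f :: "nat \<Rightarrow> 'a::comm_monoid_add"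
  by (rule sum.reindex_bij_witness[of _ Suc "\<lambda>i. i - 1"]) auto

lemma row_mult_extensional [simp]: "row_mult n U v \<in> extensional {1..n}"
  by (simp add: row_mult_def)

lemma hdot_row_mult:
  assumes U: "U \<in> unitary_group n"
  shows "hdot n (row_mult n U u) (row_mult n U v) = hdot n u v"
proof -
  note U' = unitary_groupD[OF U]
  have orth: "(\<Sum>j\<in>{1..n}. U $$ (i - 1, j - 1) * cnj (U $$ (k - 1, j - 1))) = (if i = k then 1 else 0)"
    if ik: "i \<in> {1..n}" "k \<in> {1..n}" for i k
  proof -
    have b: "i - 1 < n" "k - 1 < n" using ik by auto
    have "(\<Sum>j\<in>{1..n}. U $$ (i - 1, j - 1) * cnj (U $$ (k - 1, j - 1)))
        = (\<Sum>j\<in>{0..<n}. U $$ (i - 1, j) * mat_adjoint U $$ (j, k - 1))"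
      unfolding sum_shift_index[of "\<lambda>j. U $$ (i - 1, j) * cnj (U $$ (k - 1, j))"]
      using b by (intro sum.cong refl) (simp add: mat_adjoint_index[OF U'(1)])
    also have "\<dots> = (U * mat_adjoint U) $$ (i - 1, k - 1)"
      by (rule mat_mult_index[symmetric]) (use U' b in auto)
    also have "\<dots> = (if i = k then 1 else 0)"
      unfolding U'(2) using b ik by auto
    finally show ?thesis .
  qed
  have "hdot n (row_mult n U u) (row_mult n U v)
      = (\<Sum>j\<in>{1..n}. \<Sum>i\<in>{1..n}. \<Sum>k\<in>{1..n}. u i * cnj (v k) * (U $$ (i - 1, j - 1) * cnj (U $$ (k - 1, j - 1))))"
    unfolding hdot_def row_mult_def
    by (intro sum.cong refl) (simp add: sum_product mult_ac)
  also have "\<dots> = (\<Sum>i\<in>{1..n}. \<Sum>k\<in>{1..n}. u i * cnj (v k) * (\<Sum>j\<in>{1..n}. U $$ (i - 1, j - 1) * cnj (U $$ (k - 1, j - 1))))"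
    unfolding sum_distrib_left
    by (rule trans[OF sum.swap]) (intro sum.cong refl sum.swap)
  also have "\<dots> = (\<Sum>i\<in>{1..n}. \<Sum>k\<in>{1..n}. if i = k then u i * cnj (v k) else 0)"
  proof (intro sum.cong refl)
    fix i k assume ik: "i \<in> {1..n}" "k \<in> {1..n}"
    show "u i * cnj (v k) * (\<Sum>j\<in>{1..n}. U $$ (i - 1, j - 1) * cnj (U $$ (k - 1, j - 1))) = (if i = k then u i * cnj (v k) else 0)"
      unfolding orth[OF ik] by simp
  qed
  also have "\<dots> = hdot n u v" unfolding hdot_def by simp
  finally show ?thesis .
qed

lemma row_mult_adjoint:
  assumes U: "U \<in> unitary_group n" and v: "v \<in> extensional {1..n}"
  shows "row_mult n U (row_mult n (mat_adjoint U) v) = v"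
proof (rule extensionalityI)
  note U' = unitary_groupD[OF U]
  fix j assume j: "j \<in> {1..n}"
  have "row_mult n U (row_mult n (mat_adjoint U) v) j
      = (\<Sum>i\<in>{1..n}. \<Sum>k\<in>{1..n}. v k * (mat_adjoint U $$ (k - 1, i - 1) * U $$ (i - 1, j - 1)))"
    using j unfolding row_mult_def by (simp add: sum_distrib_right mult.assoc)
  also have "\<dots> = (\<Sum>k\<in>{1..n}. v k * (\<Sum>i\<in>{1..n}. mat_adjoint U $$ (k - 1, i - 1) * U $$ (i - 1, j - 1)))"
    unfolding sum_distrib_left by (rule sum.swap)
  also have "\<dots> = (\<Sum>k\<in>{1..n}. if k = j then v k else 0)"
  proof (rule sum.cong[OF refl])
    fix k assume k: "k \<in> {1..n}"
    have b: "k - 1 < n" "j - 1 < n" using j k by auto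
    have "(\<Sum>i\<in>{1..n}. mat_adjoint U $$ (k - 1, i - 1) * U $$ (i - 1, j - 1)) = (mat_adjoint U * U) $$ (k - 1, j - 1)"
      unfolding sum_shift_index[of "\<lambda>i. mat_adjoint U $$ (k - 1, i) * U $$ (i, j - 1)"]
      by (rule mat_mult_index[symmetric]) (use U' b in auto)
    also have "\<dots> = (if k = j then 1 else 0)" unfolding U'(3) using b j k by auto
    finally show "v k * (\<Sum>i\<in>{1..n}. mat_adjoint U $$ (k - 1, i - 1) * U $$ (i - 1, j - 1)) = (if k = j then v k else 0)"
      by simp
  qed
  also have "\<dots> = v j" using j by simp
  finally show "row_mult n U (row_mult n (mat_adjoint U) v) j = v j" .
qed (rule row_mult_extensional, rule v)

lemma hdot_self: "hdot n u u = complex_of_real ((hnorm n u)\<^sup>2)"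
proof -
  have "0 \<le> (\<Sum>i\<in>{1..n}. (cmod (u i))\<^sup>2)" by (intro sum_nonneg) auto
  then show ?thesis
    by (simp add: hdot_def hnorm_def complex_norm_square[symmetric] del: of_real_power)
qed

lemma hnorm_nonneg [simp]: "0 \<le> hnorm n u"
  unfolding hnorm_def by (auto intro: sum_nonneg)

lemma hnorm_eq_0_iff: "hnorm n u = 0 \<longleftrightarrow> (\<forall>i\<in>{1..n}. u i = 0)"
  unfolding hnorm_def by (subst real_sqrt_eq_0_iff, subst sum_nonneg_eq_0_iff) auto

lemma hnorm_row_mult: "U \<in> unitary_group n \<Longrightarrow> hnorm n (row_mult n U u) = hnorm n u"
  using hdot_row_mult[of U n u u] unfolding hdot_self
  by (simp add: power2_eq_iff_nonneg flip: of_real_power)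

lemma hdot_linear:
  "hdot n (\<lambda>i\<in>{1..n}. u i - w i) v = hdot n u v - hdot n w v"
  "hdot n (\<lambda>i\<in>{1..n}. c * u i) v = c * hdot n u v"
  "hdot n (\<lambda>i\<in>{1..n}. u i / c) v = hdot n u v / c"
  by (simp_all add: hdot_def sum_subtractf sum_distrib_left sum_divide_distrib left_diff_distrib mult.assoc)

lemma hdot_cnj: "hdot n v u = cnj (hdot n u v)"
  by (simp add: hdot_def mult.commute)

text \<open>
  The \<open>k\<close>-th Gram-Schmidt vector of the sequence \<open>G 0, G 1, \<dots>\<close>. It is 0 if \<open>G k\<close> lies in the span of its
  predecessors, since \<open>z / 0 = 0\<close>.
\<close>

fun gs :: "nat \<Rightarrow> (nat \<Rightarrow> nat \<Rightarrow> complex) \<Rightarrow> nat \<Rightarrow> nat \<Rightarrow> complex" where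
  "gs n G k = (let r = (\<lambda>j\<in>{1..n}. G k j - (\<Sum>l\<in>{..<k}. hdot n (G k) (gs n G l) * gs n G l j))
     in (\<lambda>j\<in>{1..n}. r j / complex_of_real (hnorm n r)))"
declare gs.simps [simp del]

definition gs_residual :: "nat \<Rightarrow> (nat \<Rightarrow> nat \<Rightarrow> complex) \<Rightarrow> nat \<Rightarrow> nat \<Rightarrow> complex" where
  "gs_residual n G k = (\<lambda>j\<in>{1..n}. G k j - (\<Sum>l\<in>{..<k}. hdot n (G k) (gs n G l) * gs n G l j))"

lemma gs_eq: "gs n G k = (\<lambda>j\<in>{1..n}. gs_residual n G k j / complex_of_real (hnorm n (gs_residual n G k)))"
  by (subst gs.simps) (simp add: gs_residual_def Let_def)

lemma gs_zero: "hnorm n (gs_residual n G k) = 0 \<Longrightarrow> j \<in> {1..n} \<Longrightarrow> gs n G k j = 0"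
  by (simp add: gs_eq)

lemma hdot_residual: "hdot n (gs_residual n G k) v = hdot n (G k) v - (\<Sum>l\<in>{..<k}. hdot n (G k) (gs n G l) * hdot n (gs n G l) v)"
proof -
  have "hdot n (gs_residual n G k) v = hdot n (G k) v - (\<Sum>j\<in>{1..n}. \<Sum>l\<in>{..<k}. hdot n (G k) (gs n G l) * (gs n G l j * cnj (v j)))"
    by (simp add: hdot_def[of n _ v] gs_residual_def left_diff_distrib sum_subtractf sum_distrib_right mult.assoc)
  also have "(\<Sum>j\<in>{1..n}. \<Sum>l\<in>{..<k}. hdot n (G k) (gs n G l) * (gs n G l j * cnj (v j)))
      = (\<Sum>l\<in>{..<k}. hdot n (G k) (gs n G l) * hdot n (gs n G l) v)"
    unfolding hdot_def[of n _ v] sum_distrib_left by (rule sum.swap)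
  finally show ?thesis .
qed

lemma hdot_gs: "hdot n (gs n G k) v = hdot n (gs_residual n G k) v / complex_of_real (hnorm n (gs_residual n G k))"
  unfolding gs_eq hdot_linear ..

lemma hdot_gs_self: "hdot n (gs n G k) (gs n G k) = (if hnorm n (gs_residual n G k) = 0 then 0 else 1)"
proof (cases "hnorm n (gs_residual n G k) = 0")
  case False
  let ?r = "gs_residual n G k"
  have "hdot n (gs n G k) (gs n G k) = cnj (hdot n (gs n G k) ?r) / complex_of_real (hnorm n ?r)"
    unfolding hdot_gs[of n G k "gs n G k"] by (simp only: hdot_cnj[of n ?r "gs n G k"])
  also have "\<dots> = cnj (hdot n ?r ?r / complex_of_real (hnorm n ?r)) / complex_of_real (hnorm n ?r)"
    by (simp only: hdot_gs[of n G k ?r])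
  finally show ?thesis using False unfolding hdot_self by (simp add: power2_eq_square)
next
  case True
  then show ?thesis by (subst hdot_gs) simp
qed

lemma hdot_gs_less: "l < k \<Longrightarrow> hdot n (gs n G k) (gs n G l) = 0"
proof (induction k arbitrary: l rule: less_induct)
  case (less k)
  have "(\<Sum>l'\<in>{..<k}. hdot n (G k) (gs n G l') * hdot n (gs n G l') (gs n G l))
      = (\<Sum>l'\<in>{..<k}. if l' = l then hdot n (G k) (gs n G l) * hdot n (gs n G l) (gs n G l) else 0)"
  proof (rule sum.cong[OF refl])
    fix l' assume l': "l' \<in> {..<k}"
    have "hdot n (gs n G l') (gs n G l) = 0" if "l' \<noteq> l"
    proof (cases "l < l'")
      case True then show ?thesis using less.IH[of l' l] l' by simp
    next
      case False
      then have "hdot n (gs n G l) (gs n G l') = 0" using less.IH[of l l'] less.prems that by simp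
      then show ?thesis by (subst hdot_cnj) simp
    qed
    then show "hdot n (G k) (gs n G l') * hdot n (gs n G l') (gs n G l) = (if l' = l then hdot n (G k) (gs n G l) * hdot n (gs n G l) (gs n G l) else 0)"
      by simp
  qed
  also have "\<dots> = hdot n (G k) (gs n G l) * hdot n (gs n G l) (gs n G l)"
    using less.prems by simp
  also have "\<dots> = hdot n (G k) (gs n G l)"
  proof (cases "hnorm n (gs_residual n G l) = 0")
    case True
    then have "hdot n (G k) (gs n G l) = 0"
      using gs_zero[OF True] by (simp add: hdot_def)
    then show ?thesis by simp
  qed (simp add: hdot_gs_self)
  finally have s: "(\<Sum>l'\<in>{..<k}. hdot n (G k) (gs n G l') * hdot n (gs n G l') (gs n G l)) = hdot n (G k) (gs n G l)" .
  show ?case unfolding hdot_gs[of n G k "gs n G l"] hdot_residual[of n G k "gs n G l"] s by simp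
qed

lemma gs_expansion:
  assumes "j \<in> {1..n}"
  shows "G k j = complex_of_real (hnorm n (gs_residual n G k)) * gs n G k j + (\<Sum>l\<in>{..<k}. hdot n (G k) (gs n G l) * gs n G l j)"
proof -
  have "complex_of_real (hnorm n (gs_residual n G k)) * gs n G k j = gs_residual n G k j"
    using assms hnorm_eq_0_iff[of n "gs_residual n G k"] by (auto simp: gs_eq)
  then show ?thesis using assms by (simp add: gs_residual_def)
qed

lemma gs_cong: "(\<And>l j. l \<le> k \<Longrightarrow> j \<in> {1..n} \<Longrightarrow> G l j = G' l j) \<Longrightarrow> gs n G k = gs n G' k"
proof (induction k rule: less_induct)
  case (less k)
  have q: "gs n G l = gs n G' l" if "l < k" for l using less that by simp
  have "hdot n (G k) v = hdot n (G' k) v" for v using less.prems by (simp add: hdot_def)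
  then have "gs_residual n G k = gs_residual n G' k"
    unfolding gs_residual_def using q less.prems by (intro restrict_ext) simp
  then show ?case by (simp add: gs_eq)
qed

text \<open>
  Gram-Schmidt orthogonalization uses linear combinations with coefficients given by inner products, which a
  unitary matrix preserves.
\<close>

lemma gs_row_mult:
  assumes U: "U \<in> unitary_group n"
  shows "gs n (\<lambda>k. row_mult n U (G k)) k = row_mult n U (gs n G k)"
    and "hnorm n (gs_residual n (\<lambda>k. row_mult n U (G k)) k) = hnorm n (gs_residual n G k)"
proof -
  have res: "gs_residual n (\<lambda>k. row_mult n U (G k)) k = row_mult n U (gs_residual n G k)"
    if "\<And>l. l < k \<Longrightarrow> gs n (\<lambda>k. row_mult n U (G k)) l = row_mult n U (gs n G l)" for k
  proof (rule extensionalityI)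
    fix j assume j: "j \<in> {1..n}"
    have "(\<Sum>l\<in>{..<k}. hdot n (G k) (gs n G l) * row_mult n U (gs n G l) j)
        = (\<Sum>i\<in>{1..n}. (\<Sum>l\<in>{..<k}. hdot n (G k) (gs n G l) * gs n G l i) * U $$ (i - 1, j - 1))"
      using j unfolding row_mult_def
      by (simp add: sum_distrib_left sum_distrib_right mult.assoc) (rule sum.swap)
    then show "gs_residual n (\<lambda>k. row_mult n U (G k)) k j = row_mult n U (gs_residual n G k) j"
      using j that by (simp add: gs_residual_def hdot_row_mult[OF U]) 
        (simp add: row_mult_def left_diff_distrib sum_subtractf)
  qed (simp add: gs_residual_def, rule row_mult_extensional)
  have norm: "gs n (\<lambda>k. row_mult n U (G k)) k = row_mult n U (gs n G k)"
    if "gs_residual n (\<lambda>k. row_mult n U (G k)) k = row_mult n U (gs_residual n G k)" for k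
    unfolding gs_eq that hnorm_row_mult[OF U]
    by (rule extensionalityI) (auto simp: row_mult_def sum_divide_distrib)
  have main: "gs n (\<lambda>k. row_mult n U (G k)) k = row_mult n U (gs n G k)" for k
    by (induction k rule: less_induct) (blast intro: norm res)
  show "gs n (\<lambda>k. row_mult n U (G k)) k = row_mult n U (gs n G k)" by (rule main)
  show "hnorm n (gs_residual n (\<lambda>k. row_mult n U (G k)) k) = hnorm n (gs_residual n G k)"
    using res[OF main] hnorm_row_mult[OF U] by simp
qed

text \<open>
  The Gram-Schmidt vectors are the rows from the bottom to the top. So the last row is a multiple of
  \<open>G 0\<close>, and a matrix with the rows \<open>G (n - 1), \<dots>, G 0\<close> is an upper triangular matrix times \<open>gs_mat n G\<close>.
\<close>

definition gs_mat :: "nat \<Rightarrow> (nat \<Rightarrow> nat \<Rightarrow> complex) \<Rightarrow> complex mat" where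
  "gs_mat n G = mat n n (\<lambda>(i, j). gs n G (n - 1 - i) (Suc j))"

lemma gs_mat_carrier [simp]: "gs_mat n G \<in> carrier_mat n n"
  by (simp add: gs_mat_def)

lemma gs_mat_unitary:
  assumes "\<And>k. k < n \<Longrightarrow> hnorm n (gs_residual n G k) \<noteq> 0"
  shows "gs_mat n G \<in> unitary_group n"
proof -
  have c: "mat_adjoint (gs_mat n G) \<in> carrier_mat n n" by simp
  have "gs_mat n G * mat_adjoint (gs_mat n G) = 1\<^sub>m n"
  proof (rule eq_matI)
    fix i j assume "i < dim_row (1\<^sub>m n :: complex mat)" "j < dim_col (1\<^sub>m n :: complex mat)"
    then have ij: "i < n" "j < n" by auto
    have "(gs_mat n G * mat_adjoint (gs_mat n G)) $$ (i, j)
        = (\<Sum>k\<in>{0..<n}. gs_mat n G $$ (i, k) * mat_adjoint (gs_mat n G) $$ (k, j))"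
      by (rule mat_mult_index) (use ij in auto)
    also have "\<dots> = (\<Sum>k\<in>{0..<n}. gs n G (n - 1 - i) (Suc k) * cnj (gs n G (n - 1 - j) (Suc k)))"
      using ij by (intro sum.cong refl) (simp add: mat_adjoint_index[OF gs_mat_carrier], simp add: gs_mat_def)
    also have "\<dots> = (\<Sum>k\<in>{1..n}. gs n G (n - 1 - i) k * cnj (gs n G (n - 1 - j) k))"
      by (rule sum.reindex_bij_witness[of _ "\<lambda>i. i - 1" Suc]) auto
    also have "\<dots> = hdot n (gs n G (n - 1 - i)) (gs n G (n - 1 - j))"
      by (simp add: hdot_def)
    also have "\<dots> = (if i = j then 1 else 0)"
    proof (cases "i = j")
      case True then show ?thesis using assms[of "n - 1 - i"] ij by (simp add: hdot_gs_self)
    next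
      case False
      then consider "n - 1 - j < n - 1 - i" | "n - 1 - i < n - 1 - j" using ij by linarith
      then show ?thesis
      proof cases
        case 1 then show ?thesis using False by (simp add: hdot_gs_less)
      next
        case 2 then show ?thesis using False by (subst hdot_cnj) (simp add: hdot_gs_less)
      qed
    qed
    finally show "(gs_mat n G * mat_adjoint (gs_mat n G)) $$ (i, j) = 1\<^sub>m n $$ (i, j)" using ij by simp
  qed (use carrier_matD[OF c] carrier_matD[OF gs_mat_carrier[of n G]] in simp_all)
  then show ?thesis
    using mat_mult_left_right_inverse[OF gs_mat_carrier c] c by (simp add: unitary_group_def)
qed

lemma gs_mat_row_mult:
  assumes U: "U \<in> unitary_group n"
  shows "gs_mat n (\<lambda>k. row_mult n U (G k)) = gs_mat n G * U"
proof (rule eq_matI)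
  note U' = unitary_groupD[OF U]
  show "dim_row (gs_mat n (\<lambda>k. row_mult n U (G k))) = dim_row (gs_mat n G * U)"
    "dim_col (gs_mat n (\<lambda>k. row_mult n U (G k))) = dim_col (gs_mat n G * U)"
    using U' by (auto simp: gs_mat_def)
  fix i j assume "i < dim_row (gs_mat n G * U)" "j < dim_col (gs_mat n G * U)"
  then have ij: "i < n" "j < n" using U' by (auto simp: gs_mat_def)
  have "gs_mat n (\<lambda>k. row_mult n U (G k)) $$ (i, j) = (\<Sum>k\<in>{1..n}. gs n G (n - 1 - i) k * U $$ (k - 1, j))"
    using ij by (simp add: gs_mat_def gs_row_mult(1)[OF U]) (simp add: row_mult_def)
  also have "\<dots> = (\<Sum>k\<in>{0..<n}. gs_mat n G $$ (i, k) * U $$ (k, j))"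
    by (rule sum.reindex_bij_witness[of _ Suc "\<lambda>i. i - 1"]) (use ij in \<open>auto simp: gs_mat_def\<close>)
  also have "\<dots> = (gs_mat n G * U) $$ (i, j)"
    by (rule mat_mult_index[symmetric]) (use ij U' in auto)
  finally show "gs_mat n (\<lambda>k. row_mult n U (G k)) $$ (i, j) = (gs_mat n G * U) $$ (i, j)" .
qed

section \<open>Unitary invariance of Gaussian vectors\<close>

lemma measurable_row_mult:
  "row_mult n U \<in> PiM {1..n} (\<lambda>_. lborel) \<rightarrow>\<^sub>M PiM {1..n} (\<lambda>_. lborel)"
  unfolding row_mult_def[abs_def] by (rule measurable_restrict) auto

lemma gauss_vec_density_hnorm:
  "gauss_vec_density n v = ennreal (exp (- (hnorm n v)\<^sup>2) / pi ^ n)"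
  unfolding gauss_vec_density_eq hnorm_def by (subst real_sqrt_pow2) (auto intro: sum_nonneg)

lemma borel_measurable_gauss_vec_density [measurable]:
  "gauss_vec_density n \<in> borel_measurable (PiM {1..n} (\<lambda>_. lborel))"
  unfolding gauss_vec_density_eq[abs_def] by measurable

lemma prob_space_PiM_gauss: "prob_space (PiM I (\<lambda>_. gauss))"
  by (rule prob_space_PiM) (rule prob_space_gauss)

lemma nn_integral_gauss_vec_density: "(\<integral>\<^sup>+v. gauss_vec_density n v \<partial>PiM {1..n} (\<lambda>_. lborel)) = 1"
proof -
  interpret P: prob_space "PiM {1..n} (\<lambda>_. gauss)" by (rule prob_space_PiM_gauss)
  have "emeasure (PiM {1..n} (\<lambda>_. gauss)) (space (PiM {1..n} (\<lambda>_. gauss))) = 1"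
    by (rule P.emeasure_space_1)
  moreover have "emeasure (PiM {1..n} (\<lambda>_. gauss)) (space (PiM {1..n} (\<lambda>_. gauss)))
     = (\<integral>\<^sup>+v. gauss_vec_density n v * indicator (space (PiM {1..n} (\<lambda>_. lborel))) v \<partial>PiM {1..n} (\<lambda>_. lborel))"
    unfolding PiM_gauss space_density by (rule emeasure_density[OF borel_measurable_gauss_vec_density sets.top])
  moreover have "\<dots> = (\<integral>\<^sup>+v. gauss_vec_density n v \<partial>PiM {1..n} (\<lambda>_. lborel))"
    by (rule nn_integral_cong) simp
  ultimately show ?thesis by simp
qed

text \<open>
  Unitary invariance of Lebesgue measure on \<open>\<complex>\<^sup>n\<close>, by the argument for the uniqueness of Haar measure: the
  integrand is multiplied by \<open>1 = \<integral> g (y - T v) dy\<close> with a unitarily invariant probability density \<open>g\<close>,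
  the integrals are exchanged, and \<open>v\<close> and then \<open>y\<close> are translated.
\<close>

lemma nn_integral_row_mult:
  assumes U: "U \<in> unitary_group n" and f [measurable]: "f \<in> borel_measurable (PiM {1..n} (\<lambda>_. lborel))"
  shows "(\<integral>\<^sup>+v. f (row_mult n U v) \<partial>PiM {1..n} (\<lambda>_. lborel)) = (\<integral>\<^sup>+v. f v \<partial>PiM {1..n} (\<lambda>_. lborel))"
proof -
  define L where "L = PiM {1..n} (\<lambda>_. lborel :: complex measure)"
  define T where "T = row_mult n U"
  define g where "g = gauss_vec_density n"
  define shift where "shift v w = (\<lambda>i\<in>{1..n}. v i + w i)" for v w :: "nat \<Rightarrow> complex"
  define neg where "neg v = (\<lambda>i\<in>{1..n}. - v i)" for v :: "nat \<Rightarrow> complex"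
  interpret L: sigma_finite_measure L unfolding L_def by (rule sigma_finite_PiM_lborel) simp
  interpret LL: pair_sigma_finite L L ..
  have [measurable]: "T \<in> L \<rightarrow>\<^sub>M L" unfolding T_def L_def by (rule measurable_row_mult)
  have [measurable]: "f \<in> borel_measurable L" "g \<in> borel_measurable L" unfolding L_def g_def by measurable
  have [measurable]: "(\<lambda>p. shift (fst p) (snd p)) \<in> L \<Otimes>\<^sub>M L \<rightarrow>\<^sub>M L" "neg \<in> L \<rightarrow>\<^sub>M L"
    unfolding shift_def neg_def[abs_def] L_def by (rule measurable_restrict; simp)+
  have [measurable]: "(\<lambda>x. shift (h x) (k x)) \<in> M \<rightarrow>\<^sub>M L" if [measurable]: "h \<in> M \<rightarrow>\<^sub>M L" "k \<in> M \<rightarrow>\<^sub>M L" for h k and M :: "'x measure"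
  proof -
    have "(\<lambda>x. (\<lambda>p. shift (fst p) (snd p)) (h x, k x)) \<in> M \<rightarrow>\<^sub>M L" by measurable
    then show ?thesis by simp
  qed
  have trans: "(\<integral>\<^sup>+v. h (shift v w) \<partial>L) = (\<integral>\<^sup>+v. h v \<partial>L)" if "h \<in> borel_measurable L" for h w
    using nn_integral_PiM_lborel_translate[of "{1..n}" h w] that unfolding L_def shift_def by simp
  have g1: "(\<integral>\<^sup>+v. g v \<partial>L) = 1" unfolding g_def L_def by (rule nn_integral_gauss_vec_density)
  have sp: "v \<in> extensional {1..n}" if "v \<in> space L" for v
    using that by (auto simp: L_def space_PiM PiE_def)
  have "(\<integral>\<^sup>+v. f (T v) \<partial>L) = (\<integral>\<^sup>+v. \<integral>\<^sup>+y. f (T v) * g (shift y (neg (T v))) \<partial>L \<partial>L)"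
    by (intro nn_integral_cong) (subst nn_integral_cmult; simp add: trans g1)
  also have "\<dots> = (\<integral>\<^sup>+y. \<integral>\<^sup>+v. f (T v) * g (shift y (neg (T v))) \<partial>L \<partial>L)"
    by (rule LL.Fubini') measurable
  also have "\<dots> = (\<integral>\<^sup>+y. \<integral>\<^sup>+v. f (shift y (T v)) * g v \<partial>L \<partial>L)"
  proof (rule nn_integral_cong)
    fix y assume y: "y \<in> space L"
    define w where "w = row_mult n (mat_adjoint U) y"
    have Tw: "T w = y" unfolding T_def w_def by (rule row_mult_adjoint[OF U sp[OF y]])
    have Ts: "T (shift v w) = shift y (T v)" for v
    proof -
      have "T (shift v w) = shift (T w) (T v)"
        by (auto simp: T_def shift_def row_mult_def fun_eq_iff sum.distrib distrib_right)
      then show ?thesis by (simp only: Tw)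
    qed
    have gs: "g (shift y (neg (shift y (T v)))) = g v" for v
    proof -
      have "hnorm n (shift y (neg (shift y (T v)))) = hnorm n (T v)"
        unfolding hnorm_def shift_def neg_def by (intro arg_cong[where f=sqrt] sum.cong) auto
      also have "\<dots> = hnorm n v" unfolding T_def by (rule hnorm_row_mult[OF U])
      finally show ?thesis unfolding g_def gauss_vec_density_hnorm by simp
    qed
    have "(\<integral>\<^sup>+v. f (T v) * g (shift y (neg (T v))) \<partial>L)
        = (\<integral>\<^sup>+v. f (T (shift v w)) * g (shift y (neg (T (shift v w)))) \<partial>L)"
      by (rule trans[symmetric]) (use y in measurable)
    then show "(\<integral>\<^sup>+v. f (T v) * g (shift y (neg (T v))) \<partial>L) = (\<integral>\<^sup>+v. f (shift y (T v)) * g v \<partial>L)"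
      unfolding Ts gs .
  qed
  also have "\<dots> = (\<integral>\<^sup>+v. \<integral>\<^sup>+y. f (shift y (T v)) * g v \<partial>L \<partial>L)"
    by (rule LL.Fubini') measurable
  also have "\<dots> = (\<integral>\<^sup>+v. (\<integral>\<^sup>+y. f y \<partial>L) * g v \<partial>L)"
    by (intro nn_integral_cong) (subst nn_integral_multc; simp add: trans)
  also have "\<dots> = (\<integral>\<^sup>+y. f y \<partial>L)"
    by (simp add: nn_integral_cmult g1)
  finally show ?thesis unfolding T_def L_def .
qed

lemma sets_PiM_gauss: "sets (PiM I (\<lambda>_. gauss)) = sets (PiM I (\<lambda>_. lborel))"
  by (rule sets_PiM_cong) simp_all

lemma measurable_row_mult_gauss [measurable]:
  "row_mult n U \<in> PiM {1..n} (\<lambda>_. gauss) \<rightarrow>\<^sub>M PiM {1..n} (\<lambda>_. gauss)"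
  unfolding measurable_cong_sets[OF sets_PiM_gauss sets_PiM_gauss] by (rule measurable_row_mult)

lemma distr_gauss_row_mult:
  assumes U: "U \<in> unitary_group n"
  shows "distr (PiM {1..n} (\<lambda>_. gauss)) (PiM {1..n} (\<lambda>_. gauss)) (row_mult n U) = PiM {1..n} (\<lambda>_. gauss)"
proof (rule measure_eqI)
  let ?P = "PiM {1..n} (\<lambda>_. gauss)" and ?L = "PiM {1..n} (\<lambda>_. lborel :: complex measure)"
  fix A assume "A \<in> sets (distr ?P ?P (row_mult n U))"
  then have A: "A \<in> sets ?P" and A' [measurable]: "A \<in> sets ?L" by (simp_all add: sets_PiM_gauss)
  note [measurable] = measurable_row_mult[of n U]
  have "emeasure (distr ?P ?P (row_mult n U)) A = (\<integral>\<^sup>+v. indicator A v \<partial>distr ?P ?P (row_mult n U))"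
    using A by simp
  also have "\<dots> = (\<integral>\<^sup>+v. indicator A (row_mult n U v) \<partial>?P)"
    by (subst nn_integral_distr[OF measurable_row_mult_gauss]) (use A in simp_all)
  also have "\<dots> = (\<integral>\<^sup>+v. gauss_vec_density n v * indicator A (row_mult n U v) \<partial>?L)"
    unfolding PiM_gauss by (rule nn_integral_density) measurable
  also have "\<dots> = (\<integral>\<^sup>+v. gauss_vec_density n (row_mult n U v) * indicator A (row_mult n U v) \<partial>?L)"
    by (simp add: gauss_vec_density_hnorm hnorm_row_mult[OF U])
  also have "\<dots> = (\<integral>\<^sup>+v. gauss_vec_density n v * indicator A v \<partial>?L)"
    by (rule nn_integral_row_mult[OF U, of "\<lambda>v. gauss_vec_density n v * indicator A v"]) measurable
  also have "\<dots> = emeasure ?P A"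
    unfolding PiM_gauss by (rule emeasure_density[symmetric, OF borel_measurable_gauss_vec_density A'])
  finally show "emeasure (distr ?P ?P (row_mult n U)) A = emeasure ?P A" .
qed simp

definition gauss_rows :: "nat \<Rightarrow> (nat \<Rightarrow> nat \<Rightarrow> complex) measure" where
  "gauss_rows n = PiM {..<n} (\<lambda>_. PiM {1..n} (\<lambda>_. gauss))"

lemma prob_space_gauss_rows: "prob_space (gauss_rows n)"
  unfolding gauss_rows_def by (rule prob_space_PiM) (rule prob_space_PiM_gauss)

lemma gauss_null_singleton: "emeasure gauss {z} = 0"
proof -
  have "emeasure gauss {z} = (\<integral>\<^sup>+w. ennreal (exp (- (cmod w)\<^sup>2) / pi) * indicator {z} w \<partial>lborel)"
    unfolding gauss_def by (rule emeasure_density) auto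
  also have "\<dots> = 0"
  proof (subst nn_integral_0_iff_AE)
    show "AE w in lborel. ennreal (exp (- (cmod w)\<^sup>2) / pi) * indicator {z} w = 0"
      using AE_lborel_singleton[of z] by eventually_elim simp
  qed measurable
  finally show ?thesis .
qed

text \<open>
  Once the other coordinates are fixed, at most one value of \<open>v j\<close> lies on the hyperplane.
\<close>

lemma AE_gauss_hyperplane:
  fixes c :: "nat \<Rightarrow> complex"
  assumes j: "j \<in> {1..n}" and c: "c j \<noteq> 0"
  shows "AE v in PiM {1..n} (\<lambda>_. gauss). (\<Sum>i\<in>{1..n}. c i * v i) \<noteq> 0"
proof -
  interpret product_sigma_finite "\<lambda>_::nat. gauss" by (rule product_sigma_finite_gauss)
  define J where "J = {1..n} - {j}"
  have J: "{1..n} = insert j J" "finite J" "j \<notin> J" using j by (auto simp: J_def)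
  let ?Z = "{v \<in> space (PiM {1..n} (\<lambda>_. gauss)). (\<Sum>i\<in>{1..n}. c i * v i) = 0}"
  have Z: "?Z \<in> sets (PiM {1..n} (\<lambda>_. gauss))"
    unfolding sets_PiM_gauss space_PiM space_gauss by (auto intro: measurable_component_lborel) measurable
  have "emeasure (PiM {1..n} (\<lambda>_. gauss)) ?Z = (\<integral>\<^sup>+v. indicator ?Z v \<partial>PiM (insert j J) (\<lambda>_. gauss))"
    using Z J(1) by simp
  also have "\<dots> = (\<integral>\<^sup>+u. \<integral>\<^sup>+z. indicator ?Z (u(j := z)) \<partial>gauss \<partial>PiM J (\<lambda>_. gauss))"
    by (rule product_nn_integral_insert) (use J Z in auto)
  also have "\<dots> = (\<integral>\<^sup>+u. 0 \<partial>PiM J (\<lambda>_. gauss))"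
  proof (rule nn_integral_cong)
    fix u assume "u \<in> space (PiM J (\<lambda>_. gauss))"
    define z0 where "z0 = - (\<Sum>i\<in>J. c i * u i) / c j"
    have "z = z0" if "(\<Sum>i\<in>{1..n}. c i * (u(j := z)) i) = 0" for z
    proof -
      have "(\<Sum>i\<in>{1..n}. c i * (u(j := z)) i) = c j * z + (\<Sum>i\<in>J. c i * (u(j := z)) i)"
        unfolding J(1) using J by simp
      also have "(\<Sum>i\<in>J. c i * (u(j := z)) i) = (\<Sum>i\<in>J. c i * u i)"
        using J by (intro sum.cong) auto
      finally have "c j * z = - (\<Sum>i\<in>J. c i * u i)" using that by (simp add: add_eq_0_iff)
      then show ?thesis using c by (simp add: z0_def field_simps)
    qed
    then have "(\<integral>\<^sup>+z. indicator ?Z (u(j := z)) \<partial>gauss) \<le> (\<integral>\<^sup>+z. indicator {z0} z \<partial>gauss)"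
      by (intro nn_integral_mono) (auto simp: indicator_def simp del: fun_upd_apply)
    also have "\<dots> = 0" using gauss_null_singleton by simp
    finally show "(\<integral>\<^sup>+z. indicator ?Z (u(j := z)) \<partial>gauss) = 0" by simp
  qed
  finally have "emeasure (PiM {1..n} (\<lambda>_. gauss)) ?Z = 0" by simp
  then show ?thesis using Z by (subst AE_iff_measurable[OF Z]) auto
qed

section \<open>Haar measure on the unitary group\<close>

lemma measurable_gauss_rows_entry:
  assumes "k < n" "j \<in> {1..n}"
  shows "(\<lambda>\<omega>. \<omega> k j) \<in> borel_measurable (gauss_rows n)"
proof -
  have "(\<lambda>\<omega>. \<omega> k) \<in> gauss_rows n \<rightarrow>\<^sub>M PiM {1..n} (\<lambda>_. gauss)"
    unfolding gauss_rows_def by (rule measurable_component_singleton) (use assms in simp)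
  moreover have "(\<lambda>v. v j) \<in> PiM {1..n} (\<lambda>_. gauss) \<rightarrow>\<^sub>M gauss"
    by (rule measurable_component_singleton) (use assms in simp)
  ultimately have "(\<lambda>\<omega>. \<omega> k j) \<in> gauss_rows n \<rightarrow>\<^sub>M gauss" by (rule measurable_compose)
  then show ?thesis unfolding measurable_cong_sets[OF refl sets_gauss] .
qed

lemma measurable_hdot:
  assumes "\<And>j. j \<in> {1..n} \<Longrightarrow> (\<lambda>\<omega>. u \<omega> j) \<in> borel_measurable M"
    and "\<And>j. j \<in> {1..n} \<Longrightarrow> (\<lambda>\<omega>. v \<omega> j) \<in> borel_measurable M"
  shows "(\<lambda>\<omega>. hdot n (u \<omega>) (v \<omega>)) \<in> borel_measurable M"
  unfolding hdot_def
proof (rule borel_measurable_sum)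
  fix j assume "j \<in> {1..n}"
  note [measurable] = assms[OF this]
  have [measurable]: "cnj \<in> borel_measurable borel" by (intro borel_measurable_continuous_onI continuous_intros)
  show "(\<lambda>\<omega>. u \<omega> j * cnj (v \<omega> j)) \<in> borel_measurable M" by measurable
qed

lemma measurable_hnorm:
  assumes "\<And>j. j \<in> {1..n} \<Longrightarrow> (\<lambda>\<omega>. u \<omega> j) \<in> borel_measurable M"
  shows "(\<lambda>\<omega>. hnorm n (u \<omega>)) \<in> borel_measurable M"
proof -
  have [measurable]: "(\<lambda>\<omega>. \<Sum>j\<in>{1..n}. (cmod (u \<omega> j))\<^sup>2) \<in> borel_measurable M"
    by (intro borel_measurable_sum borel_measurable_power measurable_compose[OF assms borel_measurable_norm])
  show ?thesis unfolding hnorm_def by measurable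
qed

lemma measurable_gs:
  assumes "k < n"
  shows "j \<in> {1..n} \<Longrightarrow> (\<lambda>\<omega>. gs_residual n \<omega> k j) \<in> borel_measurable (gauss_rows n)"
    and "j \<in> {1..n} \<Longrightarrow> (\<lambda>\<omega>. gs n \<omega> k j) \<in> borel_measurable (gauss_rows n)"
proof -
  have "\<forall>j\<in>{1..n}. (\<lambda>\<omega>. gs_residual n \<omega> k j) \<in> borel_measurable (gauss_rows n)
      \<and> (\<lambda>\<omega>. gs n \<omega> k j) \<in> borel_measurable (gauss_rows n)"
    using assms
  proof (induction k rule: less_induct)
    case (less k)
    have q: "(\<lambda>\<omega>. gs n \<omega> l j) \<in> borel_measurable (gauss_rows n)" if "l < k" "j \<in> {1..n}" for l j
      using less.IH[OF that(1)] that less.prems by simp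
    have r: "(\<lambda>\<omega>. gs_residual n \<omega> k j) \<in> borel_measurable (gauss_rows n)" if j: "j \<in> {1..n}" for j
    proof -
      have "(\<lambda>\<omega>. \<omega> k j - (\<Sum>l\<in>{..<k}. hdot n (\<omega> k) (gs n \<omega> l) * gs n \<omega> l j)) \<in> borel_measurable (gauss_rows n)"
        by (intro borel_measurable_diff borel_measurable_sum borel_measurable_times measurable_hdot
            measurable_gauss_rows_entry q j less.prems) auto
      then show ?thesis unfolding gs_residual_def using j by simp
    qed
    have "(\<lambda>\<omega>. gs n \<omega> k j) \<in> borel_measurable (gauss_rows n)" if j: "j \<in> {1..n}" for j
    proof -
      note r[OF j, measurable]
      have [measurable]: "(\<lambda>\<omega>. hnorm n (gs_residual n \<omega> k)) \<in> borel_measurable (gauss_rows n)"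
        by (intro measurable_hnorm r)
      have "(\<lambda>\<omega>. gs_residual n \<omega> k j / complex_of_real (hnorm n (gs_residual n \<omega> k))) \<in> borel_measurable (gauss_rows n)"
        by measurable
      then show ?thesis unfolding gs_eq using j by simp
    qed
    with r show ?case by blast
  qed
  then show "j \<in> {1..n} \<Longrightarrow> (\<lambda>\<omega>. gs_residual n \<omega> k j) \<in> borel_measurable (gauss_rows n)"
    and "j \<in> {1..n} \<Longrightarrow> (\<lambda>\<omega>. gs n \<omega> k j) \<in> borel_measurable (gauss_rows n)" by auto
qed

lemma product_sigma_finite_PiM_gauss: "product_sigma_finite (\<lambda>_. PiM I (\<lambda>_. gauss))"
  by (intro product_sigma_finite.intro prob_space_imp_sigma_finite prob_space_PiM_gauss)

text \<open>
  The matrix \<open>\<Sum>l. q l (q l)\<^sup>*\<close> has trace at most \<open>k < n\<close>, so not all its diagonal entries are 1. For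
  orthonormal \<open>q l\<close> this says that some unit vector lies outside their span.
\<close>

lemma exists_coordinate_outside_span:
  fixes q :: "nat \<Rightarrow> nat \<Rightarrow> complex"
  assumes k: "k < n" and q: "\<And>l. l < k \<Longrightarrow> hdot n (q l) (q l) \<in> {0, 1}"
  obtains j where "j \<in> {1..n}" "1 - (\<Sum>l\<in>{..<k}. cnj (q l j) * q l j) \<noteq> 0"
proof -
  have "\<exists>j\<in>{1..n}. 1 - (\<Sum>l\<in>{..<k}. cnj (q l j) * q l j) \<noteq> 0"
  proof (rule ccontr)
    assume "\<not> ?thesis"
    then have *: "(\<Sum>l\<in>{..<k}. cnj (q l j) * q l j) = 1" if "j \<in> {1..n}" for j
      using that by simp
    have "complex_of_nat n = (\<Sum>j\<in>{1..n}. \<Sum>l\<in>{..<k}. cnj (q l j) * q l j)"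
      by (subst sum.cong[OF refl *]) simp_all
    also have "\<dots> = (\<Sum>l\<in>{..<k}. hdot n (q l) (q l))"
      unfolding hdot_def by (subst sum.swap) (simp add: mult.commute)
    finally have "Re (complex_of_nat n) = Re (\<Sum>l\<in>{..<k}. hdot n (q l) (q l))" by (simp only:)
    then have "real n = (\<Sum>l\<in>{..<k}. Re (hdot n (q l) (q l)))"
      by simp
    also have "\<dots> \<le> (\<Sum>l\<in>{..<k}. 1)"
      using q by (intro sum_mono) force
    finally show False using k by simp
  qed
  then show thesis using that by blast
qed

text \<open>
  For fixed other rows, the vanishing of the \<open>j\<close>-th entry of the residual is a linear equation for row \<open>k\<close>;
  for a suitable \<open>j\<close> its coefficient at \<open>j\<close> is nonzero, so that it defines a hyperplane.
\<close>

lemma AE_gs_residual: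
  assumes k: "k < n"
  shows "AE \<omega> in gauss_rows n. hnorm n (gs_residual n \<omega> k) \<noteq> 0"
proof -
  let ?P = "PiM {1..n} (\<lambda>_. gauss)"
  interpret product_sigma_finite "\<lambda>_::nat. ?P" by (rule product_sigma_finite_PiM_gauss)
  define J where "J = {..<n} - {k}"
  have J: "{..<n} = insert k J" "finite J" "k \<notin> J" using k by (auto simp: J_def)
  let ?Z = "{\<omega> \<in> space (gauss_rows n). hnorm n (gs_residual n \<omega> k) = 0}"
  have [measurable]: "(\<lambda>\<omega>. hnorm n (gs_residual n \<omega> k)) \<in> borel_measurable (gauss_rows n)"
    by (intro measurable_hnorm measurable_gs k)
  have Z: "?Z \<in> sets (gauss_rows n)" by measurable
  have "emeasure (gauss_rows n) ?Z = (\<integral>\<^sup>+\<omega>. indicator ?Z \<omega> \<partial>PiM (insert k J) (\<lambda>_. ?P))"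
    using Z J(1) unfolding gauss_rows_def by simp
  also have "\<dots> = (\<integral>\<^sup>+u. \<integral>\<^sup>+g. indicator ?Z (u(k := g)) \<partial>?P \<partial>PiM J (\<lambda>_. ?P))"
    by (rule product_nn_integral_insert) (use J Z in \<open>auto simp: gauss_rows_def\<close>)
  also have "\<dots> = (\<integral>\<^sup>+u. 0 \<partial>PiM J (\<lambda>_. ?P))"
  proof (rule nn_integral_cong)
    fix u
    define q where "q = gs n u"
    have "hdot n (q l) (q l) \<in> {0, 1}" for l by (simp add: q_def hdot_gs_self)
    then obtain j where j: "j \<in> {1..n}" and cj: "1 - (\<Sum>l\<in>{..<k}. cnj (q l j) * q l j) \<noteq> 0"
      using exists_coordinate_outside_span[OF k, of q] by blast
    \<comment> \<open>The coefficients of the \<open>j\<close>-th entry of the residual as a linear form in row \<open>k\<close>.\<close>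
    define c where "c m = (if m = j then 1 else 0) - (\<Sum>l\<in>{..<k}. cnj (q l m) * q l j)" for m
    have c: "c j \<noteq> 0" using cj by (simp add: c_def)
    have "(\<Sum>m\<in>{1..n}. c m * g m) = 0" if "u(k := g) \<in> ?Z" for g
    proof -
      have ql: "gs n (u(k := g)) l = q l" if "l < k" for l
        unfolding q_def by (rule gs_cong) (use that in auto)
      have "gs_residual n (u(k := g)) k j = 0"
        using that hnorm_eq_0_iff j by blast
      then have "g j = (\<Sum>l\<in>{..<k}. hdot n g (q l) * q l j)"
        using j by (simp add: gs_residual_def ql)
      also have "\<dots> = (\<Sum>m\<in>{1..n}. \<Sum>l\<in>{..<k}. g m * cnj (q l m) * q l j)"
        unfolding hdot_def sum_distrib_right by (rule sum.swap)
      finally have "(\<Sum>m\<in>{1..n}. \<Sum>l\<in>{..<k}. g m * cnj (q l m) * q l j) = g j" by simp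
      moreover have "(\<Sum>m\<in>{1..n}. c m * g m) = (\<Sum>m\<in>{1..n}. if m = j then g m else 0) - (\<Sum>m\<in>{1..n}. \<Sum>l\<in>{..<k}. g m * cnj (q l m) * q l j)"
        unfolding c_def sum_subtractf[symmetric]
        by (intro sum.cong refl) (simp add: left_diff_distrib right_diff_distrib sum_distrib_left sum_distrib_right mult_ac)
      ultimately show ?thesis using j by simp
    qed
    then have "AE g in ?P. u(k := g) \<notin> ?Z"
      using AE_gauss_hyperplane[of j n c, OF j c] by (auto elim!: eventually_mono)
    then show "(\<integral>\<^sup>+g. indicator ?Z (u(k := g)) \<partial>?P) = 0"
      by (subst nn_integral_cong_AE[of _ "\<lambda>_. 0"]) (auto elim!: eventually_mono simp del: fun_upd_apply)
  qed
  finally have "emeasure (gauss_rows n) ?Z = 0" by simp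
  then show ?thesis using Z by (subst AE_iff_measurable[OF Z]) auto
qed

definition mat_borel :: "nat \<Rightarrow> complex mat measure" where
  "mat_borel n = vimage_algebra (carrier_mat n n) (\<lambda>H. \<lambda>ij\<in>{..<n} \<times> {..<n}. H $$ ij)
      (PiM ({..<n} \<times> {..<n}) (\<lambda>_. borel))"

lemma space_mat_borel [simp]: "space (mat_borel n) = carrier_mat n n"
  by (simp add: mat_borel_def)

lemma space_herm_borel [simp]: "space (herm_borel n) = herm n"
  by (simp add: herm_borel_def)

lemma measurable_entry:
  assumes "i < n" "j < n"
  shows "(\<lambda>H. H $$ (i, j)) \<in> borel_measurable (vimage_algebra X (\<lambda>H. \<lambda>ij\<in>{..<n} \<times> {..<n}. H $$ ij) (PiM ({..<n} \<times> {..<n}) (\<lambda>_. borel)))"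
    (is "_ \<in> borel_measurable ?M")
proof -
  have "(\<lambda>H. \<lambda>ij\<in>{..<n} \<times> {..<n}. H $$ ij) \<in> ?M \<rightarrow>\<^sub>M PiM ({..<n} \<times> {..<n}) (\<lambda>_. borel)"
    by (rule measurable_vimage_algebra1) (auto simp: space_PiM)
  from measurable_compose[OF this measurable_component_singleton[of "(i, j)"]]
  show ?thesis using assms by simp
qed

lemma measurable_entryI:
  assumes "\<And>i j. i < n \<Longrightarrow> j < n \<Longrightarrow> (\<lambda>\<omega>. f \<omega> $$ (i, j)) \<in> borel_measurable M" and "f \<in> space M \<rightarrow> X"
  shows "f \<in> M \<rightarrow>\<^sub>M vimage_algebra X (\<lambda>H. \<lambda>ij\<in>{..<n} \<times> {..<n}. H $$ ij) (PiM ({..<n} \<times> {..<n}) (\<lambda>_. borel))"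
proof (rule measurable_vimage_algebra2[OF assms(2)], rule measurable_restrict)
  fix ij assume "ij \<in> {..<n} \<times> {..<n}"
  then show "(\<lambda>\<omega>. f \<omega> $$ ij) \<in> borel_measurable M"
    using assms(1)[of "fst ij" "snd ij"] by auto
qed

lemma measurable_mat_entry: "i < n \<Longrightarrow> j < n \<Longrightarrow> (\<lambda>H. H $$ (i, j)) \<in> borel_measurable (mat_borel n)"
  unfolding mat_borel_def by (rule measurable_entry)

lemma measurable_herm_entry: "i < n \<Longrightarrow> j < n \<Longrightarrow> (\<lambda>H. H $$ (i, j)) \<in> borel_measurable (herm_borel n)"
  unfolding herm_borel_def by (rule measurable_entry)

lemma measurable_mat_borelI:
  assumes "\<And>i j. i < n \<Longrightarrow> j < n \<Longrightarrow> (\<lambda>\<omega>. f \<omega> $$ (i, j)) \<in> borel_measurable M"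
    and "f \<in> space M \<rightarrow> carrier_mat n n"
  shows "f \<in> M \<rightarrow>\<^sub>M mat_borel n"
  unfolding mat_borel_def by (rule measurable_entryI[OF assms])

lemma measurable_herm_borelI:
  assumes "\<And>i j. i < n \<Longrightarrow> j < n \<Longrightarrow> (\<lambda>\<omega>. f \<omega> $$ (i, j)) \<in> borel_measurable M"
    and "f \<in> space M \<rightarrow> herm n"
  shows "f \<in> M \<rightarrow>\<^sub>M herm_borel n"
  unfolding herm_borel_def by (rule measurable_entryI[OF assms])

lemma measurable_gs_mat: "gs_mat n \<in> gauss_rows n \<rightarrow>\<^sub>M mat_borel n"
proof (rule measurable_mat_borelI)
  fix i j assume ij: "i < n" "j < n"
  have "(\<lambda>\<omega>. gs n \<omega> (n - 1 - i) (Suc j)) \<in> borel_measurable (gauss_rows n)"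
    by (rule measurable_gs) (use ij in auto)
  then show "(\<lambda>\<omega>. gs_mat n \<omega> $$ (i, j)) \<in> borel_measurable (gauss_rows n)"
    using ij by (simp add: gs_mat_def)
qed simp

text \<open>
  A measure on all matrices, because a degenerate family of rows does not yield a unitary matrix; such families
  form a null set.
\<close>

definition haar :: "nat \<Rightarrow> complex mat measure" where
  "haar n = distr (gauss_rows n) (mat_borel n) (gs_mat n)"

lemma sets_haar [measurable_cong, simp]: "sets (haar n) = sets (mat_borel n)"
  by (simp add: haar_def)

lemma space_haar [simp]: "space (haar n) = carrier_mat n n"
  by (simp add: haar_def)

lemma prob_space_haar: "prob_space (haar n)"
  unfolding haar_def by (intro prob_space.prob_space_distr prob_space_gauss_rows measurable_gs_mat)

lemma AE_gs_mat_unitary: "AE \<omega> in gauss_rows n. gs_mat n \<omega> \<in> unitary_group n"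
proof -
  have "AE \<omega> in gauss_rows n. \<forall>k\<in>{..<n}. hnorm n (gs_residual n \<omega> k) \<noteq> 0"
    by (rule AE_finite_allI) (auto intro: AE_gs_residual)
  then show ?thesis by eventually_elim (auto intro: gs_mat_unitary)
qed

lemma measurable_mat_mult:
  assumes f: "f \<in> M \<rightarrow>\<^sub>M mat_borel n" and g: "g \<in> M \<rightarrow>\<^sub>M mat_borel n"
  shows "(\<lambda>\<omega>. f \<omega> * g \<omega>) \<in> M \<rightarrow>\<^sub>M mat_borel n"
proof (rule measurable_mat_borelI)
  have c: "f \<omega> \<in> carrier_mat n n" "g \<omega> \<in> carrier_mat n n" if "\<omega> \<in> space M" for \<omega>
    using measurable_space[OF f that] measurable_space[OF g that] by auto
  show "(\<lambda>\<omega>. f \<omega> * g \<omega>) \<in> space M \<rightarrow> carrier_mat n n" using c by (auto intro: mult_carrier_mat[of _ n n])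
  fix i j assume ij: "i < n" "j < n"
  have "(\<lambda>\<omega>. \<Sum>k\<in>{0..<n}. f \<omega> $$ (i, k) * g \<omega> $$ (k, j)) \<in> borel_measurable M"
    by (intro borel_measurable_sum borel_measurable_times measurable_compose[OF f measurable_mat_entry]
        measurable_compose[OF g measurable_mat_entry]) (use ij in auto)
  then show "(\<lambda>\<omega>. (f \<omega> * g \<omega>) $$ (i, j)) \<in> borel_measurable M"
    by (rule measurable_cong[THEN iffD1, rotated]) (use c ij in \<open>simp add: mat_mult_index[of _ n n _ n] del: index_mult_mat\<close>)
qed

lemma measurable_mat_adjoint:
  assumes f: "f \<in> M \<rightarrow>\<^sub>M mat_borel n"
  shows "(\<lambda>\<omega>. mat_adjoint (f \<omega>)) \<in> M \<rightarrow>\<^sub>M mat_borel n"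
proof (rule measurable_mat_borelI)
  have c: "f \<omega> \<in> carrier_mat n n" if "\<omega> \<in> space M" for \<omega>
    using measurable_space[OF f that] by auto
  show "(\<lambda>\<omega>. mat_adjoint (f \<omega>)) \<in> space M \<rightarrow> carrier_mat n n" using c by auto
  fix i j assume ij: "i < n" "j < n"
  have cnj: "cnj \<in> borel_measurable borel" by (intro borel_measurable_continuous_onI continuous_intros)
  have "(\<lambda>\<omega>. cnj (f \<omega> $$ (j, i))) \<in> borel_measurable M"
    by (rule measurable_compose[OF measurable_compose[OF f measurable_mat_entry] cnj]) (use ij in auto)
  then show "(\<lambda>\<omega>. mat_adjoint (f \<omega>) $$ (i, j)) \<in> borel_measurable M"
    by (rule measurable_cong[THEN iffD1, rotated]) (use c ij in \<open>simp add: mat_adjoint_index[of _ n n]\<close>)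
qed

text \<open>
  Right multiplication by \<open>V\<close> commutes with Gram-Schmidt orthogonalization and preserves the law of the
  Gaussian rows.
\<close>

theorem haar_right_invariant:
  assumes V: "V \<in> unitary_group n"
  shows "distr (haar n) (mat_borel n) (\<lambda>U. U * V) = haar n"
proof -
  have Vc: "V \<in> carrier_mat n n" using unitary_groupD[OF V] by simp
  let ?P = "PiM {1..n} (\<lambda>_. gauss)"
  have psf: "product_sigma_finite (\<lambda>_::nat. ?P)" by (rule product_sigma_finite_PiM_gauss)
  define \<tau> where "\<tau> \<omega> = (\<lambda>k\<in>{..<n}. row_mult n V (\<omega> k))" for \<omega> :: "nat \<Rightarrow> nat \<Rightarrow> complex"
  have \<tau>: "distr (gauss_rows n) (gauss_rows n) \<tau> = gauss_rows n"
    unfolding gauss_rows_def \<tau>_def[abs_def]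
    by (rule distr_PiM_sigma_finite[OF _ psf psf]) (simp, rule measurable_row_mult_gauss, rule distr_gauss_row_mult[OF V])
  have \<tau>m: "\<tau> \<in> gauss_rows n \<rightarrow>\<^sub>M gauss_rows n"
    unfolding gauss_rows_def \<tau>_def[abs_def]
  proof (rule measurable_restrict)
    fix k assume "k \<in> {..<n}"
    then have "(\<lambda>\<omega>. \<omega> k) \<in> PiM {..<n} (\<lambda>_. ?P) \<rightarrow>\<^sub>M ?P"
      by (rule measurable_component_singleton)
    from measurable_compose[OF this measurable_row_mult_gauss]
    show "(\<lambda>\<omega>. row_mult n V (\<omega> k)) \<in> PiM {..<n} (\<lambda>_. ?P) \<rightarrow>\<^sub>M ?P" .
  qed
  have mV: "(\<lambda>U. U * V) \<in> mat_borel n \<rightarrow>\<^sub>M mat_borel n"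
    by (rule measurable_mat_mult) (use Vc in auto)
  have eq: "gs_mat n \<omega> * V = gs_mat n (\<tau> \<omega>)" for \<omega>
  proof -
    have "gs n (\<tau> \<omega>) k = gs n (\<lambda>k. row_mult n V (\<omega> k)) k" if "k < n" for k
      by (rule gs_cong) (use that in \<open>auto simp: \<tau>_def\<close>)
    then have "gs_mat n (\<tau> \<omega>) = gs_mat n (\<lambda>k. row_mult n V (\<omega> k))"
      unfolding gs_mat_def by (intro eq_matI) auto
    then show ?thesis using gs_mat_row_mult[OF V] by simp
  qed
  have "distr (haar n) (mat_borel n) (\<lambda>U. U * V) = distr (gauss_rows n) (mat_borel n) (\<lambda>\<omega>. gs_mat n \<omega> * V)"
    unfolding haar_def by (subst distr_distr[OF mV measurable_gs_mat]) (simp add: o_def)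
  also have "\<dots> = distr (distr (gauss_rows n) (gauss_rows n) \<tau>) (mat_borel n) (gs_mat n)"
    unfolding eq by (subst distr_distr[OF measurable_gs_mat \<tau>m]) (simp add: o_def)
  finally show ?thesis unfolding \<tau> haar_def .
qed

section \<open>Diagonalization of Hermitian matrices\<close>

definition diag_of :: "nat \<Rightarrow> (nat \<Rightarrow> complex) \<Rightarrow> complex mat" where
  "diag_of n y = mat n n (\<lambda>(i, j). if i = j then y (Suc i) else 0)"

lemma diag_of_carrier [simp]: "diag_of n y \<in> carrier_mat n n"
  by (simp add: diag_of_def)

lemma prod_list_roots: "(\<Prod>e\<leftarrow>map y [1..<Suc n]. [:- e, 1:]) = (\<Prod>i\<in>{1..n}. [:- y i, 1:])"
  for y :: "nat \<Rightarrow> 'a::comm_ring_1"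
proof -
  have "{1..<Suc n} = {1..n}" by auto
  then show ?thesis
    by (simp add: prod.distinct_set_conv_list[symmetric] del: upt_Suc One_nat_def)
qed

text \<open>
  The Schur decomposition gives \<open>H = P B S\<close> with \<open>S = P\<^sup>-\<^sup>1\<close> and \<open>B\<close> upper triangular with diagonal \<open>y\<close>.
  Gram-Schmidt orthogonalization of the rows of \<open>S\<close> gives \<open>S = R Q\<close> with \<open>R\<close> upper triangular and \<open>Q\<close> unitary.
  Then \<open>T = Q H Q\<^sup>*\<close> satisfies \<open>R T = B R\<close>, so it is upper triangular with the diagonal of \<open>B\<close>; being
  Hermitian, it is diagonal.
\<close>

theorem hermitian_diagonalization:
  assumes H: "H \<in> herm n" and cp: "char_poly H = (\<Prod>i\<in>{1..n}. [:- y i, 1:])"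
  obtains V where "V \<in> unitary_group n" "H = V * diag_of n y * mat_adjoint V"
proof -
  have Hc: "H \<in> carrier_mat n n" and Ha: "mat_adjoint H = H" using H by (auto simp: herm_def)
  define es where "es = map y [1..<Suc n]"
  have cp': "char_poly H = (\<Prod>e\<leftarrow>es. [:- e, 1:])" unfolding es_def prod_list_roots by (rule cp)
  obtain B P S where sd: "schur_decomposition H es = (B, P, S)" by (cases "schur_decomposition H es") auto
  from schur_decomposition[OF Hc cp' sd]
  have sim: "similar_mat_wit H B P S" and ut: "upper_triangular B" and dB: "diag_mat B = es" by auto
  from similar_mat_witD2[OF Hc sim]
  have PS: "P * S = 1\<^sub>m n" and SP: "S * P = 1\<^sub>m n" and HPBS: "H = P * B * S"
    and B: "B \<in> carrier_mat n n" and P: "P \<in> carrier_mat n n" and S: "S \<in> carrier_mat n n" by auto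
  have SH: "S * H = B * S"
  proof -
    have "S * H = S * (P * (B * S))" unfolding HPBS using P B S by (simp add: assoc_mult_mat[of _ n n _ n _ n])
    also have "\<dots> = S * P * (B * S)" using P B S by (intro assoc_mult_mat[symmetric]) auto
    finally show ?thesis using SP B S by simp
  qed
  \<comment> \<open>The rows of \<open>S\<close> from the bottom to the top, to match the order in \<open>gs_mat\<close>.\<close>
  define G where "G k j = S $$ (n - 1 - k, j - 1)" for k j
  define Q where "Q = gs_mat n G"
  define R where "R = mat n n (\<lambda>(i, j). if i = j then complex_of_real (hnorm n (gs_residual n G (n - 1 - i)))
      else if i < j then hdot n (G (n - 1 - i)) (gs n G (n - 1 - j)) else 0)"
  have Q: "Q \<in> carrier_mat n n" and R: "R \<in> carrier_mat n n" by (simp_all add: Q_def R_def)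
  have SRQ: "S = R * Q"
  proof (rule eq_matI)
    show "dim_row S = dim_row (R * Q)" "dim_col S = dim_col (R * Q)" using S Q R by auto
    fix i j assume "i < dim_row (R * Q)" "j < dim_col (R * Q)"
    then have ij: "i < n" "j < n" using Q R by auto
    have "(R * Q) $$ (i, j) = (\<Sum>k\<in>{0..<n}. R $$ (i, k) * Q $$ (k, j))"
      by (rule mat_mult_index[OF R Q ij])
    also have "\<dots> = (\<Sum>k\<in>{0..<n}. (if i = k then complex_of_real (hnorm n (gs_residual n G (n - 1 - i))) * gs n G (n - 1 - i) (Suc j) else 0)
        + (if i < k then hdot n (G (n - 1 - i)) (gs n G (n - 1 - k)) * gs n G (n - 1 - k) (Suc j) else 0))"
      using ij by (intro sum.cong) (auto simp: R_def Q_def gs_mat_def)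
    also have "\<dots> = complex_of_real (hnorm n (gs_residual n G (n - 1 - i))) * gs n G (n - 1 - i) (Suc j)
        + (\<Sum>k\<in>{0..<n}. if i < k then hdot n (G (n - 1 - i)) (gs n G (n - 1 - k)) * gs n G (n - 1 - k) (Suc j) else 0)"
      unfolding sum.distrib using ij by simp
    also have "(\<Sum>k\<in>{0..<n}. if i < k then hdot n (G (n - 1 - i)) (gs n G (n - 1 - k)) * gs n G (n - 1 - k) (Suc j) else 0)
        = (\<Sum>k\<in>{k\<in>{0..<n}. i < k}. hdot n (G (n - 1 - i)) (gs n G (n - 1 - k)) * gs n G (n - 1 - k) (Suc j))"
      by (rule sum.inter_filter[symmetric]) simp
    also have "\<dots> = (\<Sum>l\<in>{..<n - 1 - i}. hdot n (G (n - 1 - i)) (gs n G l) * gs n G l (Suc j))"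
      by (rule sum.reindex_bij_witness[of _ "\<lambda>l. n - 1 - l" "\<lambda>k. n - 1 - k"]) auto
    also have "complex_of_real (hnorm n (gs_residual n G (n - 1 - i))) * gs n G (n - 1 - i) (Suc j)
        + (\<Sum>l\<in>{..<n - 1 - i}. hdot n (G (n - 1 - i)) (gs n G l) * gs n G l (Suc j)) = G (n - 1 - i) (Suc j)"
      by (rule gs_expansion[symmetric]) (use ij in auto)
    also have "\<dots> = S $$ (i, j)" using ij by (simp add: G_def)
    finally show "S $$ (i, j) = (R * Q) $$ (i, j)" by simp
  qed
  have nz: "hnorm n (gs_residual n G k) \<noteq> 0" if k: "k < n" for k
  proof
    assume 0: "hnorm n (gs_residual n G k) = 0"
    define i where "i = n - 1 - k"
    have i: "i < n" using k by (simp add: i_def)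
    have row0: "Q $$ (i, j) = 0" if "j < n" for j
      using k that gs_zero[OF 0, of "Suc j"] by (simp add: Q_def gs_mat_def i_def)
    have QP: "Q * P \<in> carrier_mat n n" using Q P by simp
    have "R * (Q * P) = 1\<^sub>m n" using SP unfolding SRQ using R Q P by (simp add: assoc_mult_mat[of _ n n _ n _ n])
    from mat_mult_left_right_inverse[OF R QP this] have "Q * P * R = 1\<^sub>m n" .
    then have "(Q * P * R) $$ (i, i) = 1" using i by simp
    moreover have "(Q * P * R) $$ (i, i) = (\<Sum>k\<in>{0..<n}. (Q * P) $$ (i, k) * R $$ (k, i))"
      by (rule mat_mult_index[OF QP R i i])
    moreover have "(Q * P) $$ (i, k) = 0" if "k < n" for k
      unfolding mat_mult_index[OF Q P i that] using row0 by simp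
    ultimately show False by simp
  qed
  have Qu: "Q \<in> unitary_group n" unfolding Q_def by (rule gs_mat_unitary) (rule nz)
  note q = unitary_groupD[OF Qu]
  have Qa: "mat_adjoint Q \<in> carrier_mat n n" using Q by simp
  define T where "T = Q * H * mat_adjoint Q"
  have T: "T \<in> carrier_mat n n" unfolding T_def using Q Hc Qa by (intro mult_carrier_mat[of _ n n]) auto
  have RT: "R * T = B * R"
  proof -
    have QH: "Q * H \<in> carrier_mat n n" and RQ: "R * Q \<in> carrier_mat n n" using Q Hc R by auto
    have "R * T = R * (Q * H) * mat_adjoint Q" unfolding T_def by (rule assoc_mult_mat[symmetric, OF R QH Qa])
    also have "R * (Q * H) = B * (R * Q)"
      using SH unfolding SRQ by (simp add: assoc_mult_mat[OF R Q Hc])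
    also have "B * (R * Q) * mat_adjoint Q = B * (R * (Q * mat_adjoint Q))"
      by (simp add: assoc_mult_mat[OF B RQ Qa] assoc_mult_mat[OF R Q Qa])
    finally show ?thesis using q R by simp
  qed
  have Th: "mat_adjoint T = T"
    unfolding T_def using mat_adjoint_mult[OF mult_carrier_mat[OF Q Hc] Qa] mat_adjoint_mult[OF Q Hc]
    by (simp add: mat_adjoint_adjoint[OF Q] Ha assoc_mult_mat[OF Q Hc Qa])
  have Tij: "T $$ (i, j) = cnj (T $$ (j, i))" if "i < n" "j < n" for i j
    using mat_adjoint_index[OF T that] unfolding Th .
  have Rii: "R $$ (i, i) \<noteq> 0" if "i < n" for i using nz[of "n - 1 - i"] that by (simp add: R_def)
  have Rlow: "R $$ (i, j) = 0" if "j < i" "i < n" for i j using that by (simp add: R_def)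
  have Blow: "B $$ (i, j) = 0" if "j < i" "i < n" for i j
    using ut B that by (auto simp: upper_triangular_def)
  have low: "T $$ (i, j) = 0" if "j < i" "i < n" for i j
    using that
  proof (induction "n - i" arbitrary: i rule: less_induct)
    case less
    have "(R * T) $$ (i, j) = (\<Sum>k\<in>{0..<n}. R $$ (i, k) * T $$ (k, j))"
      by (rule mat_mult_index[OF R T]) (use less.prems in auto)
    also have "\<dots> = (\<Sum>k\<in>{0..<n}. if k = i then R $$ (i, i) * T $$ (i, j) else 0)"
    proof (rule sum.cong[OF refl])
      fix k assume k: "k \<in> {0..<n}"
      consider "k < i" | "k = i" | "i < k" by linarith
      then show "R $$ (i, k) * T $$ (k, j) = (if k = i then R $$ (i, i) * T $$ (i, j) else 0)"
      proof cases
        case 1 then show ?thesis using Rlow less.prems by simp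
      next
        case 3
        then have "T $$ (k, j) = 0" using k less.prems by (intro less.hyps) auto
        then show ?thesis using 3 by simp
      qed simp
    qed
    also have "\<dots> = R $$ (i, i) * T $$ (i, j)" using less.prems by simp
    finally have "R $$ (i, i) * T $$ (i, j) = (B * R) $$ (i, j)" unfolding RT by simp
    also have "\<dots> = (\<Sum>k\<in>{0..<n}. B $$ (i, k) * R $$ (k, j))"
      by (rule mat_mult_index[OF B R]) (use less.prems in auto)
    also have "\<dots> = 0"
    proof (rule sum.neutral, rule ballI)
      fix k assume k: "k \<in> {0..<n}"
      show "B $$ (i, k) * R $$ (k, j) = 0"
      proof (cases "k < i")
        case True then show ?thesis using Blow less.prems by simp
      next
        case False then show ?thesis using Rlow[of j k] less.prems k by simp
      qed
    qed
    finally show ?case using Rii[of i] less.prems by simp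
  qed
  have off: "T $$ (i, j) = 0" if "i \<noteq> j" "i < n" "j < n" for i j
  proof (cases "j < i")
    case True then show ?thesis using low that by simp
  next
    case False
    then have "T $$ (j, i) = 0" using low that by simp
    then show ?thesis using Tij[of i j] that by simp
  qed
  have dg: "T $$ (i, i) = y (Suc i)" if i: "i < n" for i
  proof -
    have "(R * T) $$ (i, i) = (\<Sum>k\<in>{0..<n}. R $$ (i, k) * T $$ (k, i))"
      by (rule mat_mult_index[OF R T i i])
    also have "\<dots> = (\<Sum>k\<in>{0..<n}. if k = i then R $$ (i, i) * T $$ (i, i) else 0)"
      using off i by (intro sum.cong) auto
    finally have 1: "(R * T) $$ (i, i) = R $$ (i, i) * T $$ (i, i)" using i by simp
    have "(B * R) $$ (i, i) = (\<Sum>k\<in>{0..<n}. B $$ (i, k) * R $$ (k, i))"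
      by (rule mat_mult_index[OF B R i i])
    also have "\<dots> = (\<Sum>k\<in>{0..<n}. if k = i then B $$ (i, i) * R $$ (i, i) else 0)"
    proof (rule sum.cong[OF refl])
      fix k assume k: "k \<in> {0..<n}"
      consider "k < i" | "k = i" | "i < k" by linarith
      then show "B $$ (i, k) * R $$ (k, i) = (if k = i then B $$ (i, i) * R $$ (i, i) else 0)"
        using Blow[of k i] Rlow[of i k] i k by cases auto
    qed
    finally have 2: "(B * R) $$ (i, i) = B $$ (i, i) * R $$ (i, i)" using i by simp
    have "B $$ (i, i) = diag_mat B ! i" using i B by (simp add: diag_mat_def)
    also have "\<dots> = y (Suc i)" unfolding dB es_def using i by (simp del: upt_Suc)
    finally show ?thesis using 1 2 RT Rii[OF i] by simp
  qed
  have TD: "T = diag_of n y"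
    by (rule eq_matI) (use T off dg in \<open>auto simp: diag_of_def\<close>)
  have "H = mat_adjoint Q * T * Q"
  proof -
    have "mat_adjoint Q * T * Q = mat_adjoint Q * (Q * H) * mat_adjoint Q * Q"
      unfolding T_def using Q Hc Qa by (simp add: assoc_mult_mat[of _ n n _ n _ n])
    also have "mat_adjoint Q * (Q * H) = H"
      using Q Hc Qa q by (simp add: assoc_mult_mat[of _ n n _ n _ n, symmetric])
    also have "H * mat_adjoint Q * Q = H"
      using Q Hc Qa q by (simp add: assoc_mult_mat[of _ n n _ n _ n])
    finally show ?thesis by simp
  qed
  then show thesis
    using that[of "mat_adjoint Q"] q TD by (simp add: mat_adjoint_adjoint[OF Q])
qed

text \<open>
  The characteristic polynomial splits over the complex numbers; the diagonal form of \<open>H\<close> is Hermitian, so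
  its entries are real, and they can be sorted.
\<close>

lemma hermitian_spectrum:
  assumes H: "H \<in> herm n"
  obtains y where "y \<in> weyl_chamber n" "H \<in> spectral_orbit n y"
proof -
  have Hc: "H \<in> carrier_mat n n" using H by (simp add: herm_def)
  obtain as where as: "char_poly H = (\<Prod>a\<leftarrow>as. [:- a, 1:])" "length as = n"
    using char_poly_factorized[OF Hc] by auto
  define y where "y i = as ! (i - 1)" for i
  have asy: "as = map y [1..<Suc n]"
    using as(2) by (intro nth_equalityI) (auto simp: y_def simp del: upt_Suc)
  have "char_poly H = (\<Prod>i\<in>{1..n}. [:- y i, 1:])"
    unfolding as(1) asy prod_list_roots ..
  from hermitian_diagonalization[OF H this] obtain V
    where V: "V \<in> unitary_group n" and HV: "H = V * diag_of n y * mat_adjoint V" by auto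
  note v = unitary_groupD[OF V]
  have va: "mat_adjoint V \<in> carrier_mat n n" using v by simp
  have D: "diag_of n y = mat_adjoint V * H * V"
    unfolding HV by (rule unitary_conjugation_cancel[symmetric, OF V]) simp
  have "mat_adjoint (diag_of n y) = diag_of n y"
    unfolding D using mat_adjoint_conjugation[OF va Hc] H v by (simp add: herm_def mat_adjoint_adjoint[of V n n])
  then have "cnj (y (Suc i)) = y (Suc i)" if "i < n" for i
    using mat_adjoint_index[OF diag_of_carrier that that, of y] that by (simp add: diag_of_def)
  then have yr: "y i \<in> \<real>" if "i \<in> {1..n}" for i
    using that by (cases i) (auto simp: complex_is_Real_iff complex_eq_iff)
  define zs where "zs = sort (map Re as)"
  define z where "z = (\<lambda>i\<in>{1..n}. zs ! (i - 1))"
  have len: "length zs = n" using as(2) by (simp add: zs_def)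
  have "z \<in> weyl_chamber n"
    unfolding weyl_chamber_def
  proof (intro CollectI conjI mono_onI)
    show "z \<in> extensional {1..n}" by (simp add: z_def)
    fix i j assume "i \<in> {1..n}" "j \<in> {1..n}" "i \<le> j"
    then show "z i \<le> z j" using len by (auto simp: z_def zs_def intro!: sorted_nth_mono)
  qed
  moreover have "H \<in> spectral_orbit n z"
  proof -
    have sas: "set as = y ` {1..n}" unfolding asy set_map set_upt atLeastLessThanSuc_atLeastAtMost ..
    have ra: "complex_of_real (Re a) = a" if a: "a \<in> set as" for a
    proof (rule of_real_Re)
      obtain i where "i \<in> {1..n}" "a = y i" using a unfolding sas by auto
      then show "a \<in> \<real>" using yr by simp
    qed
    have re: "map complex_of_real (map Re as) = as"
      unfolding map_map by (rule map_idI) (simp only: o_apply ra)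
    have mset_prod: "(\<Prod>a\<in>#mset xs. [:- a, 1:]) = (\<Prod>a\<leftarrow>xs. [:- a, 1:])" for xs :: "complex list"
      by (simp only: mset_map[symmetric] prod_mset_prod_list)
    have "mset as = mset (map complex_of_real zs)"
      by (subst re[symmetric]) (simp add: zs_def multiset.map_comp)
    moreover have "map complex_of_real zs = map (\<lambda>i. complex_of_real (z i)) [1..<Suc n]"
    proof (rule nth_equalityI)
      fix i assume "i < length (map complex_of_real zs)"
      then have i: "i < n" using len by simp
      then have "[1..<Suc n] ! i = Suc i" by (simp del: upt_Suc)
      then show "map complex_of_real zs ! i = map (\<lambda>i. complex_of_real (z i)) [1..<Suc n] ! i"
        using i len by (simp add: z_def del: upt_Suc)
    qed (simp add: len)
    ultimately have "char_poly H = (\<Prod>a\<leftarrow>map (\<lambda>i. complex_of_real (z i)) [1..<Suc n]. [:- a, 1:])"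
      unfolding as(1) mset_prod[symmetric] by (simp only:)
    also have "\<dots> = (\<Prod>i\<in>{1..n}. [:- complex_of_real (z i), 1:])" by (rule prod_list_roots)
    finally show ?thesis using H by (simp add: spectral_orbit_def)
  qed
  ultimately show thesis by (rule that)
qed

section \<open>Measurable dependence of roots on coefficients\<close>

lemma poly_real_rooted_Re:
  "poly (\<Prod>i\<in>{1..k}. [:- complex_of_real (y i), 1:]) (complex_of_real z) = complex_of_real (\<Prod>i\<in>{1..k}. z - y i)"
  by (simp add: poly_prod)

text \<open>
  The largest roots agree, because each of them is a root of the other polynomial; the rest follows after
  division by the common linear factor.
\<close>

lemma chamber_roots_unique:
  fixes y y' :: "nat \<Rightarrow> real"
  assumes "mono_on {1..k} y" "mono_on {1..k} y'"
    and "(\<Prod>i\<in>{1..k}. [:- complex_of_real (y i), 1:]) = (\<Prod>i\<in>{1..k}. [:- complex_of_real (y' i), 1:])"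
    and "i \<in> {1..k}"
  shows "y i = y' i"
  using assms
proof (induction k arbitrary: i)
  case 0
  then show ?case by simp
next
  case (Suc k)
  have le: "w' (Suc k) \<le> w (Suc k)" if w: "mono_on {1..Suc k} w"
    and e: "(\<Prod>i\<in>{1..Suc k}. [:- complex_of_real (w i), 1:]) = (\<Prod>i\<in>{1..Suc k}. [:- complex_of_real (w' i), 1:])" for w w'
  proof -
    have "complex_of_real (\<Prod>i\<in>{1..Suc k}. w' (Suc k) - w i) = complex_of_real (\<Prod>i\<in>{1..Suc k}. w' (Suc k) - w' i)"
      unfolding poly_real_rooted_Re[symmetric] e ..
    also have "(\<Prod>i\<in>{1..Suc k}. w' (Suc k) - w' i) = 0" by (rule prod_zero[OF _ bexI[of _ "Suc k"]]) auto
    finally have "(\<Prod>i\<in>{1..Suc k}. w' (Suc k) - w i) = 0" by simp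
    then obtain i where "i \<in> {1..Suc k}" "w' (Suc k) = w i"
      by (auto simp del: prod.atLeast_Suc_atMost prod.cl_ivl_Suc atLeastAtMostSuc_conv)
    then show ?thesis using mono_onD[OF w, of i "Suc k"] by simp
  qed
  have top: "y (Suc k) = y' (Suc k)"
    using le[OF Suc.prems(1) Suc.prems(3)] le[OF Suc.prems(2) Suc.prems(3)[symmetric]] by simp
  have "(\<Prod>i\<in>{1..k}. [:- complex_of_real (y i), 1:]) * [:- complex_of_real (y (Suc k)), 1:]
      = (\<Prod>i\<in>{1..k}. [:- complex_of_real (y' i), 1:]) * [:- complex_of_real (y (Suc k)), 1:]"
    using Suc.prems(3) top by simp
  then have "(\<Prod>i\<in>{1..k}. [:- complex_of_real (y i), 1:]) = (\<Prod>i\<in>{1..k}. [:- complex_of_real (y' i), 1:])"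
    by (subst (asm) mult_right_cancel) auto
  moreover have "mono_on {1..k} y" "mono_on {1..k} y'"
    using Suc.prems(1,2) by (auto intro: mono_on_subset)
  ultimately have "y i = y' i" if "i \<in> {1..k}" for i using Suc.IH that by blast
  then show ?case using top Suc.prems(4) by (cases "i = Suc k") auto
qed

text \<open>
  This expresses the largest root through the values of the polynomial at the rational points. If
  \<open>y (Suc k) > t\<close>, the inequality fails just below \<open>y (Suc k)\<close>, where the polynomial tends to 0 while
  the power on the left does not.
\<close>

lemma largest_root_le_iff:
  fixes y :: "nat \<Rightarrow> real"
  assumes y: "mono_on {1..Suc k} y"
  shows "y (Suc k) \<le> t \<longleftrightarrow> (\<forall>q::rat. t < of_rat q \<longrightarrow> (of_rat q - t) ^ Suc k \<le> (\<Prod>i\<in>{1..Suc k}. of_rat q - y i))"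
proof
  assume t: "y (Suc k) \<le> t"
  have "(z - t) ^ Suc k \<le> (\<Prod>i\<in>{1..Suc k}. z - y i)" if z: "t < z" for z
  proof -
    have "(z - t) ^ Suc k = (\<Prod>i\<in>{1..Suc k}. z - t)" by (simp only: prod_constant card_atLeastAtMost diff_Suc_1)
    also have "\<dots> \<le> (\<Prod>i\<in>{1..Suc k}. z - y i)"
    proof (rule prod_mono)
      fix i assume "i \<in> {1..Suc k}"
      then have "y i \<le> y (Suc k)" by (intro mono_onD[OF y]) auto
      then show "0 \<le> z - t \<and> z - t \<le> z - y i" using t z by simp
    qed
    finally show ?thesis .
  qed
  then show "\<forall>q::rat. t < of_rat q \<longrightarrow> (of_rat q - t) ^ Suc k \<le> (\<Prod>i\<in>{1..Suc k}. of_rat q - y i)" by blast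
next
  assume *: "\<forall>q::rat. t < of_rat q \<longrightarrow> (of_rat q - t) ^ Suc k \<le> (\<Prod>i\<in>{1..Suc k}. of_rat q - y i)"
  show "y (Suc k) \<le> t"
  proof (rule ccontr)
    assume "\<not> y (Suc k) \<le> t"
    then have t: "t < y (Suc k)" by simp
    define h where "h z = (z - t) ^ Suc k - (\<Prod>i\<in>{1..Suc k}. z - y i)" for z
    have "(\<Prod>i\<in>{1..Suc k}. y (Suc k) - y i) = 0" by (rule prod_zero[OF _ bexI[of _ "Suc k"]]) auto
    then have "0 < h (y (Suc k))" using t by (simp only: h_def) simp
    moreover have "(h \<longlongrightarrow> h (y (Suc k))) (at_left (y (Suc k)))"
      unfolding h_def by (intro tendsto_intros)
    ultimately have "eventually (\<lambda>z. 0 < h z) (at_left (y (Suc k)))"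
      by (auto dest: order_tendstoD)
    then obtain b where b: "b < y (Suc k)" "\<And>z. b < z \<Longrightarrow> z < y (Suc k) \<Longrightarrow> 0 < h z"
      unfolding eventually_at_left_field by blast
    obtain q :: rat where "max b t < of_rat q" "of_rat q < y (Suc k)"
      using of_rat_dense[of "max b t" "y (Suc k)"] b(1) t by auto
    then show False using b(2)[of "of_rat q"] *[rule_format, of q] by (simp add: h_def del: power_Suc prod.cl_ivl_Suc)
  qed
qed

text \<open>
  The largest root is measurable by the countable criterion above. The quotient by its linear factor has
  measurable coefficients, as synthetic division computes them from the top degree downwards.
\<close>

lemma borel_measurable_roots:
  fixes p :: "'w \<Rightarrow> complex poly" and y :: "'w \<Rightarrow> nat \<Rightarrow> real"
  assumes "\<And>j. (\<lambda>\<omega>. poly.coeff (p \<omega>) j) \<in> borel_measurable M"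
    and "\<And>\<omega>. \<omega> \<in> space M \<Longrightarrow> mono_on {1..k} (y \<omega>)"
    and "\<And>\<omega>. \<omega> \<in> space M \<Longrightarrow> p \<omega> = (\<Prod>i\<in>{1..k}. [:- complex_of_real (y \<omega> i), 1:])"
    and "i \<in> {1..k}"
  shows "(\<lambda>\<omega>. y \<omega> i) \<in> borel_measurable M"
  using assms
proof (induction k arbitrary: p i)
  case 0
  then show ?case by simp
next
  case (Suc k)
  have deg: "degree (\<Prod>i\<in>{1..m}. [:- complex_of_real (w i), 1:]) = m" for m w
    by (subst degree_prod_eq_sum_degree) auto
  have top: "(\<lambda>\<omega>. y \<omega> (Suc k)) \<in> borel_measurable M"
    unfolding borel_measurable_iff_le
  proof
    fix t :: real
    have [measurable]: "(\<lambda>\<omega>. poly.coeff (p \<omega>) j) \<in> borel_measurable M" for j by (rule Suc.prems)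
    have ev: "(\<Prod>i\<in>{1..Suc k}. z - y \<omega> i) = Re (\<Sum>j\<le>Suc k. poly.coeff (p \<omega>) j * complex_of_real z ^ j)" if "\<omega> \<in> space M" for z \<omega>
    proof -
      have "complex_of_real (\<Prod>i\<in>{1..Suc k}. z - y \<omega> i) = poly (p \<omega>) (complex_of_real z)"
        unfolding Suc.prems(3)[OF that] poly_real_rooted_Re ..
      also have "\<dots> = (\<Sum>j\<le>degree (p \<omega>). poly.coeff (p \<omega>) j * complex_of_real z ^ j)" by (rule poly_altdef)
      also have "degree (p \<omega>) = Suc k" unfolding Suc.prems(3)[OF that] by (rule deg)
      finally show ?thesis by (metis Re_complex_of_real)
    qed
    have "{\<omega> \<in> space M. y \<omega> (Suc k) \<le> t}
      = {\<omega> \<in> space M. \<forall>q::rat. t < of_rat q \<longrightarrow> (of_rat q - t) ^ Suc k \<le> Re (\<Sum>j\<le>Suc k. poly.coeff (p \<omega>) j * complex_of_real (of_rat q) ^ j)}"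
      by (intro Collect_cong conj_cong refl) (simp only: largest_root_le_iff[OF Suc.prems(2)] ev)
    also have "\<dots> \<in> sets M" by measurable
    finally show "{\<omega> \<in> space M. y \<omega> (Suc k) \<le> t} \<in> sets M" .
  qed
  note coeff_p = Suc.prems(1)
  define q where "q \<omega> = (\<Prod>i\<in>{1..k}. [:- complex_of_real (y \<omega> i), 1:])" for \<omega>
  have step: "poly.coeff (q \<omega>) j = poly.coeff (p \<omega>) (Suc j) + complex_of_real (y \<omega> (Suc k)) * poly.coeff (q \<omega>) (Suc j)"
    if "\<omega> \<in> space M" for \<omega> j
  proof -
    have "p \<omega> = [:- complex_of_real (y \<omega> (Suc k)), 1:] * q \<omega>"
      unfolding Suc.prems(3)[OF that] q_def by (simp add: mult.commute)
    then show ?thesis by simp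
  qed
  have q0: "(\<lambda>\<omega>. poly.coeff (q \<omega>) j) \<in> borel_measurable M" if "k < j + d" for j d
    using that
  proof (induction d arbitrary: j)
    case 0
    then have "poly.coeff (q \<omega>) j = 0" for \<omega>
      unfolding q_def by (intro coeff_eq_0) (simp only: deg)
    then show ?case by simp
  next
    case (Suc d)
    have [measurable]: "(\<lambda>\<omega>. poly.coeff (p \<omega>) (Suc j)) \<in> borel_measurable M" by (rule coeff_p)
    have [measurable]: "(\<lambda>\<omega>. poly.coeff (q \<omega>) (Suc j)) \<in> borel_measurable M" using Suc by simp
    note top [measurable]
    have "(\<lambda>\<omega>. poly.coeff (p \<omega>) (Suc j) + complex_of_real (y \<omega> (Suc k)) * poly.coeff (q \<omega>) (Suc j)) \<in> borel_measurable M"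
      by measurable
    then show ?case by (subst measurable_cong[OF step])
  qed
  have q: "(\<lambda>\<omega>. poly.coeff (q \<omega>) j) \<in> borel_measurable M" for j by (rule q0[of _ "Suc k"]) simp
  have m: "mono_on {1..k} (y \<omega>)" if "\<omega> \<in> space M" for \<omega>
    using Suc.prems(2)[OF that] by (rule mono_on_subset) auto
  have "(\<lambda>\<omega>. y \<omega> i) \<in> borel_measurable M" if "i \<in> {1..k}" for i
    by (rule Suc.IH[OF q m q_def that])
  then show ?case using top Suc.prems(4) by (cases "i = Suc k") auto
qed

section \<open>Conjugation-invariant laws on Hermitian matrices\<close>

definition real_diag :: "nat \<Rightarrow> (nat \<Rightarrow> real) \<Rightarrow> complex mat" where
  "real_diag n x = diag_of n (\<lambda>i. complex_of_real (x i))"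

lemma real_diag_carrier [simp]: "real_diag n x \<in> carrier_mat n n"
  by (simp add: real_diag_def)

lemma real_diag_herm: "real_diag n x \<in> herm n"
proof -
  have "mat_adjoint (real_diag n x) = real_diag n x"
  proof (rule eq_matI)
    fix i j assume "i < dim_row (real_diag n x)" "j < dim_col (real_diag n x)"
    then have "i < n" "j < n" by (auto simp: real_diag_def diag_of_def)
    then show "mat_adjoint (real_diag n x) $$ (i, j) = real_diag n x $$ (i, j)"
      by (subst mat_adjoint_index[OF real_diag_carrier]) (auto simp: real_diag_def diag_of_def)
  qed (use carrier_matD[OF mat_adjoint_carrier[OF real_diag_carrier[of n x]]] in \<open>simp_all add: real_diag_def diag_of_def\<close>)
  then show ?thesis by (simp add: herm_def)
qed

lemma herm_carrier: "H \<in> herm n \<Longrightarrow> H \<in> carrier_mat n n"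
  by (simp add: herm_def)

lemma conjugate_herm:
  assumes U: "U \<in> carrier_mat n n" and H: "H \<in> herm n"
  shows "U * H * mat_adjoint U \<in> herm n"
proof -
  have "U * H * mat_adjoint U \<in> carrier_mat n n"
    using U herm_carrier[OF H] by (intro mult_carrier_mat[of _ n n]) auto
  then show ?thesis
    using mat_adjoint_conjugation[OF U herm_carrier[OF H]] H by (simp add: herm_def)
qed

lemma char_poly_unitary_conjugate:
  assumes U: "U \<in> unitary_group n" and H: "H \<in> carrier_mat n n"
  shows "char_poly (U * H * mat_adjoint U) = char_poly H"
proof -
  note u = unitary_groupD[OF U]
  have ua: "mat_adjoint U \<in> carrier_mat n n" using u by simp
  have "similar_mat_wit (U * H * mat_adjoint U) H U (mat_adjoint U)"
    using u ua H by (intro similar_mat_witI[of _ _ n]) (auto intro: mult_carrier_mat[of _ n n])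
  then show ?thesis by (intro char_poly_similar) (auto simp: similar_mat_def)
qed

lemma spectral_orbit_unitary_conjugate:
  assumes "U \<in> unitary_group n" and "H \<in> spectral_orbit n x"
  shows "U * H * mat_adjoint U \<in> spectral_orbit n x"
  using assms char_poly_unitary_conjugate[of U n H] conjugate_herm[of U n H] unitary_groupD(1)[of U n]
  by (auto simp: spectral_orbit_def herm_carrier)

lemma real_diag_spectral_orbit: "real_diag n x \<in> spectral_orbit n x"
proof -
  have "char_poly (real_diag n x) = (\<Prod>a\<leftarrow>diag_mat (real_diag n x). [:- a, 1:])"
    by (rule char_poly_upper_triangular[OF real_diag_carrier]) (auto simp: real_diag_def diag_of_def)
  also have "diag_mat (real_diag n x) = map (\<lambda>i. complex_of_real (x i)) [1..<Suc n]"
  proof (rule nth_equalityI)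
    fix i assume "i < length (diag_mat (real_diag n x))"
    then have i: "i < n" by (simp add: diag_mat_def real_diag_def diag_of_def)
    then have "[1..<Suc n] ! i = Suc i" by (simp del: upt_Suc)
    then show "diag_mat (real_diag n x) ! i = map (\<lambda>i. complex_of_real (x i)) [1..<Suc n] ! i"
      using i by (simp add: diag_mat_def real_diag_def diag_of_def del: upt_Suc)
  qed (simp add: diag_mat_def real_diag_def diag_of_def)
  finally show ?thesis
    unfolding prod_list_roots using real_diag_herm by (simp add: spectral_orbit_def)
qed

lemma measurable_herm_mat: "(\<lambda>H. H) \<in> herm_borel n \<rightarrow>\<^sub>M mat_borel n"
  by (rule measurable_mat_borelI) (auto intro: measurable_herm_entry herm_carrier)

lemma measurable_into_herm:
  assumes "f \<in> M \<rightarrow>\<^sub>M mat_borel n" and "f \<in> space M \<rightarrow> herm n"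
  shows "f \<in> M \<rightarrow>\<^sub>M herm_borel n"
  by (rule measurable_herm_borelI[OF _ assms(2)]) (rule measurable_compose[OF assms(1) measurable_mat_entry])

lemma measurable_conjugate:
  assumes f: "f \<in> M \<rightarrow>\<^sub>M mat_borel n" and g: "g \<in> M \<rightarrow>\<^sub>M herm_borel n"
  shows "(\<lambda>\<omega>. f \<omega> * g \<omega> * mat_adjoint (f \<omega>)) \<in> M \<rightarrow>\<^sub>M herm_borel n"
proof (rule measurable_into_herm)
  show "(\<lambda>\<omega>. f \<omega> * g \<omega> * mat_adjoint (f \<omega>)) \<in> M \<rightarrow>\<^sub>M mat_borel n"
    by (intro measurable_mat_mult measurable_mat_adjoint f measurable_compose[OF g measurable_herm_mat])
  show "(\<lambda>\<omega>. f \<omega> * g \<omega> * mat_adjoint (f \<omega>)) \<in> space M \<rightarrow> herm n"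
    using measurable_space[OF f] measurable_space[OF g] by (auto intro: conjugate_herm)
qed

lemma measurable_id_mat: "(\<lambda>U. U) \<in> mat_borel n \<rightarrow>\<^sub>M mat_borel n" by simp

definition orbit_law :: "nat \<Rightarrow> complex mat \<Rightarrow> complex mat measure" where
  "orbit_law n H = distr (haar n) (herm_borel n) (\<lambda>U. U * H * mat_adjoint U)"

lemma measurable_orbit_map:
  "H \<in> herm n \<Longrightarrow> (\<lambda>U. U * H * mat_adjoint U) \<in> haar n \<rightarrow>\<^sub>M herm_borel n"
  unfolding measurable_cong_sets[OF sets_haar refl]
  by (rule measurable_conjugate) auto

lemma orbit_law_conjugate:
  assumes V: "V \<in> unitary_group n" and H: "H \<in> herm n"
  shows "orbit_law n (V * H * mat_adjoint V) = orbit_law n H"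
proof -
  note v = unitary_groupD(1)[OF V]
  have mV: "(\<lambda>U. U * V) \<in> haar n \<rightarrow>\<^sub>M mat_borel n"
    unfolding measurable_cong_sets[OF sets_haar refl] by (rule measurable_mat_mult) (use v in auto)
  have mo: "(\<lambda>U. U * H * mat_adjoint U) \<in> mat_borel n \<rightarrow>\<^sub>M herm_borel n"
    by (rule measurable_conjugate) (use H in auto)
  have "orbit_law n H = distr (distr (haar n) (mat_borel n) (\<lambda>U. U * V)) (herm_borel n) (\<lambda>U. U * H * mat_adjoint U)"
    unfolding haar_right_invariant[OF V] orbit_law_def ..
  also have "\<dots> = distr (haar n) (herm_borel n) (\<lambda>U. U * V * H * mat_adjoint (U * V))"
    by (subst distr_distr[OF mo mV]) (simp add: o_def)
  also have "\<dots> = orbit_law n (V * H * mat_adjoint V)"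
    unfolding orbit_law_def
    by (rule distr_cong) (use unitary_conjugation_comp[OF _ v herm_carrier[OF H]] in auto)
  finally show ?thesis by simp
qed

text \<open>
  By the spectral theorem \<open>H\<close> is a unitary conjugate of the diagonal matrix, and right invariance of \<open>haar\<close>
  absorbs the conjugating matrix.
\<close>

lemma orbit_law_spectral_orbit:
  assumes "H \<in> spectral_orbit n x"
  shows "orbit_law n H = orbit_law n (real_diag n x)"
proof -
  have H: "H \<in> herm n" "char_poly H = (\<Prod>i\<in>{1..n}. [:- complex_of_real (x i), 1:])"
    using assms by (auto simp: spectral_orbit_def)
  obtain V where "V \<in> unitary_group n" "H = V * real_diag n x * mat_adjoint V"
    using hermitian_diagonalization[OF H] unfolding real_diag_def by blast
  then show ?thesis using orbit_law_conjugate real_diag_herm by simp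
qed

definition conj_invariant :: "nat \<Rightarrow> complex mat measure \<Rightarrow> bool" where
  "conj_invariant n \<mu> \<longleftrightarrow> sets \<mu> = sets (herm_borel n) \<and> prob_space \<mu> \<and>
    (\<forall>U\<in>unitary_group n. distr \<mu> (herm_borel n) (\<lambda>H. U * H * mat_adjoint U) = \<mu>)"

lemma AE_haar_unitary:
  assumes "\<And>U. U \<in> unitary_group n \<Longrightarrow> P U" and "{U \<in> carrier_mat n n. P U} \<in> sets (mat_borel n)"
  shows "AE U in haar n. P U"
  unfolding haar_def
proof (subst AE_distr_iff[OF measurable_gs_mat])
  show "{x \<in> space (mat_borel n). P x} \<in> sets (mat_borel n)" using assms(2) by simp
  show "AE \<omega> in gauss_rows n. P (gs_mat n \<omega>)"
    using AE_gs_mat_unitary by eventually_elim (rule assms(1))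
qed

text \<open>
  Replacing \<open>H\<close> by \<open>U H U\<^sup>*\<close> with an independent Haar distributed \<open>U\<close> does not change an invariant law.
\<close>

lemma conj_invariant_mixture:
  assumes \<mu>: "conj_invariant n \<mu>" and g: "g \<in> borel_measurable (herm_borel n)"
  shows "(\<integral>\<^sup>+H. g H \<partial>\<mu>) = (\<integral>\<^sup>+H. (\<integral>\<^sup>+H'. g H' \<partial>orbit_law n H) \<partial>\<mu>)"
proof -
  interpret mu: prob_space \<mu> using \<mu> by (simp add: conj_invariant_def)
  interpret h: prob_space "haar n" by (rule prob_space_haar)
  interpret hm: pair_sigma_finite "haar n" \<mu> ..
  have s [measurable_cong]: "sets \<mu> = sets (herm_borel n)" using \<mu> by (simp add: conj_invariant_def)
  have sp: "space \<mu> = herm n" using sets_eq_imp_space_eq[OF s] by simp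
  have m2: "(\<lambda>p. fst p * snd p * mat_adjoint (fst p)) \<in> haar n \<Otimes>\<^sub>M \<mu> \<rightarrow>\<^sub>M herm_borel n"
  proof (rule measurable_conjugate)
    show "fst \<in> haar n \<Otimes>\<^sub>M \<mu> \<rightarrow>\<^sub>M mat_borel n"
      using measurable_fst[of "haar n" \<mu>] unfolding measurable_cong_sets[OF refl sets_haar] .
    show "snd \<in> haar n \<Otimes>\<^sub>M \<mu> \<rightarrow>\<^sub>M herm_borel n"
      using measurable_snd[of "haar n" \<mu>] unfolding measurable_cong_sets[OF refl s] .
  qed
  have ind: "(\<lambda>p. g (fst p * snd p * mat_adjoint (fst p))) \<in> borel_measurable (haar n \<Otimes>\<^sub>M \<mu>)"
    by (rule measurable_compose[OF m2 g])
  have inner: "(\<integral>\<^sup>+H. g (U * H * mat_adjoint U) \<partial>\<mu>) = (\<integral>\<^sup>+H. g H \<partial>\<mu>)" if U: "U \<in> unitary_group n" for U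
  proof -
    have m: "(\<lambda>H. U * H * mat_adjoint U) \<in> \<mu> \<rightarrow>\<^sub>M herm_borel n"
      unfolding measurable_cong_sets[OF s refl]
      by (rule measurable_conjugate) (use unitary_groupD(1)[OF U] in auto)
    have "(\<integral>\<^sup>+H. g H \<partial>\<mu>) = (\<integral>\<^sup>+H. g H \<partial>distr \<mu> (herm_borel n) (\<lambda>H. U * H * mat_adjoint U))"
      using \<mu> U by (simp add: conj_invariant_def)
    also have "\<dots> = (\<integral>\<^sup>+H. g (U * H * mat_adjoint U) \<partial>\<mu>)"
      by (subst nn_integral_distr[OF m]) (use g in simp_all)
    finally show ?thesis by simp
  qed
  have "AE U in haar n. (\<integral>\<^sup>+H. g (U * H * mat_adjoint U) \<partial>\<mu>) = (\<integral>\<^sup>+H. g H \<partial>\<mu>)"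
  proof (rule AE_haar_unitary[OF inner])
    have "(\<lambda>U. \<integral>\<^sup>+H. g (U * H * mat_adjoint U) \<partial>\<mu>) \<in> borel_measurable (haar n)"
      using mu.borel_measurable_nn_integral_fst[OF ind] by simp
    then have [measurable]: "(\<lambda>U. \<integral>\<^sup>+H. g (U * H * mat_adjoint U) \<partial>\<mu>) \<in> borel_measurable (mat_borel n)"
      unfolding measurable_cong_sets[OF sets_haar refl] .
    have "{U \<in> space (mat_borel n). (\<integral>\<^sup>+H. g (U * H * mat_adjoint U) \<partial>\<mu>) = (\<integral>\<^sup>+H. g H \<partial>\<mu>)} \<in> sets (mat_borel n)"
      by measurable
    then show "{U \<in> carrier_mat n n. (\<integral>\<^sup>+H. g (U * H * mat_adjoint U) \<partial>\<mu>) = (\<integral>\<^sup>+H. g H \<partial>\<mu>)} \<in> sets (mat_borel n)"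
      by simp
  qed
  then have "(\<integral>\<^sup>+H. g H \<partial>\<mu>) = (\<integral>\<^sup>+U. \<integral>\<^sup>+H. g (U * H * mat_adjoint U) \<partial>\<mu> \<partial>haar n)"
    by (subst nn_integral_cong_AE[of _ "\<lambda>_. (\<integral>\<^sup>+H. g H \<partial>\<mu>)"]) (auto simp: h.emeasure_space_1 simp del: space_haar)
  also have "\<dots> = (\<integral>\<^sup>+H. \<integral>\<^sup>+U. g (U * H * mat_adjoint U) \<partial>haar n \<partial>\<mu>)"
    by (rule hm.Fubini'[symmetric]) (use ind in \<open>simp add: split_beta'\<close>)
  also have "\<dots> = (\<integral>\<^sup>+H. (\<integral>\<^sup>+H'. g H' \<partial>orbit_law n H) \<partial>\<mu>)"
  proof (rule nn_integral_cong)
    fix H assume "H \<in> space \<mu>"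
    then have H: "H \<in> herm n" by (simp add: sp)
    show "(\<integral>\<^sup>+U. g (U * H * mat_adjoint U) \<partial>haar n) = (\<integral>\<^sup>+H'. g H' \<partial>orbit_law n H)"
      unfolding orbit_law_def by (subst nn_integral_distr[OF measurable_orbit_map[OF H]]) (use g in simp_all)
  qed
  finally show ?thesis .
qed

lemma is_orbital_measure_iff:
  "is_orbital_measure n x \<mu> \<longleftrightarrow> conj_invariant n \<mu> \<and> (AE H in \<mu>. H \<in> spectral_orbit n x)"
  by (auto simp: is_orbital_measure_def conj_invariant_def)

text \<open>
  An invariant law is a mixture of orbit laws, and on a spectral orbit these all coincide.
\<close>

lemma is_orbital_measure_unique:
  assumes "is_orbital_measure n x \<mu>"
  shows "\<mu> = orbit_law n (real_diag n x)"
proof (rule measure_eqI)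
  have \<mu>: "conj_invariant n \<mu>" and ae: "AE H in \<mu>. H \<in> spectral_orbit n x"
    using assms by (auto simp: is_orbital_measure_iff)
  interpret mu: prob_space \<mu> using \<mu> by (simp add: conj_invariant_def)
  show "sets \<mu> = sets (orbit_law n (real_diag n x))"
    using \<mu> by (simp add: conj_invariant_def orbit_law_def)
  fix S assume "S \<in> sets \<mu>"
  then have S: "S \<in> sets (herm_borel n)" using \<mu> by (simp add: conj_invariant_def)
  have so: "sets (orbit_law n H) = sets (herm_borel n)" for H by (simp add: orbit_law_def)
  have "emeasure \<mu> S = (\<integral>\<^sup>+H. indicator S H \<partial>\<mu>)" using \<open>S \<in> sets \<mu>\<close> by simp
  also have "\<dots> = (\<integral>\<^sup>+H. (\<integral>\<^sup>+H'. indicator S H' \<partial>orbit_law n H) \<partial>\<mu>)"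
    by (rule conj_invariant_mixture[OF \<mu>]) (use S in measurable)
  also have "\<dots> = (\<integral>\<^sup>+H. emeasure (orbit_law n H) S \<partial>\<mu>)" using S by (simp add: so)
  also have "\<dots> = (\<integral>\<^sup>+H. emeasure (orbit_law n (real_diag n x)) S \<partial>\<mu>)"
    by (rule nn_integral_cong_AE) (use ae in eventually_elim, simp add: orbit_law_spectral_orbit)
  also have "\<dots> = emeasure (orbit_law n (real_diag n x)) S"
    by (simp add: mu.emeasure_space_1)
  finally show "emeasure \<mu> S = emeasure (orbit_law n (real_diag n x)) S" .
qed

section \<open>Orbital measures and sorted eigenvalues\<close>

definition coeff_measurable :: "'w measure \<Rightarrow> ('w \<Rightarrow> complex poly) \<Rightarrow> bool" where
  "coeff_measurable M p \<longleftrightarrow> (\<forall>j. (\<lambda>\<omega>. poly.coeff (p \<omega>) j) \<in> borel_measurable M)"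

lemma coeff_measurable_const: "coeff_measurable M (\<lambda>_. c)"
  by (simp add: coeff_measurable_def)

lemma coeff_measurable_add:
  "coeff_measurable M p \<Longrightarrow> coeff_measurable M q \<Longrightarrow> coeff_measurable M (\<lambda>\<omega>. p \<omega> + q \<omega>)"
  by (simp add: coeff_measurable_def borel_measurable_add)

lemma coeff_measurable_mult:
  "coeff_measurable M p \<Longrightarrow> coeff_measurable M q \<Longrightarrow> coeff_measurable M (\<lambda>\<omega>. p \<omega> * q \<omega>)"
  unfolding coeff_measurable_def coeff_mult
  by (intro allI borel_measurable_sum borel_measurable_times) auto

lemma coeff_measurable_sum:
  "(\<And>i. i \<in> I \<Longrightarrow> coeff_measurable M (p i)) \<Longrightarrow> coeff_measurable M (\<lambda>\<omega>. \<Sum>i\<in>I. p i \<omega>)"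
  unfolding coeff_measurable_def coeff_sum by (intro allI borel_measurable_sum) auto

lemma coeff_measurable_prod:
  "(\<And>i. i \<in> I \<Longrightarrow> coeff_measurable M (p i)) \<Longrightarrow> coeff_measurable M (\<lambda>\<omega>. \<Prod>i\<in>I. p i \<omega>)"
  by (induction I rule: infinite_finite_induct) (auto intro: coeff_measurable_const coeff_measurable_mult)

lemma coeff_measurable_monomial:
  "f \<in> borel_measurable M \<Longrightarrow> coeff_measurable M (\<lambda>\<omega>. [:f \<omega>:])"
  by (auto simp: coeff_measurable_def coeff_pCons split: nat.split)

lemma coeff_measurable_char_poly:
  assumes f: "f \<in> M \<rightarrow>\<^sub>M mat_borel n"
  shows "coeff_measurable M (\<lambda>\<omega>. char_poly (f \<omega>))"
proof -
  let ?q = "\<lambda>\<omega>. \<Sum>p\<in>{p. p permutes {0..<n}}. signof p * (\<Prod>i\<in>{0..<n}. (if i = p i then [:0, 1:] else 0) + [:- f \<omega> $$ (i, p i):])"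
  have eq: "char_poly (f \<omega>) = ?q \<omega>" if "\<omega> \<in> space M" for \<omega>
  proof -
    have c: "f \<omega> \<in> carrier_mat n n" using measurable_space[OF f that] by simp
    have "char_poly (f \<omega>) = (\<Sum>p\<in>{p. p permutes {0..<n}}. signof p * (\<Prod>i\<in>{0..<n}. char_poly_matrix (f \<omega>) $$ (i, p i)))"
      unfolding char_poly_def by (rule det_def') (use c in simp)
    also have "\<dots> = ?q \<omega>"
    proof (intro sum.cong refl arg_cong2[where f="(*)"] prod.cong)
      fix p i assume "p \<in> {p. p permutes {0..<n}}" "i \<in> {0..<n}"
      then have "i < n" "p i < n" by (auto dest: permutes_in_image)
      then show "char_poly_matrix (f \<omega>) $$ (i, p i) = (if i = p i then [:0, 1:] else 0) + [:- f \<omega> $$ (i, p i):]"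
        using c by (auto simp: char_poly_matrix_def)
    qed
    finally show ?thesis .
  qed
  have m: "(\<lambda>\<omega>. - f \<omega> $$ (i, j)) \<in> borel_measurable M" if "i < n" "j < n" for i j
    using measurable_compose[OF f measurable_mat_entry[OF that]] by (rule borel_measurable_uminus)
  have "coeff_measurable M ?q"
  proof (intro coeff_measurable_sum coeff_measurable_mult coeff_measurable_const coeff_measurable_prod coeff_measurable_add coeff_measurable_monomial)
    fix p i assume "p \<in> {p. p permutes {0..<n}}" "i \<in> {0..<n}"
    then show "(\<lambda>\<omega>. - f \<omega> $$ (i, p i)) \<in> borel_measurable M" by (intro m) (auto dest: permutes_in_image)
  qed
  then have q: "(\<lambda>\<omega>. poly.coeff (?q \<omega>) j) \<in> borel_measurable M" for j
    unfolding coeff_measurable_def by blast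
  show ?thesis
    unfolding coeff_measurable_def
  proof
    fix j
    show "(\<lambda>\<omega>. poly.coeff (char_poly (f \<omega>)) j) \<in> borel_measurable M"
      by (rule measurable_cong[THEN iffD1, OF _ q]) (simp only: eq)
  qed
qed

lemma sets_spectral_orbit: "spectral_orbit n x \<in> sets (herm_borel n)"
proof -
  let ?p = "\<Prod>i\<in>{1..n}. [:- complex_of_real (x i), 1:]"
  have [measurable]: "(\<lambda>H. poly.coeff (char_poly H) j) \<in> borel_measurable (herm_borel n)" for j
    using coeff_measurable_char_poly[OF measurable_herm_mat] by (simp add: coeff_measurable_def)
  have "spectral_orbit n x = {H \<in> space (herm_borel n). \<forall>j. poly.coeff (char_poly H) j = poly.coeff ?p j}"
    by (auto simp: spectral_orbit_def poly_eq_iff)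
  also have "\<dots> \<in> sets (herm_borel n)" by measurable
  finally show ?thesis .
qed

text \<open>
  The adjoint of \<open>U\<close> stands on the left because \<open>haar\<close> is right invariant: conjugation by \<open>V\<close> becomes right
  multiplication of \<open>U\<close> by \<open>V\<^sup>*\<close>.
\<close>

lemma is_orbital_measure_exists:
  "is_orbital_measure n x (distr (haar n) (herm_borel n) (\<lambda>U. mat_adjoint U * real_diag n x * mat_adjoint (mat_adjoint U)))"
    (is "is_orbital_measure n x ?\<mu>")
proof -
  let ?h = "\<lambda>U. mat_adjoint U * real_diag n x * mat_adjoint (mat_adjoint U)"
  have h: "?h \<in> mat_borel n \<rightarrow>\<^sub>M herm_borel n"
    by (rule measurable_conjugate[OF measurable_mat_adjoint[OF measurable_id_mat] measurable_const]) (simp add: real_diag_herm)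
  have h': "?h \<in> haar n \<rightarrow>\<^sub>M herm_borel n" using h unfolding measurable_cong_sets[OF sets_haar refl] .
  have "distr ?\<mu> (herm_borel n) (\<lambda>H. V * H * mat_adjoint V) = ?\<mu>" if V: "V \<in> unitary_group n" for V
  proof -
    note v = unitary_groupD[OF V]
    have va: "mat_adjoint V \<in> carrier_mat n n" using v by simp
    have mV: "(\<lambda>H. V * H * mat_adjoint V) \<in> herm_borel n \<rightarrow>\<^sub>M herm_borel n"
      by (rule measurable_conjugate) (use v in auto)
    have mU: "(\<lambda>U. U * mat_adjoint V) \<in> haar n \<rightarrow>\<^sub>M mat_borel n"
      unfolding measurable_cong_sets[OF sets_haar refl] by (rule measurable_mat_mult) (use va in auto)
    have "distr ?\<mu> (herm_borel n) (\<lambda>H. V * H * mat_adjoint V) = distr (haar n) (herm_borel n) (\<lambda>U. V * ?h U * mat_adjoint V)"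
      by (subst distr_distr[OF mV h']) (simp add: o_def)
    also have "\<dots> = distr (haar n) (herm_borel n) (\<lambda>U. ?h (U * mat_adjoint V))"
    proof (rule distr_cong)
      fix U assume "U \<in> space (haar n)"
      then have U: "U \<in> carrier_mat n n" by simp
      then have Ua: "mat_adjoint U \<in> carrier_mat n n" by simp
      have "mat_adjoint (U * mat_adjoint V) = V * mat_adjoint U"
        using mat_adjoint_mult[OF U va] mat_adjoint_adjoint[OF v(1)] by simp
      then show "V * ?h U * mat_adjoint V = ?h (U * mat_adjoint V)"
        using unitary_conjugation_comp[OF v(1) Ua real_diag_carrier] by simp
    qed simp_all
    also have "\<dots> = distr (distr (haar n) (mat_borel n) (\<lambda>U. U * mat_adjoint V)) (herm_borel n) ?h"
      by (subst distr_distr[OF h mU]) (simp add: o_def)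
    also have "\<dots> = ?\<mu>" unfolding haar_right_invariant[OF v(4)] ..
    finally show ?thesis .
  qed
  moreover have "prob_space ?\<mu>" by (rule prob_space.prob_space_distr[OF prob_space_haar h'])
  moreover have "AE H in ?\<mu>. H \<in> spectral_orbit n x"
  proof -
    have so: "?h U \<in> spectral_orbit n x" if "U \<in> unitary_group n" for U
      by (rule spectral_orbit_unitary_conjugate) (use unitary_groupD[OF that] real_diag_spectral_orbit in auto)
    have "AE U in haar n. ?h U \<in> spectral_orbit n x"
    proof (rule AE_haar_unitary[OF so])
      have "?h -` spectral_orbit n x \<inter> space (mat_borel n) \<in> sets (mat_borel n)"
        by (rule measurable_sets[OF h sets_spectral_orbit])
      moreover have "?h -` spectral_orbit n x \<inter> space (mat_borel n) = {U \<in> carrier_mat n n. ?h U \<in> spectral_orbit n x}"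
        by auto
      ultimately show "{U \<in> carrier_mat n n. ?h U \<in> spectral_orbit n x} \<in> sets (mat_borel n)" by simp
    qed
    moreover have "{H \<in> space (herm_borel n). H \<in> spectral_orbit n x} \<in> sets (herm_borel n)"
    proof -
      have "{H \<in> space (herm_borel n). H \<in> spectral_orbit n x} = spectral_orbit n x"
        by (auto simp: spectral_orbit_def)
      then show ?thesis using sets_spectral_orbit by simp
    qed
    ultimately show ?thesis by (subst AE_distr_iff[OF h']) auto
  qed
  ultimately show ?thesis by (simp add: is_orbital_measure_def)
qed

lemma is_orbital_measure_orbit_law: "is_orbital_measure n x (orbit_law n (real_diag n x))"
  using is_orbital_measure_exists[of n x] is_orbital_measure_unique[OF is_orbital_measure_exists[of n x]] by simp

lemma orbital_measure_eq: "orbital_measure n x = orbit_law n (real_diag n x)"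
  unfolding orbital_measure_def
proof (rule the_equality)
  show "is_orbital_measure n x (orbit_law n (real_diag n x))" by (rule is_orbital_measure_orbit_law)
qed (rule is_orbital_measure_unique)

lemma orbital_measure_props:
  "conj_invariant n (orbital_measure n x)" "AE H in orbital_measure n x. H \<in> spectral_orbit n x"
  using is_orbital_measure_orbit_law[of n x] unfolding is_orbital_measure_iff orbital_measure_eq by simp_all

definition sorted_eigenvalues :: "nat \<Rightarrow> complex mat \<Rightarrow> nat \<Rightarrow> real" where
  "sorted_eigenvalues n H = (THE y. y \<in> weyl_chamber n \<and> H \<in> spectral_orbit n y)"

lemma spectral_orbit_unique:
  assumes "y \<in> weyl_chamber n" "H \<in> spectral_orbit n y" "y' \<in> weyl_chamber n" "H \<in> spectral_orbit n y'"
  shows "y = y'"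
proof (rule extensionalityI)
  show "y \<in> extensional {1..n}" "y' \<in> extensional {1..n}" using assms by (auto simp: weyl_chamber_def)
  show "y i = y' i" if "i \<in> {1..n}" for i
    by (rule chamber_roots_unique[OF _ _ _ that]) (use assms in \<open>auto simp: weyl_chamber_def spectral_orbit_def\<close>)
qed

lemma sorted_eigenvalues_eq: "y \<in> weyl_chamber n \<Longrightarrow> H \<in> spectral_orbit n y \<Longrightarrow> sorted_eigenvalues n H = y"
  unfolding sorted_eigenvalues_def by (rule the_equality) (auto intro: spectral_orbit_unique)

lemma sorted_eigenvalues_spec:
  assumes "H \<in> herm n" shows "sorted_eigenvalues n H \<in> weyl_chamber n" "H \<in> spectral_orbit n (sorted_eigenvalues n H)"
proof -
  obtain y where "y \<in> weyl_chamber n" "H \<in> spectral_orbit n y" using hermitian_spectrum[OF assms] .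
  with sorted_eigenvalues_eq[OF this] show "sorted_eigenvalues n H \<in> weyl_chamber n" "H \<in> spectral_orbit n (sorted_eigenvalues n H)" by simp_all
qed

lemma space_chamber [simp]: "space (chamber_lebesgue k) = weyl_chamber k"
  by (auto simp: chamber_lebesgue_def space_restrict_space space_PiM weyl_chamber_def PiE_def)

lemma measurable_chamberI:
  assumes "\<And>i. i \<in> {1..k} \<Longrightarrow> (\<lambda>\<omega>. f \<omega> i) \<in> borel_measurable M" and "f \<in> space M \<rightarrow> weyl_chamber k"
  shows "f \<in> M \<rightarrow>\<^sub>M chamber_lebesgue k"
  unfolding chamber_lebesgue_def
proof (rule measurable_restrict_space2[OF assms(2)])
  have "(\<lambda>\<omega>. \<lambda>i\<in>{1..k}. f \<omega> i) \<in> M \<rightarrow>\<^sub>M PiM {1..k} (\<lambda>_. lborel)"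
    by (rule measurable_restrict) (use assms(1) in simp)
  then show "f \<in> M \<rightarrow>\<^sub>M PiM {1..k} (\<lambda>_. lborel)"
    by (rule measurable_cong[THEN iffD1, rotated])
       (use assms(2) in \<open>auto simp: weyl_chamber_def extensional_restrict Pi_iff\<close>)
qed

lemma measurable_chamber_component: "i \<in> {1..k} \<Longrightarrow> (\<lambda>Y. Y i) \<in> borel_measurable (chamber_lebesgue k)"
  unfolding chamber_lebesgue_def by (rule measurable_restrict_space1) (rule measurable_component_lborel)

lemma measurable_sorted_eigenvalues: "sorted_eigenvalues n \<in> herm_borel n \<rightarrow>\<^sub>M chamber_lebesgue n"
proof (rule measurable_chamberI)
  show "sorted_eigenvalues n \<in> space (herm_borel n) \<rightarrow> weyl_chamber n" using sorted_eigenvalues_spec by auto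
  fix i assume i: "i \<in> {1..n}"
  show "(\<lambda>H. sorted_eigenvalues n H i) \<in> borel_measurable (herm_borel n)"
  proof (rule borel_measurable_roots[where k=n and p=char_poly])
    show "(\<lambda>H. poly.coeff (char_poly H) j) \<in> borel_measurable (herm_borel n)" for j
      using coeff_measurable_char_poly[OF measurable_herm_mat] by (simp add: coeff_measurable_def)
    show "mono_on {1..n} (sorted_eigenvalues n H)" "char_poly H = (\<Prod>i\<in>{1..n}. [:- complex_of_real (sorted_eigenvalues n H i), 1:])"
      if "H \<in> space (herm_borel n)" for H
      using sorted_eigenvalues_spec[of H n] that by (auto simp: weyl_chamber_def spectral_orbit_def)
  qed (rule i)
qed

lemma measurable_real_diag: "real_diag k \<in> chamber_lebesgue k \<rightarrow>\<^sub>M herm_borel k"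
proof (rule measurable_herm_borelI)
  show "real_diag k \<in> space (chamber_lebesgue k) \<rightarrow> herm k" using real_diag_herm by simp
  fix i j assume ij: "i < k" "j < k"
  have [measurable]: "(\<lambda>Y. Y (Suc i)) \<in> borel_measurable (chamber_lebesgue k)"
    by (rule measurable_chamber_component) (use ij in auto)
  have "(\<lambda>Y. if i = j then complex_of_real (Y (Suc i)) else 0) \<in> borel_measurable (chamber_lebesgue k)"
    by measurable
  then show "(\<lambda>Y. real_diag k Y $$ (i, j)) \<in> borel_measurable (chamber_lebesgue k)"
    using ij by (simp add: real_diag_def diag_of_def)
qed

lemma measurable_orbital_measure:
  assumes g: "g \<in> borel_measurable (herm_borel k)"
  shows "(\<lambda>Y. \<integral>\<^sup>+H. g H \<partial>orbital_measure k Y) \<in> borel_measurable (chamber_lebesgue k)"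
proof -
  interpret h: prob_space "haar k" by (rule prob_space_haar)
  have m2: "(\<lambda>p. snd p * real_diag k (fst p) * mat_adjoint (snd p)) \<in> chamber_lebesgue k \<Otimes>\<^sub>M haar k \<rightarrow>\<^sub>M herm_borel k"
  proof (rule measurable_conjugate)
    show "snd \<in> chamber_lebesgue k \<Otimes>\<^sub>M haar k \<rightarrow>\<^sub>M mat_borel k"
      using measurable_snd[of "chamber_lebesgue k" "haar k"] unfolding measurable_cong_sets[OF refl sets_haar] .
    show "(\<lambda>p. real_diag k (fst p)) \<in> chamber_lebesgue k \<Otimes>\<^sub>M haar k \<rightarrow>\<^sub>M herm_borel k"
      by (rule measurable_compose[OF measurable_fst measurable_real_diag])
  qed
  have "(\<integral>\<^sup>+H. g H \<partial>orbital_measure k Y) = (\<integral>\<^sup>+U. g (U * real_diag k Y * mat_adjoint U) \<partial>haar k)" for Y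
    unfolding orbital_measure_eq orbit_law_def
    by (subst nn_integral_distr[OF measurable_orbit_map[OF real_diag_herm]]) (use g in simp_all)
  then show ?thesis using h.borel_measurable_nn_integral_fst[OF measurable_compose[OF m2 g]] by simp
qed

text \<open>
  Given its eigenvalues, a matrix with an invariant law is distributed according to their orbital measure.
\<close>

lemma conj_invariant_radial:
  assumes \<mu>: "conj_invariant k \<mu>" and g: "g \<in> borel_measurable (herm_borel k)"
  shows "(\<integral>\<^sup>+H. g H \<partial>\<mu>) = (\<integral>\<^sup>+Y. (\<integral>\<^sup>+H. g H \<partial>orbital_measure k Y) \<partial>distr \<mu> (chamber_lebesgue k) (sorted_eigenvalues k))"
proof -
  have s: "sets \<mu> = sets (herm_borel k)" using \<mu> by (simp add: conj_invariant_def)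
  have me: "sorted_eigenvalues k \<in> \<mu> \<rightarrow>\<^sub>M chamber_lebesgue k"
    unfolding measurable_cong_sets[OF s refl] by (rule measurable_sorted_eigenvalues)
  have "(\<integral>\<^sup>+Y. (\<integral>\<^sup>+H. g H \<partial>orbital_measure k Y) \<partial>distr \<mu> (chamber_lebesgue k) (sorted_eigenvalues k))
      = (\<integral>\<^sup>+H. (\<integral>\<^sup>+H'. g H' \<partial>orbital_measure k (sorted_eigenvalues k H)) \<partial>\<mu>)"
    by (subst nn_integral_distr[OF me]) (use measurable_orbital_measure[OF g] in simp_all)
  also have "\<dots> = (\<integral>\<^sup>+H. (\<integral>\<^sup>+H'. g H' \<partial>orbit_law k H) \<partial>\<mu>)"
  proof (rule nn_integral_cong)
    fix H assume "H \<in> space \<mu>"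
    then have "H \<in> herm k" using sets_eq_imp_space_eq[OF s] by simp
    then show "(\<integral>\<^sup>+H'. g H' \<partial>orbital_measure k (sorted_eigenvalues k H)) = (\<integral>\<^sup>+H'. g H' \<partial>orbit_law k H)"
      using orbit_law_spectral_orbit[OF sorted_eigenvalues_spec(2)] by (simp add: orbital_measure_eq)
  qed
  also have "\<dots> = (\<integral>\<^sup>+H. g H \<partial>\<mu>)" by (rule conj_invariant_mixture[OF \<mu> g, symmetric])
  finally show ?thesis by simp
qed

text \<open>
  The orbital measure of \<open>Y\<close> is concentrated on matrices with eigenvalues \<open>Y\<close>, so the mixing measure can be
  recovered as the law of the eigenvalues.
\<close>

lemma radial_measure_unique:
  assumes s: "sets \<mu> = sets (herm_borel k)" and n: "sets \<nu> = sets (chamber_lebesgue k)"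
    and mix: "\<And>S. S \<in> sets (herm_borel k) \<Longrightarrow> emeasure \<mu> S = (\<integral>\<^sup>+Y. emeasure (orbital_measure k Y) S \<partial>\<nu>)"
  shows "\<nu> = distr \<mu> (chamber_lebesgue k) (sorted_eigenvalues k)"
proof (rule measure_eqI)
  show "sets \<nu> = sets (distr \<mu> (chamber_lebesgue k) (sorted_eigenvalues k))" by (simp add: n)
  fix T assume "T \<in> sets \<nu>"
  then have T: "T \<in> sets (chamber_lebesgue k)" by (simp add: n)
  define S where "S = sorted_eigenvalues k -` T \<inter> herm k"
  have S: "S \<in> sets (herm_borel k)"
    using measurable_sets[OF measurable_sorted_eigenvalues T] by (simp add: S_def)
  have me: "sorted_eigenvalues k \<in> \<mu> \<rightarrow>\<^sub>M chamber_lebesgue k"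
    unfolding measurable_cong_sets[OF s refl] by (rule measurable_sorted_eigenvalues)
  have "emeasure (distr \<mu> (chamber_lebesgue k) (sorted_eigenvalues k)) T = emeasure \<mu> S"
    using emeasure_distr[OF me T] sets_eq_imp_space_eq[OF s] by (simp add: S_def)
  also have "\<dots> = (\<integral>\<^sup>+Y. emeasure (orbital_measure k Y) S \<partial>\<nu>)" by (rule mix[OF S])
  also have "\<dots> = (\<integral>\<^sup>+Y. indicator T Y \<partial>\<nu>)"
  proof (rule nn_integral_cong)
    fix Y assume "Y \<in> space \<nu>"
    then have Y: "Y \<in> weyl_chamber k" using sets_eq_imp_space_eq[OF n] by simp
    note p = orbital_measure_props[of k Y]
    interpret o: prob_space "orbital_measure k Y" using p by (simp add: conj_invariant_def)
    have so: "sets (orbital_measure k Y) = sets (herm_borel k)" using p by (simp add: conj_invariant_def)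
    have "AE H in orbital_measure k Y. (H \<in> S) = (Y \<in> T)"
      using p(2)
    proof eventually_elim
      case (elim H)
      then have "sorted_eigenvalues k H = Y" using sorted_eigenvalues_eq[OF Y] by simp
      then show ?case using elim by (auto simp: S_def spectral_orbit_def)
    qed
    then have "(\<integral>\<^sup>+H. indicator S H \<partial>orbital_measure k Y) = (\<integral>\<^sup>+H. indicator T Y \<partial>orbital_measure k Y)"
      by (intro nn_integral_cong_AE) (auto elim!: eventually_mono simp: indicator_def)
    then show "emeasure (orbital_measure k Y) S = indicator T Y"
      using S so o.emeasure_space_1 by simp
  qed
  also have "\<dots> = emeasure \<nu> T" using T n by simp
  finally show "emeasure \<nu> T = emeasure (distr \<mu> (chamber_lebesgue k) (sorted_eigenvalues k)) T" by simp
qed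

section \<open>Corners and the radial part\<close>

lemma corner_entry: "i < k \<Longrightarrow> j < k \<Longrightarrow> corner k H $$ (i, j) = H $$ (i, j)"
  by (simp add: corner_def)

lemma corner_carrier [simp]: "corner k H \<in> carrier_mat k k"
  by (simp add: corner_def)

lemma corner_herm:
  assumes "H \<in> herm n" "k \<le> n" shows "corner k H \<in> herm k"
proof -
  have "mat_adjoint (corner k H) = corner k H"
  proof (rule eq_matI)
    fix i j assume "i < dim_row (corner k H)" "j < dim_col (corner k H)"
    then have ij: "i < k" "j < k" by (auto simp: corner_def)
    have "H $$ (i, j) = cnj (H $$ (j, i))"
      using mat_adjoint_index[OF herm_carrier[OF assms(1)], of i j] assms ij by (simp add: herm_def)
    then show "mat_adjoint (corner k H) $$ (i, j) = corner k H $$ (i, j)"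
      using ij by (simp add: mat_adjoint_index[OF corner_carrier] corner_entry)
  qed (use carrier_matD[OF mat_adjoint_carrier[OF corner_carrier[of k H]]] carrier_matD[OF corner_carrier[of k H]] in simp_all)
  then show ?thesis by (simp add: herm_def)
qed

lemma measurable_corner: "k \<le> n \<Longrightarrow> corner k \<in> herm_borel n \<rightarrow>\<^sub>M herm_borel k"
  by (rule measurable_herm_borelI) (auto simp: corner_entry intro: measurable_herm_entry corner_herm)

lemma corner_corner: "k \<le> m \<Longrightarrow> corner k (corner m H) = corner k H"
  by (rule eq_matI) (auto simp: corner_def)

definition extend_unitary :: "nat \<Rightarrow> nat \<Rightarrow> complex mat \<Rightarrow> complex mat" where
  "extend_unitary n k U = mat n n (\<lambda>(i, j). if i < k \<and> j < k then U $$ (i, j) else if i = j then 1 else 0)"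

lemma sum_restrict_lessThan:
  "k \<le> n \<Longrightarrow> (\<And>l. k \<le> l \<Longrightarrow> l < n \<Longrightarrow> f l = 0) \<Longrightarrow> (\<Sum>l\<in>{0..<n}. f l) = (\<Sum>l\<in>{0..<k}. f l)"
  for f :: "nat \<Rightarrow> 'a::comm_monoid_add"
  by (rule sum.mono_neutral_right) auto

lemma extend_unitary:
  assumes U: "U \<in> unitary_group k" and k: "k \<le> n"
  shows "extend_unitary n k U \<in> unitary_group n"
    and "H \<in> carrier_mat n n \<Longrightarrow>
      corner k (extend_unitary n k U * H * mat_adjoint (extend_unitary n k U)) = U * corner k H * mat_adjoint U"
proof -
  let ?W = "extend_unitary n k U"
  note u = unitary_groupD[OF U]
  have W: "?W \<in> carrier_mat n n" and Wa: "mat_adjoint ?W \<in> carrier_mat n n"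
    by (simp_all add: extend_unitary_def)
  have ent: "?W $$ (i, j) = (if i < k \<and> j < k then U $$ (i, j) else if i = j then 1 else 0)" if "i < n" "j < n" for i j
    using that by (simp add: extend_unitary_def)
  have "?W * mat_adjoint ?W = 1\<^sub>m n"
  proof (rule eq_matI)
    fix i j assume "i < dim_row (1\<^sub>m n :: complex mat)" "j < dim_col (1\<^sub>m n :: complex mat)"
    then have ij: "i < n" "j < n" by auto
    have "(?W * mat_adjoint ?W) $$ (i, j) = (\<Sum>l\<in>{0..<n}. ?W $$ (i, l) * mat_adjoint ?W $$ (l, j))"
      by (rule mat_mult_index[OF W Wa ij])
    also have "\<dots> = (\<Sum>l\<in>{0..<n}. ?W $$ (i, l) * cnj (?W $$ (j, l)))"
      using ij by (intro sum.cong refl) (simp add: mat_adjoint_index[OF W])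
    also have "\<dots> = (if i = j then 1 else 0)"
    proof (cases "i < k \<and> j < k")
      case True
      have "(\<Sum>l\<in>{0..<n}. ?W $$ (i, l) * cnj (?W $$ (j, l))) = (\<Sum>l\<in>{0..<k}. ?W $$ (i, l) * cnj (?W $$ (j, l)))"
        by (rule sum_restrict_lessThan[OF k]) (use True ij in \<open>auto simp: ent\<close>)
      also have "\<dots> = (\<Sum>l\<in>{0..<k}. U $$ (i, l) * mat_adjoint U $$ (l, j))"
        using True ij k by (intro sum.cong refl) (simp add: ent mat_adjoint_index[OF u(1)])
      also have "\<dots> = (U * mat_adjoint U) $$ (i, j)"
        by (rule mat_mult_index[symmetric]) (use True u in auto)
      also have "\<dots> = (if i = j then 1 else 0)" unfolding u(2) using True by simp
      finally show ?thesis .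
    next
      case False
      have "(\<Sum>l\<in>{0..<n}. ?W $$ (i, l) * cnj (?W $$ (j, l))) = (\<Sum>l\<in>{0..<n}. if l = i then (if i = j then 1 else 0) else 0)"
        using False ij k by (intro sum.cong refl) (auto simp: ent)
      then show ?thesis using ij by simp
    qed
    finally show "(?W * mat_adjoint ?W) $$ (i, j) = 1\<^sub>m n $$ (i, j)" using ij by simp
  qed (use carrier_matD[OF W] carrier_matD[OF Wa] in simp_all)
  then show "?W \<in> unitary_group n"
    using mat_mult_left_right_inverse[OF W Wa] W by (simp add: unitary_group_def)
  assume H: "H \<in> carrier_mat n n"
  have WH: "?W * H \<in> carrier_mat n n" and UH: "U * corner k H \<in> carrier_mat k k" using W H u(1) by auto
  have ua: "mat_adjoint U \<in> carrier_mat k k" using u(1) by simp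
  show "corner k (?W * H * mat_adjoint ?W) = U * corner k H * mat_adjoint U"
  proof (rule eq_matI)
    show "dim_row (corner k (?W * H * mat_adjoint ?W)) = dim_row (U * corner k H * mat_adjoint U)"
      "dim_col (corner k (?W * H * mat_adjoint ?W)) = dim_col (U * corner k H * mat_adjoint U)"
      using carrier_matD[OF u(1)] carrier_matD[OF ua] by (auto simp: corner_def)
    fix i j assume "i < dim_row (U * corner k H * mat_adjoint U)" "j < dim_col (U * corner k H * mat_adjoint U)"
    then have ij: "i < k" "j < k" using carrier_matD[OF u(1)] carrier_matD[OF ua] by auto
    then have ijn: "i < n" "j < n" using k by auto
    have WHe: "(?W * H) $$ (i, l) = (U * corner k H) $$ (i, l)" if l: "l < k" for l
    proof -
      have ln: "l < n" using l k by simp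
      have "(?W * H) $$ (i, l) = (\<Sum>p\<in>{0..<n}. ?W $$ (i, p) * H $$ (p, l))"
        by (rule mat_mult_index[OF W H ijn(1) ln])
      also have "\<dots> = (\<Sum>p\<in>{0..<k}. ?W $$ (i, p) * H $$ (p, l))"
        by (rule sum_restrict_lessThan[OF k]) (use ij ijn in \<open>auto simp: ent\<close>)
      also have "\<dots> = (\<Sum>p\<in>{0..<k}. U $$ (i, p) * corner k H $$ (p, l))"
        using ij k l by (intro sum.cong refl) (simp add: ent corner_entry)
      also have "\<dots> = (U * corner k H) $$ (i, l)"
        by (rule mat_mult_index[symmetric]) (use u ij l in auto)
      finally show ?thesis .
    qed
    have "corner k (?W * H * mat_adjoint ?W) $$ (i, j) = (?W * H * mat_adjoint ?W) $$ (i, j)"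
      by (rule corner_entry[OF ij])
    also have "\<dots> = (\<Sum>l\<in>{0..<n}. (?W * H) $$ (i, l) * mat_adjoint ?W $$ (l, j))"
      by (rule mat_mult_index[OF WH Wa ijn])
    also have "\<dots> = (\<Sum>l\<in>{0..<n}. (?W * H) $$ (i, l) * cnj (?W $$ (j, l)))"
      using ijn by (intro sum.cong refl) (simp add: mat_adjoint_index[OF W])
    also have "\<dots> = (\<Sum>l\<in>{0..<k}. (?W * H) $$ (i, l) * cnj (?W $$ (j, l)))"
      by (rule sum_restrict_lessThan[OF k]) (use ij ijn in \<open>auto simp: ent\<close>)
    also have "\<dots> = (\<Sum>l\<in>{0..<k}. (U * corner k H) $$ (i, l) * mat_adjoint U $$ (l, j))"
      using ij ijn k by (intro sum.cong refl) (simp add: WHe ent mat_adjoint_index[OF u(1)] del: index_mult_mat)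
    also have "\<dots> = (U * corner k H * mat_adjoint U) $$ (i, j)"
      by (rule mat_mult_index[symmetric, OF UH ua ij])
    finally show "corner k (?W * H * mat_adjoint ?W) $$ (i, j) = (U * corner k H * mat_adjoint U) $$ (i, j)" .
  qed
qed

text \<open>
  A unitary matrix acting on the corner extends by an identity block to one that acts on the whole matrix.
\<close>

lemma conj_invariant_corner:
  assumes \<mu>: "conj_invariant n \<mu>" and k: "k \<le> n"
  shows "conj_invariant k (distr \<mu> (herm_borel k) (corner k))"
proof -
  have s: "sets \<mu> = sets (herm_borel n)" and p: "prob_space \<mu>" using \<mu> by (simp_all add: conj_invariant_def)
  have sp: "space \<mu> = herm n" using sets_eq_imp_space_eq[OF s] by simp
  have mc: "corner k \<in> \<mu> \<rightarrow>\<^sub>M herm_borel k" unfolding measurable_cong_sets[OF s refl] by (rule measurable_corner[OF k])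
  have "distr (distr \<mu> (herm_borel k) (corner k)) (herm_borel k) (\<lambda>H. U * H * mat_adjoint U) = distr \<mu> (herm_borel k) (corner k)"
    if U: "U \<in> unitary_group k" for U
  proof -
    let ?W = "extend_unitary n k U"
    have W: "?W \<in> unitary_group n" by (rule extend_unitary[OF U k])
    have mU: "(\<lambda>H. U * H * mat_adjoint U) \<in> herm_borel k \<rightarrow>\<^sub>M herm_borel k"
      by (rule measurable_conjugate) (use unitary_groupD[OF U] in auto)
    have mW: "(\<lambda>H. ?W * H * mat_adjoint ?W) \<in> \<mu> \<rightarrow>\<^sub>M herm_borel n"
      unfolding measurable_cong_sets[OF s refl] by (rule measurable_conjugate) (use unitary_groupD[OF W] in auto)
    have "distr (distr \<mu> (herm_borel k) (corner k)) (herm_borel k) (\<lambda>H. U * H * mat_adjoint U)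
        = distr \<mu> (herm_borel k) (\<lambda>H. U * corner k H * mat_adjoint U)"
      by (subst distr_distr[OF mU mc]) (simp add: o_def)
    also have "\<dots> = distr \<mu> (herm_borel k) (\<lambda>H. corner k (?W * H * mat_adjoint ?W))"
      by (rule distr_cong) (use extend_unitary(2)[OF U k] herm_carrier sp in auto)
    also have "\<dots> = distr (distr \<mu> (herm_borel n) (\<lambda>H. ?W * H * mat_adjoint ?W)) (herm_borel k) (corner k)"
      by (subst distr_distr[OF measurable_corner[OF k] mW]) (simp add: o_def)
    also have "\<dots> = distr \<mu> (herm_borel k) (corner k)"
      using \<mu> W by (simp add: conj_invariant_def)
    finally show ?thesis .
  qed
  then show ?thesis
    using prob_space.prob_space_distr[OF p mc] by (simp add: conj_invariant_def)
qed

theorem radial_part_eq: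
  assumes k: "k \<le> n"
  shows "radial_part n k x = distr (corner_measure n k x) (chamber_lebesgue k) (sorted_eigenvalues k)"
    and "prob_space (distr (corner_measure n k x) (chamber_lebesgue k) (sorted_eigenvalues k))"
proof -
  let ?\<mu> = "corner_measure n k x"
  let ?\<nu> = "distr ?\<mu> (chamber_lebesgue k) (sorted_eigenvalues k)"
  have \<mu>: "conj_invariant k ?\<mu>"
    unfolding corner_measure_def by (rule conj_invariant_corner[OF orbital_measure_props(1) k])
  then have s: "sets ?\<mu> = sets (herm_borel k)" and p: "prob_space ?\<mu>" by (simp_all add: conj_invariant_def)
  have me: "sorted_eigenvalues k \<in> ?\<mu> \<rightarrow>\<^sub>M chamber_lebesgue k"
    unfolding measurable_cong_sets[OF s refl] by (rule measurable_sorted_eigenvalues)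
  show pr: "prob_space ?\<nu>" by (rule prob_space.prob_space_distr[OF p me])
  have "emeasure ?\<mu> S = (\<integral>\<^sup>+Y. emeasure (orbital_measure k Y) S \<partial>?\<nu>)" if S: "S \<in> sets (herm_borel k)" for S
  proof -
    have so: "sets (orbital_measure k Y) = sets (herm_borel k)" for Y
      using orbital_measure_props(1)[of k Y] by (simp add: conj_invariant_def)
    have "(\<integral>\<^sup>+H. indicator S H \<partial>?\<mu>) = (\<integral>\<^sup>+Y. (\<integral>\<^sup>+H. indicator S H \<partial>orbital_measure k Y) \<partial>?\<nu>)"
      by (rule conj_invariant_radial[OF \<mu>]) (use S in measurable)
    then show ?thesis using S by (simp add: s so)
  qed
  then have "is_radial_part n k x ?\<nu>"
    unfolding is_radial_part_def using pr by simp
  moreover have "\<nu> = ?\<nu>" if "is_radial_part n k x \<nu>" for \<nu>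
    by (rule radial_measure_unique[OF s]) (use that in \<open>auto simp: is_radial_part_def\<close>)
  ultimately show "radial_part n k x = ?\<nu>"
    unfolding radial_part_def by (rule the_equality)
qed

section \<open>Characteristic polynomials of corners of codimension one\<close>

text \<open>
  At \<open>x k\<close> only the summand \<open>i = k\<close> survives. In the product of the values at neighbouring nodes, the factors
  for every other node \<open>r\<close> have equal signs, and the two remaining factors are opposite.
\<close>

lemma secular_sign_change:
  fixes x s :: "nat \<Rightarrow> real"
  assumes x: "strict_mono_on {1..n} x" and s: "\<And>i. i \<in> {1..n} \<Longrightarrow> 0 < s i" and j: "j \<in> {1..<n}"
  shows "poly (\<Sum>i\<in>{1..n}. Polynomial.smult (s i) (\<Prod>r\<in>{1..n} - {i}. [:- x r, 1:])) (x j)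
    * poly (\<Sum>i\<in>{1..n}. Polynomial.smult (s i) (\<Prod>r\<in>{1..n} - {i}. [:- x r, 1:])) (x (Suc j)) < 0"
proof -
  have ev: "poly (\<Sum>i\<in>{1..n}. Polynomial.smult (s i) (\<Prod>r\<in>{1..n} - {i}. [:- x r, 1:])) (x k) = s k * (\<Prod>r\<in>{1..n} - {k}. x k - x r)"
    if k: "k \<in> {1..n}" for k
  proof -
    have "poly (\<Sum>i\<in>{1..n}. Polynomial.smult (s i) (\<Prod>r\<in>{1..n} - {i}. [:- x r, 1:])) (x k)
        = (\<Sum>i\<in>{1..n}. s i * (\<Prod>r\<in>{1..n} - {i}. x k - x r))"
      by (simp add: poly_sum poly_prod)
    also have "\<dots> = (\<Sum>i\<in>{1..n}. if i = k then s k * (\<Prod>r\<in>{1..n} - {k}. x k - x r) else 0)"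
    proof (rule sum.cong[OF refl])
      fix i assume "i \<in> {1..n}"
      show "s i * (\<Prod>r\<in>{1..n} - {i}. x k - x r) = (if i = k then s k * (\<Prod>r\<in>{1..n} - {k}. x k - x r) else 0)"
      proof (cases "i = k")
        case False
        then have "(\<Prod>r\<in>{1..n} - {i}. x k - x r) = 0" using k by (intro prod_zero bexI[of _ k]) auto
        then show ?thesis using False by simp
      qed simp
    qed
    finally show ?thesis using k by simp
  qed
  define R where "R = {1..n} - {j, Suc j}"
  have R: "{1..n} - {j} = insert (Suc j) R" "{1..n} - {Suc j} = insert j R" "finite R" "j \<notin> R" "Suc j \<notin> R"
    using j by (auto simp: R_def)
  have lt: "x j < x (Suc j)" using j by (intro strict_mono_onD[OF x]) auto
  have "0 < (\<Prod>r\<in>R. (x j - x r) * (x (Suc j) - x r))"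
  proof (rule prod_pos)
    fix r assume r: "r \<in> R"
    then consider "r < j" | "Suc j < r" by (auto simp: R_def) (metis Suc_lessI linorder_neqE_nat)
    then show "0 < (x j - x r) * (x (Suc j) - x r)"
    proof cases
      case 1
      then have "x r < x j" using r j by (intro strict_mono_onD[OF x]) (auto simp: R_def)
      then show ?thesis using lt by (intro mult_pos_pos) auto
    next
      case 2
      then have "x (Suc j) < x r" using r j by (intro strict_mono_onD[OF x]) (auto simp: R_def)
      then show ?thesis using lt by (intro mult_neg_neg) auto
    qed
  qed
  then have "0 < (s j * s (Suc j)) * (x (Suc j) - x j)\<^sup>2 * (\<Prod>r\<in>R. (x j - x r) * (x (Suc j) - x r))"
    using s[of j] s[of "Suc j"] j lt by (intro mult_pos_pos) auto
  also have "\<dots> = - (s j * (\<Prod>r\<in>{1..n} - {j}. x j - x r) * (s (Suc j) * (\<Prod>r\<in>{1..n} - {Suc j}. x (Suc j) - x r)))"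
    unfolding R prod.insert[OF R(3,4)] prod.insert[OF R(3,5)] prod.distrib by (simp add: power2_eq_square algebra_simps)
  finally show ?thesis using j by (subst (1 2) ev) auto
qed

text \<open>
  The intermediate value theorem provides a root between any two neighbouring nodes. These are \<open>n - 1\<close> roots
  of a polynomial of degree at most \<open>n - 1\<close> with leading coefficient \<open>\<Sum>i. s i\<close>.
\<close>

lemma secular_polynomial_roots:
  fixes x s :: "nat \<Rightarrow> real"
  assumes x: "strict_mono_on {1..n} x" and s: "\<And>i. i \<in> {1..n} \<Longrightarrow> 0 < s i" and n: "1 \<le> n"
  obtains a where "strictly_interlaces n x a"
    "(\<Sum>i\<in>{1..n}. Polynomial.smult (s i) (\<Prod>r\<in>{1..n} - {i}. [:- x r, 1:]))
      = Polynomial.smult (\<Sum>i\<in>{1..n}. s i) (\<Prod>j\<in>{1..<n}. [:- a j, 1:])"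
proof -
  let ?p = "\<Sum>i\<in>{1..n}. Polynomial.smult (s i) (\<Prod>r\<in>{1..n} - {i}. [:- x r, 1:])"
  have "\<forall>j\<in>{1..<n}. \<exists>a. x j < a \<and> a < x (Suc j) \<and> poly ?p a = 0"
  proof
    fix j assume j: "j \<in> {1..<n}"
    have "x j < x (Suc j)" using j by (intro strict_mono_onD[OF x]) auto
    moreover have "poly ?p (x j) * poly ?p (x (Suc j)) < 0"
      by (rule secular_sign_change[OF x s j])
    ultimately have "\<exists>a>x j. a < x (Suc j) \<and> poly ?p a = 0" by (rule poly_IVT)
    then
    show "\<exists>a. x j < a \<and> a < x (Suc j) \<and> poly ?p a = 0" by blast
  qed
  from bchoice[OF this] obtain a where "\<forall>j\<in>{1..<n}. x j < a j \<and> a j < x (Suc j) \<and> poly ?p (a j) = 0"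
    by blast
  then have a: "x j < a j \<and> a j < x (Suc j) \<and> poly ?p (a j) = 0" if "j \<in> {1..<n}" for j
    using that by blast
  have il: "strictly_interlaces n x a" using a by (simp add: strictly_interlaces_def)
  have inj: "inj_on a {1..<n}"
    by (rule strict_mono_on_imp_inj_on[OF strictly_interlaces_strict_mono[OF x il]])
  have deg: "degree (\<Prod>r\<in>A. [:- f r, 1:]) = card A" if "finite A" for A :: "nat set" and f :: "nat \<Rightarrow> real"
    by (subst degree_prod_eq_sum_degree) auto
  have lead: "poly.coeff (\<Prod>r\<in>A. [:- f r, 1:]) (card A) = 1" if "finite A" for A :: "nat set" and f :: "nat \<Rightarrow> real"
  proof -
    have "lead_coeff (\<Prod>r\<in>A. [:- f r, 1:]) = 1" by (simp add: lead_coeff_prod)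
    then show ?thesis by (simp only: deg[OF that])
  qed
  have cd: "card ({1..n} - {i}) = n - 1" if "i \<in> {1..n}" for i using that by (simp add: card_Diff_singleton)
  have "?p = Polynomial.smult (\<Sum>i\<in>{1..n}. s i) (\<Prod>j\<in>{1..<n}. [:- a j, 1:])"
  proof (rule poly_eqI_degree_lead_coeff[where n="n - 1" and A="a ` {1..<n}"])
    have "poly.coeff ?p (n - 1) = (\<Sum>i\<in>{1..n}. s i * poly.coeff (\<Prod>r\<in>{1..n} - {i}. [:- x r, 1:]) (n - 1))"
      by (simp add: coeff_sum)
    also have "\<dots> = (\<Sum>i\<in>{1..n}. s i)"
    proof (rule sum.cong[OF refl])
      fix i assume i: "i \<in> {1..n}"
      from lead[of "{1..n} - {i}" x]
      show "s i * poly.coeff (\<Prod>r\<in>{1..n} - {i}. [:- x r, 1:]) (n - 1) = s i"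
        unfolding cd[OF i] by simp
    qed
    finally show "poly.coeff ?p (n - 1) = poly.coeff (Polynomial.smult (\<Sum>i\<in>{1..n}. s i) (\<Prod>j\<in>{1..<n}. [:- a j, 1:])) (n - 1)"
      using lead[of "{1..<n}" a] by simp
    show "n - 1 \<le> card (a ` {1..<n})" using card_image[OF inj] by simp
    show "degree ?p \<le> n - 1"
      by (intro degree_sum_le order_trans[OF degree_smult_le]) (simp_all only: deg finite_Diff finite_atLeastAtMost cd order_refl)
    show "degree (Polynomial.smult (\<Sum>i\<in>{1..n}. s i) (\<Prod>j\<in>{1..<n}. [:- a j, 1:])) \<le> n - 1"
      by (rule order_trans[OF degree_smult_le]) (simp add: deg)
    fix z assume "z \<in> a ` {1..<n}"
    then obtain j where j: "j \<in> {1..<n}" "z = a j" by auto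
    have "poly (\<Prod>j\<in>{1..<n}. [:- a j, 1:]) (a j) = 0"
      unfolding poly_prod by (rule prod_zero) (use j in \<open>auto intro!: bexI[of _ j]\<close>)
    then show "poly ?p z = poly (Polynomial.smult (\<Sum>i\<in>{1..n}. s i) (\<Prod>j\<in>{1..<n}. [:- a j, 1:])) z"
      using a[OF j(1)] j(2) by simp
  qed
  with il show thesis by (rule that)
qed

lemma poly_eqI_infinite:
  fixes p q :: "complex poly"
  assumes "infinite A" and "\<And>z. z \<in> A \<Longrightarrow> poly p z = poly q z"
  shows "p = q"
proof (rule ccontr)
  assume "p \<noteq> q"
  then have "finite {z. poly (p - q) z = 0}" by (intro poly_roots_finite) simp
  moreover have "A \<subseteq> {z. poly (p - q) z = 0}" using assms(2) by auto
  ultimately show False using assms(1) finite_subset by blast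
qed

text \<open>
  Cramer's rule for \<open>A = z - H\<close>, where \<open>z\<close> is not an eigenvalue: the characteristic polynomial of the corner at
  \<open>z\<close> is the last principal cofactor of \<open>A\<close>, that is \<open>det A\<close> times the last diagonal entry of \<open>A\<^sup>-\<^sup>1\<close>.
  Conjugated by \<open>Q\<close>, the inverse is diagonal with the entries \<open>1 / (z - y i)\<close>.
\<close>

lemma char_poly_corner_conjugate:
  assumes Q: "Q \<in> unitary_group (Suc m)"
  shows "char_poly (corner m (Q * diag_of (Suc m) y * mat_adjoint Q))
    = (\<Sum>i\<in>{1..Suc m}. Polynomial.smult (complex_of_real ((cmod (Q $$ (m, i - 1)))\<^sup>2)) (\<Prod>r\<in>{1..Suc m} - {i}. [:- y r, 1:]))"
proof (rule poly_eqI_infinite[of "- (y ` {1..Suc m})"])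
  let ?n = "Suc m"
  let ?D = "diag_of ?n y"
  let ?H = "Q * ?D * mat_adjoint Q"
  note q = unitary_groupD[OF Q]
  have Qc: "Q \<in> carrier_mat ?n ?n" and Qa: "mat_adjoint Q \<in> carrier_mat ?n ?n" using q by auto
  have H: "?H \<in> carrier_mat ?n ?n" using Qc Qa by (intro mult_carrier_mat[of _ ?n ?n]) auto
  fix z assume "z \<in> - (y ` {1..?n})"
  then have z: "z \<notin> y ` {1..?n}" by simp
  define Ez where "Ez = diag_of ?n (\<lambda>i. z - y i)"
  define Fz where "Fz = diag_of ?n (\<lambda>i. 1 / (z - y i))"
  have E: "Ez \<in> carrier_mat ?n ?n" and F: "Fz \<in> carrier_mat ?n ?n" by (simp_all add: Ez_def Fz_def)
  have zy: "z - y (Suc i) \<noteq> 0" if "i < ?n" for i using z that by force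
  have EF: "Ez * Fz = 1\<^sub>m ?n"
  proof (rule eq_matI)
    fix i j assume "i < dim_row (1\<^sub>m ?n :: complex mat)" "j < dim_col (1\<^sub>m ?n :: complex mat)"
    then have ij: "i < ?n" "j < ?n" by auto
    have "(Ez * Fz) $$ (i, j) = (\<Sum>k\<in>{0..<?n}. Ez $$ (i, k) * Fz $$ (k, j))" by (rule mat_mult_index[OF E F ij])
    also have "\<dots> = (\<Sum>k\<in>{0..<?n}. if k = i then Ez $$ (i, i) * Fz $$ (i, j) else 0)"
      using ij by (intro sum.cong) (auto simp: Ez_def diag_of_def)
    also have "\<dots> = Ez $$ (i, i) * Fz $$ (i, j)" using ij by simp
    also have "\<dots> = 1\<^sub>m ?n $$ (i, j)" using ij zy by (auto simp: Ez_def Fz_def diag_of_def)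
    finally show "(Ez * Fz) $$ (i, j) = 1\<^sub>m ?n $$ (i, j)" .
  qed (simp_all add: Ez_def Fz_def diag_of_def)
  define A where "A = Q * Ez * mat_adjoint Q"
  define B where "B = Q * Fz * mat_adjoint Q"
  have A: "A \<in> carrier_mat ?n ?n" and B: "B \<in> carrier_mat ?n ?n"
    unfolding A_def B_def using Qc Qa E F by (intro mult_carrier_mat[of _ ?n ?n]; simp)+
  have AB: "A * B = 1\<^sub>m ?n"
  proof -
    have QE: "Q * Ez \<in> carrier_mat ?n ?n" and QF: "Q * Fz \<in> carrier_mat ?n ?n" using Qc E F by auto
    have "A * B = Q * Ez * (mat_adjoint Q * (Q * Fz * mat_adjoint Q))"
      unfolding A_def B_def using QE QF Qa by (intro assoc_mult_mat[of _ ?n ?n _ ?n _ ?n]) auto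
    also have "mat_adjoint Q * (Q * Fz * mat_adjoint Q) = Fz * mat_adjoint Q"
      using Qc Qa F q(3) by (simp add: assoc_mult_mat[of _ ?n ?n _ ?n _ ?n, symmetric])
    also have "Q * Ez * (Fz * mat_adjoint Q) = Q * ((Ez * Fz) * mat_adjoint Q)"
      using Qc Qa E F by (simp add: assoc_mult_mat[of _ ?n ?n _ ?n _ ?n])
    finally show ?thesis unfolding EF using q Qa by simp
  qed
  have corner_det: "poly (char_poly (corner m ?H)) z = Determinant.det (mat_delete A m m)"
  proof -
    have Aij: "A $$ (i, j) = (if i = j then z else 0) - ?H $$ (i, j)" if ij: "i < ?n" "j < ?n" for i j
    proof -
      have Ez: "Ez = z \<cdot>\<^sub>m 1\<^sub>m ?n - ?D" by (rule eq_matI) (auto simp: Ez_def diag_of_def)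
      have Z: "z \<cdot>\<^sub>m 1\<^sub>m ?n \<in> carrier_mat ?n ?n" by simp
      have QZ: "Q * (z \<cdot>\<^sub>m 1\<^sub>m ?n) \<in> carrier_mat ?n ?n" and QD: "Q * ?D \<in> carrier_mat ?n ?n" using Qc by auto
      have "A = Q * (z \<cdot>\<^sub>m 1\<^sub>m ?n) * mat_adjoint Q - ?H"
        unfolding A_def Ez by (simp only: mult_minus_distrib_mat[OF Qc Z diag_of_carrier] minus_mult_distrib_mat[OF QZ QD Qa])
      also have "Q * (z \<cdot>\<^sub>m 1\<^sub>m ?n) * mat_adjoint Q = z \<cdot>\<^sub>m 1\<^sub>m ?n"
        unfolding mult_smult_distrib[OF Qc one_carrier_mat] right_mult_one_mat[OF Qc] mult_smult_assoc_mat[OF Qc Qa] q(2) ..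
      finally have A': "A = z \<cdot>\<^sub>m 1\<^sub>m ?n - ?H" .
      have "(z \<cdot>\<^sub>m 1\<^sub>m ?n - H') $$ (i, j) = (if i = j then z else 0) - H' $$ (i, j)"
        if "H' \<in> carrier_mat ?n ?n" for H' using that ij by auto
      from this[OF H] show ?thesis unfolding A' .
    qed
    show ?thesis
      unfolding char_poly_def
    proof (rule poly_det_cong[of _ m])
      show "char_poly_matrix (corner m ?H) \<in> carrier_mat m m" by simp
      show "mat_delete A m m \<in> carrier_mat m m" using A by (auto simp: mat_delete_def)
      fix i j assume ij: "i < m" "j < m"
      then have "mat_delete A m m $$ (i, j) = A $$ (i, j)" using A by (simp add: mat_delete_def)
      also have "\<dots> = (if i = j then z else 0) - ?H $$ (i, j)" by (rule Aij) (use ij in auto)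
      also have "\<dots> = poly (char_poly_matrix (corner m ?H) $$ (i, j)) z"
        using ij by (simp add: char_poly_matrix_def corner_def)
      finally show "poly (char_poly_matrix (corner m ?H) $$ (i, j)) z = mat_delete A m m $$ (i, j)" by simp
    qed
  qed
  have detA: "Determinant.det A = (\<Prod>r\<in>{1..?n}. z - y r)"
  proof -
    have "Determinant.det A = Determinant.det (Q * mat_adjoint Q) * Determinant.det Ez"
      unfolding A_def using Qc Qa E by (simp add: det_mult[of _ ?n])
    also have "\<dots> = Determinant.det Ez" unfolding q(2) by simp
    also have "\<dots> = prod_list (diag_mat Ez)" by (rule det_upper_triangular[OF _ E]) (auto simp: Ez_def diag_of_def)
    also have "diag_mat Ez = map (\<lambda>i. z - y (Suc i)) [0..<?n]"
      by (rule nth_equalityI) (auto simp: diag_mat_def Ez_def diag_of_def simp del: upt_Suc)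
    also have "prod_list (map (\<lambda>i. z - y (Suc i)) [0..<?n]) = (\<Prod>i\<in>{0..<?n}. z - y (Suc i))"
      by (subst prod.distinct_set_conv_list[symmetric]) (simp_all del: upt_Suc)
    also have "\<dots> = (\<Prod>r\<in>{1..?n}. z - y r)"
      by (rule prod.reindex_bij_witness[of _ "\<lambda>i. i - 1" Suc]) auto
    finally show ?thesis .
  qed
  have "Determinant.det (mat_delete A m m) = adj_mat A $$ (m, m)"
    using A by (simp add: adj_mat_def cofactor_def)
  also have "adj_mat A = Determinant.det A \<cdot>\<^sub>m B"
  proof -
    note adj = adj_mat[OF A]
    have "adj_mat A = adj_mat A * (A * B)" using adj(1) AB by simp
    also have "\<dots> = (adj_mat A * A) * B" by (rule assoc_mult_mat[symmetric, OF adj(1) A B])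
    also have "\<dots> = Determinant.det A \<cdot>\<^sub>m B" unfolding adj(3) using B by (simp add: mult_smult_assoc_mat[of _ ?n ?n])
    finally show ?thesis .
  qed
  also have "(Determinant.det A \<cdot>\<^sub>m B) $$ (m, m) = Determinant.det A * B $$ (m, m)" using B by simp
  also have "B $$ (m, m) = (\<Sum>i\<in>{1..?n}. complex_of_real ((cmod (Q $$ (m, i - 1)))\<^sup>2) / (z - y i))"
  proof -
    have QF: "Q * Fz \<in> carrier_mat ?n ?n" using Qc F by auto
    have "B $$ (m, m) = (\<Sum>k\<in>{0..<?n}. (Q * Fz) $$ (m, k) * mat_adjoint Q $$ (k, m))"
      unfolding B_def by (rule mat_mult_index[OF QF Qa]) auto
    also have "\<dots> = (\<Sum>k\<in>{0..<?n}. complex_of_real ((cmod (Q $$ (m, k)))\<^sup>2) / (z - y (Suc k)))"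
    proof (rule sum.cong[OF refl])
      fix k assume "k \<in> {0..<?n}"
      then have k: "k < ?n" by simp
      have "(Q * Fz) $$ (m, k) = (\<Sum>l\<in>{0..<?n}. Q $$ (m, l) * Fz $$ (l, k))" by (rule mat_mult_index[OF Qc F _ k]) simp
      also have "\<dots> = (\<Sum>l\<in>{0..<?n}. if l = k then Q $$ (m, k) / (z - y (Suc k)) else 0)"
        using k by (intro sum.cong) (auto simp: Fz_def diag_of_def)
      also have "\<dots> = Q $$ (m, k) / (z - y (Suc k))" using k by simp
      finally show "(Q * Fz) $$ (m, k) * mat_adjoint Q $$ (k, m) = complex_of_real ((cmod (Q $$ (m, k)))\<^sup>2) / (z - y (Suc k))"
        using k by (simp add: mat_adjoint_index[OF Qc] complex_norm_square del: index_mult_mat(1) of_real_power)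
    qed
    also have "\<dots> = (\<Sum>i\<in>{1..?n}. complex_of_real ((cmod (Q $$ (m, i - 1)))\<^sup>2) / (z - y i))"
      by (rule sum.reindex_bij_witness[of _ "\<lambda>i. i - 1" Suc]) auto
    finally show ?thesis .
  qed
  finally have "poly (char_poly (corner m ?H)) z
      = (\<Prod>r\<in>{1..?n}. z - y r) * (\<Sum>i\<in>{1..?n}. complex_of_real ((cmod (Q $$ (m, i - 1)))\<^sup>2) / (z - y i))"
    unfolding corner_det detA .
  also have "\<dots> = (\<Sum>i\<in>{1..?n}. complex_of_real ((cmod (Q $$ (m, i - 1)))\<^sup>2) * (\<Prod>r\<in>{1..?n} - {i}. z - y r))"
    unfolding sum_distrib_left
  proof (rule sum.cong[OF refl])
    fix i assume i: "i \<in> {1..?n}"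
    have "(\<Prod>r\<in>{1..?n}. z - y r) = (z - y i) * (\<Prod>r\<in>{1..?n} - {i}. z - y r)"
      using i by (intro prod.remove) auto
    moreover have "z - y i \<noteq> 0" using z i by auto
    ultimately show "(\<Prod>r\<in>{1..?n}. z - y r) * (complex_of_real ((cmod (Q $$ (m, i - 1)))\<^sup>2) / (z - y i))
        = complex_of_real ((cmod (Q $$ (m, i - 1)))\<^sup>2) * (\<Prod>r\<in>{1..?n} - {i}. z - y r)" by simp
  qed
  also have "\<dots> = poly (\<Sum>i\<in>{1..?n}. Polynomial.smult (complex_of_real ((cmod (Q $$ (m, i - 1)))\<^sup>2)) (\<Prod>r\<in>{1..?n} - {i}. [:- y r, 1:])) z"
    by (simp only: poly_sum poly_prod poly_smult) simp
  finally show "poly (char_poly (corner m ?H)) z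
      = poly (\<Sum>i\<in>{1..?n}. Polynomial.smult (complex_of_real ((cmod (Q $$ (m, i - 1)))\<^sup>2)) (\<Prod>r\<in>{1..?n} - {i}. [:- y r, 1:])) z" .
next
  have "finite (y ` {1..Suc m})" by simp
  then show "infinite (- (y ` {1..Suc m}))"
    unfolding Compl_eq_Diff_UNIV by (rule Diff_infinite_finite) (rule infinite_UNIV_char_0)
qed

section \<open>Secular roots of random weights\<close>

lemma AE_PiM_lborel_neq:
  assumes "finite I" "i \<in> I"
  shows "AE s in PiM I (\<lambda>_. lborel :: real measure). s i \<noteq> c"
proof -
  interpret product_sigma_finite "\<lambda>_. lborel :: real measure" by (rule product_sigma_finite_lborel)
  let ?Z = "PiE I (\<lambda>j. if j = i then {c} else UNIV)"
  have Z: "?Z \<in> sets (PiM I (\<lambda>_. lborel))" using assms(1) by (intro sets_PiM_I_finite) auto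
  have "emeasure (PiM I (\<lambda>_. lborel)) ?Z = (\<Prod>j\<in>I. emeasure lborel (if j = i then {c} else UNIV))"
    by (rule emeasure_PiM[OF assms(1)]) auto
  also have "\<dots> = 0" using assms by (intro prod_zero bexI[of _ i]) auto
  finally have 0: "emeasure (PiM I (\<lambda>_. lborel)) ?Z = 0" .
  have eq: "{s \<in> space (PiM I (\<lambda>_. lborel)). \<not> s i \<noteq> c} = ?Z"
    using assms(2) by (auto simp: space_PiM PiE_iff extensional_def split: if_splits)
  show ?thesis by (subst AE_iff_measurable[OF Z eq]) (rule 0)
qed

definition pos_on :: "nat \<Rightarrow> (nat \<Rightarrow> real) \<Rightarrow> bool" where
  "pos_on n s \<longleftrightarrow> (\<forall>i\<in>{1..n}. 0 < s i)"

lemma pred_pos_on [measurable]: "Measurable.pred (PiM {1..n} (\<lambda>_. lborel)) (pos_on n)"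
  unfolding pos_on_def[abs_def] by measurable

text \<open>
  The squared moduli of independent Gaussian variables are independent exponential variables.
\<close>

lemma nn_integral_gauss_squares:
  assumes F: "F \<in> borel_measurable (PiM {1..n} (\<lambda>_. lborel))"
  shows "(\<integral>\<^sup>+v. F (\<lambda>i\<in>{1..n}. (cmod (v i))\<^sup>2) \<partial>PiM {1..n} (\<lambda>_. gauss))
    = (\<integral>\<^sup>+s. F s * ennreal (exp (- (\<Sum>i\<in>{1..n}. s i))) * indicator {s. pos_on n s} s \<partial>PiM {1..n} (\<lambda>_. lborel))"
proof -
  define E where "E = density lborel (\<lambda>t. ennreal (exponential_density 1 t))"
  have pE: "prob_space E" unfolding E_def by (rule prob_space_exponential_density) simp
  have psE: "product_sigma_finite (\<lambda>_::nat. E)"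
    using pE by (intro product_sigma_finite.intro prob_space_imp_sigma_finite)
  have sE: "sets E = sets borel" by (simp add: E_def)
  have sP: "sets (PiM {1..n} (\<lambda>_. E)) = sets (PiM {1..n} (\<lambda>_. lborel))"
    by (rule sets_PiM_cong) (simp_all add: sE)
  have gm: "(\<lambda>z. (cmod z)\<^sup>2) \<in> gauss \<rightarrow>\<^sub>M E"
    unfolding measurable_cong_sets[OF sets_gauss sE] by measurable
  have gd: "distr gauss E (\<lambda>z. (cmod z)\<^sup>2) = E"
  proof -
    have "distr gauss E (\<lambda>z. (cmod z)\<^sup>2) = distr gauss borel (\<lambda>z. (cmod z)\<^sup>2)"
      by (rule distr_cong) (simp_all add: sE)
    then show ?thesis unfolding distr_gauss_norm_squared E_def .
  qed
  have mE: "(\<lambda>v. \<lambda>i\<in>{1..n}. (cmod (v i))\<^sup>2) \<in> PiM {1..n} (\<lambda>_. gauss) \<rightarrow>\<^sub>M PiM {1..n} (\<lambda>_. E)"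
  proof (rule measurable_restrict)
    fix i assume "i \<in> {1..n}"
    then have "(\<lambda>v. v i) \<in> PiM {1..n} (\<lambda>_. gauss) \<rightarrow>\<^sub>M gauss" by (rule measurable_component_singleton)
    from measurable_compose[OF this gm] show "(\<lambda>v. (cmod (v i))\<^sup>2) \<in> PiM {1..n} (\<lambda>_. gauss) \<rightarrow>\<^sub>M E" .
  qed
  have FE: "F \<in> borel_measurable (PiM {1..n} (\<lambda>_. E))"
    using F unfolding measurable_cong_sets[OF sP refl] .
  have dens: "PiM {1..n} (\<lambda>_. E) = density (PiM {1..n} (\<lambda>_. lborel)) (\<lambda>s. \<Prod>i\<in>{1..n}. ennreal (exponential_density 1 (s i)))"
    unfolding E_def by (rule density_PiM_sigma_finite) (use psE product_sigma_finite_lborel in \<open>auto simp: E_def\<close>)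
  have "(\<integral>\<^sup>+v. F (\<lambda>i\<in>{1..n}. (cmod (v i))\<^sup>2) \<partial>PiM {1..n} (\<lambda>_. gauss))
      = (\<integral>\<^sup>+s. F s \<partial>distr (PiM {1..n} (\<lambda>_. gauss)) (PiM {1..n} (\<lambda>_. E)) (\<lambda>v. \<lambda>i\<in>{1..n}. (cmod (v i))\<^sup>2))"
    by (subst nn_integral_distr[OF mE]) (use FE in simp_all)
  also have "distr (PiM {1..n} (\<lambda>_. gauss)) (PiM {1..n} (\<lambda>_. E)) (\<lambda>v. \<lambda>i\<in>{1..n}. (cmod (v i))\<^sup>2) = PiM {1..n} (\<lambda>_. E)"
    by (rule distr_PiM_sigma_finite[OF _ product_sigma_finite_gauss psE]) (simp, rule gm, rule gd)
  also have "(\<integral>\<^sup>+s. F s \<partial>PiM {1..n} (\<lambda>_. E))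
      = (\<integral>\<^sup>+s. (\<Prod>i\<in>{1..n}. ennreal (exponential_density 1 (s i))) * F s \<partial>PiM {1..n} (\<lambda>_. lborel))"
    unfolding dens
  proof (rule nn_integral_density[OF _ F], rule borel_measurable_prod_ennreal)
    fix i assume "i \<in> {1..n}"
    note [measurable] = measurable_component_lborel[OF this]
    show "(\<lambda>s. ennreal (exponential_density 1 (s i))) \<in> borel_measurable (PiM {1..n} (\<lambda>_. lborel))" by measurable
  qed
  also have "\<dots> = (\<integral>\<^sup>+s. F s * ennreal (exp (- (\<Sum>i\<in>{1..n}. s i))) * indicator {s. pos_on n s} s \<partial>PiM {1..n} (\<lambda>_. lborel))"
  proof (rule nn_integral_cong_AE)
    have "AE s in PiM {1..n} (\<lambda>_. lborel :: real measure). \<forall>i\<in>{1..n}. s i \<noteq> 0"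
      by (rule AE_finite_allI) (auto intro: AE_PiM_lborel_neq)
    then show "AE s in PiM {1..n} (\<lambda>_. lborel). (\<Prod>i\<in>{1..n}. ennreal (exponential_density 1 (s i))) * F s
        = F s * ennreal (exp (- (\<Sum>i\<in>{1..n}. s i))) * indicator {s. pos_on n s} s"
    proof eventually_elim
      case (elim s)
      show ?case
      proof (cases "pos_on n s")
        case True
        have "(\<Prod>i\<in>{1..n}. ennreal (exponential_density 1 (s i))) = (\<Prod>i\<in>{1..n}. ennreal (exp (- s i)))"
          using True by (intro prod.cong refl) (force simp: pos_on_def exponential_density_def)
        also have "\<dots> = ennreal (exp (- (\<Sum>i\<in>{1..n}. s i)))"
          by (subst prod_ennreal) (simp_all add: exp_sum sum_negf[symmetric])
        finally show ?thesis using True by (simp add: mult.commute)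
      next
        case False
        then obtain i where i: "i \<in> {1..n}" "\<not> 0 < s i" unfolding pos_on_def by blast
        then have "s i < 0" using elim by force
        then have "(\<Prod>i\<in>{1..n}. ennreal (exponential_density 1 (s i))) = 0"
          using i by (intro prod_zero bexI[of _ i]) (simp_all add: exponential_density_def)
        then show ?thesis using False by simp
      qed
    qed
  qed
  finally show ?thesis .
qed

text \<open>
  The characteristic polynomial of a corner of codimension one, if the squared moduli of the last row of the
  diagonalizing unitary matrix are proportional to \<open>s\<close>.
\<close>

definition secular_poly :: "nat \<Rightarrow> (nat \<Rightarrow> real) \<Rightarrow> (nat \<Rightarrow> real) \<Rightarrow> complex poly" where
  "secular_poly n x s = (\<Sum>i\<in>{1..n}. Polynomial.smult (complex_of_real (s i / (\<Sum>r\<in>{1..n}. s r)))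
      (\<Prod>r\<in>{1..n} - {i}. [:- complex_of_real (x r), 1:]))"

lemma poly_secular_poly:
  "poly (secular_poly n x s) (complex_of_real t)
    = complex_of_real (poly (\<Sum>i\<in>{1..n}. Polynomial.smult (s i) (\<Prod>r\<in>{1..n} - {i}. [:- x r, 1:])) t / (\<Sum>r\<in>{1..n}. s r))"
  by (simp add: secular_poly_def poly_sum poly_prod sum_divide_distrib)

lemma secular_poly_eqI:
  assumes "(\<Sum>i\<in>{1..n}. Polynomial.smult (s i) (\<Prod>r\<in>{1..n} - {i}. [:- x r, 1:]))
      = Polynomial.smult (\<Sum>i\<in>{1..n}. s i) (\<Prod>j\<in>{1..<n}. [:- a j, 1:])"
    and "(\<Sum>i\<in>{1..n}. s i) \<noteq> 0"
  shows "secular_poly n x s = (\<Prod>j\<in>{1..<n}. [:- complex_of_real (a j), 1:])"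
proof (rule poly_eqI_infinite[of "range complex_of_real"])
  show "infinite (range complex_of_real)"
  proof
    assume "finite (range complex_of_real)"
    then have "finite (UNIV :: real set)" by (rule finite_imageD) (simp add: inj_on_def)
    then show False by (simp add: infinite_UNIV_char_0)
  qed
  fix z assume "z \<in> range complex_of_real"
  then obtain t where z: "z = complex_of_real t" by auto
  show "poly (secular_poly n x s) z = poly (\<Prod>j\<in>{1..<n}. [:- complex_of_real (a j), 1:]) z"
    unfolding z poly_secular_poly assms(1) using assms(2) by (simp add: poly_prod)
qed

definition secular_roots :: "nat \<Rightarrow> (nat \<Rightarrow> real) \<Rightarrow> (nat \<Rightarrow> real) \<Rightarrow> nat \<Rightarrow> real" where
  "secular_roots n x s = (THE a. a \<in> weyl_chamber (n - 1) \<and> secular_poly n x s = (\<Prod>j\<in>{1..n - 1}. [:- complex_of_real (a j), 1:]))"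

lemma secular_roots_eq:
  assumes "a \<in> weyl_chamber (n - 1)" "secular_poly n x s = (\<Prod>j\<in>{1..n - 1}. [:- complex_of_real (a j), 1:])"
  shows "secular_roots n x s = a"
  unfolding secular_roots_def
proof (rule the_equality)
  fix b assume b: "b \<in> weyl_chamber (n - 1) \<and> secular_poly n x s = (\<Prod>j\<in>{1..n - 1}. [:- complex_of_real (b j), 1:])"
  show "b = a"
  proof (rule extensionalityI)
    show "b \<in> extensional {1..n - 1}" "a \<in> extensional {1..n - 1}" using assms b by (auto simp: weyl_chamber_def)
    show "b i = a i" if "i \<in> {1..n - 1}" for i
      by (rule chamber_roots_unique[OF _ _ _ that]) (use assms b in \<open>auto simp: weyl_chamber_def\<close>)
  qed
qed (use assms in simp)

lemma ivl_pred: "{1..<n} = {1..n - 1}" for n :: nat by auto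

lemma interlaces_weyl_chamber:
  assumes "strict_mono_on {1..n} x" "strictly_interlaces n x a" "a \<in> extensional {1..n - 1}"
  shows "a \<in> weyl_chamber (n - 1)"
proof -
  have "strict_mono_on {1..n - 1} a"
    using strictly_interlaces_strict_mono[OF assms(1,2)] unfolding ivl_pred .
  then show ?thesis using assms(3) by (auto simp: weyl_chamber_def intro: strict_mono_on_imp_mono_on)
qed

lemma secular_roots_spec:
  assumes x: "strict_mono_on {1..n} x" and s: "pos_on n s" and n: "1 \<le> n"
  shows "secular_roots n x s \<in> weyl_chamber (n - 1)"
    and "secular_poly n x s = (\<Prod>j\<in>{1..n - 1}. [:- complex_of_real (secular_roots n x s j), 1:])"
proof -
  obtain a where a: "strictly_interlaces n x a"
    "(\<Sum>i\<in>{1..n}. Polynomial.smult (s i) (\<Prod>r\<in>{1..n} - {i}. [:- x r, 1:]))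
      = Polynomial.smult (\<Sum>i\<in>{1..n}. s i) (\<Prod>j\<in>{1..<n}. [:- a j, 1:])"
    by (rule secular_polynomial_roots[OF x _ n, of s]) (use s in \<open>auto simp: pos_on_def\<close>)
  define b where "b = restrict a {1..n - 1}"
  have "0 < (\<Sum>i\<in>{1..n}. s i)" using s n by (intro sum_pos) (auto simp: pos_on_def)
  then have "secular_poly n x s = (\<Prod>j\<in>{1..<n}. [:- complex_of_real (a j), 1:])"
    by (intro secular_poly_eqI[OF a(2)]) simp
  then have p: "secular_poly n x s = (\<Prod>j\<in>{1..n - 1}. [:- complex_of_real (b j), 1:])"
    unfolding ivl_pred by (simp add: b_def)
  have "strictly_interlaces n x b"
    using a(1) strictly_interlaces_cong[of n b a x] unfolding ivl_pred by (simp add: b_def)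
  then have b: "b \<in> weyl_chamber (n - 1)"
    by (intro interlaces_weyl_chamber[OF x]) (auto simp: b_def)
  show "secular_roots n x s \<in> weyl_chamber (n - 1)"
    "secular_poly n x s = (\<Prod>j\<in>{1..n - 1}. [:- complex_of_real (secular_roots n x s j), 1:])"
    using b p secular_roots_eq[OF b p] by simp_all
qed

lemma measurable_secular_roots:
  assumes x: "strict_mono_on {1..n} x" and n: "1 \<le> n"
  shows "secular_roots n x \<in> restrict_space (PiM {1..n} (\<lambda>_. lborel)) {s. pos_on n s} \<rightarrow>\<^sub>M chamber_lebesgue (n - 1)"
    (is "_ \<in> ?M \<rightarrow>\<^sub>M _")
proof (rule measurable_chamberI)
  have sp: "pos_on n s" if "s \<in> space ?M" for s using that by (simp add: space_restrict_space)
  show "secular_roots n x \<in> space ?M \<rightarrow> weyl_chamber (n - 1)" using secular_roots_spec(1)[OF x sp n] by auto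
  fix i assume i: "i \<in> {1..n - 1}"
  have "coeff_measurable ?M (secular_poly n x)"
  proof -
    have "coeff_measurable ?M (\<lambda>s. \<Sum>i\<in>{1..n}. [:complex_of_real (s i / (\<Sum>r\<in>{1..n}. s r)):] * (\<Prod>r\<in>{1..n} - {i}. [:- complex_of_real (x r), 1:]))"
    proof (intro coeff_measurable_sum coeff_measurable_mult coeff_measurable_const coeff_measurable_monomial)
      fix i assume i: "i \<in> {1..n}"
      have [measurable]: "(\<lambda>s. s i) \<in> borel_measurable ?M" by (intro measurable_restrict_space1 measurable_component_lborel i)
      have [measurable]: "(\<lambda>s. \<Sum>r\<in>{1..n}. s r) \<in> borel_measurable ?M"
        by (intro borel_measurable_sum measurable_restrict_space1 measurable_component_lborel)
      show "(\<lambda>s. complex_of_real (s i / (\<Sum>r\<in>{1..n}. s r))) \<in> borel_measurable ?M" by measurable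
    qed
    then show ?thesis by (simp add: secular_poly_def[abs_def])
  qed
  then have cm: "(\<lambda>s. poly.coeff (secular_poly n x s) j) \<in> borel_measurable ?M" for j by (simp add: coeff_measurable_def)
  show "(\<lambda>s. secular_roots n x s i) \<in> borel_measurable ?M"
  proof (rule borel_measurable_roots[where k="n - 1" and p="secular_poly n x", OF cm])
    fix s assume s: "s \<in> space ?M"
    show "mono_on {1..n - 1} (secular_roots n x s)"
      using secular_roots_spec(1)[OF x sp[OF s] n] by (simp add: weyl_chamber_def)
    show "secular_poly n x s = (\<Prod>i\<in>{1..n - 1}. [:- complex_of_real (secular_roots n x s i), 1:])"
      by (rule secular_roots_spec(2)[OF x sp[OF s] n])
  qed (rule i)
qed

text \<open>
  The factor \<open>x i - a j\<close> of the numerator is paired with the node on the far side of \<open>a j\<close> as seen from \<open>x i\<close>, which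
  is \<open>x j\<close> if \<open>j < i\<close> and \<open>x (Suc j)\<close> otherwise; both differences have the same sign.
\<close>

lemma node_weight_pos:
  assumes x: "strict_mono_on {1..n} x" and a: "strictly_interlaces n x a" and S: "0 < S" and i: "i \<in> {1..n}"
  shows "0 < node_weight n x S a i"
proof -
  have "(\<Prod>r\<in>{1..n} - {i}. x i - x r) = (\<Prod>j\<in>{1..<n}. x i - x (if j < i then j else Suc j))"
    by (rule prod.reindex_bij_witness[of _ "\<lambda>j. if j < i then j else Suc j" "\<lambda>r. if r < i then r else r - 1"]) (use i in auto)
  then have "node_weight n x S a i = S * (\<Prod>j\<in>{1..<n}. (x i - a j) / (x i - x (if j < i then j else Suc j)))"
    by (simp add: node_weight_def prod_dividef)
  moreover have "0 < (x i - a j) / (x i - x (if j < i then j else Suc j))" if j: "j \<in> {1..<n}" for j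
  proof (cases "j < i")
    case True
    have "a j < x i" by (rule strictly_interlaces_nodes(1)[OF x a i j True])
    moreover have "x j < x i" by (rule strict_mono_onD[OF x]) (use True i j in auto)
    ultimately show ?thesis using True by simp
  next
    case False
    have "x i < a j" by (rule strictly_interlaces_nodes(2)[OF x a i j]) (use False in simp)
    moreover have "x i < x (Suc j)" by (rule strict_mono_onD[OF x]) (use False i j in auto)
    ultimately show ?thesis using False by (simp add: divide_neg_neg)
  qed
  ultimately show ?thesis using S by (auto intro!: mult_pos_pos prod_pos)
qed

lemma secular_roots_node_weight:
  assumes x: "strict_mono_on {1..n} x" and n: "1 \<le> n" and a: "strictly_interlaces n x a" "a \<in> extensional {1..n - 1}" and S: "0 < S"
  shows "secular_roots n x (\<lambda>i\<in>{1..n}. node_weight n x S a i) = a"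
proof (rule secular_roots_eq)
  have inj: "inj_on x {1..n}" by (rule strict_mono_on_imp_inj_on[OF x])
  show "a \<in> weyl_chamber (n - 1)" by (rule interlaces_weyl_chamber[OF x a])
  have sum: "(\<Sum>i\<in>{1..n}. (\<lambda>i\<in>{1..n}. node_weight n x S a i) i) = S"
    using sum_node_weight[OF inj n, of S a] by simp
  show "secular_poly n x (\<lambda>i\<in>{1..n}. node_weight n x S a i) = (\<Prod>j\<in>{1..n - 1}. [:- complex_of_real (a j), 1:])"
    unfolding ivl_pred[symmetric]
  proof (rule secular_poly_eqI)
    show "(\<Sum>i\<in>{1..n}. Polynomial.smult ((\<lambda>i\<in>{1..n}. node_weight n x S a i) i) (\<Prod>r\<in>{1..n} - {i}. [:- x r, 1:]))
        = Polynomial.smult (\<Sum>i\<in>{1..n}. (\<lambda>i\<in>{1..n}. node_weight n x S a i) i) (\<Prod>j\<in>{1..<n}. [:- a j, 1:])"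
      unfolding sum node_weight_interpolation[OF inj n, symmetric] by (intro sum.cong refl) simp
  qed (use sum S in simp)
qed

section \<open>Eigenvalues of the corner of codimension one\<close>

lemma nn_integral_orbital_measure:
  assumes F: "F \<in> borel_measurable (herm_borel n)"
  shows "(\<integral>\<^sup>+H. F H \<partial>orbital_measure n x)
    = (\<integral>\<^sup>+\<omega>. F (gs_mat n \<omega> * real_diag n x * mat_adjoint (gs_mat n \<omega>)) \<partial>gauss_rows n)"
proof -
  have m: "(\<lambda>U. U * real_diag n x * mat_adjoint U) \<in> mat_borel n \<rightarrow>\<^sub>M herm_borel n"
    by (rule measurable_conjugate[OF measurable_id_mat measurable_const]) (simp add: real_diag_herm)
  have "(\<integral>\<^sup>+H. F H \<partial>orbital_measure n x) = (\<integral>\<^sup>+U. F (U * real_diag n x * mat_adjoint U) \<partial>haar n)"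
    unfolding orbital_measure_eq orbit_law_def
    by (subst nn_integral_distr[OF measurable_orbit_map[OF real_diag_herm]]) (use F in simp_all)
  also have "\<dots> = (\<integral>\<^sup>+\<omega>. F (gs_mat n \<omega> * real_diag n x * mat_adjoint (gs_mat n \<omega>)) \<partial>gauss_rows n)"
    unfolding haar_def by (subst nn_integral_distr[OF measurable_gs_mat]) (use measurable_compose[OF m F] in simp_all)
  finally show ?thesis .
qed

lemma gs_first_row:
  "i \<in> {1..n} \<Longrightarrow> gs n \<omega> 0 i = \<omega> 0 i / complex_of_real (hnorm n (\<omega> 0))"
proof -
  assume i: "i \<in> {1..n}"
  have r: "gs_residual n \<omega> 0 j = \<omega> 0 j" if "j \<in> {1..n}" for j
    unfolding gs_residual_def using that by simp
  have h: "hnorm n (gs_residual n \<omega> 0) = hnorm n (\<omega> 0)"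
    unfolding hnorm_def by (rule arg_cong[where f=sqrt], rule sum.cong[OF refl]) (simp only: r)
  show ?thesis unfolding gs_eq[of n \<omega> 0] restrict_apply' [OF i] h r[OF i] ..
qed

text \<open>
  The last row of the Gram-Schmidt matrix is the normalized first Gaussian row, and normalization does not
  change the secular polynomial.
\<close>

lemma sorted_eigenvalues_corner_gs_mat:
  assumes x: "strict_mono_on {1..Suc m} x" and u: "gs_mat (Suc m) \<omega> \<in> unitary_group (Suc m)"
    and nz: "\<And>i. i \<in> {1..Suc m} \<Longrightarrow> \<omega> 0 i \<noteq> 0"
  shows "sorted_eigenvalues m (corner m (gs_mat (Suc m) \<omega> * real_diag (Suc m) x * mat_adjoint (gs_mat (Suc m) \<omega>)))
    = secular_roots (Suc m) x (\<lambda>i\<in>{1..Suc m}. (cmod (\<omega> 0 i))\<^sup>2)"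
proof -
  let ?n = "Suc m"
  let ?Q = "gs_mat ?n \<omega>"
  let ?s = "\<lambda>i\<in>{1..?n}. (cmod (\<omega> 0 i))\<^sup>2"
  have s: "pos_on ?n ?s" using nz by (simp add: pos_on_def)
  have sum: "(\<Sum>r\<in>{1..?n}. ?s r) = (hnorm ?n (\<omega> 0))\<^sup>2"
    unfolding hnorm_def by (subst real_sqrt_pow2, rule sum_nonneg, simp, rule sum.cong[OF refl], simp)
  have "char_poly (corner m (?Q * real_diag ?n x * mat_adjoint ?Q)) = secular_poly ?n x ?s"
    unfolding real_diag_def char_poly_corner_conjugate[OF u] secular_poly_def
  proof (rule sum.cong[OF refl])
    fix i assume i: "i \<in> {1..?n}"
    have "?Q $$ (m, i - 1) = \<omega> 0 i / complex_of_real (hnorm ?n (\<omega> 0))"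
    proof -
      obtain l where l: "i = Suc l" "l < ?n" using i by (cases i) auto
      show ?thesis using gs_first_row[OF i, of \<omega>] l(2) unfolding l(1) by (simp add: gs_mat_def)
    qed
    then have "(cmod (?Q $$ (m, i - 1)))\<^sup>2 = ?s i / (\<Sum>r\<in>{1..?n}. ?s r)"
      unfolding sum using i by (simp add: norm_divide power_divide)
    then show "Polynomial.smult (complex_of_real ((cmod (?Q $$ (m, i - 1)))\<^sup>2)) (\<Prod>r\<in>{1..?n} - {i}. [:- complex_of_real (x r), 1:])
        = Polynomial.smult (complex_of_real (?s i / (\<Sum>r\<in>{1..?n}. ?s r))) (\<Prod>r\<in>{1..?n} - {i}. [:- complex_of_real (x r), 1:])"
      by (simp only:)
  qed
  moreover have "corner m (?Q * real_diag ?n x * mat_adjoint ?Q) \<in> herm m"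
    by (rule corner_herm[OF conjugate_herm[OF gs_mat_carrier real_diag_herm]]) simp
  ultimately have "corner m (?Q * real_diag ?n x * mat_adjoint ?Q) \<in> spectral_orbit m (secular_roots ?n x ?s)"
    using secular_roots_spec(2)[OF x s] by (simp add: spectral_orbit_def del: One_nat_def)
  then show ?thesis
    using secular_roots_spec(1)[OF x s] by (intro sorted_eigenvalues_eq) simp_all
qed

lemma sets_weyl_chamber: "weyl_chamber k \<inter> space (PiM {1..k} (\<lambda>_. lborel :: real measure)) \<in> sets (PiM {1..k} (\<lambda>_. lborel))"
proof -
  have eq: "weyl_chamber k \<inter> space (PiM {1..k} (\<lambda>_. lborel :: real measure))
      = {a \<in> space (PiM {1..k} (\<lambda>_. lborel :: real measure)). \<forall>i\<in>{1..k}. \<forall>j\<in>{1..k}. i \<le> j \<longrightarrow> a i \<le> a j}"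
    unfolding weyl_chamber_def monotone_on_def space_PiM PiE_def by blast
  show ?thesis unfolding eq
  proof (intro sets.sets_Collect_finite_All finite_atLeastAtMost)
    fix i j assume "i \<in> {1..k}" "j \<in> {1..k}"
    then have "{a \<in> space (PiM {1..k} (\<lambda>_. lborel :: real measure)). a i \<le> a j} \<in> sets (PiM {1..k} (\<lambda>_. lborel))"
      by (intro borel_measurable_le measurable_component_lborel)
    then show "{a \<in> space (PiM {1..k} (\<lambda>_. lborel :: real measure)). i \<le> j \<longrightarrow> a i \<le> a j} \<in> sets (PiM {1..k} (\<lambda>_. lborel))"
      by (cases "i \<le> j") simp_all
  qed
qed

lemma nn_integral_chamber:
  "(\<integral>\<^sup>+a. f a \<partial>chamber_lebesgue k) = (\<integral>\<^sup>+a. f a * indicator (weyl_chamber k) a \<partial>PiM {1..k} (\<lambda>_. lborel))"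
  unfolding chamber_lebesgue_def by (rule nn_integral_restrict_space[OF sets_weyl_chamber])

text \<open>
  The eigenvalues of the corner are the secular roots of independent exponential weights \<open>s\<close>. In the interlacing
  coordinates \<open>S\<close> and \<open>a\<close> of the positive orthant, the roots are \<open>a\<close> and the density is \<open>exp (- S)\<close> times the
  Jacobian \<open>S ^ m * V(a) / V(x)\<close>; the integral over \<open>S\<close> is \<open>m!\<close>.
\<close>

theorem nn_integral_sorted_eigenvalues_corner_codim1:
  assumes x: "strict_mono_on {1..Suc m} x" and f: "f \<in> borel_measurable (chamber_lebesgue m)"
  shows "(\<integral>\<^sup>+H. f (sorted_eigenvalues m (corner m H)) \<partial>orbital_measure (Suc m) x)
    = (\<integral>\<^sup>+a. f a * ennreal (fact m * vandermonde m a / vandermonde (Suc m) x)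
        * indicator {a. strictly_interlaces (Suc m) x a} a \<partial>chamber_lebesgue m)"
proof -
  let ?n = "Suc m"
  let ?G = "PiM {1..?n} (\<lambda>_. gauss)"
  \<comment> \<open>Outside the positive orthant, a null set for the law of the weights, the secular roots need not exist.\<close>
  define h where "h s = (if pos_on ?n s then f (secular_roots ?n x s) else 0)" for s
  have h: "h \<in> borel_measurable (PiM {1..?n} (\<lambda>_. lborel))"
    unfolding h_def[abs_def]
  proof (subst measurable_If_restrict_space_iff)
    show "{s \<in> space (PiM {1..?n} (\<lambda>_. lborel)). pos_on ?n s} \<in> sets (PiM {1..?n} (\<lambda>_. lborel))" by measurable
    show "(\<lambda>s. f (secular_roots ?n x s)) \<in> borel_measurable (restrict_space (PiM {1..?n} (\<lambda>_. lborel)) {s. pos_on ?n s})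
        \<and> (\<lambda>s. 0) \<in> borel_measurable (restrict_space (PiM {1..?n} (\<lambda>_. lborel)) {s. \<not> pos_on ?n s})"
    proof
      have "secular_roots ?n x \<in> restrict_space (PiM {1..?n} (\<lambda>_. lborel)) {s. pos_on ?n s} \<rightarrow>\<^sub>M chamber_lebesgue m"
        by (rule measurable_secular_roots[OF x, unfolded diff_Suc_1]) simp
      then show "(\<lambda>s. f (secular_roots ?n x s)) \<in> borel_measurable (restrict_space (PiM {1..?n} (\<lambda>_. lborel)) {s. pos_on ?n s})"
        by (rule measurable_compose[OF _ f])
    qed (rule borel_measurable_const)
  qed
  have fe: "(\<lambda>H. f (sorted_eigenvalues m (corner m H))) \<in> borel_measurable (herm_borel ?n)"
    by (rule measurable_compose[OF measurable_compose[OF measurable_corner measurable_sorted_eigenvalues] f]) simp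
  have row0: "(\<lambda>\<omega>. \<omega> 0) \<in> gauss_rows ?n \<rightarrow>\<^sub>M ?G"
    unfolding gauss_rows_def by (rule measurable_component_singleton) simp
  have law0: "distr (gauss_rows ?n) ?G (\<lambda>\<omega>. \<omega> 0) = ?G"
    unfolding gauss_rows_def by (rule distr_PiM_component) (simp_all add: prob_space_PiM_gauss)
  have nz: "AE v in ?G. \<forall>i\<in>{1..?n}. v i \<noteq> 0"
  proof (rule AE_finite_allI)
    fix i assume i: "i \<in> {1..?n}"
    have "AE v in ?G. (\<Sum>r\<in>{1..?n}. (if r = i then 1 else 0) * v r) \<noteq> 0"
      by (rule AE_gauss_hyperplane[OF i]) simp
    moreover have "(\<Sum>r\<in>{1..?n}. (if r = i then 1 else 0) * v r) = v i" for v :: "nat \<Rightarrow> complex"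
    proof -
      have "(\<Sum>r\<in>{1..?n}. (if r = i then 1 else 0) * v r) = (\<Sum>r\<in>{1..?n}. if r = i then v r else 0)"
        by (intro sum.cong) auto
      then show ?thesis using i by simp
    qed
    ultimately show "AE v in ?G. v i \<noteq> 0" by simp
  qed simp
  have nz0: "AE \<omega> in gauss_rows ?n. \<forall>i\<in>{1..?n}. \<omega> 0 i \<noteq> 0"
  proof (rule AE_distrD[OF row0])
    show "AE v in distr (gauss_rows ?n) ?G (\<lambda>\<omega>. \<omega> 0). \<forall>i\<in>{1..?n}. v i \<noteq> 0"
      unfolding law0 by (rule nz)
  qed
  have hs: "(\<lambda>v. h (\<lambda>i\<in>{1..?n}. (cmod (v i))\<^sup>2)) \<in> borel_measurable ?G"
  proof (rule measurable_compose[OF _ h], rule measurable_restrict)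
    fix i assume "i \<in> {1..?n}"
    then have "(\<lambda>v. v i) \<in> ?G \<rightarrow>\<^sub>M gauss" by (rule measurable_component_singleton)
    then have [measurable]: "(\<lambda>v. v i) \<in> borel_measurable ?G" unfolding measurable_cong_sets[OF refl sets_gauss] .
    show "(\<lambda>v. (cmod (v i))\<^sup>2) \<in> ?G \<rightarrow>\<^sub>M lborel" by measurable
  qed
  have "(\<integral>\<^sup>+H. f (sorted_eigenvalues m (corner m H)) \<partial>orbital_measure ?n x)
      = (\<integral>\<^sup>+\<omega>. f (sorted_eigenvalues m (corner m (gs_mat ?n \<omega> * real_diag ?n x * mat_adjoint (gs_mat ?n \<omega>)))) \<partial>gauss_rows ?n)"
    by (rule nn_integral_orbital_measure[OF fe])
  also have "\<dots> = (\<integral>\<^sup>+\<omega>. h (\<lambda>i\<in>{1..?n}. (cmod (\<omega> 0 i))\<^sup>2) \<partial>gauss_rows ?n)"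
  proof (rule nn_integral_cong_AE)
    show "AE \<omega> in gauss_rows ?n. f (sorted_eigenvalues m (corner m (gs_mat ?n \<omega> * real_diag ?n x * mat_adjoint (gs_mat ?n \<omega>))))
        = h (\<lambda>i\<in>{1..?n}. (cmod (\<omega> 0 i))\<^sup>2)"
      using AE_gs_mat_unitary[of ?n] nz0
    proof eventually_elim
      case (elim \<omega>)
      have "pos_on ?n (\<lambda>i\<in>{1..?n}. (cmod (\<omega> 0 i))\<^sup>2)" using elim(2) by (simp add: pos_on_def)
      then show ?case
        using sorted_eigenvalues_corner_gs_mat[OF x elim(1)] elim(2) by (simp add: h_def)
    qed
  qed
  also have "\<dots> = (\<integral>\<^sup>+v. h (\<lambda>i\<in>{1..?n}. (cmod (v i))\<^sup>2) \<partial>distr (gauss_rows ?n) ?G (\<lambda>\<omega>. \<omega> 0))"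
    by (subst nn_integral_distr[OF row0]) (use hs in simp_all)
  also have "\<dots> = (\<integral>\<^sup>+s. h s * ennreal (exp (- (\<Sum>i\<in>{1..?n}. s i))) * indicator {s. pos_on ?n s} s \<partial>PiM {1..?n} (\<lambda>_. lborel))"
    unfolding law0 by (rule nn_integral_gauss_squares[OF h])
  also have "\<dots> = (\<integral>\<^sup>+S. (\<integral>\<^sup>+a. h (\<lambda>i\<in>{1..?n}. node_weight ?n x S a i)
          * ennreal (exp (- (\<Sum>i\<in>{1..?n}. (\<lambda>i\<in>{1..?n}. node_weight ?n x S a i) i)))
          * ennreal (S ^ m * vandermonde m a / vandermonde ?n x)
          * indicator {a. strictly_interlaces ?n x a} a \<partial>PiM {1..m} (\<lambda>_. lborel))
        * indicator {0<..} S \<partial>lborel)"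
    unfolding pos_on_def
    by (rule nn_integral_positive_orthant[OF x, of "\<lambda>s. h s * ennreal (exp (- (\<Sum>i\<in>{1..?n}. s i)))"])
       (use h in measurable)
  also have "\<dots> = (\<integral>\<^sup>+S. ennreal (S ^ m * exp (- S)) * indicator {0..} S
      * (\<integral>\<^sup>+a. f a * ennreal (vandermonde m a / vandermonde ?n x) * indicator {a. strictly_interlaces ?n x a} a \<partial>chamber_lebesgue m) \<partial>lborel)"
    (is "_ = (\<integral>\<^sup>+S. _ * ?C \<partial>lborel)")
  proof (rule nn_integral_cong_AE)
    have CP: "?C = (\<integral>\<^sup>+a. f a * ennreal (vandermonde m a / vandermonde ?n x) * indicator {a. strictly_interlaces ?n x a} a * indicator (weyl_chamber m) a \<partial>PiM {1..m} (\<lambda>_. lborel))"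
      by (rule nn_integral_chamber)
    show "AE S in lborel. (\<integral>\<^sup>+a. h (\<lambda>i\<in>{1..?n}. node_weight ?n x S a i)
          * ennreal (exp (- (\<Sum>i\<in>{1..?n}. (\<lambda>i\<in>{1..?n}. node_weight ?n x S a i) i)))
          * ennreal (S ^ m * vandermonde m a / vandermonde ?n x)
          * indicator {a. strictly_interlaces ?n x a} a \<partial>PiM {1..m} (\<lambda>_. lborel))
        * indicator {0<..} S = ennreal (S ^ m * exp (- S)) * indicator {0..} S * ?C"
      using AE_lborel_singleton[of 0]
    proof eventually_elim
      case (elim S)
      show ?case
      proof (cases "0 < S")
        case False
        then show ?thesis using elim by simp
      next
        case S: True
        have "(\<integral>\<^sup>+a. h (\<lambda>i\<in>{1..?n}. node_weight ?n x S a i)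
          * ennreal (exp (- (\<Sum>i\<in>{1..?n}. (\<lambda>i\<in>{1..?n}. node_weight ?n x S a i) i)))
          * ennreal (S ^ m * vandermonde m a / vandermonde ?n x)
          * indicator {a. strictly_interlaces ?n x a} a \<partial>PiM {1..m} (\<lambda>_. lborel))
          = (\<integral>\<^sup>+a. ennreal (S ^ m * exp (- S)) * (f a * ennreal (vandermonde m a / vandermonde ?n x) * indicator {a. strictly_interlaces ?n x a} a * indicator (weyl_chamber m) a) \<partial>PiM {1..m} (\<lambda>_. lborel))"
        proof (rule nn_integral_cong)
          fix a assume "a \<in> space (PiM {1..m} (\<lambda>_. lborel :: real measure))"
          then have ext: "a \<in> extensional {1..m}" by (auto simp: space_PiM PiE_def)
          show "h (\<lambda>i\<in>{1..?n}. node_weight ?n x S a i)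
              * ennreal (exp (- (\<Sum>i\<in>{1..?n}. (\<lambda>i\<in>{1..?n}. node_weight ?n x S a i) i)))
              * ennreal (S ^ m * vandermonde m a / vandermonde ?n x) * indicator {a. strictly_interlaces ?n x a} a
            = ennreal (S ^ m * exp (- S)) * (f a * ennreal (vandermonde m a / vandermonde ?n x) * indicator {a. strictly_interlaces ?n x a} a * indicator (weyl_chamber m) a)"
          proof (cases "strictly_interlaces ?n x a")
            case False then show ?thesis by simp
          next
            case il: True
            have inj: "inj_on x {1..?n}" by (rule strict_mono_on_imp_inj_on[OF x])
            have wc: "a \<in> weyl_chamber m" using interlaces_weyl_chamber[OF x il] ext by simp
            have pos: "pos_on ?n (\<lambda>i\<in>{1..?n}. node_weight ?n x S a i)"
              using node_weight_pos[OF x il S] by (simp add: pos_on_def)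
            have "secular_roots ?n x (\<lambda>i\<in>{1..?n}. node_weight ?n x S a i) = a"
              by (rule secular_roots_node_weight[OF x _ il _ S]) (use ext in simp_all)
            then have h1: "h (\<lambda>i\<in>{1..?n}. node_weight ?n x S a i) = f a" using pos by (simp only: h_def if_True)
            have s1: "(\<Sum>i\<in>{1..?n}. (\<lambda>i\<in>{1..?n}. node_weight ?n x S a i) i) = S"
            proof -
              have "(\<Sum>i\<in>{1..?n}. (\<lambda>i\<in>{1..?n}. node_weight ?n x S a i) i) = (\<Sum>i\<in>{1..?n}. node_weight ?n x S a i)"
                by (intro sum.cong refl) simp
              then show ?thesis using sum_node_weight[OF inj, of S a] by simp
            qed
            have "0 \<le> vandermonde m a / vandermonde ?n x"
              using vandermonde_pos[OF strictly_interlaces_strict_mono[OF x il, unfolded ivl_pred]] vandermonde_pos[OF x] by simp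
            then have "ennreal (exp (- S)) * ennreal (S ^ m * vandermonde m a / vandermonde ?n x)
                = ennreal (S ^ m * exp (- S)) * ennreal (vandermonde m a / vandermonde ?n x)"
              using S by (simp add: ennreal_mult'[symmetric] mult_ac)
            then show ?thesis unfolding h1 s1 using il wc by (simp add: mult_ac)
          qed
        qed
        also have "\<dots> = ennreal (S ^ m * exp (- S)) * ?C"
          unfolding CP
        proof (rule nn_integral_cmult)
          have "(\<lambda>a. f a * ennreal (vandermonde m a / vandermonde ?n x) * indicator {a. strictly_interlaces ?n x a} a) \<in> borel_measurable (chamber_lebesgue m)"
          proof -
            have [measurable]: "(\<lambda>a. vandermonde m a) \<in> borel_measurable (chamber_lebesgue m)"
              unfolding chamber_lebesgue_def by (intro measurable_restrict_space1) measurable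
            have [measurable]: "Measurable.pred (chamber_lebesgue m) (strictly_interlaces ?n x)"
              unfolding chamber_lebesgue_def by (intro measurable_restrict_space1) measurable
            note f[measurable]
            show ?thesis by measurable
          qed
          then show "(\<lambda>a. f a * ennreal (vandermonde m a / vandermonde ?n x) * indicator {a. strictly_interlaces ?n x a} a * indicator (weyl_chamber m) a) \<in> borel_measurable (PiM {1..m} (\<lambda>_. lborel))"
            unfolding chamber_lebesgue_def borel_measurable_restrict_space_iff_ennreal[OF sets_weyl_chamber] .
        qed
        finally show ?thesis using S by simp
      qed
    qed
  qed
  also have "\<dots> = (\<integral>\<^sup>+S. ennreal (S ^ m * exp (- S)) * indicator {0..} S \<partial>lborel) * ?C"
    by (rule nn_integral_multc) measurable
  also have "\<dots> = ennreal (fact m) * ?C"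
    unfolding nn_intergal_power_times_exp_Ici by simp
  also have "\<dots> = (\<integral>\<^sup>+a. f a * ennreal (fact m * vandermonde m a / vandermonde (Suc m) x)
        * indicator {a. strictly_interlaces (Suc m) x a} a \<partial>chamber_lebesgue m)"
  proof -
    have meas: "(\<lambda>a. f a * ennreal (vandermonde m a / vandermonde ?n x) * indicator {a. strictly_interlaces ?n x a} a) \<in> borel_measurable (chamber_lebesgue m)"
    proof -
      have [measurable]: "(\<lambda>a. vandermonde m a) \<in> borel_measurable (chamber_lebesgue m)"
        unfolding chamber_lebesgue_def by (intro measurable_restrict_space1) measurable
      have [measurable]: "Measurable.pred (chamber_lebesgue m) (strictly_interlaces ?n x)"
        unfolding chamber_lebesgue_def by (intro measurable_restrict_space1) measurable
      note f[measurable]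
      show ?thesis by measurable
    qed
    have "ennreal (fact m * vandermonde m a / vandermonde ?n x) = ennreal (fact m) * ennreal (vandermonde m a / vandermonde ?n x)" for a
      by (simp add: ennreal_mult'[symmetric])
    then show ?thesis
      by (subst nn_integral_cmult[OF meas, symmetric]) (simp add: mult_ac)
  qed
  finally show ?thesis .
qed

section \<open>Algebra of the corner density\<close>

lemma measurable_det_spline_matrix [measurable]:
  "(\<lambda>a. Determinant.det (spline_matrix N K x a)) \<in> borel_measurable (PiM {1..K} (\<lambda>_. lborel))"
proof -
  have det: "Determinant.det (spline_matrix N K x a)
      = (\<Sum>p\<in>{p. p permutes {0..<K}}. signof p * (\<Prod>j\<in>{0..<K}. fundamental_spline (N - K + 1) (\<lambda>l. x (p j + l)) (a (Suc j))))" for a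
  proof -
    have c: "spline_matrix N K x a \<in> carrier_mat K K" by (simp add: spline_matrix_def)
    show ?thesis unfolding det_column_form[OF c]
    proof (intro sum.cong refl arg_cong2[where f="(*)"] prod.cong)
      fix p j assume "p \<in> {p. p permutes {0..<K}}" "j \<in> {0..<K}"
      then have "p j \<in> {0..<K}" using permutes_in_image[of p "{0..<K}" j] by simp
      then show "spline_matrix N K x a $$ (p j, j) = fundamental_spline (N - K + 1) (\<lambda>l. x (p j + l)) (a (Suc j))"
        using \<open>j \<in> {0..<K}\<close> by (simp add: spline_matrix_def)
    qed
  qed
  have c: "(\<lambda>a. fundamental_spline m y (a (Suc j))) \<in> borel_measurable (PiM {1..K} (\<lambda>_. lborel))" if "j \<in> {0..<K}" for j m y
    by (rule measurable_compose[OF measurable_component_lborel borel_measurable_fundamental_spline]) (use that in simp)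
  show ?thesis unfolding det
    by (intro borel_measurable_sum borel_measurable_times borel_measurable_prod c) simp_all
qed

text \<open>
  The denominator of \<open>corner_density N K\<close> is the case \<open>m = N - K + 1\<close>, and the full Vandermonde product is
  the case \<open>m = 1\<close>.
\<close>

definition gap_product :: "nat \<Rightarrow> nat \<Rightarrow> (nat \<Rightarrow> real) \<Rightarrow> real" where
  "gap_product N m x = (\<Prod>(j, i)\<in>{(j, i) \<in> {1..N} \<times> {1..N}. i + m \<le> j}. x j - x i)"

lemma gap_product_Suc:
  "gap_product N m x = gap_product N (Suc m) x * (\<Prod>i\<in>{1..N - m}. x (i + m) - x i)"
proof -
  let ?A = "{(j, i) \<in> {1..N} \<times> {1..N}. i + Suc m \<le> j}"
  let ?B = "(\<lambda>i. (i + m, i)) ` {1..N - m}"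
  have fin: "finite ?A" by (rule finite_subset[of _ "{1..N} \<times> {1..N}"]) auto
  have "{(j, i) \<in> {1..N} \<times> {1..N}. i + m \<le> j} = ?A \<union> ?B" (is "?L = _")
  proof (rule Set.set_eqI)
    fix p :: "nat \<times> nat"
    obtain j i where p: "p = (j, i)" by (cases p)
    have "(j, i) \<in> ?B \<longleftrightarrow> j = i + m \<and> 1 \<le> i \<and> i + m \<le> N" by (auto simp: image_iff)
    then show "p \<in> ?L \<longleftrightarrow> p \<in> ?A \<union> ?B" unfolding p Un_iff by auto
  qed
  moreover have "?A \<inter> ?B = {}" by auto
  ultimately have "gap_product N m x = gap_product N (Suc m) x * (\<Prod>(j, i)\<in>?B. x j - x i)"
    unfolding gap_product_def using fin by (simp only: prod.union_disjoint finite_imageI finite_atLeastAtMost)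
  also have "(\<Prod>(j, i)\<in>?B. x j - x i) = (\<Prod>i\<in>{1..N - m}. x (i + m) - x i)"
    by (subst prod.reindex) (auto intro: inj_onI)
  finally show ?thesis .
qed

lemma gap_product_one: "gap_product N 1 x = vandermonde N x"
  unfolding gap_product_def vandermonde_def
  by (rule prod.reindex_bij_witness[of _ prod.swap prod.swap]) auto

lemma gap_product_pos:
  assumes x: "strict_mono_on {1..N} x" and m: "1 \<le> m"
  shows "0 < gap_product N m x"
  unfolding gap_product_def
proof (rule prod_pos)
  fix p assume p: "p \<in> {(j, i) \<in> {1..N} \<times> {1..N}. i + m \<le> j}"
  obtain j i where ji: "p = (j, i)" by (cases p)
  have "x i < x j" using x p m unfolding ji by (auto intro: strict_mono_onD)
  then show "0 < (case p of (j, i) \<Rightarrow> x j - x i)" unfolding ji by simp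
qed

text \<open>
  The recursion \<open>c\<^sub>N\<^sub>,\<^sub>K\<^sub>+\<^sub>1 K! = L\<^sup>K c\<^sub>N\<^sub>,\<^sub>K\<close> of the normalizing constants, with \<open>L = N - K\<close>.
\<close>

lemma prod_binomial_step:
  assumes "1 \<le> K" "1 \<le> L"
  shows "(\<Prod>i\<in>{1..<Suc K}. (L - 1 + i) choose i) * fact K = L ^ K * (\<Prod>i\<in>{1..<K}. (L + i) choose i)"
  using assms(1)
proof (induction K rule: nat_induct_at_least)
  case base
  show ?case using assms(2) by simp
next
  case (Suc K)
  have "Suc K * ((L + K) choose Suc K) = (L + K) * ((L + K - 1) choose K)"
    by (rule binomial_absorption)
  also have "\<dots> = L * ((L + K) choose K)"
    using binomial_absorb_comp[of "L + K" K] by simp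
  finally have step: "Suc K * ((L - 1 + Suc K) choose Suc K) = L * ((L + K) choose K)"
    using assms(2) by (simp add: add.commute)
  have "(\<Prod>i\<in>{1..<Suc (Suc K)}. (L - 1 + i) choose i) * fact (Suc K)
      = ((\<Prod>i\<in>{1..<Suc K}. (L - 1 + i) choose i) * fact K) * (Suc K * ((L - 1 + Suc K) choose Suc K))"
    by (subst prod.atLeastLessThan_Suc) (simp_all add: algebra_simps)
  also have "\<dots> = L ^ Suc K * ((\<Prod>i\<in>{1..<K}. (L + i) choose i) * ((L + K) choose K))"
    unfolding Suc.IH step by (simp add: mult_ac)
  also have "(\<Prod>i\<in>{1..<K}. (L + i) choose i) * ((L + K) choose K) = (\<Prod>i\<in>{1..<Suc K}. (L + i) choose i)"
    using Suc.hyps by (simp add: prod.atLeastLessThan_Suc)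
  finally show ?case .
qed

lemma prod_binomial_codim1: "1 \<le> K \<Longrightarrow> (\<Prod>i\<in>{1..<K}. (1 + i) choose i) = fact K"
proof (induction K rule: nat_induct_at_least)
  case (Suc K)
  then have "(\<Prod>i\<in>{1..<Suc K}. (1 + i) choose i) = (\<Prod>i\<in>{1..<K}. (1 + i) choose i) * ((1 + K) choose K)"
    by (simp only: prod.atLeastLessThan_Suc)
  also have "((1 + K) choose K) = Suc K" by simp
  finally show ?case unfolding Suc.IH by simp
qed simp

text \<open>
  The constants and gaps that arise when one row and column is removed: the first factor comes from the density
  for \<open>K + 1\<close> and the kernel \<open>K! V(a) / V(Y)\<close>, the second from the integral of the spline determinant.
\<close>

lemma corner_density_recursion:
  assumes x: "strict_mono_on {1..N} x" and K: "1 \<le> K" "K + 2 \<le> N"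
  shows "(\<Prod>i\<in>{1..<Suc K}. real ((N - Suc K + i) choose i)) * (fact K * vandermonde K a) / gap_product N (N - K) x
      * ((\<Prod>i\<in>{1..K}. (x (i + (N - K)) - x i) / real (N - K)) * Determinant.det (spline_matrix N K x a))
    = corner_density N K x a"
proof -
  define L where "L = N - K"
  have L: "1 \<le> L" "N - Suc K = L - 1" "N - K = L" "N - L = K" "N - K + 1 = Suc L" using K by (auto simp: L_def)
  have "real ((\<Prod>i\<in>{1..<Suc K}. (L - 1 + i) choose i) * fact K) = real (L ^ K * (\<Prod>i\<in>{1..<K}. (L + i) choose i))"
    by (simp only: prod_binomial_step[OF K(1) L(1)])
  then have c: "(\<Prod>i\<in>{1..<Suc K}. real ((L - 1 + i) choose i)) * fact K = real L ^ K * (\<Prod>i\<in>{1..<K}. real ((L + i) choose i))"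
    by (simp only: of_nat_mult of_nat_prod of_nat_power of_nat_fact)
  have g: "gap_product N L x = gap_product N (Suc L) x * (\<Prod>i\<in>{1..K}. x (i + L) - x i)"
    using gap_product_Suc[of N L x] unfolding L .
  have nz: "gap_product N (Suc L) x \<noteq> 0" "gap_product N L x \<noteq> 0" "real L ^ K \<noteq> 0"
    using gap_product_pos[OF x, of "Suc L"] gap_product_pos[OF x L(1)] L(1) by auto
  define P where "P = (\<Prod>i\<in>{1..K}. x (i + L) - x i)"
  define C1 where "C1 = (\<Prod>i\<in>{1..<Suc K}. real ((L - 1 + i) choose i))"
  define C where "C = (\<Prod>i\<in>{1..<K}. real ((L + i) choose i))"
  define G where "G = gap_product N (Suc L) x"
  have P: "P \<noteq> 0" using nz(2) unfolding g P_def by simp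
  have prod: "(\<Prod>i\<in>{1..K}. (x (i + L) - x i) / real L) = P / real L ^ K"
    unfolding P_def by (simp add: prod_dividef)
  have density: "corner_density N K x a = C * (vandermonde K a * Determinant.det (spline_matrix N K x a)) / G"
    unfolding corner_density_def G_def C_def gap_product_def L Suc_eq_plus1 ..
  define W where "W = vandermonde K a * Determinant.det (spline_matrix N K x a)"
  have "C1 * (fact K * vandermonde K a) / (G * P) * (P / real L ^ K * Determinant.det (spline_matrix N K x a))
      = C1 * fact K * W / (real L ^ K * G)"
    using P unfolding W_def by (simp add: mult_ac)
  also have "\<dots> = C * W / G"
    unfolding c[folded C1_def C_def] mult.assoc by (rule mult_divide_mult_cancel_left[OF nz(3)])
  finally show ?thesis
    unfolding density L g prod P_def[symmetric] C1_def[symmetric] G_def[symmetric] W_def .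
qed

lemma fundamental_spline_two_knots:
  assumes "y 1 < y 2"
  shows "fundamental_spline 2 y a = (if y 1 \<le> a \<and> a < y 2 then 1 / (y 2 - y 1) else 0)"
proof -
  have s: "{1..2} - {Suc 0} = {2::nat}" "{1..2} - {2} = {1::nat}" "{1..2::nat} = {1, 2}" by auto
  have "1 / (y 1 - y 2) = - (1 / (y 2 - y 1))" using assms by (simp add: field_simps)
  then show ?thesis
    unfolding fundamental_spline_alt using assms s by (simp add: s)
qed

lemma spline_matrix_codim1_entry:
  assumes x: "strict_mono_on {1..Suc K} x" and ij: "i < K" "j < K"
  shows "spline_matrix (Suc K) K x a $$ (i, j)
    = (if x (i + 1) \<le> a (j + 1) \<and> a (j + 1) < x (i + 2) then 1 / (x (i + 2) - x (i + 1)) else 0)"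
proof -
  have "x (i + 1) < x (i + 2)" using ij by (intro strict_mono_onD[OF x]) auto
  moreover have "Suc K - K + 1 = 2" by simp
  ultimately show ?thesis
    using fundamental_spline_two_knots[of "\<lambda>l. x (i + l)" "a (j + 1)"] ij
    by (simp only: spline_matrix_def index_mat(1) split_conv)
qed

text \<open>
  The entry in row \<open>i\<close> and column \<open>j\<close> is nonzero iff \<open>x (i + 1) \<le> a (j + 1) < x (i + 2)\<close>. If \<open>a\<close> interlaces
  \<open>x\<close>, the matrix is diagonal. If some term of the Leibniz expansion is nonzero, its permutation is monotone
  because \<open>a\<close> is, hence the identity, and its factors say that \<open>a\<close> interlaces \<open>x\<close>.
\<close>

lemma det_spline_matrix_codim1:
  assumes x: "strict_mono_on {1..Suc K} x" and a: "mono_on {1..K} a"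
  shows "Determinant.det (spline_matrix (Suc K) K x a)
    = (if interlaces (Suc K) x a then \<Prod>i\<in>{1..K}. 1 / (x (i + 1) - x i) else 0)"
proof -
  let ?A = "spline_matrix (Suc K) K x a"
  have A: "?A \<in> carrier_mat K K" by (simp add: spline_matrix_def)
  note entry = spline_matrix_codim1_entry[OF x, of _ _ a]
  have xle: "i < j" if "x i < x j" "i \<in> {1..Suc K}" "j \<in> {1..Suc K}" for i j
    using that by (metis not_less strict_mono_on_leD[OF x] leD)
  show ?thesis
  proof (cases "interlaces (Suc K) x a")
    case True
    then have il: "x (j + 1) \<le> a (j + 1) \<and> a (j + 1) < x (j + 2)" if "j < K" for j
      using that unfolding interlaces_def by simp
    have off: "?A $$ (i, j) = 0" if "j < i" "i < K" for i j
    proof -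
      have "x (j + 2) \<le> x (i + 1)" using that by (intro strict_mono_on_leD[OF x]) auto
      then show ?thesis using il[of j] that by (simp only: entry) auto
    qed
    have "Determinant.det ?A = prod_list (diag_mat ?A)"
      by (rule det_upper_triangular[OF _ A]) (use off in \<open>auto simp: spline_matrix_def\<close>)
    also have "\<dots> = (\<Prod>i\<in>{0..<K}. ?A $$ (i, i))"
      using A by (simp add: prod_list_diag_prod)
    also have "\<dots> = (\<Prod>i\<in>{0..<K}. 1 / (x (Suc i + 1) - x (Suc i)))"
    proof (rule prod.cong[OF refl])
      fix i assume "i \<in> {0..<K}"
      then show "?A $$ (i, i) = 1 / (x (Suc i + 1) - x (Suc i))" using il[of i] by (simp add: entry)
    qed
    also have "\<dots> = (\<Prod>i\<in>{1..K}. 1 / (x (i + 1) - x i))"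
      using prod.shift_bounds_Suc_ivl[of "\<lambda>i. 1 / (x (i + 1) - x i)" 0 K]
      by (simp add: atLeastLessThanSuc_atLeastAtMost)
    finally show ?thesis using True by simp
  next
    case False
    have zero: "signof p * (\<Prod>j\<in>{0..<K}. ?A $$ (p j, j)) = 0" if p: "p permutes {0..<K}" for p
    proof (rule ccontr)
      assume "signof p * (\<Prod>j\<in>{0..<K}. ?A $$ (p j, j)) \<noteq> 0"
      then have nz: "?A $$ (p j, j) \<noteq> 0" if "j < K" for j
        using that by (auto simp: prod_zero_iff)
      have pK: "p j < K" if "j < K" for j using permutes_in_image[OF p, of j] that by simp
      have between: "x (p j + 1) \<le> a (j + 1) \<and> a (j + 1) < x (p j + 2)" if "j < K" for j
        using nz[OF that] unfolding entry[OF pK[OF that] that] by (simp split: if_splits)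
      have mono: "p i < p j" if "i < j" "j < K" for i j
      proof -
        have "a (i + 1) \<le> a (j + 1)" using that by (intro mono_onD[OF a]) auto
        then have "x (p i + 1) < x (p j + 2)" using between[of i] between[of j] that by auto
        then have "p i + 1 < p j + 2" using pK[of i] pK[of j] that by (intro xle) auto
        moreover have "p i \<noteq> p j" using permutes_inj[OF p] that by (auto dest: injD)
        ultimately show ?thesis by simp
      qed
      have ge: "j < K \<Longrightarrow> j \<le> p j" for j
      proof (induction j)
        case (Suc j)
        then show ?case using mono[of j "Suc j"] by simp
      qed simp
      have "p = id" by (rule permutes_natset_ge[OF p]) (use ge in auto)
      then have b: "x (j + 1) \<le> a (j + 1) \<and> a (j + 1) < x (j + 2)" if "j < K" for j
        using between[OF that] by simp
      have "interlaces (Suc K) x a"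
        unfolding interlaces_def
      proof
        fix j assume "j \<in> {1..<Suc K}"
        then show "x j \<le> a j \<and> a j < x (Suc j)" using b[of "j - 1"] by (cases j) auto
      qed
      then show False using False by contradiction
    qed
    have "Determinant.det ?A = 0"
      unfolding det_column_form[OF A] by (rule sum.neutral) (use zero in blast)
    then show ?thesis using False by (simp only: if_False)
  qed
qed

lemma corner_density_codim1:
  assumes x: "strict_mono_on {1..Suc K} x" and a: "mono_on {1..K} a" and K: "1 \<le> K"
  shows "corner_density (Suc K) K x a
    = (if interlaces (Suc K) x a then fact K * vandermonde K a / vandermonde (Suc K) x else 0)"
proof -
  have "real (\<Prod>i\<in>{1..<K}. (1 + i) choose i) = real (fact K)" by (simp only: prod_binomial_codim1[OF K])
  then have c: "(\<Prod>i\<in>{1..<K}. real ((1 + i) choose i)) = fact K" by (simp only: of_nat_prod of_nat_fact)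
  have g: "vandermonde (Suc K) x = gap_product (Suc K) 2 x * (\<Prod>i\<in>{1..K}. x (i + 1) - x i)"
    using gap_product_Suc[of "Suc K" 1 x] unfolding gap_product_one by (simp add: numeral_2_eq_2)
  have d: "corner_density (Suc K) K x a = fact K * (vandermonde K a * Determinant.det (spline_matrix (Suc K) K x a)) / gap_product (Suc K) 2 x"
    unfolding corner_density_def gap_product_def using c by simp
  have p: "(\<Prod>i\<in>{1..K}. 1 / (x (i + 1) - x i)) = 1 / (\<Prod>i\<in>{1..K}. x (i + 1) - x i)"
    by (simp only: prod_dividef prod.neutral_const)
  show ?thesis unfolding d det_spline_matrix_codim1[OF x a] g p by simp
qed

lemma interlaces_mono:
  assumes "interlaces n y a" shows "mono_on {1..n} y"
proof (rule mono_onI)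
  fix i j assume ij: "i \<in> {1..n}" "j \<in> {1..n}" "i \<le> j"
  from ij(3) ij(2) show "y i \<le> y j"
  proof (induction j rule: dec_induct)
    case (step k)
    then have "k \<in> {1..<n}" using ij(1) by simp
    then have "y k \<le> y (Suc k)" using assms unfolding interlaces_def by fastforce
    moreover have "y i \<le> y k" using step ij(1) by auto
    ultimately show ?case by (rule order_trans[rotated])
  qed simp
qed

text \<open>
  The determinant for \<open>K\<close> is a positive multiple of an integral of the determinant for \<open>K + 1\<close>, and for
  \<open>K = N - 1\<close> it is explicit.
\<close>

lemma det_spline_matrix_nonneg:
  assumes x: "strict_mono_on {1..N} x"
  shows "1 \<le> K \<Longrightarrow> N = Suc K + d \<Longrightarrow> mono_on {1..K} a \<Longrightarrow> 0 \<le> Determinant.det (spline_matrix N K x a)"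
proof (induction d arbitrary: K a)
  case 0
  have "0 \<le> (\<Prod>i\<in>{1..K}. 1 / (x (i + 1) - x i))"
  proof (rule prod_nonneg)
    fix i assume "i \<in> {1..K}"
    then have "x i < x (i + 1)" using 0 by (intro strict_mono_onD[OF x]) auto
    then show "0 \<le> 1 / (x (i + 1) - x i)" by simp
  qed
  then show ?case using 0 x by (simp add: det_spline_matrix_codim1)
next
  case (Suc d)
  have K2: "K + 2 \<le> N" using Suc.prems by simp
  have "0 \<le> (\<integral>Y. Determinant.det (spline_matrix N (Suc K) x Y) * indicator {Y. interlaces (Suc K) Y a} Y \<partial>PiM {1..Suc K} (\<lambda>_. lborel))"
  proof (rule Bochner_Integration.integral_nonneg)
    fix Y
    show "0 \<le> Determinant.det (spline_matrix N (Suc K) x Y) * indicator {Y. interlaces (Suc K) Y a} Y"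
    proof (cases "interlaces (Suc K) Y a")
      case True
      have "0 \<le> Determinant.det (spline_matrix N (Suc K) x Y)"
        by (rule Suc.IH[OF _ _ interlaces_mono[OF True]]) (use Suc.prems in simp_all)
      then show ?thesis by (simp add: indicator_def)
    qed simp
  qed
  then have "0 \<le> (\<Prod>i\<in>{1..K}. (x (i + (N - K)) - x i) / real (N - K)) * Determinant.det (spline_matrix N K x a)"
    unfolding integral_det_spline_interlaces(2)[OF x Suc.prems(1) K2 Suc.prems(3)] .
  moreover have "0 < (\<Prod>i\<in>{1..K}. (x (i + (N - K)) - x i) / real (N - K))"
  proof (rule prod_pos)
    fix i assume "i \<in> {1..K}"
    then have "x i < x (i + (N - K))" using K2 by (intro strict_mono_onD[OF x]) auto
    then show "0 < (x (i + (N - K)) - x i) / real (N - K)" using K2 by simp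
  qed
  ultimately show ?case by (simp add: zero_le_mult_iff)
qed

lemma vandermonde_nonneg:
  assumes a: "mono_on {1..k} a" shows "0 \<le> vandermonde k a"
  unfolding vandermonde_def
proof (rule prod_nonneg)
  fix p assume "p \<in> {(i, j) \<in> {1..k} \<times> {1..k}. i < j}"
  then show "0 \<le> (case p of (i, j) \<Rightarrow> a j - a i)"
    using mono_onD[OF a, of "fst p" "snd p"] by (cases p) simp
qed

lemma vandermonde_not_strict:
  assumes a: "mono_on {1..k} a" and n: "\<not> strict_mono_on {1..k} a"
  shows "vandermonde k a = 0"
proof -
  obtain i j where ij: "i \<in> {1..k}" "j \<in> {1..k}" "i < j" "\<not> a i < a j"
    using n unfolding monotone_on_def by blast
  then have "a j - a i = 0" using mono_onD[OF a, of i j] by simp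
  moreover have "(i, j) \<in> {(i, j) \<in> {1..k} \<times> {1..k}. i < j}" using ij by blast
  moreover have "finite {(i, j) \<in> {1..k} \<times> {1..k}. i < j}"
    by (rule finite_subset[of _ "{1..k} \<times> {1..k}"]) auto
  ultimately show ?thesis unfolding vandermonde_def by (intro prod_zero) (auto intro: bexI[of _ "(i, j)"])
qed

lemma corner_density_nonneg:
  assumes x: "strict_mono_on {1..N} x" and K: "1 \<le> K" "K < N" and a: "mono_on {1..K} a"
  shows "0 \<le> corner_density N K x a"
proof -
  obtain d where "N = Suc K + d" using K(2) less_iff_Suc_add by auto
  then have "0 \<le> Determinant.det (spline_matrix N K x a)"
    by (intro det_spline_matrix_nonneg[OF x K(1) _ a])
  moreover have "0 < gap_product N (N - K + 1) x" by (rule gap_product_pos[OF x]) simp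
  ultimately show ?thesis
    unfolding corner_density_def gap_product_def[symmetric]
    by (intro divide_nonneg_pos mult_nonneg_nonneg prod_nonneg vandermonde_nonneg a) simp_all
qed

section \<open>Eigenvalues of corners of any size\<close>

lemma sigma_finite_chamber_lebesgue: "sigma_finite_measure (chamber_lebesgue k)"
  unfolding chamber_lebesgue_def
proof (rule sigma_finite_measure_restrict_space[OF sigma_finite_PiM_lborel])
  have "weyl_chamber k \<subseteq> space (PiM {1..k} (\<lambda>_. lborel :: real measure))"
    unfolding weyl_chamber_def space_PiM PiE_def by auto
  then show "weyl_chamber k \<in> sets (PiM {1..k} (\<lambda>_. lborel))"
    using sets_weyl_chamber[of k] by (simp only: Int_absorb2)
qed simp

lemma strictly_interlaces_nodes_strict_mono:
  assumes "strictly_interlaces n y a" shows "strict_mono_on {1..n} y"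
proof (rule strict_mono_onI)
  have step: "y k < y (Suc k)" if "k \<in> {1..<n}" for k
    using assms that unfolding strictly_interlaces_def by fastforce
  fix i j assume ij: "i \<in> {1..n}" "j \<in> {1..n}" "i < j"
  from ij(3) have "Suc i \<le> j" by simp
  then show "y i < y j" using ij(2)
  proof (induction j rule: dec_induct)
    case base
    then show ?case using step[of i] ij(1) by simp
  next
    case (step k)
    then have "y i < y k" by simp
    also have "y k < y (Suc k)" using step ij(1) by (intro \<open>\<And>k. k \<in> {1..<n} \<Longrightarrow> y k < y (Suc k)\<close>) simp
    finally show ?case .
  qed
qed

lemma AE_interlaces_strict:
  "AE a in PiM {1..m} (\<lambda>_. lborel :: real measure). strictly_interlaces (Suc m) x a = interlaces (Suc m) x a"
proof -
  have "AE a in PiM {1..m} (\<lambda>_. lborel :: real measure). \<forall>j\<in>{1..m}. a j \<noteq> x j"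
    by (intro AE_finite_allI AE_PiM_lborel_neq) simp_all
  then show ?thesis
  proof eventually_elim
    case (elim a)
    then show ?case unfolding strictly_interlaces_def interlaces_def
      by (metis atLeastLessThanSuc_atLeastAtMost less_le)
  qed
qed

lemma AE_interlaces_strict_nodes:
  "AE Y in PiM {1..Suc m} (\<lambda>_. lborel :: real measure). strictly_interlaces (Suc m) Y a = interlaces (Suc m) Y a"
proof -
  have "AE Y in PiM {1..Suc m} (\<lambda>_. lborel :: real measure). \<forall>j\<in>{1..m}. Y j \<noteq> a j"
    by (intro AE_finite_allI AE_PiM_lborel_neq) simp_all
  then show ?thesis
  proof eventually_elim
    case (elim Y)
    then show ?case unfolding strictly_interlaces_def interlaces_def
      by (metis atLeastLessThanSuc_atLeastAtMost less_le)
  qed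
qed

lemma AE_chamber:
  "(AE a in PiM {1..k} (\<lambda>_. lborel). P a) \<Longrightarrow> AE a in chamber_lebesgue k. P a"
  unfolding chamber_lebesgue_def AE_restrict_space_iff[OF sets_weyl_chamber] by auto

lemma measurable_chamber_det [measurable]:
  "(\<lambda>a. Determinant.det (spline_matrix N K x a)) \<in> borel_measurable (chamber_lebesgue K)"
  unfolding chamber_lebesgue_def by (intro measurable_restrict_space1) measurable

lemma measurable_chamber_vandermonde [measurable]:
  "(\<lambda>a. vandermonde K a) \<in> borel_measurable (chamber_lebesgue K)"
  unfolding chamber_lebesgue_def by (intro measurable_restrict_space1) measurable

lemma measurable_chamber_strictly_interlaces [measurable]:
  "Measurable.pred (chamber_lebesgue K) (strictly_interlaces (Suc K) x)"
  unfolding chamber_lebesgue_def by (intro measurable_restrict_space1) measurable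

lemma measurable_corner_density [measurable]:
  "(\<lambda>a. corner_density N K x a) \<in> borel_measurable (chamber_lebesgue K)"
  unfolding corner_density_def by measurable

lemma measurable_joint_strictly_interlaces:
  "Measurable.pred (chamber_lebesgue (Suc K) \<Otimes>\<^sub>M chamber_lebesgue K) (\<lambda>p. strictly_interlaces (Suc K) (fst p) (snd p))"
  unfolding strictly_interlaces_def
proof (rule pred_intros_finite(3))
  fix j assume j: "j \<in> {1..<Suc K}"
  have [measurable]: "(\<lambda>p. fst p j) \<in> borel_measurable (chamber_lebesgue (Suc K) \<Otimes>\<^sub>M chamber_lebesgue K)"
    "(\<lambda>p. fst p (Suc j)) \<in> borel_measurable (chamber_lebesgue (Suc K) \<Otimes>\<^sub>M chamber_lebesgue K)"
    "(\<lambda>p. snd p j) \<in> borel_measurable (chamber_lebesgue (Suc K) \<Otimes>\<^sub>M chamber_lebesgue K)"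
    using j by (auto intro!: measurable_compose[OF measurable_fst measurable_chamber_component]
      measurable_compose[OF measurable_snd measurable_chamber_component])
  show "Measurable.pred (chamber_lebesgue (Suc K) \<Otimes>\<^sub>M chamber_lebesgue K) (\<lambda>p. fst p j < snd p j \<and> snd p j < fst p (Suc j))"
    by measurable
qed simp

text \<open>
  Strict and half-open interlacing differ by a null set, and tuples interlaced by \<open>a\<close> lie in the chamber, so the
  integral over the chamber is the one over the product of slots.
\<close>

lemma nn_integral_det_spline_interlacing:
  assumes x: "strict_mono_on {1..N} x" and K: "1 \<le> K" "K + 2 \<le> N" and a: "mono_on {1..K} a"
  shows "(\<integral>\<^sup>+Y. ennreal (Determinant.det (spline_matrix N (Suc K) x Y)) * indicator {Y. strictly_interlaces (Suc K) Y a} Y \<partial>chamber_lebesgue (Suc K))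
    = ennreal ((\<Prod>i\<in>{1..K}. (x (i + (N - K)) - x i) / real (N - K)) * Determinant.det (spline_matrix N K x a))"
proof -
  let ?P = "PiM {1..Suc K} (\<lambda>_. lborel :: real measure)"
  let ?D = "\<lambda>Y. Determinant.det (spline_matrix N (Suc K) x Y)"
  obtain d where d: "N = Suc (Suc K) + d" using K(2) nat_le_iff_add[of "K + 2" N] by auto
  have nonneg: "0 \<le> ?D Y * indicator {Y. interlaces (Suc K) Y a} Y" for Y
  proof (cases "interlaces (Suc K) Y a")
    case True
    then show ?thesis using det_spline_matrix_nonneg[OF x _ d interlaces_mono[OF True]] by (simp add: indicator_def)
  qed simp
  have "(\<integral>\<^sup>+Y. ennreal (?D Y) * indicator {Y. strictly_interlaces (Suc K) Y a} Y \<partial>chamber_lebesgue (Suc K))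
      = (\<integral>\<^sup>+Y. ennreal (?D Y) * indicator {Y. strictly_interlaces (Suc K) Y a} Y * indicator (weyl_chamber (Suc K)) Y \<partial>?P)"
    by (rule nn_integral_chamber)
  also have "\<dots> = (\<integral>\<^sup>+Y. ennreal (?D Y * indicator {Y. interlaces (Suc K) Y a} Y) \<partial>?P)"
  proof (rule nn_integral_cong_AE)
    show "AE Y in ?P. ennreal (?D Y) * indicator {Y. strictly_interlaces (Suc K) Y a} Y * indicator (weyl_chamber (Suc K)) Y
        = ennreal (?D Y * indicator {Y. interlaces (Suc K) Y a} Y)"
      using AE_interlaces_strict_nodes[of K a] AE_space
    proof eventually_elim
      case (elim Y)
      have "Y \<in> weyl_chamber (Suc K)" if "interlaces (Suc K) Y a"
        using interlaces_mono[OF that] elim(2) unfolding weyl_chamber_def space_PiM PiE_def by blast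
      then show ?case using elim(1) by (cases "interlaces (Suc K) Y a") (simp_all add: indicator_def)
    qed
  qed
  also have "\<dots> = ennreal (\<integral>Y. ?D Y * indicator {Y. interlaces (Suc K) Y a} Y \<partial>?P)"
    by (rule nn_integral_eq_integral[OF integral_det_spline_interlaces(1)[OF x K a]]) (use nonneg in simp)
  finally show ?thesis unfolding integral_det_spline_interlaces(2)[OF x K a] .
qed

lemma weyl_chamber_mono: "a \<in> weyl_chamber k \<Longrightarrow> mono_on {1..k} a"
  by (simp add: weyl_chamber_def)

text \<open>
  Induction on the number of deleted rows. The corner of size \<open>K\<close> is a corner of the one of size \<open>K + 1\<close>, whose
  law is the mixture of the orbital measures of its eigenvalues \<open>Y\<close>; these have the density given by the
  induction hypothesis, and the case of codimension one applies to the orbital measure of \<open>Y\<close>.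
\<close>

theorem nn_integral_sorted_eigenvalues_corner:
  assumes x: "strict_mono_on {1..N} x"
  shows "1 \<le> K \<Longrightarrow> N = Suc K + d \<Longrightarrow> f \<in> borel_measurable (chamber_lebesgue K) \<Longrightarrow>
    (\<integral>\<^sup>+H. f (sorted_eigenvalues K (corner K H)) \<partial>orbital_measure N x)
    = (\<integral>\<^sup>+a. f a * ennreal (corner_density N K x a) \<partial>chamber_lebesgue K)"
proof (induction d arbitrary: K f)
  case 0
  then have N: "N = Suc K" by simp
  have "(\<integral>\<^sup>+H. f (sorted_eigenvalues K (corner K H)) \<partial>orbital_measure (Suc K) x)
      = (\<integral>\<^sup>+a. f a * ennreal (fact K * vandermonde K a / vandermonde (Suc K) x)
        * indicator {a. strictly_interlaces (Suc K) x a} a \<partial>chamber_lebesgue K)"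
    by (rule nn_integral_sorted_eigenvalues_corner_codim1[OF x[unfolded N] 0(3)])
  also have "\<dots> = (\<integral>\<^sup>+a. f a * ennreal (corner_density (Suc K) K x a) \<partial>chamber_lebesgue K)"
  proof (rule nn_integral_cong_AE)
    show "AE a in chamber_lebesgue K. f a * ennreal (fact K * vandermonde K a / vandermonde (Suc K) x)
        * indicator {a. strictly_interlaces (Suc K) x a} a = f a * ennreal (corner_density (Suc K) K x a)"
      using AE_chamber[OF AE_interlaces_strict[of K x]] AE_space
    proof eventually_elim
      case (elim a)
      have "mono_on {1..K} a" using elim(2) by (simp only: space_chamber weyl_chamber_mono)
      from corner_density_codim1[OF x[unfolded N] this 0(1)] show ?case
        using elim(1) by (cases "interlaces (Suc K) x a") (simp_all add: indicator_def)
    qed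
  qed
  finally show ?case unfolding N .
next
  case (Suc d)
  let ?M = "Suc K"
  let ?orb = "orbital_measure N x"
  have K: "1 \<le> K" "K + 2 \<le> N" "?M \<le> N" "N = Suc ?M + d" "1 \<le> ?M" using Suc.prems by simp_all
  have f: "f \<in> borel_measurable (chamber_lebesgue K)" by fact
  have setsorb: "sets ?orb = sets (herm_borel N)"
    using orbital_measure_props(1)[of N x] unfolding conj_invariant_def by blast
  define g where "g H = f (sorted_eigenvalues K (corner K H))" for H
  have g: "g \<in> borel_measurable (herm_borel ?M)"
    unfolding g_def[abs_def]
    by (rule measurable_compose[OF measurable_compose[OF measurable_corner measurable_sorted_eigenvalues] f]) simp
  define h where "h Y = (\<integral>\<^sup>+H. g H \<partial>orbital_measure ?M Y)" for Y
  have h: "h \<in> borel_measurable (chamber_lebesgue ?M)"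
    unfolding h_def[abs_def] by (rule measurable_orbital_measure[OF g])
  define \<mu> where "\<mu> = distr ?orb (herm_borel ?M) (corner ?M)"
  have \<mu>: "conj_invariant ?M \<mu>"
    unfolding \<mu>_def by (rule conj_invariant_corner[OF orbital_measure_props(1) K(3)])
  have mc: "corner ?M \<in> ?orb \<rightarrow>\<^sub>M herm_borel ?M"
    using measurable_corner[OF K(3)] unfolding measurable_cong_sets[OF setsorb refl] .
  have me: "sorted_eigenvalues ?M \<in> \<mu> \<rightarrow>\<^sub>M chamber_lebesgue ?M"
    using measurable_sorted_eigenvalues[of ?M] unfolding \<mu>_def by simp
  \<comment> \<open>The factors of density and kernel that do not depend on \<open>Y\<close>, after the cancellation of \<open>V(Y)\<close>.\<close>
  define c where "c a = (\<Prod>i\<in>{1..<Suc K}. real ((N - Suc K + i) choose i)) * (fact K * vandermonde K a) / gap_product N (N - K) x" for a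
  have G: "0 < gap_product N (N - K) x" by (rule gap_product_pos[OF x]) (use K in simp)
  have c: "0 \<le> c a" if "mono_on {1..K} a" for a
    unfolding c_def using G vandermonde_nonneg[OF that]
    by (intro divide_nonneg_pos mult_nonneg_nonneg prod_nonneg) simp_all
  let ?D = "\<lambda>Y. Determinant.det (spline_matrix N ?M x Y)"
  let ?I = "\<lambda>Y a. indicator {a. strictly_interlaces ?M Y a} a :: ennreal"
  have c_meas [measurable]: "c \<in> borel_measurable (chamber_lebesgue K)"
    unfolding c_def[abs_def] by measurable
  have "(\<integral>\<^sup>+H. f (sorted_eigenvalues K (corner K H)) \<partial>?orb) = (\<integral>\<^sup>+H. g (corner ?M H) \<partial>?orb)"
    unfolding g_def by (simp add: corner_corner)
  also have "\<dots> = (\<integral>\<^sup>+H. g H \<partial>\<mu>)"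
    unfolding \<mu>_def by (subst nn_integral_distr[OF mc]) (use g in simp_all)
  also have "\<dots> = (\<integral>\<^sup>+Y. h Y \<partial>distr \<mu> (chamber_lebesgue ?M) (sorted_eigenvalues ?M))"
    unfolding h_def by (rule conj_invariant_radial[OF \<mu> g])
  also have "\<dots> = (\<integral>\<^sup>+H. h (sorted_eigenvalues ?M H) \<partial>\<mu>)"
    by (subst nn_integral_distr[OF me]) (use h in simp_all)
  also have "\<dots> = (\<integral>\<^sup>+H. h (sorted_eigenvalues ?M (corner ?M H)) \<partial>?orb)"
    unfolding \<mu>_def
    by (subst nn_integral_distr[OF mc]) (use measurable_compose[OF measurable_sorted_eigenvalues h] in simp_all)
  also have "\<dots> = (\<integral>\<^sup>+Y. h Y * ennreal (corner_density N ?M x Y) \<partial>chamber_lebesgue ?M)"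
    by (rule Suc.IH[OF K(5) K(4) h])
  also have "\<dots> = (\<integral>\<^sup>+Y. (\<integral>\<^sup>+a. f a * ennreal (c a) * (ennreal (?D Y) * ?I Y a) \<partial>chamber_lebesgue K) \<partial>chamber_lebesgue ?M)"
  proof (rule nn_integral_cong)
    fix Y assume "Y \<in> space (chamber_lebesgue ?M)"
    then have Y: "mono_on {1..?M} Y" by (simp only: space_chamber weyl_chamber_mono)
    show "h Y * ennreal (corner_density N ?M x Y)
        = (\<integral>\<^sup>+a. f a * ennreal (c a) * (ennreal (?D Y) * ?I Y a) \<partial>chamber_lebesgue K)"
    \<comment> \<open>For repeated entries in \<open>Y\<close> both sides vanish: the density contains \<open>V(Y)\<close>, and no tuple interlaces \<open>Y\<close> strictly.\<close>
    proof (cases "strict_mono_on {1..?M} Y")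
      case False
      have "corner_density N ?M x Y = 0" unfolding corner_density_def vandermonde_not_strict[OF Y False] by simp
      moreover have "?I Y a = 0" for a
        using False strictly_interlaces_nodes_strict_mono[of ?M Y a] by (auto simp: indicator_def)
      ultimately show ?thesis by simp
    next
      case True
      have V: "0 < vandermonde ?M Y" by (rule vandermonde_pos[OF True])
      have "h Y = (\<integral>\<^sup>+a. f a * ennreal (fact K * vandermonde K a / vandermonde ?M Y) * ?I Y a \<partial>chamber_lebesgue K)"
        unfolding h_def g_def by (rule nn_integral_sorted_eigenvalues_corner_codim1[OF True f])
      then have "h Y * ennreal (corner_density N ?M x Y)
          = (\<integral>\<^sup>+a. f a * ennreal (fact K * vandermonde K a / vandermonde ?M Y) * ?I Y a * ennreal (corner_density N ?M x Y) \<partial>chamber_lebesgue K)"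
        using f by (subst nn_integral_multc) simp_all
      also have "\<dots> = (\<integral>\<^sup>+a. f a * ennreal (c a) * (ennreal (?D Y) * ?I Y a) \<partial>chamber_lebesgue K)"
      proof (rule nn_integral_cong)
        fix a assume "a \<in> space (chamber_lebesgue K)"
        then have a: "mono_on {1..K} a" by (simp only: space_chamber weyl_chamber_mono)
        have "N - ?M + 1 = N - K" using K by simp
        then have "corner_density N ?M x Y
            = (\<Prod>i\<in>{1..<Suc K}. real ((N - Suc K + i) choose i)) * (vandermonde ?M Y * ?D Y) / gap_product N (N - K) x"
          unfolding corner_density_def gap_product_def by simp
        then have "fact K * vandermonde K a / vandermonde ?M Y * corner_density N ?M x Y = c a * ?D Y"
          unfolding c_def using V G by (simp add: field_simps)
        moreover have "0 \<le> fact K * vandermonde K a / vandermonde ?M Y" using V vandermonde_nonneg[OF a] by simp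
        ultimately have "ennreal (fact K * vandermonde K a / vandermonde ?M Y) * ennreal (corner_density N ?M x Y) = ennreal (c a) * ennreal (?D Y)"
          using c[OF a] by (simp only: ennreal_mult'[symmetric])
        then have "f a * ?I Y a * (ennreal (fact K * vandermonde K a / vandermonde ?M Y) * ennreal (corner_density N ?M x Y))
            = f a * ?I Y a * (ennreal (c a) * ennreal (?D Y))" by (rule arg_cong)
        then show "f a * ennreal (fact K * vandermonde K a / vandermonde ?M Y) * ?I Y a * ennreal (corner_density N ?M x Y)
            = f a * ennreal (c a) * (ennreal (?D Y) * ?I Y a)" by (simp only: mult_ac)
      qed
      finally show ?thesis .
    qed
  qed
  also have "\<dots> = (\<integral>\<^sup>+a. (\<integral>\<^sup>+Y. f a * ennreal (c a) * (ennreal (?D Y) * ?I Y a) \<partial>chamber_lebesgue ?M) \<partial>chamber_lebesgue K)"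
  proof -
    interpret pair_sigma_finite "chamber_lebesgue K" "chamber_lebesgue ?M"
      by (intro pair_sigma_finite.intro sigma_finite_chamber_lebesgue)
    let ?Q = "chamber_lebesgue K \<Otimes>\<^sub>M chamber_lebesgue ?M"
    have si: "Measurable.pred ?Q (\<lambda>p. strictly_interlaces ?M (snd p) (fst p))"
      using measurable_compose[OF measurable_Pair[OF measurable_snd measurable_fst] measurable_joint_strictly_interlaces] by simp
    have "(\<lambda>p. ?I (snd p) (fst p)) \<in> borel_measurable ?Q"
    proof -
      have "(\<lambda>p. indicator {p. strictly_interlaces ?M (snd p) (fst p)} p :: ennreal) \<in> borel_measurable ?Q"
        using si by measurable
      moreover have "(\<lambda>p. indicator {p. strictly_interlaces ?M (snd p) (fst p)} p :: ennreal) = (\<lambda>p. ?I (snd p) (fst p))"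
        by (simp add: indicator_def fun_eq_iff)
      ultimately show ?thesis by simp
    qed
    moreover have "(\<lambda>p. f (fst p)) \<in> borel_measurable ?Q" by (rule measurable_compose[OF measurable_fst f])
    moreover have "(\<lambda>p. ennreal (c (fst p))) \<in> borel_measurable ?Q" by measurable
    moreover have "(\<lambda>p. ennreal (?D (snd p))) \<in> borel_measurable ?Q" by measurable
    ultimately have "(\<lambda>p. f (fst p) * ennreal (c (fst p)) * (ennreal (?D (snd p)) * ?I (snd p) (fst p))) \<in> borel_measurable ?Q"
      by (intro borel_measurable_times_ennreal)
    then show ?thesis
      by (intro Fubini') (simp add: split_beta')
  qed
  also have "\<dots> = (\<integral>\<^sup>+a. f a * ennreal (corner_density N K x a) \<partial>chamber_lebesgue K)"
  proof (rule nn_integral_cong)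
    fix a assume "a \<in> space (chamber_lebesgue K)"
    then have a: "mono_on {1..K} a" by (simp only: space_chamber weyl_chamber_mono)
    have sw: "?I Y a = indicator {Y. strictly_interlaces ?M Y a} Y" for Y by (simp add: indicator_def)
    have "(\<integral>\<^sup>+Y. f a * ennreal (c a) * (ennreal (?D Y) * ?I Y a) \<partial>chamber_lebesgue ?M)
        = f a * ennreal (c a) * (\<integral>\<^sup>+Y. ennreal (?D Y) * ?I Y a \<partial>chamber_lebesgue ?M)"
    proof (rule nn_integral_cmult)
      have "Measurable.pred (chamber_lebesgue ?M) (\<lambda>Y. strictly_interlaces ?M Y a)"
        using measurable_compose[OF measurable_Pair[OF measurable_ident_sets[OF refl] measurable_const[OF \<open>a \<in> space (chamber_lebesgue K)\<close>]] measurable_joint_strictly_interlaces] by simp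
      then have "(\<lambda>Y. indicator {Y. strictly_interlaces ?M Y a} Y :: ennreal) \<in> borel_measurable (chamber_lebesgue ?M)"
        by measurable
      then show "(\<lambda>Y. ennreal (?D Y) * ?I Y a) \<in> borel_measurable (chamber_lebesgue ?M)"
        unfolding sw by measurable
    qed
    also have "(\<integral>\<^sup>+Y. ennreal (?D Y) * ?I Y a \<partial>chamber_lebesgue ?M)
        = ennreal ((\<Prod>i\<in>{1..K}. (x (i + (N - K)) - x i) / real (N - K)) * Determinant.det (spline_matrix N K x a))"
      unfolding sw by (rule nn_integral_det_spline_interlacing[OF x K(1) K(2) a])
    also have "f a * ennreal (c a) * \<dots> = f a * ennreal (corner_density N K x a)"
      unfolding mult.assoc ennreal_mult'[OF c[OF a], symmetric]
      unfolding c_def corner_density_recursion[OF x K(1) K(2)] ..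
    finally show "(\<integral>\<^sup>+Y. f a * ennreal (c a) * (ennreal (?D Y) * ?I Y a) \<partial>chamber_lebesgue ?M)
        = f a * ennreal (corner_density N K x a)" .
  qed
  finally show ?case .
qed

theorem theorem3p3:
  fixes N K :: nat and x :: "nat \<Rightarrow> real"
  assumes "N \<ge> 2"
    and "strict_mono_on {1..N} x"
    and "K \<in> {1..N - 1}"
  shows "prob_space (radial_part N K x)
    \<and> absolutely_continuous (chamber_lebesgue K) (radial_part N K x)
    \<and> (AE a in chamber_lebesgue K. 0 \<le> corner_density N K x a)
    \<and> radial_part N K x
        = density (chamber_lebesgue K) (\<lambda>a. ennreal (corner_density N K x a))"
proof -
  have K: "1 \<le> K" "K < N" "K \<le> N" using assms(1,3) by auto
  obtain d where d: "N = Suc K + d" using K(2) less_iff_Suc_add by auto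
  have setsorb: "sets (orbital_measure N x) = sets (herm_borel N)"
    using orbital_measure_props(1)[of N x] unfolding conj_invariant_def by blast
  have mc: "corner K \<in> orbital_measure N x \<rightarrow>\<^sub>M herm_borel K"
    using measurable_corner[OF K(3)] unfolding measurable_cong_sets[OF setsorb refl] .
  have eq: "radial_part N K x = density (chamber_lebesgue K) (\<lambda>a. ennreal (corner_density N K x a))"
    unfolding radial_part_eq(1)[OF K(3)]
  proof (rule measure_eqI)
    fix T assume "T \<in> sets (distr (corner_measure N K x) (chamber_lebesgue K) (sorted_eigenvalues K))"
    then have T: "T \<in> sets (chamber_lebesgue K)" by simp
    have "distr (corner_measure N K x) (chamber_lebesgue K) (sorted_eigenvalues K)
        = distr (orbital_measure N x) (chamber_lebesgue K) (\<lambda>H. sorted_eigenvalues K (corner K H))"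
      unfolding corner_measure_def by (subst distr_distr[OF measurable_sorted_eigenvalues mc]) (simp add: comp_def)
    then have "emeasure (distr (corner_measure N K x) (chamber_lebesgue K) (sorted_eigenvalues K)) T
        = (\<integral>\<^sup>+a. indicator T a \<partial>distr (orbital_measure N x) (chamber_lebesgue K) (\<lambda>H. sorted_eigenvalues K (corner K H)))"
      using T by simp
    also have "\<dots> = (\<integral>\<^sup>+H. indicator T (sorted_eigenvalues K (corner K H)) \<partial>orbital_measure N x)"
      by (subst nn_integral_distr[OF measurable_compose[OF mc measurable_sorted_eigenvalues]]) (use T in simp_all)
    also have "\<dots> = (\<integral>\<^sup>+a. indicator T a * ennreal (corner_density N K x a) \<partial>chamber_lebesgue K)"
      by (rule nn_integral_sorted_eigenvalues_corner[OF assms(2) K(1) d]) (use T in simp)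
    also have "\<dots> = emeasure (density (chamber_lebesgue K) (\<lambda>a. ennreal (corner_density N K x a))) T"
      by (subst emeasure_density) (use T in \<open>simp_all add: mult.commute\<close>)
    finally show "emeasure (distr (corner_measure N K x) (chamber_lebesgue K) (sorted_eigenvalues K)) T
        = emeasure (density (chamber_lebesgue K) (\<lambda>a. ennreal (corner_density N K x a))) T" .
  qed simp
  have "AE a in chamber_lebesgue K. 0 \<le> corner_density N K x a"
    using corner_density_nonneg[OF assms(2) K(1,2)] weyl_chamber_mono by (intro AE_I2) simp
  moreover have "absolutely_continuous (chamber_lebesgue K) (radial_part N K x)"
    unfolding eq by (rule absolutely_continuousI_density) measurable
  moreover have "prob_space (radial_part N K x)"
    using radial_part_eq[OF K(3), of x] by simp
  ultimately show ?thesis using eq by blast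
qed

end
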